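(* Let $n>1$ and let $u$ be invariant harmonic in $\mathbf{II}(n)$. Assume either that $n$ is odd and $u\in C^{\frac{n+1}{2}}\big(\overline{\mathbf{II}(n)}\big)$, or that $n=2k$ is even and $u\in C^{k,\alpha}\big(\overline{\mathbf{II}(n)}\big)$ for some $\alpha>1/2$. Then $$\frac{\partial^2u}{\partial z_{j\alpha}\partial\bar z_{k\beta}}(0)=0,\qquad 1\le j,\alpha,k,\beta\le n.$$
   Context: $\mathbf{II}(n)=\{\mathbf{z}\in M^{n,n}(\mathbb{C}):\mathbf{z}^t=\mathbf{z},\ I_n-\mathbf{z}\mathbf{z}^*>0\}$, a domain in the space of symmetric matrices with holomorphic coordinates $z_{j\alpha}$ ($j\le\alpha$), $z_{\alpha j}=z_{j\alpha}$, and $\partial/\partial z_{\alpha j}=\partial/\partial z_{j\alpha}$ denotes differentiation with respect to that coordinate. A function $u$ is invariant harmonic in $\mathbf{II}(n)$ if it is annihilated by the Laplace–Beltrami operator of the Bergman metric of $\mathbf{II}(n)$. *)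

theory Defs
  imports "HOL-Analysis.Analysis"
begin

type_synonym 'n cmat = "complex^'n^'n"

definition cadj :: "('n::finite) cmat \<Rightarrow> 'n cmat" where
  "cadj A = (\<chi> i j. cnj (A$j$i))"

definition csmul :: "complex \<Rightarrow> ('n::finite) cmat \<Rightarrow> 'n cmat" where
  "csmul c A = (\<chi> i j. c * A$i$j)"

definition hpos_def :: "('n::finite) cmat \<Rightarrow> bool" where
  "hpos_def A \<longleftrightarrow> cadj A = A \<and>
     (\<forall>x::complex^'n. x \<noteq> 0 \<longrightarrow> 0 < Re (\<Sum>i\<in>UNIV. \<Sum>j\<in>UNIV. cnj (x$i) * A$i$j * x$j))"

definition II :: "('n::finite) cmat set" where
  "II = {z. transpose z = z \<and> hpos_def (mat 1 - z ** cadj z)}"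

text \<open>Coordinate indices: the unordered pair {j,alpha} labels the coordinate z_{j alpha} = z_{alpha j}.\<close>
definition idxP :: "('n::finite) set set" where
  "idxP = {{j, a} | j a. True}"

definition Esym :: "'n set \<Rightarrow> ('n::finite) cmat" where
  "Esym p = (\<chi> r s. if {r, s} = p then 1 else 0)"

definition has_dpart :: "(('n::finite) cmat \<Rightarrow> complex) \<Rightarrow> 'n cmat \<Rightarrow> 'n cmat \<Rightarrow> bool" where
  "has_dpart f v z \<longleftrightarrow> (\<lambda>t::real. f (z + t *\<^sub>R v)) differentiable (at 0)"

definition dpart :: "(('n::finite) cmat \<Rightarrow> complex) \<Rightarrow> 'n cmat \<Rightarrow> 'n cmat \<Rightarrow> complex" where
  "dpart f v z = vector_derivative (\<lambda>t::real. f (z + t *\<^sub>R v)) (at 0)"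

definition dz :: "'n set \<Rightarrow> (('n::finite) cmat \<Rightarrow> complex) \<Rightarrow> 'n cmat \<Rightarrow> complex" where
  "dz p f z = (dpart f (Esym p) z - \<i> * dpart f (csmul \<i> (Esym p)) z) / 2"

definition dzb :: "'n set \<Rightarrow> (('n::finite) cmat \<Rightarrow> complex) \<Rightarrow> 'n cmat \<Rightarrow> complex" where
  "dzb p f z = (dpart f (Esym p) z + \<i> * dpart f (csmul \<i> (Esym p)) z) / 2"

text \<open>Real basis of the space of symmetric matrices.\<close>
definition Dirs :: "('n::finite) cmat set" where
  "Dirs = Esym ` idxP \<union> (\<lambda>p. csmul \<i> (Esym p)) ` idxP"

fun iderivs :: "('n::finite) cmat list \<Rightarrow> ('n cmat \<Rightarrow> complex) \<Rightarrow> 'n cmat \<Rightarrow> complex" where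
  "iderivs [] f = f"
| "iderivs (v # vs) f = dpart (iderivs vs f) v"

text \<open>C^m on a set S (open in the symmetric matrices): all iterated partials of order \<le> m exist and are continuous.\<close>
definition C_on :: "nat \<Rightarrow> ('n::finite) cmat set \<Rightarrow> ('n cmat \<Rightarrow> complex) \<Rightarrow> bool" where
  "C_on m S f \<longleftrightarrow> (\<forall>vs. set vs \<subseteq> Dirs \<and> length vs \<le> m \<longrightarrow>
      continuous_on S (iderivs vs f) \<and>
      (length vs < m \<longrightarrow> (\<forall>z\<in>S. \<forall>v\<in>Dirs. has_dpart (iderivs vs f) v z)))"

definition C_closure :: "nat \<Rightarrow> (('n::finite) cmat \<Rightarrow> complex) \<Rightarrow> bool" where
  "C_closure m f \<longleftrightarrow> C_on m II f \<and>
     (\<forall>vs. set vs \<subseteq> Dirs \<and> length vs \<le> m \<longrightarrow>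
        (\<exists>g. continuous_on (closure II) g \<and> (\<forall>z\<in>II. g z = iderivs vs f z)))"

definition C_holder_closure :: "nat \<Rightarrow> real \<Rightarrow> (('n::finite) cmat \<Rightarrow> complex) \<Rightarrow> bool" where
  "C_holder_closure k \<alpha> f \<longleftrightarrow> C_closure k f \<and>
     (\<forall>vs. set vs \<subseteq> Dirs \<and> length vs = k \<longrightarrow>
        (\<exists>C. \<forall>x\<in>II. \<forall>y\<in>II. cmod (iderivs vs f x - iderivs vs f y) \<le> C * norm (x - y) powr \<alpha>))"

text \<open>Kaehler potential of the Bergman metric (log of the Bergman kernel
  K(z,z) = c det(I - z z^* )^{-(n+1)}, up to the irrelevant factor n+1 and additive constant).\<close>
definition bpot :: "('n::finite) cmat \<Rightarrow> complex" where
  "bpot z = complex_of_real (- ln (Re (det (mat 1 - z ** cadj z))))"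

definition bmetric :: "'n set \<Rightarrow> 'n set \<Rightarrow> ('n::finite) cmat \<Rightarrow> complex" where
  "bmetric p q z = dz p (dzb q bpot) z"

definition inv_metric :: "('n set \<Rightarrow> 'n set \<Rightarrow> complex) \<Rightarrow> ('n::finite) cmat \<Rightarrow> bool" where
  "inv_metric G z \<longleftrightarrow> (\<forall>i\<in>idxP. \<forall>k\<in>idxP.
      (\<Sum>j\<in>idxP. G i j * bmetric k j z) = (if i = k then 1 else 0))"

definition LB :: "('n set \<Rightarrow> 'n set \<Rightarrow> complex) \<Rightarrow> (('n::finite) cmat \<Rightarrow> complex) \<Rightarrow> 'n cmat \<Rightarrow> complex" where
  "LB G u z = (\<Sum>i\<in>idxP. \<Sum>j\<in>idxP. G i j * dz i (dzb j u) z)"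

definition invariant_harmonic :: "(('n::finite) cmat \<Rightarrow> complex) \<Rightarrow> bool" where
  "invariant_harmonic u \<longleftrightarrow> C_on 2 II u \<and>
     (\<forall>z\<in>II. \<forall>G. inv_metric G z \<longrightarrow> LB G u z = 0)"

end

theory Submission
  imports Defs
begin

text \<open>
  Let \<open>L\<close> be the Levi form of \<open>u\<close> at a point. The Laplace equation says that a sum of values of \<open>L\<close> over
  a frame of \<open>I - z z^*\<close> vanishes. A maximum principle shows that solutions continuous on the closure are
  determined by their values on the Shilov boundary of symmetric unitary matrices. Averaging \<open>u(k z k^t)\<close>
  against a suitable weight over the unitary group produces a solution that vanishes there; at the origin this
  yields Hua's equations, and Moebius maps transport them to the points \<open>r E_11\<close>.

  Put \<open>Q(x) = L(x x^t, x x^t)\<close> at the origin and average \<open>u(k z k^t)\<close> against the conjugate of \<open>Q(k e_1)\<close>. By Hua's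
  equations the average \<open>g(r)\<close> at \<open>r E_11\<close> satisfies
  \<open>(1 - r^2) (r^2 g'' + r g') + (n - 1) r g' - 2 (n + 1) g = 0\<close>,
  whose solution regular at the origin has positive Taylor coefficients of order \<open>m^(-(n+3)/2)\<close> and hence a
  singularity of type \<open>(1 - r)^((n+1)/2)\<close> at \<open>r = 1\<close>, with a logarithmic factor when \<open>n\<close> is odd. The assumed boundary regularity
  excludes it, so \<open>g = 0\<close>. Since \<open>g''(0)\<close> is twice the mean of \<open>|Q(k e_1)|^2\<close>, the quartic form \<open>Q\<close> vanishes,
  and polarization gives \<open>L = 0\<close>.
\<close>

subsection \<open>Complex matrices and the unitary group\<close>

text \<open>The single Laplace equation does not restrict to an ordinary differential equation on a
  disc. The radial equation needs the stronger Hua system: every partial trace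
  \<open>hua_form\<close> of the Levi form vanishes, not only their sum. The boundary values supply
  it. The symmetric unitary matrices form one orbit, that of \<open>mat 1\<close>, so a weighted
  average vanishes on them once certain moments of the boundary values do; invariance of
  \<open>mat 1\<close> under real orthogonal matrices reduces these moments to the trace, which is
  the Laplacian. The maximum principle needs two penalties. The Bergman potential has constant
  Laplacian, so a small multiple of \<open>ln (Re (det (Vm z)))\<close> keeps the maximum inside; a
  multiple of the squared norm then drives it to the Shilov boundary as the first multiple tends to
  0. The two regularity thresholds come from one estimate: after j derivatives the coefficients are
  at least m^(j - (n+3)/2). For 2j = n+1 this is 1/m, not summable. For 2j = n it is m^(-3/2); the
  terms with N \<le> m < 2N contribute at least a multiple of N^(-1/2) to an increment over an
  interval of length 1/N, whence the exponent 1/2.\<close>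

lemma cadj_nth [simp]: "cadj A $ i $ j = cnj (A $ j $ i)"
  by (simp add: cadj_def)

lemma csmul_nth [simp]: "csmul c A $ i $ j = c * A $ i $ j"
  by (simp add: csmul_def)

lemma transpose_nth [simp]: "transpose A $ i $ j = A $ j $ i"
  by (simp add: transpose_def)

lemma mat_nth [simp]: "mat c $ i $ j = (if i = j then c else 0)"
  by (simp add: mat_def)

lemma matmul_nth: "(A ** B) $ i $ j = (\<Sum>k\<in>UNIV. A $ i $ k * B $ k $ j)"
  by (simp add: matrix_matrix_mult_def)

lemma matvec_nth: "(A *v x) $ i = (\<Sum>k\<in>UNIV. A $ i $ k * x $ k)"
  by (simp add: matrix_vector_mult_def)

lemma cmat_eqI: "(\<And>i j. A $ i $ j = B $ i $ j) \<Longrightarrow> A = (B :: 'a^'n^'m)"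
  by (simp add: vec_eq_iff)

lemma cadj_mult: "cadj (A ** B) = cadj B ** cadj A"
  by (rule cmat_eqI) (simp add: matmul_nth cnj_sum mult.commute)

lemma matmul_diff_left: "((A::('n::finite) cmat) - B) ** C = A ** C - B ** C"
  by (rule cmat_eqI) (simp add: matmul_nth left_diff_distrib sum_subtractf)

lemma matmul_diff_right: "(A::('n::finite) cmat) ** (B - C) = A ** B - A ** C"
  by (rule cmat_eqI) (simp add: matmul_nth right_diff_distrib sum_subtractf)

lemma cadj_cadj [simp]: "cadj (cadj A) = A"
  by (rule cmat_eqI) simp

lemma cadj_mat [simp]: "cadj (mat 1) = mat 1"
  by (rule cmat_eqI) auto

definition Ug :: "('n::finite) cmat set" where
  "Ug = {k. k ** cadj k = mat 1}"

lemma Ug_iff: "k \<in> Ug \<longleftrightarrow> k ** cadj k = mat 1"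
  by (simp add: Ug_def)

lemma Ug_iff': "k \<in> Ug \<longleftrightarrow> cadj k ** k = mat 1"
  unfolding Ug_iff by (rule matrix_left_right_inverse)

lemma Ug_one [simp]: "mat 1 \<in> Ug"
  by (simp add: Ug_iff)

lemma Ug_cadj [simp]: "k \<in> Ug \<Longrightarrow> cadj k \<in> Ug"
  by (metis Ug_iff Ug_iff' cadj_cadj)

lemma Ug_mult: "k \<in> Ug \<Longrightarrow> l \<in> Ug \<Longrightarrow> k ** l \<in> Ug"
  unfolding Ug_iff cadj_mult
  by (metis matrix_mul_assoc matrix_mul_rid)

lemma norm_cmat_sq: "(norm (A::('n::finite) cmat))\<^sup>2 = (\<Sum>i\<in>UNIV. \<Sum>j\<in>UNIV. (cmod (A$i$j))\<^sup>2)"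
  by (simp add: norm_vec_def L2_set_def sum_nonneg)

text \<open>The norm of the matrix type is the Frobenius norm. Its square is a trace, so unitary
  factors on either side preserve it; this makes distances on \<open>Ug\<close> invariant under
  translation.\<close>

lemma norm_cmat_trace: "complex_of_real ((norm (A::('n::finite) cmat))\<^sup>2) = trace (A ** cadj A)"
  unfolding norm_cmat_sq
  by (simp add: trace_def matmul_nth flip: complex_norm_square)

lemma norm_mult_Ug: "k \<in> Ug \<Longrightarrow> norm (A ** k) = norm (A::('n::finite) cmat)"
proof -
  assume "k \<in> Ug"
  then have "(A ** k) ** cadj (A ** k) = A ** cadj A"
    unfolding Ug_iff cadj_mult by (metis matrix_mul_assoc matrix_mul_rid)
  then have "complex_of_real ((norm (A ** k))\<^sup>2) = complex_of_real ((norm A)\<^sup>2)"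
    unfolding norm_cmat_trace by simp
  then show ?thesis by (metis norm_ge_zero of_real_eq_iff power2_eq_imp_eq)
qed

lemma norm_cadj [simp]: "norm (cadj A) = norm (A::('n::finite) cmat)"
proof -
  have "(norm (cadj A))\<^sup>2 = (norm A)\<^sup>2"
    unfolding norm_cmat_sq by (subst sum.swap) simp
  then show ?thesis by (metis norm_ge_zero power2_eq_imp_eq)
qed

lemma norm_Ug_mult: "k \<in> Ug \<Longrightarrow> norm (k ** A) = norm (A::('n::finite) cmat)"
  by (metis Ug_cadj cadj_mult norm_cadj norm_mult_Ug)

lemma continuous_on_cmat_nth [continuous_intros]:
  "continuous_on S f \<Longrightarrow> continuous_on S (\<lambda>x. (f x :: ('n::finite) cmat) $ i $ j)"
  by (intro continuous_intros)

lemma continuous_on_cmatI: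
  "(\<And>i j. continuous_on S (\<lambda>x. f x $ i $ j)) \<Longrightarrow> continuous_on S (f :: _ \<Rightarrow> ('n::finite) cmat)"
  by (intro continuous_on_vec_lambda[where f="\<lambda>i x. f x $ i", simplified]
       continuous_on_vec_lambda[where f="\<lambda>j x. f x $ i $ j" for i, simplified])

lemma continuous_on_cadj [continuous_intros]:
  "continuous_on S f \<Longrightarrow> continuous_on S (\<lambda>x. cadj (f x :: ('n::finite) cmat))"
  by (intro continuous_on_cmatI) (auto intro!: continuous_intros)

lemma continuous_on_transpose [continuous_intros]:
  "continuous_on S f \<Longrightarrow> continuous_on S (\<lambda>x. transpose (f x :: ('n::finite) cmat))"
  by (intro continuous_on_cmatI) (auto intro!: continuous_intros)

lemma continuous_on_matmul [continuous_intros]: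
  "continuous_on S f \<Longrightarrow> continuous_on S g \<Longrightarrow> continuous_on S (\<lambda>x. (f x :: ('n::finite) cmat) ** (g x :: 'n cmat))"
  by (intro continuous_on_cmatI) (auto simp: matmul_nth intro!: continuous_intros)

lemma continuous_on_matvec [continuous_intros]:
  "continuous_on S f \<Longrightarrow> continuous_on S g \<Longrightarrow> continuous_on S (\<lambda>x. (f x :: ('n::finite) cmat) *v g x)"
  by (intro continuous_on_vec_lambda[where f="\<lambda>i x. (f x *v g x) $ i", simplified])
    (auto simp: matvec_nth intro!: continuous_intros)

lemma compact_Ug: "compact (Ug :: ('n::finite) cmat set)"
proof -
  have "closed (Ug :: 'n cmat set)"
    unfolding Ug_def by (intro closed_Collect_eq continuous_intros)
  moreover have "norm k \<le> norm (mat 1 :: 'n cmat)" if "k \<in> Ug" for k :: "'n cmat"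
    using norm_mult_Ug[OF that, of "mat 1"] by simp
  then have "bounded (Ug :: 'n cmat set)" by (auto simp: bounded_iff)
  ultimately show ?thesis by (simp add: compact_eq_bounded_closed)
qed

subsection \<open>The invariant mean on the unitary group\<close>

definition right_avg :: "('n::finite) cmat list \<Rightarrow> ('n cmat \<Rightarrow> complex) \<Rightarrow> 'n cmat \<Rightarrow> complex" where
  "right_avg as F k = (\<Sum>a\<leftarrow>as. F (k ** a)) / of_nat (length as)"

text \<open>Von Neumann's construction: iterated right averages of a continuous function converge uniformly to a constant,
  which is unique because right averages commute with left averages.\<close>

inductive_set right_averages :: "((('n::finite) cmat \<Rightarrow> complex) \<Rightarrow> 'n cmat \<Rightarrow> complex) set" where
  base: "as \<noteq> [] \<Longrightarrow> set as \<subseteq> Ug \<Longrightarrow> right_avg as \<in> right_averages"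
| comp: "T \<in> right_averages \<Longrightarrow> S \<in> right_averages \<Longrightarrow> T \<circ> S \<in> right_averages"

lemma right_averages_add: "T \<in> right_averages \<Longrightarrow> T (\<lambda>k. F k + G k) = (\<lambda>k. T F k + T G k)"
proof (induction arbitrary: F G rule: right_averages.induct)
  case (base as)
  show ?case by (simp add: right_avg_def[abs_def] sum_list_addf add_divide_distrib)
next
  case (comp T S)
  then show ?case by simp
qed

lemma right_averages_cmul: "T \<in> right_averages \<Longrightarrow> T (\<lambda>k. c * F k) = (\<lambda>k. c * T F k)"
proof (induction arbitrary: F rule: right_averages.induct)
  case (base as)
  show ?case by (simp add: right_avg_def[abs_def] sum_list_const_mult)
next
  case (comp T S)
  then show ?case by simp
qed

text \<open>The averaging points multiply from the right, so a factor on the left passes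
  through.\<close>

lemma right_averages_transl: "T \<in> right_averages \<Longrightarrow> T (\<lambda>k. F (a ** k)) = (\<lambda>k. T F (a ** k))"
proof (induction arbitrary: F rule: right_averages.induct)
  case (base as)
  show ?case by (simp add: right_avg_def[abs_def] matrix_mul_assoc)
next
  case (comp T S)
  then show ?case by simp
qed

lemma sum_list_avg_bound:
  fixes f :: "'a \<Rightarrow> real"
  assumes "\<And>x. x \<in> set xs \<Longrightarrow> f x \<le> M"
  shows "(\<Sum>x\<leftarrow>xs. f x) \<le> real (length xs) * M"
  using assms by (induction xs) (auto simp: algebra_simps add_mono)

lemma Re_ravg: "Re (right_avg as F k) = (\<Sum>a\<leftarrow>as. Re (F (k ** a))) / real (length as)"
proof -
  have "Re (\<Sum>a\<leftarrow>as. F (k ** a)) = (\<Sum>a\<leftarrow>as. Re (F (k ** a)))" by (induction as) auto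
  then show ?thesis
    by (simp add: right_avg_def Re_divide_of_nat)
qed

lemma right_avg_Re_le:
  assumes "as \<noteq> []" "\<And>a. a \<in> set as \<Longrightarrow> Re (F (k ** a)) \<le> M"
  shows "Re (right_avg as F k) \<le> M"
  using sum_list_avg_bound[of as "\<lambda>a. Re (F (k ** a))" M] assms
  by (auto simp: Re_ravg divide_le_eq mult.commute)

lemma right_averages_Re_le:
  "T \<in> right_averages \<Longrightarrow> (\<And>k. k \<in> Ug \<Longrightarrow> Re (F k) \<le> M) \<Longrightarrow> k \<in> Ug \<Longrightarrow> Re (T F k) \<le> M"
  by (induction arbitrary: F k rule: right_averages.induct) (auto intro!: right_avg_Re_le Ug_mult)

lemma right_averages_Re_ge:
  assumes "T \<in> right_averages" "\<And>k. k \<in> Ug \<Longrightarrow> m \<le> Re (F k)" "k \<in> Ug" shows "m \<le> Re (T F k)"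
  using right_averages_Re_le[OF assms(1), of "\<lambda>k. (-1) * F k" "-m" k] assms
  unfolding right_averages_cmul[OF assms(1)] by simp

lemma right_averages_norm_le:
  "T \<in> right_averages \<Longrightarrow> (\<And>k. k \<in> Ug \<Longrightarrow> cmod (F k - c) \<le> B) \<Longrightarrow> k \<in> Ug \<Longrightarrow> cmod (T F k - c) \<le> B"
proof (induction arbitrary: F k rule: right_averages.induct)
  case (base as)
  have n: "of_nat (length as) \<noteq> (0::complex)" using base by simp
  have "right_avg as F k - c = (\<Sum>a\<leftarrow>as. F (k ** a) - c) / of_nat (length as)"
    using n by (simp add: right_avg_def field_simps sum_list_subtractf sum_list_triv)
  also have "cmod \<dots> \<le> (\<Sum>a\<leftarrow>as. cmod (F (k ** a) - c)) / real (length as)"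
    unfolding norm_divide using norm_sum[of "\<lambda>i. F (k ** as ! i) - c" "{0..<length as}"]
    by (simp add: divide_right_mono sum_list_sum_nth)
  also have "\<dots> \<le> B"
    using sum_list_avg_bound[of as "\<lambda>a. cmod (F (k ** a) - c)" B] base
    by (auto simp: divide_le_eq mult.commute subset_iff intro: Ug_mult)
  finally show ?case .
qed auto

text \<open>Left translation by \<open>k' ** cadj k\<close> carries \<open>k\<close> to
  \<open>k'\<close> and moves every unitary matrix by the same distance
  \<open>norm (k - k')\<close>. It commutes with right averages, so a modulus of continuity survives
  averaging with the same constants, however many averages are composed.\<close>

lemma right_averages_modulus:
  assumes "T \<in> right_averages" "\<And>k k'. k \<in> Ug \<Longrightarrow> k' \<in> Ug \<Longrightarrow> norm (k - k') < d \<Longrightarrow> Re (F k) \<le> Re (F k') + e"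
    "k \<in> Ug" "k' \<in> Ug" "norm (k - k') < d"
  shows "Re (T F k) \<le> Re (T F k') + e"
proof -
  let ?a = "k' ** cadj k"
  have a: "?a ** k = k'" "?a \<in> Ug"
    using assms by (metis Ug_iff' matrix_mul_assoc matrix_mul_rid, metis Ug_cadj Ug_mult)
  have "Re (F h) \<le> Re (F (?a ** h)) + e" if "h \<in> Ug" for h
  proof (rule assms(2)[OF that])
    have "h = k ** (cadj k ** h)" using assms(3) by (metis Ug_iff matrix_mul_assoc matrix_mul_lid)
    moreover have "?a ** h = k' ** (cadj k ** h)" by (simp add: matrix_mul_assoc)
    ultimately have "norm (h - ?a ** h) = norm ((k - k') ** (cadj k ** h))"
      by (metis matmul_diff_left)
    then show "norm (h - ?a ** h) < d"
      using assms that by (simp add: norm_mult_Ug Ug_mult)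
  qed (use a that Ug_mult in auto)
  then have "Re (T (\<lambda>h. F h + (-1) * F (?a ** h)) k) \<le> e"
    by (intro right_averages_Re_le[OF assms(1) _ assms(3)]) (simp add: algebra_simps)
  then show ?thesis
    unfolding right_averages_add[OF assms(1)] right_averages_cmul[OF assms(1)] right_averages_transl[OF assms(1)] a by simp
qed

lemma Ug_cancel: "cadj k ** (k ** x) = x" if "k \<in> Ug"
  using that by (metis Ug_iff' matrix_mul_assoc matrix_mul_lid)

text \<open>For \<open>k\<close> and \<open>k0\<close> unitary, a net point \<open>b\<close> close
  to \<open>cadj k ** k0\<close> gives \<open>k ** b\<close> close to \<open>k0\<close>. One finite
  list therefore brings every \<open>k\<close> near every target.\<close>

lemma Ug_net:
  fixes d :: real
  assumes "d > 0"
  obtains bs :: "('n::finite) cmat list" where "bs \<noteq> []" "set bs \<subseteq> Ug"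
    "\<And>k k0. k \<in> Ug \<Longrightarrow> k0 \<in> Ug \<Longrightarrow> \<exists>b\<in>set bs. norm (k ** b - k0) < d"
proof -
  have "compact (Ug :: 'n cmat set)" by (rule compact_Ug)
  then have "\<exists>B. finite B \<and> (Ug :: 'n cmat set) \<subseteq> (\<Union>x\<in>B. ball x (d/2))"
    unfolding compact_eq_totally_bounded using assms by (meson half_gt_zero)
  then obtain B0 :: "'n cmat set" where B0: "finite B0" "Ug \<subseteq> (\<Union>x\<in>B0. ball x (d/2))" by blast
  define r where "r x = (SOME y. y \<in> Ug \<inter> ball x (d/2))" for x :: "'n cmat"
  define B where "B = r ` {x \<in> B0. Ug \<inter> ball x (d/2) \<noteq> {}}"
  have r: "r x \<in> Ug \<inter> ball x (d/2)" if "Ug \<inter> ball x (d/2) \<noteq> {}" for x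
    unfolding r_def using that by (meson ex_in_conv someI_ex)
  have B: "finite B" "B \<subseteq> Ug" "Ug \<subseteq> (\<Union>x\<in>B. ball x d)"
  proof -
    show "finite B" "B \<subseteq> Ug" using B0 r by (auto simp: B_def)
    show "Ug \<subseteq> (\<Union>x\<in>B. ball x d)"
    proof
      fix k :: "'n cmat" assume k: "k \<in> Ug"
      then obtain x where x: "x \<in> B0" "k \<in> ball x (d/2)" using B0 by blast
      then have ne: "Ug \<inter> ball x (d/2) \<noteq> {}" using k by blast
      have "dist (r x) k < d" using r[OF ne] x(2)
        by (auto intro: dist_triangle_half_r)
      then show "k \<in> (\<Union>x\<in>B. ball x d)" using x(1) ne by (auto simp: B_def)
    qed
  qed
  obtain bs where bs: "set bs = B" using B(1) finite_list by blast
  show ?thesis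
  proof (rule that[of bs])
    have "mat 1 \<in> (\<Union>x\<in>B. ball x d)" using B(3) Ug_one by blast
    then show "bs \<noteq> []" using bs by auto
    show "set bs \<subseteq> Ug" using bs B by simp
    fix k k0 :: "'n cmat" assume k: "k \<in> Ug" "k0 \<in> Ug"
    then have "cadj k ** k0 \<in> Ug" by (simp add: Ug_mult)
    then obtain b where b: "b \<in> B" "norm (cadj k ** k0 - b) < d"
      using B by (auto simp: dist_norm norm_minus_commute)
    have "cadj k ** (k ** b - k0) = b - cadj k ** k0"
      using k by (simp add: matmul_diff_right Ug_cancel)
    then have "norm (k ** b - k0) = norm (b - cadj k ** k0)"
      using norm_Ug_mult[of "cadj k" "k ** b - k0"] k by simp
    then show "\<exists>b\<in>set bs. norm (k ** b - k0) < d"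
      using b bs by (metis norm_minus_commute)
  qed
qed

text \<open>A single term that lies \<open>s\<close> below the common bound lowers the average by
  its share \<open>s / length bs\<close>.\<close>

lemma right_avg_Re_le_avg:
  assumes "set bs \<subseteq> Ug" "b \<in> set bs" "\<And>a. a \<in> set bs \<Longrightarrow> Re (F (k ** a)) \<le> M"
    and "Re (F (k ** b)) \<le> M - s"
  shows "Re (right_avg bs F k) \<le> M - s / real (length bs)"
proof -
  have "(\<Sum>a\<leftarrow>bs. Re (F (k ** a))) \<le> real (length bs) * M - s"
    using assms(2-4)
  proof (induction bs)
    case (Cons a bs)
    show ?case
    proof (cases "b = a")
      case True
      then show ?thesis using Cons sum_list_avg_bound[of bs "\<lambda>a. Re (F (k ** a))" M]
        by (auto simp: algebra_simps)
    next
      case False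
      then show ?thesis using Cons by (force simp: algebra_simps)
    qed
  qed simp
  moreover have "length bs > 0" using assms by (cases bs) auto
  ultimately show ?thesis unfolding Re_ravg
    by (simp add: field_simps)
qed

text \<open>Averaging over one fixed net contracts the range \<open>[m, M]\<close> by a fixed factor
  while it is longer than \<open>e\<close>. If some value lies in the lower half, every net average
  contains a point near it, which lowers \<open>M\<close>; otherwise \<open>m\<close> can be raised
  to the midpoint. The same net serves at every stage because averages keep the modulus of
  continuity.\<close>

lemma right_averages_osc_Re:
  fixes F :: "('n::finite) cmat \<Rightarrow> complex"
  assumes F: "continuous_on Ug F" and "e > 0"
  shows "\<exists>T\<in>right_averages. \<exists>m M. M - m \<le> e \<and> (\<forall>k\<in>Ug. m \<le> Re (T F k) \<and> Re (T F k) \<le> M)"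
proof -
  have "uniformly_continuous_on Ug F" using F compact_Ug compact_uniformly_continuous by blast
  then obtain d where d: "d > 0" "\<And>k k'. k \<in> Ug \<Longrightarrow> k' \<in> Ug \<Longrightarrow> norm (k - k') < d \<Longrightarrow> cmod (F k - F k') < e/4"
    unfolding uniformly_continuous_on_def dist_norm using \<open>e > 0\<close>
    by (metis divide_pos_pos norm_minus_commute zero_less_numeral)
  have mod: "Re (T F k) \<le> Re (T F k') + e/4" if "T \<in> right_averages" "k \<in> Ug" "k' \<in> Ug" "norm (k - k') < d" for T k k'
  proof (rule right_averages_modulus[OF that(1) _ that(2-4)])
    fix k k' :: "'n cmat" assume "k \<in> Ug" "k' \<in> Ug" "norm (k - k') < d"
    then have "cmod (F k - F k') < e/4" by (rule d)
    then show "Re (F k) \<le> Re (F k') + e/4" using abs_Re_le_cmod[of "F k - F k'"] by simp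
  qed
  obtain bs :: "'n cmat list" where bs: "bs \<noteq> []" "set bs \<subseteq> Ug"
    "\<And>k k0. k \<in> Ug \<Longrightarrow> k0 \<in> Ug \<Longrightarrow> \<exists>b\<in>set bs. norm (k ** b - k0) < d"
    using Ug_net[OF d(1)] by blast
  define N where "N = real (length bs)"
  have N: "N \<ge> 1" using bs(1) by (cases bs) (auto simp: N_def)
  \<comment> \<open>One of the N averaged values is at most (m + M)/2 + e/4, which is below M - (M -
    m)/4 when M - m > e. Hence the range shrinks by (M - m)/(4N); the bound
    \<open>1/2 \<le> q\<close> covers the case of the raised midpoint.\<close>
  define q where "q = 1 - 1/(4*N)"
  have q: "0 < q" "q < 1" "1/2 \<le> q" using N by (auto simp: q_def field_simps)
  obtain B where B: "\<And>k. k \<in> Ug \<Longrightarrow> cmod (F k) \<le> B"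
    using compact_imp_bounded[OF compact_continuous_image[OF F compact_Ug]] by (auto simp: bounded_iff)
  have "\<exists>T\<in>(right_averages :: (('n cmat \<Rightarrow> complex) \<Rightarrow> 'n cmat \<Rightarrow> complex) set). \<exists>m M. m \<le> M \<and> M - m \<le> max e (q^j * (2*B)) \<and> (\<forall>k\<in>Ug. m \<le> Re (T F k) \<and> Re (T F k) \<le> M)" for j
  proof (induction j)
    case 0
    have T: "right_avg [mat 1] \<in> right_averages" by (intro right_averages.base) auto
    have "-B \<le> Re (F k)" "Re (F k) \<le> B" if "k \<in> Ug" for k
      using B[OF that] abs_Re_le_cmod[of "F k"] by auto
    then have "-B \<le> Re (right_avg [mat 1] F k) \<and> Re (right_avg [mat 1] F k) \<le> B" if "k \<in> Ug" for k
      using right_averages_Re_le[OF T, of F B k] right_averages_Re_ge[OF T, of "-B" F k] that by auto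
    moreover have "0 \<le> B" using B[OF Ug_one] norm_ge_zero order_trans by blast
    ultimately show ?case using T by (intro bexI[OF _ T] exI[of _ "-B"] exI[of _ B]) auto
  next
    case (Suc j)
    then obtain T m M where T: "T \<in> right_averages" "m \<le> M" "M - m \<le> max e (q^j * (2*B))"
      "\<And>k. k \<in> Ug \<Longrightarrow> m \<le> Re (T F k) \<and> Re (T F k) \<le> M" by blast
    show ?case
    proof (cases "M - m \<le> e")
      case True
      then show ?thesis using T by (intro bexI[OF _ T(1)] exI[of _ m] exI[of _ M]) auto
    next
      case False
      then have le: "M - m \<le> q^j * (2*B)" using T by auto
      have qq: "q * (M - m) \<le> q^Suc j * (2*B)"
        using mult_left_mono[OF le, of q] q by (simp add: mult.assoc)
      show ?thesis
      proof (cases "\<exists>k0\<in>Ug. Re (T F k0) \<le> (m + M)/2")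
        case True
        then obtain k0 where k0: "k0 \<in> Ug" "Re (T F k0) \<le> (m + M)/2" by blast
        have S: "right_avg bs \<circ> T \<in> right_averages" using T(1) bs right_averages.base right_averages.comp by blast
        have up: "Re ((right_avg bs \<circ> T) F k) \<le> M - (M - m)/4 / N" if k: "k \<in> Ug" for k
        proof -
          obtain b where b: "b \<in> set bs" "norm (k ** b - k0) < d" using bs(3)[OF k k0(1)] by blast
          have "k ** b \<in> Ug" using b bs k Ug_mult by blast
          then have "Re (T F (k ** b)) \<le> (m + M)/2 + e/4" using mod[OF T(1) _ k0(1) b(2)] k0(2) by linarith
          then have "Re (T F (k ** b)) \<le> M - (M - m)/4" using False by (simp add: field_simps)
          then show ?thesis
            unfolding o_def N_def using T(4) bs(2) k b(1)
            by (intro right_avg_Re_le_avg[of bs b]) (auto intro: Ug_mult)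
        qed
        have lo: "m \<le> Re ((right_avg bs \<circ> T) F k)" if k: "k \<in> Ug" for k
          using right_averages_Re_ge[OF right_averages.base[OF bs(1,2)], of m "T F" k] T(4) k by simp
        have "M - (M - m)/4 / N - m = q * (M - m)" by (simp add: q_def algebra_simps)
        moreover have "0 \<le> q * (M - m)" using q T by simp
        ultimately show ?thesis using up lo qq
          by (intro bexI[OF _ S] exI[of _ m] exI[of _ "M - (M - m)/4 / N"]) auto
      next
        case nex: False
        have "M - (m + M)/2 \<le> q * (M - m)" using q T(2) mult_right_mono[of "1/2" q "M - m"]
          by (simp add: field_simps)
        then have "M - (m + M)/2 \<le> max e (q^Suc j * (2*B))" using qq by linarith
        moreover have "\<forall>k\<in>Ug. (m + M)/2 \<le> Re (T F k) \<and> Re (T F k) \<le> M"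
          using nex T(4) by (meson less_eq_real_def linorder_not_le)
        moreover have "(m + M)/2 \<le> M" using T(2) by simp
        ultimately show ?thesis using T(1) by blast
      qed
    qed
  qed
  moreover have "(\<lambda>j. q^j * (2*B)) \<longlonglongrightarrow> 0 * (2*B)"
    using q by (intro tendsto_intros LIMSEQ_realpow_zero) auto
  then have "\<forall>\<^sub>F j in sequentially. q^j * (2*B) < e"
    using \<open>e > 0\<close> by (intro order_tendstoD(2)[where a=e]) simp_all
  then obtain j where "q^j * (2*B) < e" using eventually_sequentially by auto
  then have "max e (q^j * (2*B)) = e" by simp
  ultimately show ?thesis by metis
qed

lemma right_averages_continuous:
  "T \<in> right_averages \<Longrightarrow> continuous_on Ug F \<Longrightarrow> continuous_on Ug (T F)"
proof (induction arbitrary: F rule: right_averages.induct)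
  case (base as)
  have "continuous_on Ug (\<lambda>k. F (k ** a))" if "a \<in> Ug" for a
    using base(3) by (rule continuous_on_compose2) (auto intro!: continuous_intros Ug_mult that)
  then have "continuous_on Ug (\<lambda>k. \<Sum>a\<leftarrow>as. F (k ** a))" using base(2)
    by (induction as) (auto intro!: continuous_intros)
  then show ?case using base(1) unfolding right_avg_def by (intro continuous_intros) auto
qed auto

text \<open>Real parts are flattened first and imaginary parts second. The second average preserves
  the bounds on the real part obtained by the first.\<close>

lemma right_averages_osc:
  assumes F: "continuous_on Ug F" and "e > 0"
  shows "\<exists>T\<in>right_averages. \<exists>c. \<forall>k\<in>Ug. cmod (T F k - c) \<le> e"
proof -
  obtain T m M where T: "T \<in> right_averages" "M - m \<le> e/2" "\<And>k. k \<in> Ug \<Longrightarrow> m \<le> Re (T F k) \<and> Re (T F k) \<le> M"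
    using right_averages_osc_Re[OF F, of "e/2"] \<open>e > 0\<close> by auto
  have cont: "continuous_on Ug (\<lambda>k. -\<i> * T F k)"
    using right_averages_continuous[OF T(1) F] by (intro continuous_intros)
  obtain S m' M' where S: "S \<in> right_averages" "M' - m' \<le> e/2"
    "\<And>k. k \<in> Ug \<Longrightarrow> m' \<le> Re (S (\<lambda>k. -\<i> * T F k) k) \<and> Re (S (\<lambda>k. -\<i> * T F k) k) \<le> M'"
    using right_averages_osc_Re[OF cont, of "e/2"] \<open>e > 0\<close> by auto
  have im: "m' \<le> Im (S (T F) k) \<and> Im (S (T F) k) \<le> M'" if "k \<in> Ug" for k
    using S(3)[OF that] unfolding right_averages_cmul[OF S(1)] by simp
  have re: "m \<le> Re (S (T F) k) \<and> Re (S (T F) k) \<le> M" if "k \<in> Ug" for k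
    using right_averages_Re_le[OF S(1), of "T F" M] right_averages_Re_ge[OF S(1), of m "T F"] T(3) that by blast
  have "cmod ((S \<circ> T) F k - Complex m m') \<le> e" if "k \<in> Ug" for k
  proof -
    have "cmod (S (T F) k - Complex m m') \<le> \<bar>Re (S (T F) k - Complex m m')\<bar> + \<bar>Im (S (T F) k - Complex m m')\<bar>"
      by (rule cmod_le)
    also have "\<dots> \<le> e" using im[OF that] re[OF that] T(2) S(2) by simp
    finally show ?thesis by simp
  qed
  then show ?thesis using right_averages.comp[OF S(1) T(1)] by blast
qed

definition is_mean :: "(('n::finite) cmat \<Rightarrow> complex) \<Rightarrow> complex \<Rightarrow> bool" where
  "is_mean F c \<longleftrightarrow> (\<forall>e>0. \<exists>T\<in>right_averages. \<forall>k\<in>Ug. cmod (T F k - c) \<le> e)"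

text \<open>Inversion turns right averages into left ones: for a list \<open>as\<close> this is the
  average of \<open>F (cadj a ** k)\<close> over \<open>as\<close>.\<close>

definition left_avg :: "((('n::finite) cmat \<Rightarrow> complex) \<Rightarrow> 'n cmat \<Rightarrow> complex) \<Rightarrow> ('n cmat \<Rightarrow> complex) \<Rightarrow> 'n cmat \<Rightarrow> complex" where
  "left_avg T F k = T (\<lambda>h. F (cadj h)) (cadj k)"

lemma left_avg_transl:
  assumes "T \<in> right_averages" shows "left_avg T (\<lambda>k. F (k ** a)) = (\<lambda>k. left_avg T F (k ** a))"
  unfolding left_avg_def
  using right_averages_transl[OF assms, of "\<lambda>h. F (cadj h)" "cadj a"] by (simp add: cadj_mult)

lemma left_avg_add: "T \<in> right_averages \<Longrightarrow> left_avg T (\<lambda>k. F k + G k) = (\<lambda>k. left_avg T F k + left_avg T G k)"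
  unfolding left_avg_def using right_averages_add[of T] by simp

lemma left_avg_cmul: "T \<in> right_averages \<Longrightarrow> left_avg T (\<lambda>k. c * F k) = (\<lambda>k. c * left_avg T F k)"
  unfolding left_avg_def using right_averages_cmul[of T] by simp

lemma left_avg_sum_list: "T \<in> right_averages \<Longrightarrow> left_avg T (\<lambda>k. \<Sum>a\<leftarrow>as. F a k) = (\<lambda>k. \<Sum>a\<leftarrow>as. left_avg T (F a) k)"
proof (induction as)
  case Nil
  then show ?case using left_avg_cmul[of T 0 "\<lambda>_. 0"] by simp
qed (simp add: left_avg_add)

text \<open>Left and right translations commute by associativity, and averages are finite
  combinations of them.\<close>

lemma left_avg_comm:
  assumes "T \<in> right_averages" shows "S \<in> right_averages \<Longrightarrow> left_avg T (S F) = S (left_avg T F)"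
proof (induction arbitrary: F rule: right_averages.induct)
  case (base as)
  have "left_avg T (right_avg as F) = left_avg T (\<lambda>k. (1 / of_nat (length as)) * (\<Sum>a\<leftarrow>as. F (k ** a)))"
    by (simp add: right_avg_def[abs_def])
  also have "\<dots> = right_avg as (left_avg T F)"
    unfolding left_avg_cmul[OF assms] left_avg_sum_list[OF assms] left_avg_transl[OF assms]
    by (simp add: right_avg_def[abs_def])
  finally show ?case .
qed auto

lemma left_avg_norm_le:
  "T \<in> right_averages \<Longrightarrow> (\<And>k. k \<in> Ug \<Longrightarrow> cmod (F k - c) \<le> B) \<Longrightarrow> k \<in> Ug \<Longrightarrow> cmod (left_avg T F k - c) \<le> B"
  unfolding left_avg_def by (rule right_averages_norm_le) auto

lemma left_avg_osc:
  assumes F: "continuous_on Ug F" and "e > 0"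
  shows "\<exists>T\<in>right_averages. \<exists>c. \<forall>k\<in>Ug. cmod (left_avg T F k - c) \<le> e"
proof -
  have "continuous_on Ug (\<lambda>k. F (cadj k))"
    by (rule continuous_on_compose2[OF F]) (auto intro!: continuous_intros)
  from right_averages_osc[OF this assms(2)] show ?thesis unfolding left_avg_def by (meson Ug_cadj)
qed

text \<open>Both constants approximate the single value of
  \<open>left_avg S (T F) = T (left_avg S F)\<close> at \<open>mat 1\<close>. All uniqueness and
  invariance of the mean rests on this comparison.\<close>

lemma means_close:
  assumes "T \<in> right_averages" "S \<in> right_averages" "\<And>k. k \<in> Ug \<Longrightarrow> cmod (T F k - c) \<le> e"
    and "\<And>k. k \<in> Ug \<Longrightarrow> cmod (left_avg S F k - c') \<le> e'"
  shows "cmod (c - c') \<le> e + e'"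
proof -
  let ?w = "left_avg S (T F) (mat 1)"
  have "cmod (?w - c) \<le> e" by (rule left_avg_norm_le) (use assms in auto)
  moreover have "cmod (T (left_avg S F) (mat 1) - c') \<le> e'" by (rule right_averages_norm_le) (use assms in auto)
  ultimately show ?thesis using left_avg_comm[OF assms(2,1), of F]
    by (smt (verit) norm_minus_commute norm_triangle_sub norm_triangle_ineq norm_diff_triangle_le)
qed

text \<open>The constants of increasingly flat right averages form a Cauchy sequence, since any two
  are compared through one very flat left average.\<close>

lemma is_mean_ex:
  assumes F: "continuous_on Ug F" shows "\<exists>c. is_mean F c"
proof -
  have "\<forall>n. \<exists>T c. T \<in> right_averages \<and> (\<forall>k\<in>Ug. cmod (T F k - c) \<le> 1 / Suc n)"
    using right_averages_osc[OF F] by (metis of_nat_0_less_iff zero_less_Suc zero_less_divide_1_iff)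
  then obtain T c where T: "\<And>n. T n \<in> right_averages" "\<And>n k. k \<in> Ug \<Longrightarrow> cmod (T n F k - c n) \<le> 1 / Suc n"
    by metis
  have cl: "cmod (c n - c m) \<le> 1/Suc n + 1/Suc m" for n m
  proof (rule field_le_epsilon)
    fix e :: real assume "e > 0"
    then obtain S c' where S: "S \<in> right_averages" "\<And>k. k \<in> Ug \<Longrightarrow> cmod (left_avg S F k - c') \<le> e/2"
      using left_avg_osc[OF F, of "e/2"] by auto
    show "cmod (c n - c m) \<le> 1/Suc n + 1/Suc m + e"
      using means_close[OF T(1) S(1) T(2) S(2), of n] means_close[OF T(1) S(1) T(2) S(2), of m]
        norm_triangle_ineq4[of "c n - c'" "c m - c'"] by simp
  qed
  have "Cauchy c"
  proof (rule metric_CauchyI)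
    fix e :: real assume "e > 0"
    then obtain N where N: "1 / Suc N < e/2" by (metis half_gt_zero nat_approx_posE)
    have "1 / Suc n < e/2" if "n \<ge> N" for n
    proof -
      have "1 / real (Suc n) \<le> 1 / real (Suc N)" using that by (intro divide_left_mono) auto
      then show ?thesis using N by linarith
    qed
    then have "dist (c m) (c n) < e" if "m \<ge> N" "n \<ge> N" for m n
      using cl[of m n] that unfolding dist_norm by (smt (verit) field_sum_of_halves)
    then show "\<exists>M. \<forall>m\<ge>M. \<forall>n\<ge>M. dist (c m) (c n) < e" by blast
  qed
  then obtain c' where c': "c \<longlonglongrightarrow> c'" using Cauchy_convergent convergent_def by blast
  have "is_mean F c'" unfolding is_mean_def
  proof (intro allI impI)
    fix e :: real assume e: "e > 0"
    obtain N where N: "\<And>n. n \<ge> N \<Longrightarrow> cmod (c n - c') < e/2"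
      using LIMSEQ_D[OF c', of "e/2"] e by auto
    obtain M where M: "1 / Suc M < e/2" by (metis e half_gt_zero nat_approx_posE)
    define n where "n = max N M"
    have n: "1 / Suc n \<le> 1 / Suc M" by (simp add: n_def frac_le)
    have "cmod (T n F k - c') \<le> e" if "k \<in> Ug" for k
      using T(2)[OF that, of n] N[of n] M n norm_triangle_ineq[of "T n F k - c n" "c n - c'"]
      by (simp add: n_def)
    then show "\<exists>T\<in>right_averages. \<forall>k\<in>Ug. cmod (T F k - c') \<le> e" using T(1) by blast
  qed
  then show ?thesis by blast
qed

lemma is_mean_lavg:
  assumes F: "continuous_on Ug F" and "is_mean F c" "e > 0"
  shows "\<exists>S\<in>right_averages. \<forall>k\<in>Ug. cmod (left_avg S F k - c) \<le> e"
proof -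
  obtain S c' where S: "S \<in> right_averages" "\<And>k. k \<in> Ug \<Longrightarrow> cmod (left_avg S F k - c') \<le> e/3"
    using left_avg_osc[OF F, of "e/3"] assms(3) by auto
  obtain T where T: "T \<in> right_averages" "\<And>k. k \<in> Ug \<Longrightarrow> cmod (T F k - c) \<le> e/3"
    using assms(2,3) unfolding is_mean_def by (metis zero_less_divide_iff zero_less_numeral)
  have "cmod (c - c') \<le> e/3 + e/3" using means_close[OF T(1) S(1) T(2) S(2)] .
  then have "cmod (left_avg S F k - c) \<le> e" if "k \<in> Ug" for k
    using S(2)[OF that] norm_triangle_ineq4[of "left_avg S F k - c'" "c - c'"] by simp
  then show ?thesis using S(1) by blast
qed

lemma is_mean_unique:
  assumes F: "continuous_on Ug F" and "is_mean F c" "is_mean F c'"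
  shows "c = c'"
proof (rule ccontr)
  assume "c \<noteq> c'"
  then have e: "cmod (c - c') / 3 > 0" by simp
  obtain S where S: "S \<in> right_averages" "\<And>k. k \<in> Ug \<Longrightarrow> cmod (left_avg S F k - c') \<le> cmod (c - c') / 3"
    using is_mean_lavg[OF F assms(3) e] by auto
  obtain T where T: "T \<in> right_averages" "\<And>k. k \<in> Ug \<Longrightarrow> cmod (T F k - c) \<le> cmod (c - c') / 3"
    using assms(2) e unfolding is_mean_def by blast
  show False using means_close[OF T(1) S(1) T(2) S(2)] e by simp
qed

text \<open>The choice is meaningful for functions continuous on the unitary group only.\<close>

definition haar_mean :: "(('n::finite) cmat \<Rightarrow> complex) \<Rightarrow> complex" where
  "haar_mean F = (THE c. is_mean F c)"

section \<open>Linearity, invariance and strict positivity of the mean\<close>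

lemma is_mean_haar_mean: "continuous_on Ug F \<Longrightarrow> is_mean F (haar_mean F)"
  unfolding haar_mean_def using is_mean_ex is_mean_unique by (metis theI)

lemma haar_mean_eqI: "continuous_on Ug F \<Longrightarrow> is_mean F c \<Longrightarrow> haar_mean F = c"
  using is_mean_haar_mean is_mean_unique by blast

text \<open>An average \<open>T\<close> that flattens \<open>F\<close> may leave \<open>G\<close>
  uneven. A further average \<open>S\<close> flattens \<open>T G\<close> and keeps
  \<open>T F\<close> flat; the mean of \<open>T G\<close> is that of \<open>G\<close> because
  \<open>S \<circ> T\<close> is again an average of \<open>G\<close>.\<close>

lemma haar_mean_add:
  assumes F: "continuous_on Ug F" and G: "continuous_on Ug G"
  shows "haar_mean (\<lambda>k. F k + G k) = haar_mean F + haar_mean G"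
proof (rule haar_mean_eqI)
  show "continuous_on Ug (\<lambda>k. F k + G k)" using F G by (intro continuous_intros)
  show "is_mean (\<lambda>k. F k + G k) (haar_mean F + haar_mean G)"
    unfolding is_mean_def
  proof (intro allI impI)
    fix e :: real assume "e > 0"
    then have e: "e/3 > 0" by simp
    obtain T where T: "T \<in> right_averages" "\<And>k. k \<in> Ug \<Longrightarrow> cmod (T F k - haar_mean F) \<le> e/3"
      using is_mean_haar_mean[OF F] e unfolding is_mean_def by blast
    obtain S where S: "S \<in> right_averages" "\<And>k. k \<in> Ug \<Longrightarrow> cmod (S (T G) k - haar_mean (T G)) \<le> e/3"
      using is_mean_haar_mean[OF right_averages_continuous[OF T(1) G]] e unfolding is_mean_def by blast
    have "is_mean G (haar_mean (T G))" unfolding is_mean_def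
    proof (intro allI impI)
      fix e :: real assume "e > 0"
      then obtain S where "S \<in> right_averages" "\<And>k. k \<in> Ug \<Longrightarrow> cmod (S (T G) k - haar_mean (T G)) \<le> e"
        using is_mean_haar_mean[OF right_averages_continuous[OF T(1) G]] unfolding is_mean_def by blast
      then show "\<exists>S\<in>right_averages. \<forall>k\<in>Ug. cmod (S G k - haar_mean (T G)) \<le> e"
        by (intro bexI[of _ "S \<circ> T"] right_averages.comp T(1)) auto
    qed
    then have TG: "haar_mean (T G) = haar_mean G" using haar_mean_eqI[OF G] by simp
    have ST: "S \<circ> T \<in> right_averages" using S T right_averages.comp by blast
    have "cmod ((S \<circ> T) (\<lambda>k. F k + G k) k - (haar_mean F + haar_mean G)) \<le> e" if "k \<in> Ug" for k
    proof -
      have 1: "cmod (S (T F) k - haar_mean F) \<le> e/3" by (rule right_averages_norm_le[OF S(1) T(2) that])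
      have 2: "cmod (S (T G) k - haar_mean G) \<le> e/3" using S(2)[OF that] TG by simp
      have eq: "(S \<circ> T) (\<lambda>k. F k + G k) k - (haar_mean F + haar_mean G) = (S (T F) k - haar_mean F) + (S (T G) k - haar_mean G)"
        by (simp add: right_averages_add[OF T(1)] right_averages_add[OF S(1)])
      show ?thesis unfolding eq
        using 1 2 norm_triangle_ineq[of "S (T F) k - haar_mean F" "S (T G) k - haar_mean G"] \<open>e > 0\<close> by linarith
    qed
    then show "\<exists>T\<in>right_averages. \<forall>k\<in>Ug. cmod (T (\<lambda>k. F k + G k) k - (haar_mean F + haar_mean G)) \<le> e" using ST by blast
  qed
qed

lemma is_mean_cmul: "is_mean F c \<Longrightarrow> is_mean (\<lambda>k. a * F k) (a * c)"
  unfolding is_mean_def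
proof (intro allI impI)
  fix e :: real assume *: "\<forall>e>0. \<exists>T\<in>right_averages. \<forall>k\<in>Ug. cmod (T F k - c) \<le> e" and "e > 0"
  then have "e / (1 + cmod a) > 0" by (simp add: add_pos_nonneg)
  then obtain T where T: "T \<in> right_averages" "\<And>k. k \<in> Ug \<Longrightarrow> cmod (T F k - c) \<le> e / (1 + cmod a)" using * by blast
  have "cmod (a * T F k - a * c) \<le> e" if "k \<in> Ug" for k
  proof -
    have "cmod (a * T F k - a * c) = cmod a * cmod (T F k - c)"
      by (simp add: norm_mult flip: right_diff_distrib)
    also have "\<dots> \<le> (1 + cmod a) * (e / (1 + cmod a))" using T(2)[OF that] by (intro mult_mono) auto
    also have "1 + cmod a \<noteq> 0" using norm_ge_zero[of a] by linarith
    then have "(1 + cmod a) * (e / (1 + cmod a)) = e" by simp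
    finally show ?thesis .
  qed
  then show "\<exists>T\<in>right_averages. \<forall>k\<in>Ug. cmod (T (\<lambda>k. a * F k) k - a * c) \<le> e"
    using T(1) by (intro bexI[OF _ T(1)]) (simp add: right_averages_cmul)
qed

lemma haar_mean_cmul: "continuous_on Ug F \<Longrightarrow> haar_mean (\<lambda>k. a * F k) = a * haar_mean F"
  by (intro haar_mean_eqI is_mean_cmul is_mean_haar_mean) (auto intro!: continuous_intros)

lemma haar_mean_const_bound:
  assumes F: "continuous_on Ug F" and "\<And>k. k \<in> Ug \<Longrightarrow> cmod (F k - c) \<le> B"
  shows "cmod (haar_mean F - c) \<le> B"
proof (rule field_le_epsilon)
  fix e :: real assume "e > 0"
  then obtain T where T: "T \<in> right_averages" "\<And>k. k \<in> Ug \<Longrightarrow> cmod (T F k - haar_mean F) \<le> e"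
    using is_mean_haar_mean[OF F] unfolding is_mean_def by blast
  have "cmod (T F (mat 1) - c) \<le> B" by (rule right_averages_norm_le) (use assms T in auto)
  moreover have "cmod (T F (mat 1) - haar_mean F) \<le> e" using T by simp
  ultimately show "cmod (haar_mean F - c) \<le> B + e"
    using norm_triangle_ineq4[of "T F (mat 1) - c" "T F (mat 1) - haar_mean F"] by simp
qed

lemma haar_mean_bound:
  "continuous_on Ug F \<Longrightarrow> (\<And>k. k \<in> Ug \<Longrightarrow> cmod (F k) \<le> B) \<Longrightarrow> cmod (haar_mean F) \<le> B"
  using haar_mean_const_bound[of F 0 B] by simp

lemma haar_mean_eq_const:
  assumes "\<And>k. k \<in> Ug \<Longrightarrow> F k = c"
  shows "haar_mean F = c"
proof -
  have "continuous_on Ug F" using assms by (metis continuous_on_cong continuous_on_const)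
  from haar_mean_const_bound[OF this, of c 0] show ?thesis using assms by simp
qed

lemma haar_mean_diff:
  assumes F: "continuous_on Ug F" and G: "continuous_on Ug G"
  shows "haar_mean (\<lambda>k. F k - G k) = haar_mean F - haar_mean G"
proof -
  have "haar_mean (\<lambda>k. F k + (-1) * G k) = haar_mean F + (-1) * haar_mean G"
    using assms haar_mean_cmul[OF G, of "-1"] by (subst haar_mean_add) (auto intro!: continuous_intros)
  then show ?thesis by simp
qed

lemma haar_mean_cong:
  assumes F: "continuous_on Ug F" and "\<And>k. k \<in> Ug \<Longrightarrow> F k = G k"
  shows "haar_mean F = haar_mean G"
proof -
  have G: "continuous_on Ug G" using assms by (metis continuous_on_cong)
  have "haar_mean (\<lambda>k. F k - G k) = 0" by (rule haar_mean_eq_const) (use assms in auto)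
  then show ?thesis using haar_mean_diff[OF F G] by simp
qed

lemma haar_mean_sum:
  assumes "finite I" "\<And>i. i \<in> I \<Longrightarrow> continuous_on Ug (F i)"
  shows "haar_mean (\<lambda>k. \<Sum>i\<in>I. F i k) = (\<Sum>i\<in>I. haar_mean (F i))"
  using assms
proof (induction I)
  case empty
  then show ?case by (simp add: haar_mean_eq_const)
next
  case (insert i I)
  have "haar_mean (\<lambda>k. F i k + (\<Sum>i\<in>I. F i k)) = haar_mean (F i) + haar_mean (\<lambda>k. \<Sum>i\<in>I. F i k)"
    using insert by (intro haar_mean_add) (auto intro!: continuous_intros)
  then show ?case using insert by simp
qed

text \<open>A left average that flattens \<open>F\<close> also flattens its right translate, at the
  same constant, so \<open>means_close\<close> excludes a different mean.\<close>

lemma haar_mean_right: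
  assumes F: "continuous_on Ug F" and l: "l \<in> Ug"
  shows "haar_mean (\<lambda>k. F (k ** l)) = haar_mean F"
proof -
  have Fl: "continuous_on Ug (\<lambda>k. F (k ** l))"
    by (rule continuous_on_compose2[OF F]) (auto intro!: continuous_intros Ug_mult l)
  show ?thesis
  proof (rule ccontr)
    let ?c = "haar_mean (\<lambda>k. F (k ** l))"
    assume "\<not> ?thesis"
    then have e: "cmod (?c - haar_mean F) / 3 > 0" by simp
    obtain S where S: "S \<in> right_averages" "\<And>k. k \<in> Ug \<Longrightarrow> cmod (left_avg S F k - haar_mean F) \<le> cmod (?c - haar_mean F) / 3"
      using is_mean_lavg[OF F is_mean_haar_mean[OF F] e] by auto
    have S2: "cmod (left_avg S (\<lambda>k. F (k ** l)) k - haar_mean F) \<le> cmod (?c - haar_mean F) / 3" if "k \<in> Ug" for k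
      unfolding left_avg_transl[OF S(1)] using S(2) that l Ug_mult by blast
    obtain T where T: "T \<in> right_averages" "\<And>k. k \<in> Ug \<Longrightarrow> cmod (T (\<lambda>k. F (k ** l)) k - ?c) \<le> cmod (?c - haar_mean F) / 3"
      using is_mean_haar_mean[OF Fl] e unfolding is_mean_def by blast
    show False using means_close[OF T(1) S(1) T(2) S2] e by simp
  qed
qed

text \<open>If \<open>r k\<close> were positive, \<open>r\<close> would exceed half of it on a ball
  around \<open>k\<close>. Some translate by a net point enters that ball from every starting point,
  so the sum of the translates is at least \<open>r k / 2\<close> everywhere, although its mean is 0
  by invariance.\<close>

lemma haar_mean_eq_0_imp:
  fixes r :: "('n::finite) cmat \<Rightarrow> real"
  assumes F: "continuous_on Ug (\<lambda>k. complex_of_real (r k))" and r: "\<And>k. k \<in> Ug \<Longrightarrow> 0 \<le> r k"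
    and 0: "haar_mean (\<lambda>k. complex_of_real (r k)) = 0" and k: "k \<in> Ug"
  shows "r k = 0"
proof (rule ccontr)
  assume "r k \<noteq> 0"
  then have pos: "r k > 0" using r k by force
  let ?F = "\<lambda>k. complex_of_real (r k)"
  obtain d where d: "d > 0" "\<And>h. h \<in> Ug \<Longrightarrow> norm (h - k) < d \<Longrightarrow> cmod (?F h - ?F k) < r k / 2"
    using F k pos unfolding continuous_on_iff dist_norm by (metis half_gt_zero)
  obtain bs :: "'n cmat list" where bs: "bs \<noteq> []" "set bs \<subseteq> Ug"
    "\<And>k k0. k \<in> Ug \<Longrightarrow> k0 \<in> Ug \<Longrightarrow> \<exists>b\<in>set bs. norm (k ** b - k0) < d"
    using Ug_net[OF d(1)] by blast
  let ?G = "\<lambda>h. \<Sum>b\<leftarrow>bs. ?F (h ** b)"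
  have cont: "continuous_on Ug (\<lambda>h. ?F (h ** b))" if "b \<in> Ug" for b
    by (rule continuous_on_compose2[OF F]) (auto intro!: continuous_intros Ug_mult that)
  have contG: "continuous_on Ug ?G" using bs(2) by (induction bs) (auto intro!: continuous_intros cont)
  have hmG: "haar_mean ?G = 0" using bs(2)
  proof (induction bs)
    case Nil
    then show ?case by (simp add: haar_mean_eq_const)
  next
    case (Cons b bs)
    have c: "continuous_on Ug (\<lambda>h. \<Sum>b\<leftarrow>bs. ?F (h ** b))"
      using Cons(2) by (induction bs) (auto intro!: continuous_intros cont)
    have "haar_mean (\<lambda>h. ?F (h ** b) + (\<Sum>b\<leftarrow>bs. ?F (h ** b))) = haar_mean (\<lambda>h. ?F (h ** b)) + haar_mean (\<lambda>h. \<Sum>b\<leftarrow>bs. ?F (h ** b))"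
      using Cons(2) by (intro haar_mean_add cont c) auto
    then show ?case using Cons haar_mean_right[OF F, of b] 0 by simp
  qed
  have G: "?G h = complex_of_real (\<Sum>b\<leftarrow>bs. r (h ** b))" for h by (induction bs) auto
  have ge: "r k / 2 \<le> Re (?G h)" if h: "h \<in> Ug" for h
  proof -
    obtain b where b: "b \<in> set bs" "norm (h ** b - k) < d" using bs(3)[OF h k] by blast
    have "cmod (?F (h ** b) - ?F k) < r k / 2" using d(2) b bs h Ug_mult by blast
    then have "\<bar>r (h ** b) - r k\<bar> < r k / 2" by (simp flip: of_real_diff)
    then have "r k / 2 \<le> r (h ** b)" by linarith
    also have "\<dots> \<le> (\<Sum>b\<leftarrow>bs. r (h ** b))"
      using b(1) bs(2) r h by (intro member_le_sum_list) (auto intro: Ug_mult)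
    finally show ?thesis unfolding G by simp
  qed
  obtain T where T: "T \<in> right_averages" "\<And>h. h \<in> Ug \<Longrightarrow> cmod (T ?G h - 0) \<le> r k / 4"
    using is_mean_haar_mean[OF contG] pos unfolding is_mean_def hmG
    by (metis zero_less_divide_iff zero_less_numeral)
  have "r k / 2 \<le> Re (T ?G (mat 1))" by (rule right_averages_Re_ge[OF T(1) ge]) auto
  then show False using T(2)[of "mat 1"] complex_Re_le_cmod[of "T ?G (mat 1)"] pos by simp
qed

subsection \<open>Twice continuously differentiable functions\<close>

text \<open>The derivatives are carried as explicit functions; in \<open>f2 z w v\<close> the
  direction \<open>v\<close> belongs to the first differentiation and \<open>w\<close> to the
  second. In finite dimension, continuity for each fixed pair of directions is enough.\<close>

definition C2_on :: "'a::euclidean_space set \<Rightarrow> ('a \<Rightarrow> complex) \<Rightarrow> ('a \<Rightarrow> 'a \<Rightarrow> complex) \<Rightarrow> ('a \<Rightarrow> 'a \<Rightarrow> 'a \<Rightarrow> complex) \<Rightarrow> bool" where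
  "C2_on U f f1 f2 \<longleftrightarrow> open U \<and> (\<forall>z\<in>U. (f has_derivative f1 z) (at z)) \<and>
     (\<forall>z\<in>U. \<forall>v. ((\<lambda>y. f1 y v) has_derivative (\<lambda>w. f2 z w v)) (at z)) \<and>
     (\<forall>v w. continuous_on U (\<lambda>z. f2 z w v))"

lemma C2_onD:
  assumes "C2_on U f f1 f2"
  shows "open U" "z \<in> U \<Longrightarrow> (f has_derivative f1 z) (at z)"
    "z \<in> U \<Longrightarrow> ((\<lambda>y. f1 y v) has_derivative (\<lambda>w. f2 z w v)) (at z)"
    "continuous_on U (\<lambda>z. f2 z w v)"
  using assms by (auto simp: C2_on_def)

lemma C2_on_linear1: "C2_on U f f1 f2 \<Longrightarrow> z \<in> U \<Longrightarrow> linear (f1 z)"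
  by (meson C2_onD(2) has_derivative_linear)

text \<open>Linearity in the second argument is inherited from linearity of \<open>f1 y\<close> at
  all \<open>y\<close> near \<open>z\<close>, through uniqueness of derivatives.\<close>

lemma C2_on_bilinear:
  assumes "C2_on U f f1 f2" "z \<in> U" shows "bilinear (f2 z)"
  unfolding bilinear_def
proof (intro conjI allI)
  fix v
  show "linear (\<lambda>w. f2 z w v)" using C2_onD(3)[OF assms] has_derivative_linear by blast
next
  fix w
  have ev: "\<forall>\<^sub>F y in at z. y \<in> U"
    using C2_onD(1)[OF assms(1)] assms(2) by (simp add: eventually_at_in_open')
  show "linear (f2 z w)"
  proof (rule linearI)
    fix a b
    have "((\<lambda>y. f1 y a + f1 y b) has_derivative (\<lambda>w. f2 z w a + f2 z w b)) (at z)"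
      by (intro has_derivative_add C2_onD(3)[OF assms])
    moreover have "((\<lambda>y. f1 y a + f1 y b) has_derivative (\<lambda>w. f2 z w (a + b))) (at z)"
      by (rule has_derivative_transform_within_open[OF C2_onD(3)[OF assms, of "a+b"] C2_onD(1)[OF assms(1)] assms(2)])
        (use C2_on_linear1[OF assms(1)] linear_add in blast)
    ultimately show "f2 z w (a + b) = f2 z w a + f2 z w b"
      by (metis has_derivative_unique)
  next
    fix r a
    have "((\<lambda>y. r *\<^sub>R f1 y a) has_derivative (\<lambda>w. r *\<^sub>R f2 z w a)) (at z)"
      by (intro has_derivative_scaleR_right C2_onD(3)[OF assms])
    moreover have "((\<lambda>y. r *\<^sub>R f1 y a) has_derivative (\<lambda>w. f2 z w (r *\<^sub>R a))) (at z)"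
      by (rule has_derivative_transform_within_open[OF C2_onD(3)[OF assms, of "r *\<^sub>R a"] C2_onD(1)[OF assms(1)] assms(2)])
        (use C2_on_linear1[OF assms(1)] linear_scale in blast)
    ultimately show "f2 z w (r *\<^sub>R a) = r *\<^sub>R f2 z w a"
      by (metis has_derivative_unique)
  qed
qed

lemma linear_euclidean_expand:
  fixes g :: "'a::euclidean_space \<Rightarrow> complex"
  assumes "linear g" shows "g x = (\<Sum>b\<in>Basis. (x \<bullet> b) *\<^sub>R g b)"
proof -
  have "g (\<Sum>b\<in>Basis. (x \<bullet> b) *\<^sub>R b) = (\<Sum>b\<in>Basis. (x \<bullet> b) *\<^sub>R g b)"
    using assms by (simp add: linear_sum linear_scale o_def)
  then show ?thesis by (simp add: euclidean_representation)
qed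

lemma C2_on_continuous:
  assumes f: "C2_on U f f1 f2" and p: "continuous_on S p" "p ` S \<subseteq> U"
  shows "continuous_on S (\<lambda>z. f (p z))"
proof -
  have "continuous_on U f"
    by (meson C2_onD(2)[OF f] continuous_at_imp_continuous_on has_derivative_continuous)
  then show ?thesis using p by (rule continuous_on_compose2)
qed

text \<open>The direction moves with the point. Expanding it in the basis leaves only fixed
  directions, where the definition applies; the next two lemmas on moving directions use the same
  device.\<close>

lemma C2_on_continuous1:
  assumes f: "C2_on U f f1 f2" and p: "continuous_on S p" "p ` S \<subseteq> U" and x: "continuous_on S x"
  shows "continuous_on S (\<lambda>z. f1 (p z) (x z))"
proof -
  have c: "continuous_on U (\<lambda>z. f1 z b)" for b
    by (intro continuous_at_imp_continuous_on ballI has_derivative_continuous[OF C2_onD(3)[OF f]])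
  have "continuous_on S (\<lambda>z. \<Sum>b\<in>Basis. (x z \<bullet> b) *\<^sub>R f1 (p z) b)"
    by (intro continuous_intros x continuous_on_compose2[OF c p])
  then show ?thesis
    using C2_on_linear1[OF f] p linear_euclidean_expand
    by (subst continuous_on_cong[OF refl]) (auto simp: image_subset_iff)
qed

lemma C2_on_continuous2:
  assumes f: "C2_on U f f1 f2" and p: "continuous_on S p" "p ` S \<subseteq> U"
    and x: "continuous_on S x" and y: "continuous_on S y"
  shows "continuous_on S (\<lambda>z. f2 (p z) (x z) (y z))"
proof -
  have "continuous_on S (\<lambda>z. \<Sum>b\<in>Basis. (x z \<bullet> b) *\<^sub>R (\<Sum>c\<in>Basis. (y z \<bullet> c) *\<^sub>R f2 (p z) b c))"
    by (intro continuous_intros x y continuous_on_compose2[OF C2_onD(4)[OF f] p])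
  moreover have "f2 (p z) (x z) (y z) = (\<Sum>b\<in>Basis. (x z \<bullet> b) *\<^sub>R (\<Sum>c\<in>Basis. (y z \<bullet> c) *\<^sub>R f2 (p z) b c))"
    if "z \<in> S" for z
  proof -
    have "bilinear (f2 (p z))" using C2_on_bilinear[OF f] p that by blast
    then have l: "linear (\<lambda>w. f2 (p z) w c)" "linear (f2 (p z) b)" for b c
      by (auto simp: bilinear_def)
    have "f2 (p z) (x z) (y z) = (\<Sum>b\<in>Basis. (x z \<bullet> b) *\<^sub>R f2 (p z) b (y z))"
      by (rule linear_euclidean_expand[OF l(1)])
    also have "\<dots> = (\<Sum>b\<in>Basis. (x z \<bullet> b) *\<^sub>R (\<Sum>c\<in>Basis. (y z \<bullet> c) *\<^sub>R f2 (p z) b c))"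
      by (intro sum.cong refl arg_cong2[of _ _ _ _ scaleR] linear_euclidean_expand[OF l(2)])
    finally show ?thesis .
  qed
  ultimately show ?thesis by (subst continuous_on_cong[OF refl]) auto
qed

lemma C2_on_has_derivative_f1:
  assumes f: "C2_on U f f1 f2" and z: "p z \<in> U" "open W" "z \<in> W" "\<And>y. y \<in> W \<Longrightarrow> p y \<in> U"
    and p: "(p has_derivative p') (at z)" and x: "(x has_derivative x') (at z)"
  shows "((\<lambda>y. f1 (p y) (x y)) has_derivative (\<lambda>w. f2 (p z) (p' w) (x z) + f1 (p z) (x' w))) (at z)"
proof -
  have c: "((\<lambda>y. f1 (p y) b) has_derivative (\<lambda>w. f2 (p z) (p' w) b)) (at z)" for b
    by (rule has_derivative_compose[OF p C2_onD(3)[OF f z(1)]])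
  have "((\<lambda>y. \<Sum>b\<in>Basis. (x y \<bullet> b) *\<^sub>R f1 (p y) b) has_derivative
    (\<lambda>w. \<Sum>b\<in>Basis. (x z \<bullet> b) *\<^sub>R f2 (p z) (p' w) b + (x' w \<bullet> b) *\<^sub>R f1 (p z) b)) (at z)"
    by (intro has_derivative_sum has_derivative_scaleR has_derivative_inner_left x c)
  moreover have "(\<Sum>b\<in>Basis. (x z \<bullet> b) *\<^sub>R f2 (p z) (p' w) b + (x' w \<bullet> b) *\<^sub>R f1 (p z) b)
    = f2 (p z) (p' w) (x z) + f1 (p z) (x' w)" for w
    unfolding sum.distrib
    by (intro arg_cong2[of _ _ _ _ "(+)"] linear_euclidean_expand[symmetric] C2_on_linear1[OF f z(1)])
      (use C2_on_bilinear[OF f z(1)] in \<open>simp add: bilinear_def\<close>)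
  ultimately have D: "((\<lambda>y. \<Sum>b\<in>Basis. (x y \<bullet> b) *\<^sub>R f1 (p y) b) has_derivative
    (\<lambda>w. f2 (p z) (p' w) (x z) + f1 (p z) (x' w))) (at z)" by simp
  show ?thesis
    by (rule has_derivative_transform_within_open[OF D z(2,3)])
      (rule linear_euclidean_expand[OF C2_on_linear1[OF f z(4)], symmetric])
qed

lemma C2_on_compose:
  assumes f: "C2_on U f f1 f2" and W: "open W" "\<And>z. z \<in> W \<Longrightarrow> p z \<in> U"
    and p1: "\<And>z. z \<in> W \<Longrightarrow> (p has_derivative p1 z) (at z)"
    and p2: "\<And>z v. z \<in> W \<Longrightarrow> ((\<lambda>y. p1 y v) has_derivative (\<lambda>w. p2 z w v)) (at z)"
    and cp2: "\<And>v w. continuous_on W (\<lambda>z. p2 z w v)"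
  shows "C2_on W (\<lambda>z. f (p z)) (\<lambda>z v. f1 (p z) (p1 z v))
    (\<lambda>z w v. f2 (p z) (p1 z w) (p1 z v) + f1 (p z) (p2 z w v))"
proof -
  have pair_weight: "continuous_on W p"
    by (meson p1 continuous_at_imp_continuous_on has_derivative_continuous)
  have cp1: "continuous_on W (\<lambda>z. p1 z v)" for v
    by (intro continuous_at_imp_continuous_on ballI has_derivative_continuous[OF p2])
  show ?thesis unfolding C2_on_def
  proof (intro conjI ballI allI W(1))
    fix z assume z: "z \<in> W"
    show "((\<lambda>z. f (p z)) has_derivative (\<lambda>v. f1 (p z) (p1 z v))) (at z)"
      by (rule has_derivative_compose[OF p1[OF z] C2_onD(2)[OF f W(2)[OF z]]])
    fix v
    show "((\<lambda>y. f1 (p y) (p1 y v)) has_derivative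
        (\<lambda>w. f2 (p z) (p1 z w) (p1 z v) + f1 (p z) (p2 z w v))) (at z)"
      by (rule C2_on_has_derivative_f1[OF f W(2)[OF z] W(1) z W(2) p1[OF z] p2[OF z]])
  next
    fix v w
    show "continuous_on W (\<lambda>z. f2 (p z) (p1 z w) (p1 z v) + f1 (p z) (p2 z w v))"
      using W(2) by (intro continuous_on_add C2_on_continuous2[OF f] C2_on_continuous1[OF f] pair_weight cp1 cp2) auto
  qed
qed

lemma C2_on_curve1:
  assumes f: "C2_on U f f1 f2" and "c s \<in> U" "(c has_vector_derivative c1) (at s)"
  shows "((\<lambda>t. f (c t)) has_vector_derivative f1 (c s) c1) (at s)"
  using has_derivative_compose[OF assms(3)[unfolded has_vector_derivative_def] C2_onD(2)[OF f assms(2)]]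
    linear_scale[OF C2_on_linear1[OF f assms(2)]]
  by (simp add: has_vector_derivative_def)

lemma C2_on_curve2:
  assumes f: "C2_on U f f1 f2" and cU: "\<And>t. c t \<in> U"
    and c: "(c has_vector_derivative c1 s) (at s)" and c1: "(c1 has_vector_derivative c2) (at s)"
  shows "((\<lambda>t. f1 (c t) (c1 t)) has_vector_derivative f2 (c s) (c1 s) (c1 s) + f1 (c s) c2) (at s)"
proof -
  have l1: "linear (f1 (c s))" and l2: "bilinear (f2 (c s))"
    using C2_on_linear1[OF f cU] C2_on_bilinear[OF f cU] by auto
  have "((\<lambda>t. f1 (c t) (c1 t)) has_derivative (\<lambda>w. f2 (c s) (w *\<^sub>R c1 s) (c1 s) + f1 (c s) (w *\<^sub>R c2))) (at s)"
    by (rule C2_on_has_derivative_f1[where p=c and W=UNIV, OF f cU open_UNIV UNIV_I cU])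
      (use c c1 in \<open>auto simp: has_vector_derivative_def\<close>)
  then show ?thesis
    using l2 linear_scale[OF l1] by (simp add: has_vector_derivative_def bilinear_lmul scaleR_add_right)
qed

lemma vd_bound:
  fixes g :: "real \<Rightarrow> complex"
  assumes "\<And>x. x \<in> {a..b} \<Longrightarrow> (g has_vector_derivative g' x) (at x)"
    and "\<And>x. x \<in> {a..b} \<Longrightarrow> cmod (g' x) \<le> B" "a \<le> b"
  shows "cmod (g b - g a) \<le> B * (b - a)"
proof -
  have "cmod (g b - g a) \<le> B * norm (b - a)"
  proof (rule differentiable_bound[of "{a..b}" g "\<lambda>x h. h *\<^sub>R g' x"])
    show "(g has_derivative (\<lambda>h. h *\<^sub>R g' x)) (at x within {a..b})" if "x \<in> {a..b}" for x
      using assms(1)[OF that] has_derivative_at_withinI by (auto simp: has_vector_derivative_def)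
    show "onorm (\<lambda>h. h *\<^sub>R g' x) \<le> B" if "x \<in> {a..b}" for x
      using assms(2)[OF that] by (simp add: onorm_scaleR_left bounded_linear_ident onorm_id)
  qed (use assms in auto)
  then show ?thesis using assms by simp
qed

lemma C2_on_line:
  assumes f: "C2_on U f f1 f2" and a: "a + t *\<^sub>R w \<in> U"
  shows "((\<lambda>t. f (a + t *\<^sub>R w)) has_vector_derivative f1 (a + t *\<^sub>R w) w) (at t)"
    and "((\<lambda>t. f1 (a + t *\<^sub>R w) v) has_vector_derivative f2 (a + t *\<^sub>R w) w v) (at t)"
proof -
  have l: "((\<lambda>t. a + t *\<^sub>R w) has_derivative (\<lambda>h. h *\<^sub>R w)) (at t)"
    by (auto intro!: derivative_eq_intros)
  show "((\<lambda>t. f (a + t *\<^sub>R w)) has_vector_derivative f1 (a + t *\<^sub>R w) w) (at t)"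
    using has_derivative_compose[OF l C2_onD(2)[OF f a]] linear_scale[OF C2_on_linear1[OF f a]]
    by (simp add: has_vector_derivative_def)
  show "((\<lambda>t. f1 (a + t *\<^sub>R w) v) has_vector_derivative f2 (a + t *\<^sub>R w) w v) (at t)"
    using has_derivative_compose[OF l C2_onD(3)[OF f a]] C2_on_bilinear[OF f a]
    by (simp add: has_vector_derivative_def bilinear_lmul)
qed

text \<open>Two mean value inequalities: along \<open>w\<close> for the first derivative in
  direction \<open>v\<close>, with error \<open>e * h\<close>, and then along \<open>v\<close> for
  the difference of \<open>f\<close> at base points \<open>h *\<^sub>R w\<close> apart.\<close>

lemma C2_on_mixed_difference:
  assumes f: "C2_on U f f1 f2" and z: "z \<in> U" and e: "e > 0"
  shows "\<exists>d>0. \<forall>h. 0 < h \<and> h < d \<longrightarrow>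
    cmod (f (z + h *\<^sub>R v + h *\<^sub>R w) - f (z + h *\<^sub>R v) - (f (z + h *\<^sub>R w) - f z) - (h * h) *\<^sub>R f2 z w v) \<le> e * (h * h)"
proof -
  have "isCont (\<lambda>y. f2 y w v) z"
    using C2_onD(1,4)[OF f] z continuous_on_eq_continuous_at by blast
  then obtain r where r: "r > 0" "\<And>y. norm (y - z) < r \<Longrightarrow> cmod (f2 y w v - f2 z w v) < e"
    using e unfolding continuous_at_eps_delta dist_norm by blast
  obtain r' where r': "r' > 0" "\<And>y. norm (y - z) < r' \<Longrightarrow> y \<in> U"
    using C2_onD(1)[OF f] z by (metis dist_norm open_dist)
  define d where "d = min r r' / (norm v + norm w + 1)"
  have pos: "norm v + norm w + 1 > 0" by (simp add: add_nonneg_pos)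
  have d: "d > 0" using r(1) r'(1) pos by (simp add: d_def)
  have near: "norm (z + s *\<^sub>R v + t *\<^sub>R w - z) < min r r'" if "0 \<le> s" "s \<le> h" "0 \<le> t" "t \<le> h" "h < d" for s t h
  proof -
    have "norm (s *\<^sub>R v + t *\<^sub>R w) \<le> s * norm v + t * norm w"
      using norm_triangle_ineq[of "s *\<^sub>R v" "t *\<^sub>R w"] that by simp
    also have "\<dots> \<le> h * norm v + h * norm w" using that by (intro add_mono mult_right_mono) auto
    also have "\<dots> \<le> h * (norm v + norm w + 1)" using that by (simp add: algebra_simps)
    also have "\<dots> < d * (norm v + norm w + 1)" using that pos by (intro mult_strict_right_mono) auto
    also have "\<dots> = min r r'" using pos by (simp add: d_def)
    finally show ?thesis by (simp add: add.assoc)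
  qed
  have inU: "z + s *\<^sub>R v + t *\<^sub>R w \<in> U" and bd: "cmod (f2 (z + s *\<^sub>R v + t *\<^sub>R w) w v - f2 z w v) < e"
    if "0 \<le> s" "s \<le> h" "0 \<le> t" "t \<le> h" "h < d" for s t h
    using near[OF that] r(2) r'(2) by auto
  have inner: "cmod (f1 (z + s *\<^sub>R v + h *\<^sub>R w) v - f1 (z + s *\<^sub>R v) v - h *\<^sub>R f2 z w v) \<le> e * h"
    if "0 \<le> s" "s \<le> h" "h < d" for s h
  proof -
    let ?p = "\<lambda>t. f1 (z + s *\<^sub>R v + t *\<^sub>R w) v - t *\<^sub>R f2 z w v"
    have "cmod (?p h - ?p 0) \<le> e * (h - 0)"
    proof (rule vd_bound)
      fix x assume "x \<in> {0..h}"
      then have x: "0 \<le> x" "x \<le> h" by auto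
      show "(?p has_vector_derivative f2 (z + s *\<^sub>R v + x *\<^sub>R w) w v - f2 z w v) (at x)"
        by (intro has_vector_derivative_diff C2_on_line(2)[OF f] inU[OF that(1,2) x that(3)])
          (auto intro!: derivative_eq_intros)
      show "cmod (f2 (z + s *\<^sub>R v + x *\<^sub>R w) w v - f2 z w v) \<le> e"
        using bd[OF that(1,2) x that(3)] by simp
    qed (use that in auto)
    then show ?thesis by (simp add: algebra_simps)
  qed
  have "cmod (f (z + h *\<^sub>R v + h *\<^sub>R w) - f (z + h *\<^sub>R v) - (f (z + h *\<^sub>R w) - f z) - (h * h) *\<^sub>R f2 z w v) \<le> e * (h * h)"
    if h: "0 < h" "h < d" for h
  proof -
    let ?q = "\<lambda>s. f (z + h *\<^sub>R w + s *\<^sub>R v) - f (z + s *\<^sub>R v) - s *\<^sub>R (h *\<^sub>R f2 z w v)"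
    have B: "cmod (?q h - ?q 0) \<le> (e * h) * (h - 0)"
    proof (rule vd_bound)
      fix x assume "x \<in> {0..h}"
      then have x: "0 \<le> x" "x \<le> h" by auto
      have 1: "z + h *\<^sub>R w + x *\<^sub>R v \<in> U" "z + x *\<^sub>R v \<in> U"
        using inU[OF x _ order_refl h(2)] inU[OF x order_refl _ h(2)] h by (auto simp: add_ac)
      show "(?q has_vector_derivative f1 (z + h *\<^sub>R w + x *\<^sub>R v) v - f1 (z + x *\<^sub>R v) v - h *\<^sub>R f2 z w v) (at x)"
        by (intro has_vector_derivative_diff C2_on_line(1)[OF f] 1) (auto intro!: derivative_eq_intros)
      show "cmod (f1 (z + h *\<^sub>R w + x *\<^sub>R v) v - f1 (z + x *\<^sub>R v) v - h *\<^sub>R f2 z w v) \<le> e * h"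
        using inner[OF x h(2)] by (simp add: add_ac)
    qed (use h in auto)
    have eq: "?q h - ?q 0 = f (z + h *\<^sub>R v + h *\<^sub>R w) - f (z + h *\<^sub>R v) - (f (z + h *\<^sub>R w) - f z) - (h * h) *\<^sub>R f2 z w v"
      by (simp add: add_ac)
    show ?thesis using B unfolding eq by (simp only: diff_zero mult.assoc)
  qed
  then show ?thesis using d by blast
qed

text \<open>The second difference of \<open>f\<close> is symmetric in \<open>v\<close> and
  \<open>w\<close> and approximates both values. With \<open>e\<close> a third of their distance,
  two errors of \<open>e * (h * h)\<close> cannot account for it.\<close>

lemma C2_on_symmetric:
  assumes f: "C2_on U f f1 f2" and z: "z \<in> U"
  shows "f2 z v w = f2 z w v"
proof (rule ccontr)
  assume ne: "f2 z v w \<noteq> f2 z w v"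
  define e where "e = cmod (f2 z v w - f2 z w v) / 3"
  have e: "e > 0" using ne by (simp add: e_def)
  obtain d where d: "d > 0" "\<And>h. 0 < h \<Longrightarrow> h < d \<Longrightarrow>
    cmod (f (z + h *\<^sub>R v + h *\<^sub>R w) - f (z + h *\<^sub>R v) - (f (z + h *\<^sub>R w) - f z) - (h * h) *\<^sub>R f2 z w v) \<le> e * (h * h)"
    using C2_on_mixed_difference[OF f z e] by blast
  obtain d' where d': "d' > 0" "\<And>h. 0 < h \<Longrightarrow> h < d' \<Longrightarrow>
    cmod (f (z + h *\<^sub>R w + h *\<^sub>R v) - f (z + h *\<^sub>R w) - (f (z + h *\<^sub>R v) - f z) - (h * h) *\<^sub>R f2 z v w) \<le> e * (h * h)"
    using C2_on_mixed_difference[OF f z e] by blast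
  define h where "h = min d d' / 2"
  have h: "0 < h" "h < d" "h < d'" using d(1) d'(1) by (auto simp: h_def)
  let ?D = "f (z + h *\<^sub>R v + h *\<^sub>R w) - f (z + h *\<^sub>R v) - (f (z + h *\<^sub>R w) - f z)"
  have D: "f (z + h *\<^sub>R w + h *\<^sub>R v) - f (z + h *\<^sub>R w) - (f (z + h *\<^sub>R v) - f z) = ?D"
    by (simp add: add_ac)
  have "cmod (?D - (h * h) *\<^sub>R f2 z w v) \<le> e * (h * h)" "cmod (?D - (h * h) *\<^sub>R f2 z v w) \<le> e * (h * h)"
    using d(2)[OF h(1,2)] d'(2)[OF h(1,3)] unfolding D by auto
  then have "cmod ((?D - (h * h) *\<^sub>R f2 z w v) - (?D - (h * h) *\<^sub>R f2 z v w)) \<le> 2 * e * (h * h)"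
    using norm_triangle_ineq4[of "?D - (h * h) *\<^sub>R f2 z w v" "?D - (h * h) *\<^sub>R f2 z v w"] by linarith
  moreover have "(?D - (h * h) *\<^sub>R f2 z w v) - (?D - (h * h) *\<^sub>R f2 z v w) = (h * h) *\<^sub>R (f2 z v w - f2 z w v)"
    by (simp add: scaleR_diff_right)
  ultimately have "(h * h) * (3 * e) \<le> 2 * e * (h * h)"
    using h(1) by (simp add: e_def)
  then show False using h(1) e by (simp add: mult_le_cancel_right)
qed

lemma has_vector_derivative_cis_line: "((\<lambda>t. f t) has_vector_derivative d) (at s) \<Longrightarrow>
   ((\<lambda>t. Re (f t)) has_real_derivative Re d) (at s)"
  using has_derivative_Re[of f "\<lambda>h. h *\<^sub>R d" "at s"]
  by (simp add: has_vector_derivative_def has_real_derivative_iff_has_vector_derivative)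

lemma second_derivative_local_max:
  fixes g :: "real \<Rightarrow> real"
  assumes g: "\<And>t. \<bar>t\<bar> < r \<Longrightarrow> (g has_real_derivative g' t) (at t)" and g2: "(g' has_real_derivative D) (at 0)"
    and r: "r > 0" and mx: "\<And>t. \<bar>t\<bar> < r \<Longrightarrow> g t \<le> g 0"
  shows "D \<le> 0"
proof (rule ccontr)
  assume "\<not> D \<le> 0"
  then have D: "D > 0" by simp
  have g0: "g' 0 = 0"
    by (rule DERIV_local_max[OF g[of 0] r]) (use mx r in auto)
  obtain d where d: "d > 0" "\<And>h. 0 < h \<Longrightarrow> h < d \<Longrightarrow> g' 0 < g' (0 + h)"
    using DERIV_pos_inc_right[OF g2 D] by auto
  define h where "h = min r d / 2"
  have h: "0 < h" "h < r" "h < d" using r d(1) by (auto simp: h_def)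
  obtain x where x: "0 < x" "x < h" "g h - g 0 = (h - 0) * g' x"
    using MVT2[OF h(1), of g g'] g h by (auto simp: abs_if)
  have "g' x > 0" using d(2)[of x] x h g0 by auto
  then have "g h > g 0" using x h by (metis diff_gt_0_iff_gt diff_zero mult_pos_pos)
  moreover have "g h \<le> g 0" using mx[of h] h by simp
  ultimately show False by simp
qed

subsection \<open>The mean of a parametrised family\<close>

lemma continuous_on_slice:
  assumes "continuous_on (X \<times> C) (\<lambda>(x, k). F x k)" "x \<in> X"
  shows "continuous_on C (F x)"
  using continuous_on_compose2[OF assms(1), of C "\<lambda>k. (x, k)"] assms(2)
  by (simp add: continuous_on_Pair image_subset_iff)

text \<open>Compactness of \<open>Ug\<close> makes continuity in the parameter uniform over the
  group, and the mean is bounded by the supremum.\<close>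

lemma haar_mean_continuous:
  fixes X :: "'a::metric_space set"
  assumes F: "continuous_on (X \<times> Ug) (\<lambda>(x, k). F x k)"
  shows "continuous_on X (\<lambda>x. haar_mean (F x))"
  unfolding continuous_on_iff
proof (intro ballI allI impI)
  fix x and e :: real assume x: "x \<in> X" and e: "e > 0"
  have c: "continuous_on Ug (F y)" if "y \<in> X" for y
    using continuous_on_slice[OF F that] .
  obtain X0 where X0: "x \<in> X0" "open X0"
    "\<forall>y\<in>X0 \<inter> X. \<forall>k\<in>Ug. dist ((\<lambda>(x, k). F x k) (y, k)) ((\<lambda>(x, k). F x k) (x, k)) \<le> e/2"
    by (rule continuous_on_prod_compactE[OF F compact_Ug x half_gt_zero[OF e]])
  obtain d where d: "d > 0" "\<And>y. dist y x < d \<Longrightarrow> y \<in> X0"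
    using X0(1,2) unfolding open_dist by blast
  have "dist (haar_mean (F y)) (haar_mean (F x)) < e" if "y \<in> X" "dist y x < d" for y
  proof -
    have "cmod (haar_mean (\<lambda>k. F y k - F x k)) \<le> e/2"
      using X0(3) d(2) that c x by (intro haar_mean_bound) (auto intro!: continuous_intros simp: dist_norm)
    then show ?thesis using e by (simp add: haar_mean_diff c that x dist_norm)
  qed
  then show "\<exists>d>0. \<forall>y\<in>X. dist y x < d \<longrightarrow> dist (haar_mean (F y)) (haar_mean (F x)) < e" using d(1) by blast
qed

text \<open>Differentiation under the mean needs a remainder estimate uniform in \<open>k\<close>.
  Near \<open>z\<close> the derivative differs from \<open>D z k\<close> by at most
  \<open>e / N\<close> on each of the \<open>N\<close> basis vectors, uniformly by compactness; the
  mean value inequality for \<open>F y k - D z k y\<close> then gives the bound.\<close>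

lemma haar_mean_has_derivative:
  fixes F :: "'a::euclidean_space \<Rightarrow> ('n::finite) cmat \<Rightarrow> complex"
  assumes U: "open U" "z \<in> U"
    and F: "\<And>y. y \<in> U \<Longrightarrow> continuous_on Ug (F y)"
    and D: "\<And>y k. y \<in> U \<Longrightarrow> k \<in> Ug \<Longrightarrow> ((\<lambda>y. F y k) has_derivative D y k) (at y)"
    and cD: "\<And>v. continuous_on (U \<times> Ug) (\<lambda>(y, k). D y k v)"
  shows "((\<lambda>y. haar_mean (F y)) has_derivative (\<lambda>v. haar_mean (\<lambda>k. D z k v))) (at z)"
  unfolding has_derivative_at_alt
proof (intro conjI allI impI)
  have c: "continuous_on Ug (\<lambda>k. D y k v)" if "y \<in> U" for y v
    using continuous_on_slice[OF cD that] .
  have lin: "linear (D y k)" if "y \<in> U" "k \<in> Ug" for y k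
    using D[OF that] has_derivative_linear by blast
  have linh: "linear (\<lambda>v. haar_mean (\<lambda>k. D z k v))"
  proof (rule linearI)
    fix a b
    have "haar_mean (\<lambda>k. D z k (a + b)) = haar_mean (\<lambda>k. D z k a + D z k b)"
      using lin U(2) by (intro haar_mean_cong c) (auto simp: linear_add)
    then show "haar_mean (\<lambda>k. D z k (a + b)) = haar_mean (\<lambda>k. D z k a) + haar_mean (\<lambda>k. D z k b)"
      by (simp add: haar_mean_add c U)
  next
    fix r a
    have "haar_mean (\<lambda>k. D z k (r *\<^sub>R a)) = haar_mean (\<lambda>k. complex_of_real r * D z k a)"
      using lin U(2) by (intro haar_mean_cong c) (auto simp: linear_scale scaleR_conv_of_real)
    then show "haar_mean (\<lambda>k. D z k (r *\<^sub>R a)) = r *\<^sub>R haar_mean (\<lambda>k. D z k a)"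
      by (simp add: haar_mean_cmul c U scaleR_conv_of_real)
  qed
  then show "bounded_linear (\<lambda>v. haar_mean (\<lambda>k. D z k v))" by (rule linear_conv_bounded_linear[THEN iffD1])
  fix e :: real assume e: "e > 0"
  define N where "N = real DIM('a)"
  have N: "N > 0" by (simp add: N_def)
  have "\<exists>X0. z \<in> X0 \<and> open X0 \<and> (\<forall>y\<in>X0 \<inter> U. \<forall>k\<in>Ug. dist (D y k b) (D z k b) \<le> e / N)" for b
  proof -
    have eN: "e / N > 0" using e N by simp
    obtain X0 where X0: "z \<in> X0" "open X0"
      "\<forall>y\<in>X0 \<inter> U. \<forall>k\<in>Ug. dist ((\<lambda>(y, k). D y k b) (y, k)) ((\<lambda>(y, k). D y k b) (z, k)) \<le> e / N"
      by (rule continuous_on_prod_compactE[OF cD compact_Ug U(2) eN])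
    then show ?thesis unfolding prod.case by blast
  qed
  then obtain X where X0: "\<forall>b. z \<in> X b \<and> open (X b) \<and> (\<forall>y\<in>X b \<inter> U. \<forall>k\<in>Ug. dist (D y k b) (D z k b) \<le> e / N)"
    using choice_iff[of "\<lambda>b X0. z \<in> X0 \<and> open X0 \<and> (\<forall>y\<in>X0 \<inter> U. \<forall>k\<in>Ug. dist (D y k b) (D z k b) \<le> e / N)"]
    by blast
  then have X: "\<And>b. z \<in> X b" "\<And>b. open (X b)"
    "\<And>b y k. y \<in> X b \<Longrightarrow> y \<in> U \<Longrightarrow> k \<in> Ug \<Longrightarrow> dist (D y k b) (D z k b) \<le> e / N" by blast+
  have "open (U \<inter> (\<Inter>b\<in>Basis. X b))" using U(1) X(2) by (intro open_Int open_INT) auto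
  then obtain d where d: "d > 0" "ball z d \<subseteq> U \<inter> (\<Inter>b\<in>Basis. X b)"
    using U(2) X(1) unfolding open_contains_ball by blast
  have "cmod (haar_mean (F y) - haar_mean (F z) - haar_mean (\<lambda>k. D z k (y - z))) \<le> e * norm (y - z)" if y: "norm (y - z) < d" for y
  proof -
    have yU: "y \<in> U" using y d by (auto simp: dist_norm norm_minus_commute)
    have "cmod (F y k - F z k - D z k (y - z)) \<le> e * norm (y - z)" if k: "k \<in> Ug" for k
    proof -
      have "cmod ((F y k - D z k y) - (F z k - D z k z)) \<le> e * norm (y - z)"
      proof (rule differentiable_bound[of "ball z d" "\<lambda>y. F y k - D z k y" "\<lambda>y h. D y k h - D z k h"])
        fix x assume x: "x \<in> ball z d"
        then have xU: "x \<in> U" using d by blast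
        have lz: "(D z k has_derivative D z k) (at x)"
          using lin[OF U(2) k] by (intro bounded_linear_imp_has_derivative) (simp add: linear_conv_bounded_linear)
        show "((\<lambda>y. F y k - D z k y) has_derivative (\<lambda>h. D x k h - D z k h)) (at x within ball z d)"
          by (rule has_derivative_at_withinI[OF has_derivative_diff[OF D[OF xU k] lz]])
        show "onorm (\<lambda>h. D x k h - D z k h) \<le> e"
        proof (rule onorm_le)
          fix h
          have "D x k h - D z k h = (\<Sum>b\<in>Basis. (h \<bullet> b) *\<^sub>R (D x k b - D z k b))"
            using linear_euclidean_expand[OF lin[OF xU k], of h] linear_euclidean_expand[OF lin[OF U(2) k], of h]
            by (simp add: scaleR_diff_right sum_subtractf)
          also have "cmod \<dots> \<le> (\<Sum>b\<in>(Basis::'a set). norm h * (e / N))"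
          proof (rule sum_norm_le)
            fix b :: 'a assume b: "b \<in> Basis"
            have "x \<in> X b" using x d b by blast
            then have "cmod (D x k b - D z k b) \<le> e / N" using X(3)[OF _ xU k] by (simp add: dist_norm)
            then show "cmod ((h \<bullet> b) *\<^sub>R (D x k b - D z k b)) \<le> norm h * (e / N)"
              unfolding norm_scaleR using Basis_le_norm[OF b, of h] by (intro mult_mono) auto
          qed
          also have "\<dots> = e * norm h" using N by (simp add: N_def)
          finally show "cmod (D x k h - D z k h) \<le> e * norm h" .
        qed
      qed (use y d in \<open>auto simp: dist_norm norm_minus_commute\<close>)
      then show ?thesis unfolding linear_diff[OF lin[OF U(2) k]] by (simp add: algebra_simps)
    qed
    moreover have "haar_mean (F y) - haar_mean (F z) - haar_mean (\<lambda>k. D z k (y - z)) = haar_mean (\<lambda>k. F y k - F z k - D z k (y - z))"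
      using F yU U c by (simp add: haar_mean_diff continuous_on_diff)
    ultimately show ?thesis
      using F yU U c by (auto intro!: haar_mean_bound continuous_intros)
  qed
  then show "\<exists>d>0. \<forall>y. norm (y - z) < d \<longrightarrow>
      cmod (haar_mean (F y) - haar_mean (F z) - haar_mean (\<lambda>k. D z k (y - z))) \<le> e * norm (y - z)" using d(1) by blast
qed

subsection \<open>Frechet differentiability from continuous partial derivatives\<close>

text \<open>The point is moved along one direction at a time, each move costing at most
  \<open>e * \<bar>x i\<bar>\<close>. The directions may be linearly dependent, as happens for
  \<open>sym_dir\<close>.\<close>

lemma partials_increment:
  fixes f :: "'a::real_normed_vector \<Rightarrow> complex" and d :: "'i \<Rightarrow> 'a"
  assumes I: "finite I" and r: "r > 0" "\<And>x. (\<And>i. i \<in> I \<Longrightarrow> \<bar>x i\<bar> < r) \<Longrightarrow> z + (\<Sum>i\<in>I. x i *\<^sub>R d i) \<in> S"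
    and g: "\<And>y i. y \<in> S \<Longrightarrow> i \<in> I \<Longrightarrow> ((\<lambda>t. f (y + t *\<^sub>R d i)) has_vector_derivative g i y) (at 0)"
    and cg: "\<And>i. i \<in> I \<Longrightarrow> continuous_on S (g i)" and e: "e > 0"
  shows "\<exists>\<delta>>0. \<forall>x. (\<forall>i\<in>I. \<bar>x i\<bar> < \<delta>) \<longrightarrow>
    cmod (f (z + (\<Sum>i\<in>I. x i *\<^sub>R d i)) - f z - (\<Sum>i\<in>I. x i *\<^sub>R g i z)) \<le> e * (\<Sum>i\<in>I. \<bar>x i\<bar>)"
proof -
  have zS: "z \<in> S" using r(2)[of "\<lambda>_. 0"] r(1) by simp
  have "\<forall>i\<in>I. \<exists>\<rho>>0. \<forall>y\<in>S. dist y z < \<rho> \<longrightarrow> dist (g i y) (g i z) < e"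
    using cg zS e unfolding continuous_on_iff by blast
  then obtain \<rho> where \<rho>: "\<And>i. i \<in> I \<Longrightarrow> \<rho> i > 0"
    "\<And>i y. i \<in> I \<Longrightarrow> y \<in> S \<Longrightarrow> dist y z < \<rho> i \<Longrightarrow> dist (g i y) (g i z) < e" by metis
  define P where "P = Min (insert 1 (\<rho> ` I))"
  have P: "P > 0" "\<And>i. i \<in> I \<Longrightarrow> P \<le> \<rho> i" using I \<rho>(1) by (auto simp: P_def)
  define D where "D = (\<Sum>i\<in>I. norm (d i)) + 1"
  have D: "D > 0" by (simp add: D_def add_nonneg_pos sum_nonneg)
  define \<delta> where "\<delta> = min r (P / D)"
  have \<delta>: "\<delta> > 0" "\<delta> \<le> r" using r P D by (auto simp: \<delta>_def)
  have "cmod (f (z + (\<Sum>i\<in>J. x i *\<^sub>R d i)) - f z - (\<Sum>i\<in>J. x i *\<^sub>R g i z)) \<le> e * (\<Sum>i\<in>J. \<bar>x i\<bar>)"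
    if J: "finite J" "J \<subseteq> I" and x: "\<And>i. i \<in> I \<Longrightarrow> \<bar>x i\<bar> < \<delta>" for J x
    using J
  proof (induction J)
    case (insert j J)
    then have j: "j \<in> I" "j \<notin> J" "J \<subseteq> I" "finite J" by auto
    let ?y = "z + (\<Sum>i\<in>J. x i *\<^sub>R d i)"
    have pt: "?y + t *\<^sub>R d j \<in> S \<and> dist (?y + t *\<^sub>R d j) z < P" if t: "\<bar>t\<bar> \<le> \<bar>x j\<bar>" for t
    proof -
      \<comment> \<open>An intermediate point has coordinates \<open>x\<close> on \<open>J\<close>,
        \<open>t\<close> at \<open>j\<close> and 0 elsewhere, so the hypothesis on small coordinates
        places it in \<open>S\<close>.\<close>
      define x' where "x' i = (if i = j then t else if i \<in> J then x i else 0)" for i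
      have "(\<Sum>i\<in>I. x' i *\<^sub>R d i) = (\<Sum>i\<in>insert j J. x' i *\<^sub>R d i)"
        by (rule sum.mono_neutral_right) (use I j in \<open>auto simp: x'_def\<close>)
      also have "\<dots> = t *\<^sub>R d j + (\<Sum>i\<in>J. x i *\<^sub>R d i)"
        using j by (simp add: x'_def) (auto intro!: sum.cong)
      finally have eq: "z + (\<Sum>i\<in>I. x' i *\<^sub>R d i) = ?y + t *\<^sub>R d j" by (simp add: add_ac)
      have x': "\<bar>x' i\<bar> < \<delta>" if "i \<in> I" for i using x[OF that] x[OF j(1)] t \<delta>(1) by (auto simp: x'_def)
      have "z + (\<Sum>i\<in>I. x' i *\<^sub>R d i) \<in> S" using x' \<delta> by (intro r(2)) force
      moreover have "norm (\<Sum>i\<in>I. x' i *\<^sub>R d i) < P"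
      proof -
        have "norm (\<Sum>i\<in>I. x' i *\<^sub>R d i) \<le> (\<Sum>i\<in>I. \<delta> * norm (d i))"
          using x' by (intro sum_norm_le) (auto intro!: mult_right_mono intro: less_imp_le)
        also have "\<dots> < \<delta> * D" using \<delta> by (simp add: D_def sum_distrib_left[symmetric])
        also have "\<dots> \<le> P / D * D" using D by (intro mult_right_mono) (auto simp: \<delta>_def)
        finally show ?thesis using D by simp
      qed
      moreover have "dist (?y + t *\<^sub>R d j) z = norm (\<Sum>i\<in>I. x' i *\<^sub>R d i)"
        unfolding eq[symmetric] by (simp add: dist_norm)
      ultimately show ?thesis using eq by simp
    qed
    let ?h = "\<lambda>t. f (?y + t *\<^sub>R d j) - t *\<^sub>R g j z"
    have hd: "(?h has_vector_derivative g j (?y + t *\<^sub>R d j) - g j z) (at t)" if t: "\<bar>t\<bar> \<le> \<bar>x j\<bar>" for t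
    proof -
      have "((\<lambda>s. f (?y + t *\<^sub>R d j + s *\<^sub>R d j)) has_vector_derivative g j (?y + t *\<^sub>R d j)) (at 0)"
        using g pt[OF t] j by blast
      then have "((\<lambda>s. f (?y + t *\<^sub>R d j + s *\<^sub>R d j)) \<circ> (\<lambda>s. s - t) has_vector_derivative 1 *\<^sub>R g j (?y + t *\<^sub>R d j)) (at t)"
        by (intro vector_diff_chain_at) (auto intro!: derivative_eq_intros)
      then have "((\<lambda>s. f (?y + s *\<^sub>R d j)) has_vector_derivative g j (?y + t *\<^sub>R d j)) (at t)"
        by (simp add: o_def algebra_simps)
      then show ?thesis by (intro has_vector_derivative_diff) (auto intro!: derivative_eq_intros)
    qed
    have bd: "cmod (g j (?y + t *\<^sub>R d j) - g j z) \<le> e" if t: "\<bar>t\<bar> \<le> \<bar>x j\<bar>" for t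
      using \<rho>(2)[OF j(1)] pt[OF t] P(2)[OF j(1)] by (auto simp: dist_norm intro: less_imp_le)
    have step: "cmod (?h (x j) - ?h 0) \<le> e * \<bar>x j\<bar>"
    proof (cases "x j \<ge> 0")
      case True
      then show ?thesis using vd_bound[of 0 "x j" ?h "\<lambda>t. g j (?y + t *\<^sub>R d j) - g j z" e] hd bd by auto
    next
      case False
      then have "cmod (?h 0 - ?h (x j)) \<le> e * (0 - x j)"
        using hd bd by (intro vd_bound[of "x j" 0 ?h "\<lambda>t. g j (?y + t *\<^sub>R d j) - g j z" e]) auto
      then show ?thesis using False by (simp add: norm_minus_commute)
    qed
    have "f (z + (\<Sum>i\<in>insert j J. x i *\<^sub>R d i)) - f z - (\<Sum>i\<in>insert j J. x i *\<^sub>R g i z)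
      = (?h (x j) - ?h 0) + (f ?y - f z - (\<Sum>i\<in>J. x i *\<^sub>R g i z))"
      using j by (simp add: add_ac)
    also have "cmod \<dots> \<le> e * \<bar>x j\<bar> + e * (\<Sum>i\<in>J. \<bar>x i\<bar>)"
      using step insert.IH j by (intro norm_triangle_mono) auto
    also have "\<dots> = e * (\<Sum>i\<in>insert j J. \<bar>x i\<bar>)" using j by (simp add: distrib_left)
    finally show ?case .
  qed simp
  from this[OF I order_refl] show ?thesis using \<delta>(1) by blast
qed

subsection \<open>The Levi form\<close>

text \<open>When \<open>B\<close> is the second derivative of a function, this is its mixed second derivative, holomorphic along \<open>v\<close> and antiholomorphic along \<open>w\<close>.\<close>

definition levi :: "(('n::finite) cmat \<Rightarrow> 'n cmat \<Rightarrow> complex) \<Rightarrow> 'n cmat \<Rightarrow> 'n cmat \<Rightarrow> complex" where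
  "levi B v w = (B v w + B (csmul \<i> v) (csmul \<i> w) + \<i> * (B v (csmul \<i> w) - B (csmul \<i> v) w)) / 4"

lemma csmul_add: "csmul c (v + w) = csmul c v + csmul c w"
  by (rule cmat_eqI) (simp add: distrib_left)

lemma csmul_csmul: "csmul c (csmul d v) = csmul (c * d) v"
  by (rule cmat_eqI) simp

lemma csmul_scaleR: "csmul c (r *\<^sub>R v) = r *\<^sub>R csmul c v"
  by (rule cmat_eqI) simp

lemma csmul_decomp: "csmul c v = Re c *\<^sub>R v + Im c *\<^sub>R csmul \<i> v"
  by (rule cmat_eqI) (auto simp: complex_eq_iff)

lemma csmul_of_real: "csmul (complex_of_real r) v = r *\<^sub>R v"
  by (rule cmat_eqI) (simp add: scaleR_conv_of_real[where 'a=complex])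

lemma csmul_ii: "csmul \<i> (csmul \<i> v) = - v"
  by (rule cmat_eqI) simp

lemma levi_add_left: "bilinear B \<Longrightarrow> levi B (v + v') w = levi B v w + levi B v' w"
  by (simp add: levi_def csmul_add bilinear_ladd algebra_simps add_divide_distrib diff_divide_distrib)

lemma levi_add_right: "bilinear B \<Longrightarrow> levi B v (w + w') = levi B v w + levi B v w'"
  by (simp add: levi_def csmul_add bilinear_radd algebra_simps add_divide_distrib diff_divide_distrib)

lemma levi_scaleR_left: "bilinear B \<Longrightarrow> levi B (r *\<^sub>R v) w = of_real r * levi B v w"
  by (simp add: levi_def csmul_scaleR bilinear_lmul scaleR_conv_of_real[where 'a=complex] algebra_simps add_divide_distrib diff_divide_distrib)

lemma levi_scaleR_right: "bilinear B \<Longrightarrow> levi B v (r *\<^sub>R w) = of_real r * levi B v w"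
  by (simp add: levi_def csmul_scaleR bilinear_rmul scaleR_conv_of_real[where 'a=complex] algebra_simps add_divide_distrib diff_divide_distrib)

lemma levi_ii_left: "bilinear B \<Longrightarrow> levi B (csmul \<i> v) w = \<i> * levi B v w"
  by (simp add: levi_def csmul_ii bilinear_lneg algebra_simps)

lemma levi_ii_right: "bilinear B \<Longrightarrow> levi B v (csmul \<i> w) = - \<i> * levi B v w"
  by (simp add: levi_def csmul_ii bilinear_rneg algebra_simps)

lemma levi_csmul_left: "bilinear B \<Longrightarrow> levi B (csmul c v) w = c * levi B v w"
  by (subst csmul_decomp, subst (2) complex_eq[of c])
    (simp add: levi_add_left levi_scaleR_left levi_ii_left algebra_simps)

lemma levi_csmul_right: "bilinear B \<Longrightarrow> levi B v (csmul c w) = cnj c * levi B v w"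
  by (subst csmul_decomp, subst (2) complex_eq[of c])
    (simp add: levi_add_right levi_scaleR_right levi_ii_right algebra_simps)

lemma csmul_0 [simp]: "csmul c 0 = 0" "csmul 0 v = 0"
  by (auto intro!: cmat_eqI)

lemma levi_zero: "bilinear B \<Longrightarrow> levi B 0 w = 0" "bilinear B \<Longrightarrow> levi B v 0 = 0"
  by (simp_all add: levi_def bilinear_lzero bilinear_rzero)

lemma levi_sum_left: "bilinear B \<Longrightarrow> levi B (\<Sum>i\<in>I. v i) w = (\<Sum>i\<in>I. levi B (v i) w)"
  by (induction I rule: infinite_finite_induct) (auto simp: levi_add_left levi_zero)

lemma levi_sum_right: "bilinear B \<Longrightarrow> levi B v (\<Sum>i\<in>I. w i) = (\<Sum>i\<in>I. levi B v (w i))"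
  by (induction I rule: infinite_finite_induct) (auto simp: levi_add_right levi_zero)

lemma levi_diag:
  assumes "\<And>v w. B v w = B w v" shows "levi B v v = (B v v + B (csmul \<i> v) (csmul \<i> v)) / 4"
  using assms[of v "csmul \<i> v"] by (simp add: levi_def)

text \<open>For a holomorphic change of variables the chain rule adds \<open>L (q v w)\<close> with
  \<open>q\<close> complex bilinear. Its bidegree is (2,0), so the four terms of the Levi form
  cancel.\<close>

lemma levi_pullback:
  assumes "linear L" and p: "\<And>v. p (csmul \<i> v) = csmul \<i> (p v)"
    and q: "\<And>v w. q (csmul \<i> v) w = csmul \<i> (q v w)" "\<And>v w. q v (csmul \<i> w) = csmul \<i> (q v w)"
  shows "levi (\<lambda>v w. B (p v) (p w) + L (q v w)) v w = levi B (p v) (p w)"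
  by (simp add: levi_def p q csmul_ii linear_neg[OF assms(1)])

subsection \<open>Hermitian forms\<close>

definition hf :: "('n::finite) cmat \<Rightarrow> complex^'n \<Rightarrow> complex^'n \<Rightarrow> complex" where
  "hf A x y = (\<Sum>i\<in>UNIV. \<Sum>j\<in>UNIV. cnj (x$i) * A$i$j * y$j)"

lemma hpos_def_hf: "hpos_def A \<longleftrightarrow> cadj A = A \<and> (\<forall>x. x \<noteq> 0 \<longrightarrow> 0 < Re (hf A x x))"
  by (simp add: hpos_def_def hf_def)

lemma hf_add_left: "hf A (x + x') y = hf A x y + hf A x' y"
  by (simp add: hf_def distrib_right sum.distrib)

lemma hf_add_right: "hf A x (y + y') = hf A x y + hf A x y'"
  by (simp add: hf_def distrib_left sum.distrib)

lemma hf_smult_left: "hf A (c *s x) y = cnj c * hf A x y"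
  by (simp add: hf_def sum_distrib_left mult.assoc)

lemma hf_smult_right: "hf A x (c *s y) = c * hf A x y"
  by (simp add: hf_def sum_distrib_left algebra_simps)

lemma hf_diff_mat: "hf (A - B) x y = hf A x y - hf B x y"
  by (simp add: hf_def left_diff_distrib right_diff_distrib sum_subtractf)

lemma hf_matvec: "hf A x y = (\<Sum>i\<in>UNIV. cnj (x$i) * (A *v y)$i)"
  by (simp add: hf_def matvec_nth sum_distrib_left mult.assoc)

lemma hf_axis_left: "hf A (axis i 1) y = (A *v y) $ i"
proof -
  have "hf A (axis i 1) y = (\<Sum>k\<in>UNIV. if k = i then (A *v y)$k else 0)"
    unfolding hf_matvec by (intro sum.cong) (auto simp: axis_def)
  then show ?thesis by simp
qed

lemma matvec_axis: "((A::('n::finite) cmat) *v axis j 1) $ i = A $ i $ j"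
proof -
  have "(A *v axis j 1) $ i = (\<Sum>k\<in>UNIV. if k = j then A $ i $ j else 0)"
    unfolding matvec_nth by (intro sum.cong) (auto simp: axis_def)
  then show ?thesis by simp
qed

lemma hf_axis: "hf A (axis i 1) (axis j 1) = A $ i $ j"
  by (simp add: hf_axis_left matvec_axis)

lemma hf_cnj: "cadj A = A \<Longrightarrow> hf A y x = cnj (hf A x y)"
proof -
  assume A: "cadj A = A"
  have Ac: "cnj (A $ i $ j) = A $ j $ i" for i j using A by (metis cadj_nth)
  have "cnj (hf A x y) = (\<Sum>i\<in>UNIV. \<Sum>j\<in>UNIV. cnj (y$j) * A$j$i * x$i)"
    unfolding hf_def cnj_sum complex_cnj_mult complex_cnj_cnj Ac by (simp add: mult_ac)
  also have "\<dots> = hf A y x" unfolding hf_def by (rule sum.swap)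
  finally show ?thesis by simp
qed

lemma hf_conj: "hf (N ** A ** cadj N) x y = hf A (cadj N *v x) (cadj N *v y)"
proof -
  have "hf (N ** A ** cadj N) x y = (\<Sum>i\<in>UNIV. cnj (x$i) * (N *v (A *v (cadj N *v y)))$i)"
    unfolding hf_matvec by (simp add: matrix_vector_mul_assoc matrix_mul_assoc)
  also have "\<dots> = (\<Sum>i\<in>UNIV. \<Sum>k\<in>UNIV. cnj (x$i) * N$i$k * (A *v (cadj N *v y))$k)"
    by (simp add: matvec_nth[of N] sum_distrib_left mult.assoc)
  also have "\<dots> = (\<Sum>k\<in>UNIV. \<Sum>i\<in>UNIV. cnj (x$i) * N$i$k * (A *v (cadj N *v y))$k)" by (rule sum.swap)
  also have "\<dots> = (\<Sum>k\<in>UNIV. cnj ((cadj N *v x)$k) * (A *v (cadj N *v y))$k)"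
    by (simp add: matvec_nth[of "cadj N"] cnj_sum sum_distrib_left mult.commute)
  finally show ?thesis by (simp add: hf_matvec)
qed

lemma norm_vec_sq: "(norm (x::complex^'n))\<^sup>2 = (\<Sum>i\<in>UNIV. (cmod (x$i))\<^sup>2)"
  by (simp add: norm_vec_def L2_set_def sum_nonneg)

lemma hf_mat1: "hf (mat 1) x x = complex_of_real ((norm x)\<^sup>2)"
  by (simp add: hf_matvec norm_vec_sq mult.commute flip: complex_norm_square)

lemma hf_square: "hf (N ** cadj N) x x = complex_of_real ((norm (cadj N *v x))\<^sup>2)"
  using hf_conj[of N "mat 1" x x] by (simp add: hf_mat1)

definition psd :: "('n::finite) cmat \<Rightarrow> bool" where
  "psd A \<longleftrightarrow> cadj A = A \<and> (\<forall>x. 0 \<le> Re (hf A x x))"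

lemma hpos_psd: "hpos_def A \<Longrightarrow> psd A"
  unfolding hpos_def_hf psd_def by (metis hf_smult_left less_eq_real_def mult_zero_left complex_cnj_zero vector_smult_lzero zero_complex.sel(1))

lemma herm_diag_real: "cadj A = A \<Longrightarrow> Im (A $ i $ i) = 0"
  by (metis cadj_nth cnj.sel(2) neg_equal_zero)

lemma psd_diag: "psd A \<Longrightarrow> 0 \<le> Re (A $ i $ i)" "psd A \<Longrightarrow> A $ i $ i = complex_of_real (Re (A $ i $ i))"
  using hf_axis[of A i i] herm_diag_real[of A i] by (auto simp: psd_def complex_eq_iff) (metis hf_axis)

lemma hf_expand:
  assumes "cadj A = A"
  shows "Re (hf A (x + c *s y) (x + c *s y)) = Re (hf A x x) + 2 * Re (c * hf A x y) + (cmod c)\<^sup>2 * Re (hf A y y)"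
proof -
  have "hf A (x + c *s y) (x + c *s y) = hf A x x + c * hf A x y + cnj (c * hf A x y) + (c * cnj c) * hf A y y"
    using hf_cnj[OF assms, of y x] by (simp add: hf_add_left hf_add_right hf_smult_left hf_smult_right algebra_simps)
  moreover have "Re ((c * cnj c) * hf A y y) = (cmod c)\<^sup>2 * Re (hf A y y)"
    by (subst complex_norm_square[symmetric]) (simp only: Re_complex_of_real Im_complex_of_real times_complex.sel mult_zero_left diff_zero)
  ultimately show ?thesis by simp
qed

text \<open>With a zero on the diagonal the form is affine along multiples of
  \<open>axis i 1\<close>, so a nonzero entry beside it makes the form negative far out.\<close>

lemma psd_zero_diag:
  assumes A: "psd A" and z: "A $ i $ i = 0" shows "A $ i $ j = 0" "A $ j $ i = 0"
proof -
  have h: "cadj A = A" using A by (simp add: psd_def)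
  show 0: "A $ j $ i = 0"
  proof (rule ccontr)
    assume ne: "A $ j $ i \<noteq> 0"
    define m where "m = (cmod (A $ j $ i))\<^sup>2"
    \<comment> \<open>The slope is -2m, so this value of \<open>s\<close> brings the form exactly to
      -1.\<close>
    define s where "s = (Re (A $ j $ j) + 1) / (2 * m)"
    have m: "m > 0" using ne by (simp add: m_def)
    let ?c = "- complex_of_real s * cnj (A $ j $ i)"
    have "0 \<le> Re (hf A (axis j 1 + ?c *s axis i 1) (axis j 1 + ?c *s axis i 1))" using A by (simp add: psd_def)
    also have "\<dots> = Re (A $ j $ j) + 2 * Re (?c * A $ j $ i)"
      unfolding hf_expand[OF h] hf_axis z by simp
    also have "?c * A $ j $ i = - complex_of_real (s * m)"
      by (simp add: m_def complex_norm_square mult.commute mult.left_commute del: of_real_power)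
    also have "Re (A $ j $ j) + 2 * Re (- complex_of_real (s * m)) = Re (A $ j $ j) - 2 * (s * m)" by simp
    also have "2 * (s * m) = Re (A $ j $ j) + 1" using m by (simp add: s_def)
    finally show False by simp
  qed
  then show "A $ i $ j = 0" using h by (metis cadj_nth complex_cnj_zero)
qed

text \<open>Cholesky elimination, by induction on the number of nonzero diagonal entries. Removing
  the rank one part of column \<open>j\<close> clears the entry at \<open>j\<close> and creates no
  new one. The clause on zero diagonal entries keeps the slot \<open>p j\<close> free for the vector
  just removed.\<close>

lemma psd_factor_aux:
  "card {j. A $ j $ j \<noteq> 0} = m \<Longrightarrow> psd A \<Longrightarrow>
    \<exists>p. (\<forall>a. A $ a $ a = 0 \<longrightarrow> p a = 0) \<and> (\<forall>i j. (A::('n::finite) cmat) $ i $ j = (\<Sum>a\<in>UNIV. p a $ i * cnj (p a $ j)))"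
proof (induction m arbitrary: A rule: less_induct)
  case (less m A)
  have h: "cadj A = A" using less by (simp add: psd_def)
  show ?case
  proof (cases "\<exists>j. A $ j $ j \<noteq> 0")
    case False
    then have "A $ i $ j = 0" for i j using psd_zero_diag[OF less.prems(2)] by blast
    then show ?thesis by (intro exI[of _ "\<lambda>_. 0"]) simp
  next
    case True
    then obtain j where j: "A $ j $ j \<noteq> 0" by blast
    define r where "r = Re (A $ j $ j)"
    have r: "r > 0" "A $ j $ j = complex_of_real r"
      using psd_diag[OF less.prems(2), of j] j by (auto simp: r_def less_le)
    define q :: "complex^'n" where "q = (\<chi> i. A $ i $ j / complex_of_real (sqrt r))"
    define B where "B = (\<chi> i k. A $ i $ k - q $ i * cnj (q $ k))"
    have Bn: "B $ i $ k = A $ i $ k - q $ i * cnj (q $ k)" for i k by (simp add: B_def)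
    have q2: "q $ i * cnj (q $ k) = A $ i $ j * cnj (A $ k $ j) / complex_of_real r" for i k
    proof -
      have "complex_of_real (sqrt r) * complex_of_real (sqrt r) = complex_of_real r"
        using r(1) by (simp flip: of_real_mult)
      then show ?thesis by (simp add: q_def)
    qed
    have Ac: "cnj (A $ k $ i) = A $ i $ k" for i k using h by (metis cadj_nth)
    have hB: "cadj B = B" by (rule cmat_eqI) (simp add: Bn Ac mult.commute)
    have hfB: "hf B x x = hf A x x - complex_of_real ((cmod (hf A x (axis j 1)))\<^sup>2 / r)" for x
    proof -
      have "hf B x x = hf A x x - (\<Sum>i\<in>UNIV. \<Sum>k\<in>UNIV. cnj (x$i) * (q $ i * cnj (q $ k)) * x$k)"
        by (simp add: hf_def Bn left_diff_distrib right_diff_distrib sum_subtractf)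
      also have "(\<Sum>i\<in>UNIV. \<Sum>k\<in>UNIV. cnj (x$i) * (q $ i * cnj (q $ k)) * x$k)
        = (\<Sum>i\<in>UNIV. cnj (x$i) * A $ i $ j) * (\<Sum>k\<in>UNIV. cnj (A $ k $ j) * x $ k) / complex_of_real r"
        unfolding sum_product sum_divide_distrib q2 by (intro sum.cong refl) simp
      also have "(\<Sum>i\<in>UNIV. cnj (x$i) * A $ i $ j) = hf A x (axis j 1)"
        by (simp add: hf_matvec matvec_axis)
      also have "(\<Sum>k\<in>UNIV. cnj (A $ k $ j) * x $ k) = cnj (hf A x (axis j 1))"
        by (simp add: hf_matvec matvec_axis cnj_sum mult.commute)
      finally show ?thesis by (simp add: complex_norm_square del: of_real_power)
    qed
    have psdB: "psd B" unfolding psd_def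
    proof (intro conjI hB allI)
      fix x
      let ?w = "hf A x (axis j 1)"
      \<comment> \<open>The minimiser of the quadratic in \<open>c\<close>; the minimum is the value
        of the Schur complement \<open>B\<close>.\<close>
      let ?c = "- cnj ?w / complex_of_real r"
      have "0 \<le> Re (hf A (x + ?c *s axis j 1) (x + ?c *s axis j 1))"
        using less.prems(2) by (simp add: psd_def)
      also have "\<dots> = Re (hf A x x) + 2 * Re (?c * ?w) + (cmod ?c)\<^sup>2 * r"
        unfolding hf_expand[OF h] hf_axis r(2) by simp
      also have "?c * ?w = - complex_of_real ((cmod ?w)\<^sup>2 / r)"
        by (simp add: complex_norm_square mult.commute del: of_real_power)
      also have "(cmod ?c)\<^sup>2 * r = (cmod ?w)\<^sup>2 / r"
        using r(1) by (simp add: norm_divide power_divide power2_eq_square)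
      finally show "0 \<le> Re (hf B x x)" unfolding hfB by simp
    qed
    have B0: "B $ a $ a = 0" if "A $ a $ a = 0 \<or> a = j" for a
      using that psd_zero_diag(1)[OF less.prems(2), of a j] r Ac[of j j] by (auto simp: Bn q2)
    have "{a. B $ a $ a \<noteq> 0} \<subset> {a. A $ a $ a \<noteq> 0}" using B0 j by auto
    then have "card {a. B $ a $ a \<noteq> 0} < m"
      using psubset_card_mono[of "{a. A $ a $ a \<noteq> 0}" "{a. B $ a $ a \<noteq> 0}"] less.prems(1) by simp
    from less.IH[OF this refl psdB] obtain p where p: "\<And>a. B $ a $ a = 0 \<Longrightarrow> p a = 0"
      "\<And>i k. B $ i $ k = (\<Sum>a\<in>UNIV. p a $ i * cnj (p a $ k))" by blast
    have "(\<Sum>a\<in>UNIV. (p(j := q)) a $ i * cnj ((p(j := q)) a $ k)) = A $ i $ k" for i k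
    proof -
      have "(\<Sum>a\<in>UNIV. (p(j := q)) a $ i * cnj ((p(j := q)) a $ k))
        = (\<Sum>a\<in>UNIV. p a $ i * cnj (p a $ k) + (if a = j then q $ i * cnj (q $ k) else 0))"
        using p(1)[OF B0[of j]] by (intro sum.cong) auto
      also have "\<dots> = B $ i $ k + q $ i * cnj (q $ k)" by (simp add: sum.distrib p(2))
      finally show ?thesis by (simp add: Bn)
    qed
    moreover have "(p(j := q)) a = 0" if "A $ a $ a = 0" for a using that j p(1)[OF B0[of a]] by auto
    ultimately show ?thesis by (intro exI[of _ "p(j := q)"]) simp
  qed
qed

lemma psd_factor:
  assumes "psd (A::('n::finite) cmat)"
  obtains p :: "'n \<Rightarrow> complex^'n" where "\<And>i j. A $ i $ j = (\<Sum>a\<in>UNIV. p a $ i * cnj (p a $ j))"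
  using psd_factor_aux[OF refl assms] by blast

lemma det_cadj: "det (cadj (A::('n::finite) cmat)) = cnj (det A)"
proof -
  have "det (cadj A) = det (transpose (cadj A))" by simp
  also have "\<dots> = cnj (det A)"
    unfolding det_def by (simp add: cnj_sum cnj_prod)
  finally show ?thesis .
qed

text \<open>With A = P \<open>cadj P\<close> the determinant is the squared modulus of
  \<open>det P\<close>; if it is nonzero, \<open>cadj P\<close> is injective and the form is
  strictly positive.\<close>

lemma psd_det:
  assumes "psd (A::('n::finite) cmat)"
  shows "Im (det A) = 0" "0 \<le> Re (det A)" "det A \<noteq> 0 \<Longrightarrow> hpos_def A"
proof -
  obtain p :: "'n \<Rightarrow> complex^'n" where p: "\<And>i j. A $ i $ j = (\<Sum>a\<in>UNIV. p a $ i * cnj (p a $ j))"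
    using psd_factor[OF assms] by blast
  define P where "P = (\<chi> i a. p a $ i)"
  have A: "A = P ** cadj P" by (rule cmat_eqI) (simp add: p P_def matmul_nth)
  have d: "det A = complex_of_real ((cmod (det P))\<^sup>2)"
    unfolding A det_mul det_cadj by (rule complex_norm_square[symmetric])
  then show "Im (det A) = 0" "0 \<le> Re (det A)" by (simp_all del: of_real_power)
  assume "det A \<noteq> 0"
  then have "det (cadj P) \<noteq> 0" unfolding A det_mul by auto
  then have inj: "cadj P *v x = 0 \<Longrightarrow> x = 0" for x
    by (metis invertible_det_nz matrix_left_invertible_ker invertible_def)
  show "hpos_def A" unfolding hpos_def_hf
  proof (intro conjI allI impI)
    show "cadj A = A" using assms by (simp add: psd_def)
    fix x :: "complex^'n" assume "x \<noteq> 0"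
    then have "norm (cadj P *v x) > 0" using inj by auto
    then show "0 < Re (hf A x x)" unfolding A hf_square by simp
  qed
qed

lemma hpos_det: assumes "hpos_def (A::('n::finite) cmat)" shows "0 < Re (det A)" "det A \<noteq> 0"
proof -
  show "det A \<noteq> 0"
  proof
    assume "det A = 0"
    then have "\<not> invertible A" by (simp add: invertible_det_nz)
    then obtain x where x: "A *v x = 0" "x \<noteq> 0"
      by (metis invertible_left_inverse matrix_left_invertible_ker)
    then have "hf A x x = 0" by (simp add: hf_matvec)
    then show False using assms x by (metis hpos_def_hf less_irrefl zero_complex.sel(1))
  qed
  then show "0 < Re (det A)" using psd_det(1,2)[OF hpos_psd[OF assms]] by (metis complex_eq_0 less_le power2_eq_square complex_eq_iff zero_complex.sel)
qed

subsection \<open>The domain\<close>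

definition Vm :: "('n::finite) cmat \<Rightarrow> 'n cmat" where
  "Vm z = mat 1 - z ** cadj z"

lemma II_iff: "z \<in> II \<longleftrightarrow> transpose z = z \<and> hpos_def (Vm z)"
  by (simp add: II_def Vm_def)

lemma cadj_Vm [simp]: "cadj (Vm z) = Vm z"
proof (rule cmat_eqI)
  show "cadj (Vm z) $ i $ j = Vm z $ i $ j" for i j
    by (auto simp: Vm_def matmul_nth cnj_sum mult.commute)
qed

lemma hf_Vm: "Re (hf (Vm z) x x) = (norm x)\<^sup>2 - (norm (cadj z *v x))\<^sup>2"
  by (simp add: Vm_def hf_diff_mat hf_mat1 hf_square)

lemma continuous_on_Vm [continuous_intros]:
  "continuous_on S f \<Longrightarrow> continuous_on S (\<lambda>x. Vm (f x :: ('n::finite) cmat))"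
  unfolding Vm_def by (intro continuous_intros)

lemma continuous_on_hf [continuous_intros]:
  "continuous_on S f \<Longrightarrow> continuous_on S g \<Longrightarrow> continuous_on S h \<Longrightarrow>
    continuous_on S (\<lambda>x. hf (f x :: ('n::finite) cmat) (g x) (h x))"
  unfolding hf_def by (intro continuous_intros)

lemma continuous_on_det [continuous_intros]:
  "continuous_on S f \<Longrightarrow> continuous_on S (\<lambda>x. det (f x :: ('n::finite) cmat))"
  unfolding det_def by (intro continuous_intros)

lemma closure_II:
  assumes "z \<in> closure II" shows "transpose z = z" "psd (Vm z)"
proof -
  let ?C = "{z. transpose z = z} \<inter> (\<Inter>x. {z. 0 \<le> Re (hf (Vm z) x x)})"
  have "closed ?C"
    by (intro closed_Int closed_INT ballI closed_Collect_eq closed_Collect_le continuous_intros)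
  moreover have "II \<subseteq> ?C" by (auto simp: II_iff dest!: hpos_psd) (simp add: psd_def)
  ultimately have "z \<in> ?C" using assms closure_minimal by blast
  then show "transpose z = z" "psd (Vm z)" by (auto simp: psd_def)
qed

lemma psd_Vm_row: assumes "psd (Vm z)" shows "(\<Sum>j\<in>UNIV. (cmod (z $ i $ j))\<^sup>2) \<le> 1" "cmod (z $ i $ j) \<le> 1"
proof -
  have "Vm z $ i $ i = complex_of_real (1 - (\<Sum>j\<in>UNIV. (cmod (z $ i $ j))\<^sup>2))"
    by (simp add: Vm_def matmul_nth complex_norm_square del: of_real_power)
  then show *: "(\<Sum>j\<in>UNIV. (cmod (z $ i $ j))\<^sup>2) \<le> 1" using psd_diag(1)[OF assms, of i] by simp
  have "(cmod (z $ i $ j))\<^sup>2 \<le> (\<Sum>j\<in>UNIV. (cmod (z $ i $ j))\<^sup>2)"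
    by (rule member_le_sum) auto
  then have "(cmod (z $ i $ j))\<^sup>2 \<le> 1\<^sup>2" using * by simp
  then show "cmod (z $ i $ j) \<le> 1" by (rule power2_le_imp_le) simp
qed

lemma norm_closure_II:
  assumes "z \<in> closure (II :: ('n::finite) cmat set)" shows "(norm z)\<^sup>2 \<le> real CARD('n)"
proof -
  have "(norm z)\<^sup>2 \<le> (\<Sum>i\<in>(UNIV::'n set). 1)"
    unfolding norm_cmat_sq using psd_Vm_row(1)[OF closure_II(2)[OF assms]] by (rule sum_mono)
  then show ?thesis by simp
qed

lemma compact_closure_II: "compact (closure (II :: ('n::finite) cmat set))"
proof -
  have "norm z \<le> sqrt (real CARD('n))" if "z \<in> closure (II :: 'n cmat set)" for z
    using norm_closure_II[OF that] real_le_rsqrt by blast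
  then have "bounded (closure (II :: 'n cmat set))" by (auto simp: bounded_iff)
  then show ?thesis by (simp add: compact_eq_bounded_closed)
qed

text \<open>On the closure \<open>Vm z\<close> is positive semidefinite, and a nonzero determinant
  makes it definite. A maximum where the determinant is positive is therefore interior.\<close>

lemma closure_II_det: "z \<in> closure II \<Longrightarrow> 0 < Re (det (Vm z)) \<Longrightarrow> z \<in> II"
  using closure_II psd_det(3) by (metis II_iff less_irrefl zero_complex.sel(1))

section \<open>Symmetrization and an open set of matrices for Frechet calculus\<close>

definition symm :: "('n::finite) cmat \<Rightarrow> 'n cmat" where
  "symm z = (1/2) *\<^sub>R (z + transpose z)"

lemma symm_id: "transpose z = z \<Longrightarrow> symm z = z"
  by (simp add: symm_def scaleR_2[symmetric])

lemma symm_nth: "symm z $ i $ j = (z $ i $ j + z $ j $ i) / 2"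
  by (simp add: symm_def scaleR_conv_of_real[where 'a=complex])

lemma transpose_symm [simp]: "transpose (symm z) = symm z"
  by (rule cmat_eqI) (simp add: symm_nth add.commute)

lemma linear_symm: "linear (symm :: ('n::finite) cmat \<Rightarrow> _)"
  by (rule linearI; rule cmat_eqI)
    (simp_all add: symm_nth scaleR_conv_of_real[where 'a=complex] algebra_simps add_divide_distrib)

lemma symm_csmul: "symm (csmul c z) = csmul c (symm z)"
  by (rule cmat_eqI) (simp add: symm_nth algebra_simps)

lemma continuous_on_symm [continuous_intros]:
  "continuous_on S f \<Longrightarrow> continuous_on S (\<lambda>x. symm (f x :: ('n::finite) cmat))"
  unfolding symm_def by (intro continuous_intros)

text \<open>A function on the domain is extended by composition with \<open>symm\<close> to this open subset of all matrices, where Frechet derivatives are available.\<close>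

definition Om :: "('n::finite) cmat set" where "Om = {z. symm z \<in> II}"

lemma II_sub_Om: "z \<in> II \<Longrightarrow> z \<in> Om"
  by (simp add: Om_def symm_id II_iff)

text \<open>The form has a positive minimum on the compact unit sphere. Nearby matrices change it
  there by at most half of that minimum, and homogeneity covers all other vectors.\<close>

lemma open_hpos_Vm: "open {z :: ('n::finite) cmat. hpos_def (Vm z)}"
proof (rule openI)
  fix z :: "'n cmat" assume "z \<in> {z. hpos_def (Vm z)}"
  then have z: "hpos_def (Vm z)" by simp
  let ?S = "sphere 0 1 :: (complex^'n) set"
  have c: "continuous_on (UNIV \<times> ?S) (\<lambda>(z, x). Re (hf (Vm z) x x))"
    unfolding case_prod_beta by (intro continuous_intros)
  have "axis undefined 1 \<in> ?S" by (simp add: norm_axis_1)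
  then have ne: "?S \<noteq> {}" by blast
  have "continuous_on ?S (\<lambda>x. Re (hf (Vm z) x x))" by (intro continuous_intros)
  then obtain x0 where x0: "x0 \<in> ?S" "\<And>x. x \<in> ?S \<Longrightarrow> Re (hf (Vm z) x0 x0) \<le> Re (hf (Vm z) x x)"
    using continuous_attains_inf[OF compact_sphere ne] by blast
  define e where "e = Re (hf (Vm z) x0 x0) / 2"
  have "x0 \<noteq> 0" using x0(1) by auto
  then have e: "e > 0" using z unfolding hpos_def_hf e_def by simp
  obtain X0 where X0: "z \<in> X0" "open X0"
    "\<forall>y\<in>X0 \<inter> UNIV. \<forall>x\<in>?S. dist ((\<lambda>(z, x). Re (hf (Vm z) x x)) (y, x)) ((\<lambda>(z, x). Re (hf (Vm z) x x)) (z, x)) \<le> e"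
    by (rule continuous_on_prod_compactE[OF c compact_sphere UNIV_I e])
  have "hpos_def (Vm y)" if y: "y \<in> X0" for y
    unfolding hpos_def_hf
  proof (intro conjI allI impI cadj_Vm)
    fix x :: "complex^'n" assume x: "x \<noteq> 0"
    define c where "c = complex_of_real (1 / norm x)"
    have "c *s x = (1 / norm x) *\<^sub>R x" by (simp add: vec_eq_iff c_def scaleR_conv_of_real[where 'a=complex])
    then have S: "c *s x \<in> ?S" using x by simp
    have "dist (Re (hf (Vm y) (c *s x) (c *s x))) (Re (hf (Vm z) (c *s x) (c *s x))) \<le> e"
      using X0(3) y S by auto
    then have "0 < Re (hf (Vm y) (c *s x) (c *s x))"
      using x0(2)[OF S] e unfolding dist_real_def e_def by linarith
    also have "hf (Vm y) (c *s x) (c *s x) = complex_of_real ((1 / norm x)\<^sup>2) * hf (Vm y) x x"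
      by (simp add: hf_smult_left hf_smult_right c_def power2_eq_square)
    finally show "0 < Re (hf (Vm y) x x)" using x by (simp add: zero_less_mult_iff)
  qed
  then have "X0 \<subseteq> {z. hpos_def (Vm z)}" by blast
  then show "\<exists>e>0. ball z e \<subseteq> {z. hpos_def (Vm z)}"
    using X0(1,2) by (meson open_contains_ball order_trans)
qed

lemma open_Om: "open (Om :: ('n::finite) cmat set)"
proof -
  have "Om = symm -` {z :: 'n cmat. hpos_def (Vm z)}" by (auto simp: Om_def II_iff)
  moreover have "continuous_on UNIV (symm :: 'n cmat \<Rightarrow> _)" by (intro continuous_intros)
  ultimately show ?thesis using open_hpos_Vm continuous_open_vimage by (metis continuous_on_eq_continuous_at open_UNIV iso_tuple_UNIV_I open_vimage)
qed

section \<open>Rank one matrices and the action z -> k z k^t of the unitary group\<close>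

definition outer :: "complex^'n \<Rightarrow> complex^'n \<Rightarrow> ('n::finite) cmat" where
  "outer x y = (\<chi> i j. x $ i * y $ j)"

text \<open>The symmetric product without the factor 1/2. Since \<open>Tm x x\<close> is twice
  \<open>outer x x\<close>, Levi forms on such pairs acquire the factors 4 seen later.\<close>

definition Tm :: "complex^'n \<Rightarrow> complex^'n \<Rightarrow> ('n::finite) cmat" where
  "Tm x y = outer x y + outer y x"

lemma outer_nth [simp]: "outer x y $ i $ j = x $ i * y $ j"
  by (simp add: outer_def)

lemma Tm_nth: "Tm x y $ i $ j = x $ i * y $ j + y $ i * x $ j"
  by (simp add: Tm_def)

lemma transpose_Tm [simp]: "transpose (Tm x y) = Tm x y"
  by (rule cmat_eqI) (simp add: Tm_nth mult.commute add.commute)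

lemma Tm_commute: "Tm x y = Tm y x"
  by (simp add: Tm_def add.commute)

lemma Tm_diag: "Tm x x = 2 *\<^sub>R outer x x"
  by (simp add: Tm_def scaleR_2)

definition act :: "('n::finite) cmat \<Rightarrow> 'n cmat \<Rightarrow> 'n cmat" where
  "act k z = k ** z ** transpose k"

lemma act_outer: "act k (outer x y) = outer (k *v x) (k *v y)"
proof (rule cmat_eqI)
  fix i j
  have "act k (outer x y) $ i $ j = (\<Sum>b\<in>UNIV. \<Sum>a\<in>UNIV. k $ i $ a * x $ a * (y $ b * k $ j $ b))"
    by (simp add: act_def matmul_nth sum_distrib_right mult.assoc)
  also have "\<dots> = (\<Sum>a\<in>UNIV. \<Sum>b\<in>UNIV. k $ i $ a * x $ a * (y $ b * k $ j $ b))" by (rule sum.swap)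
  also have "\<dots> = outer (k *v x) (k *v y) $ i $ j"
    by (simp add: matvec_nth sum_product mult.commute[of "k $ j $ _"])
  finally show "act k (outer x y) $ i $ j = outer (k *v x) (k *v y) $ i $ j" .
qed

lemma linear_act: "linear (act k)"
proof (rule linearI)
  show "act k (x + y) = act k x + act k y" for x y
    by (rule cmat_eqI) (simp add: act_def matmul_nth distrib_left distrib_right sum.distrib)
  show "act k (r *\<^sub>R x) = r *\<^sub>R act k x" for r x
    by (rule cmat_eqI) (simp add: act_def matmul_nth scaleR_sum_right sum_distrib_right)
qed

lemma act_csmul: "act k (csmul c x) = csmul c (act k x)"
  by (rule cmat_eqI) (simp add: act_def matmul_nth sum_distrib_left sum_distrib_right algebra_simps)

lemma act_Tm: "act k (Tm x y) = Tm (k *v x) (k *v y)"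
  by (simp add: Tm_def act_outer linear_add[OF linear_act])

lemma act_act: "act k (act l z) = act (k ** l) z"
  by (simp add: act_def matrix_transpose_mul matrix_mul_assoc)

lemma transpose_act: "transpose (act k z) = act k (transpose z)"
  by (simp add: act_def matrix_transpose_mul matrix_mul_assoc)

lemma symm_act: "symm (act k z) = act k (symm z)"
  unfolding symm_def transpose_act by (simp add: linear_scale[OF linear_act] linear_add[OF linear_act])

lemma Vm_act:
  assumes "k \<in> Ug" shows "Vm (act k z) = k ** Vm z ** cadj k"
proof -
  have ct: "cadj (transpose k) = transpose (cadj k)" by (rule cmat_eqI) simp
  have "transpose k ** cadj (transpose k) = transpose (cadj k ** k)"
    by (simp add: ct matrix_transpose_mul)
  also have "\<dots> = mat 1" using assms by (simp add: Ug_iff')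
  finally have kt: "transpose k ** cadj (transpose k) = mat 1" .
  have "act k z ** cadj (act k z) = k ** z ** (transpose k ** cadj (transpose k)) ** cadj z ** cadj k"
    by (simp add: act_def cadj_mult matrix_mul_assoc)
  also have "\<dots> = k ** (z ** cadj z) ** cadj k" by (simp add: kt matrix_mul_assoc)
  finally have 1: "act k z ** cadj (act k z) = k ** (z ** cadj z) ** cadj k" .
  have "k ** Vm z ** cadj k = k ** cadj k - k ** (z ** cadj z) ** cadj k"
    by (simp add: Vm_def matmul_diff_left matmul_diff_right)
  then show ?thesis using assms 1 by (simp add: Vm_def Ug_iff)
qed

lemma hpos_conj:
  assumes "hpos_def A" "\<And>x. cadj N *v x = 0 \<Longrightarrow> x = 0"
  shows "hpos_def (N ** A ** cadj N)"
  using assms unfolding hpos_def_hf hf_conj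
  by (metis cadj_mult cadj_cadj matrix_mul_assoc)

lemma act_II:
  assumes "k \<in> Ug" "z \<in> II" shows "act k z \<in> II"
  unfolding II_iff
proof
  show "transpose (act k z) = act k z" using assms by (simp add: transpose_act II_iff)
  have "cadj k *v x = 0 \<Longrightarrow> x = 0" for x
    using assms(1) unfolding Ug_iff by (metis matrix_vector_mul_assoc matrix_vector_mul_lid matrix_vector_mult_0_right)
  then show "hpos_def (Vm (act k z))" unfolding Vm_act[OF assms(1)]
    using assms(2) by (intro hpos_conj) (auto simp: II_iff)
qed

lemma continuous_on_act [continuous_intros]:
  "continuous_on S f \<Longrightarrow> continuous_on S g \<Longrightarrow> continuous_on S (\<lambda>x. act (f x :: ('n::finite) cmat) (g x))"
  unfolding act_def by (intro continuous_intros)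

lemma act_closure_II:
  assumes "k \<in> Ug" "z \<in> closure II" shows "act k z \<in> closure II"
proof -
  have "act k ` closure II \<subseteq> closure II"
    by (rule image_closure_subset) (auto intro!: continuous_intros subsetD[OF closure_subset] act_II assms)
  then show ?thesis using assms by blast
qed

lemma act_Om: "k \<in> Ug \<Longrightarrow> z \<in> Om \<Longrightarrow> act k z \<in> Om"
  by (simp add: Om_def symm_act act_II)

lemma zero_II [simp]: "0 \<in> II"
proof -
  have [simp]: "Vm 0 = mat 1" by (rule cmat_eqI) (simp add: Vm_def matmul_nth)
  show ?thesis by (auto simp: II_iff hpos_def_hf hf_mat1 intro!: cmat_eqI)
qed

definition E1 :: "'n \<Rightarrow> ('n::finite) cmat" where
  "E1 o1 = outer (axis o1 1) (axis o1 1)"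

lemma E1_nth: "E1 o1 $ i $ j = (if i = o1 \<and> j = o1 then 1 else 0)"
  by (auto simp: E1_def axis_def)

lemma csmul_E1_II:
  assumes "cmod c < 1" shows "csmul c (E1 o1) \<in> II"
  unfolding II_iff hpos_def_hf
proof (intro conjI allI impI cadj_Vm)
  show "transpose (csmul c (E1 o1)) = csmul c (E1 o1)" by (rule cmat_eqI) (auto simp: E1_nth)
  fix x :: "complex^'a" assume x: "x \<noteq> 0"
  have "(cadj (csmul c (E1 o1)) *v x) $ i = (if i = o1 then cnj c * x $ o1 else 0)" for i
  proof -
    have "(cadj (csmul c (E1 o1)) *v x) $ i = (\<Sum>k\<in>UNIV. if k = o1 then (if i = o1 then cnj c * x $ o1 else 0) else 0)"
      unfolding matvec_nth by (intro sum.cong) (auto simp: E1_nth)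
    then show ?thesis by simp
  qed
  then have "(norm (cadj (csmul c (E1 o1)) *v x))\<^sup>2 = (\<Sum>i\<in>UNIV. if i = o1 then (cmod c * cmod (x $ o1))\<^sup>2 else 0)"
    unfolding norm_vec_sq by (intro sum.cong) (auto simp: norm_mult)
  also have "\<dots> = (cmod c)\<^sup>2 * (cmod (x $ o1))\<^sup>2" by (simp add: power_mult_distrib)
  also have "\<dots> \<le> (cmod c)\<^sup>2 * (norm x)\<^sup>2"
    by (intro mult_left_mono power_mono Finite_Cartesian_Product.norm_nth_le) auto
  also have "\<dots> < 1 * (norm x)\<^sup>2"
    using assms x by (intro mult_strict_right_mono) (auto simp: power2_eq_1_iff abs_square_less_1 power_less_one_iff)
  finally show "0 < Re (hf (Vm (csmul c (E1 o1))) x x)" unfolding hf_Vm by simp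
qed

lemma scaleR_E1_II: "\<bar>r\<bar> < 1 \<Longrightarrow> r *\<^sub>R E1 o1 \<in> II"
  using csmul_E1_II[of "complex_of_real r" o1] by (simp add: csmul_of_real)

subsection \<open>Derivatives of determinant and inverse\<close>

lemma bounded_bilinear_matmul: "bounded_bilinear ((**) :: ('n::finite) cmat \<Rightarrow> 'n cmat \<Rightarrow> 'n cmat)"
proof -
  have "bilinear ((**) :: 'n cmat \<Rightarrow> 'n cmat \<Rightarrow> 'n cmat)"
    unfolding bilinear_def
  proof (intro conjI allI linearI)
    fix A B C :: "'n cmat" and r :: real
    show "A ** (B + C) = A ** B + A ** C" by (rule matrix_add_ldistrib)
    show "(B + C) ** A = B ** A + C ** A"
      by (rule cmat_eqI) (simp add: matmul_nth distrib_right sum.distrib)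
    show "A ** (r *\<^sub>R B) = r *\<^sub>R (A ** B)"
      by (rule cmat_eqI) (simp add: matmul_nth scaleR_sum_right)
    show "(r *\<^sub>R B) ** A = r *\<^sub>R (B ** A)"
      by (rule cmat_eqI) (simp add: matmul_nth scaleR_sum_right)
  qed
  then show ?thesis by (simp add: bilinear_conv_bounded_bilinear)
qed

lemmas has_derivative_matmul = bounded_bilinear.FDERIV[OF bounded_bilinear_matmul]

lemma linear_cadj: "linear (cadj :: ('n::finite) cmat \<Rightarrow> 'n cmat)"
  by (rule linearI; rule cmat_eqI) simp_all

lemma linear_trace: "linear (trace :: ('n::finite) cmat \<Rightarrow> complex)"
  by (rule linearI) (simp_all add: trace_def sum.distrib scaleR_sum_right)

lemma has_derivative_cadj:
  "(f has_derivative f') F \<Longrightarrow> ((\<lambda>x. cadj (f x :: ('n::finite) cmat)) has_derivative (\<lambda>h. cadj (f' h))) F"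
  using bounded_linear.has_derivative linear_cadj linear_conv_bounded_linear by blast

lemma has_derivative_trace:
  "(f has_derivative f') F \<Longrightarrow> ((\<lambda>x. trace (f x :: ('n::finite) cmat)) has_derivative (\<lambda>h. trace (f' h))) F"
  using bounded_linear.has_derivative linear_trace linear_conv_bounded_linear by blast

text \<open>A permutation other than the identity moves at least two indices. After one factor is
  differentiated, a vanishing off-diagonal entry of the identity matrix remains, so only the
  identity contributes.\<close>

lemma has_derivative_det_one:
  "((det :: ('n::finite) cmat \<Rightarrow> complex) has_derivative trace) (at (mat 1))"
proof -
  let ?P = "{p :: 'n \<Rightarrow> 'n. p permutes UNIV}"
  have nth: "((\<lambda>A :: 'n cmat. A $ i $ j) has_derivative (\<lambda>H. H $ i $ j)) (at A)" for i j A
    by (intro bounded_linear_imp_has_derivative bounded_linear_compose[OF bounded_linear_vec_nth bounded_linear_vec_nth])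
  have "((\<lambda>A :: 'n cmat. \<Sum>p\<in>?P. of_int (sign p) * (\<Prod>i\<in>UNIV. A $ i $ p i)) has_derivative
    (\<lambda>H. \<Sum>p\<in>?P. of_int (sign p) * (\<Sum>i\<in>UNIV. H $ i $ p i * (\<Prod>j\<in>UNIV - {i}. mat 1 $ j $ p j)))) (at (mat 1))"
    by (intro has_derivative_sum has_derivative_mult_right has_derivative_prod nth)
  moreover have "(\<Sum>p\<in>?P. of_int (sign p) * (\<Sum>i\<in>UNIV. H $ i $ p i * (\<Prod>j\<in>UNIV - {i}. mat 1 $ j $ p j))) = trace H"
    for H :: "'n cmat"
  proof -
    have "(\<Sum>i\<in>UNIV. H $ i $ p i * (\<Prod>j\<in>UNIV - {i}. mat 1 $ j $ p j)) = 0" if p: "p \<in> ?P - {id}" for p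
    proof (rule sum.neutral, rule ballI)
      fix i :: 'n
      have ex: "\<exists>j. j \<noteq> i \<and> p j \<noteq> j"
      proof (rule ccontr)
        assume "\<not> ?thesis"
        then have *: "p j = j" if "j \<noteq> i" for j using that by blast
        have "inj p" using p permutes_inj by auto
        then have "p i = i" using * by (metis injD)
        then have "p x = x" for x using * by (cases "x = i") auto
        then have "p = id" by (auto simp: fun_eq_iff)
        then show False using p by simp
      qed
      then have "(\<Prod>j\<in>UNIV - {i}. (mat 1 :: 'n cmat) $ j $ p j) = 0"
        by (intro prod_zero) (use ex in force)+
      then show "H $ i $ p i * (\<Prod>j\<in>UNIV - {i}. mat 1 $ j $ p j) = 0" by simp
    qed
    then have "(\<Sum>p\<in>?P. of_int (sign p) * (\<Sum>i\<in>UNIV. H $ i $ p i * (\<Prod>j\<in>UNIV - {i}. mat 1 $ j $ p j)))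
      = (\<Sum>p\<in>{id}. of_int (sign p) * (\<Sum>i\<in>UNIV. H $ i $ p i * (\<Prod>j\<in>UNIV - {i}. mat 1 $ j $ p j)))"
      by (intro sum.mono_neutral_right) (auto simp: permutes_id)
    then show ?thesis by (simp add: trace_def sign_id)
  qed
  ultimately show ?thesis unfolding det_def[abs_def] by simp
qed

lemma matrix_inv_cmat:
  assumes "det (A::('n::finite) cmat) \<noteq> 0"
  shows "A ** matrix_inv A = mat 1" "matrix_inv A ** A = mat 1"
proof -
  have "\<exists>B. A ** B = mat 1 \<and> B ** A = mat 1"
    using assms invertible_det_nz[of A] by (simp add: invertible_def)
  from someI_ex[OF this] show "A ** matrix_inv A = mat 1" "matrix_inv A ** A = mat 1"
    by (auto simp: matrix_inv_def)
qed

lemma has_derivative_det: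
  assumes A: "det (A::('n::finite) cmat) \<noteq> 0"
  shows "(det has_derivative (\<lambda>H. det A * trace (matrix_inv A ** H))) (at A)"
proof -
  have l: "((\<lambda>Y. matrix_inv A ** Y) has_derivative (\<lambda>H. matrix_inv A ** H)) (at A)"
    using bounded_linear_imp_has_derivative bounded_bilinear.bounded_linear_right[OF bounded_bilinear_matmul] by blast
  have "((\<lambda>Y. det (matrix_inv A ** Y)) has_derivative (\<lambda>H. trace (matrix_inv A ** H))) (at A)"
    by (rule has_derivative_compose[OF l]) (simp add: matrix_inv_cmat[OF A] has_derivative_det_one)
  then have "((\<lambda>Y. det A * det (matrix_inv A ** Y)) has_derivative (\<lambda>H. det A * trace (matrix_inv A ** H))) (at A)"
    by (rule has_derivative_mult_right)
  moreover have "det A * det (matrix_inv A ** Y) = det Y" for Y :: "'n cmat"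
    by (metis det_mul matrix_mul_assoc matrix_inv_cmat(1)[OF A] matrix_mul_lid)
  ultimately show ?thesis by (simp add: fun_eq_iff[symmetric])
qed

text \<open>The resolvent identity X - Z = Z H X, with X and Z the inverses at \<open>A\<close> and
  at \<open>Y\<close> and H = Y - A, is used twice: once to bound the norm of Z by twice that of X
  near \<open>A\<close>, and once more to show that the remainder Z H X H X is quadratic in
  H.\<close>

lemma has_derivative_matrix_inv:
  assumes A: "det (A::('n::finite) cmat) \<noteq> 0"
  shows "(matrix_inv has_derivative (\<lambda>H. - (matrix_inv A ** H ** matrix_inv A))) (at A)"
  unfolding has_derivative_at_alt
proof (intro conjI allI impI)
  let ?X = "matrix_inv A"
  note hua_form = bounded_bilinear_matmul
  show "bounded_linear (\<lambda>H. - (?X ** H ** ?X))"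
    by (rule bounded_linear_minus[OF bounded_linear_compose[OF bounded_bilinear.bounded_linear_left[OF hua_form]
          bounded_bilinear.bounded_linear_right[OF hua_form]]])
  have "\<exists>K>0. \<forall>(a::'n cmat) (b::'n cmat). norm (a ** b) \<le> norm a * norm b * K"
    by (rule bounded_bilinear.pos_bounded[OF hua_form])
  then obtain K where K: "K > 0" "\<And>(a::'n cmat) (b::'n cmat). norm (a ** b) \<le> norm a * norm b * K" by metis
  define a where "a = norm ?X"
  have a: "a \<ge> 0" by (simp add: a_def)
  have "open {Y :: 'n cmat. det Y \<noteq> 0}"
    by (intro open_Collect_neq continuous_intros)
  then obtain d0 where d0: "d0 > 0" "\<And>Y :: 'n cmat. norm (Y - A) < d0 \<Longrightarrow> det Y \<noteq> 0"
    using A unfolding open_dist dist_norm by blast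
  fix e :: real assume e: "e > 0"
  \<comment> \<open>\<open>c1\<close> lets half of the norm of the new inverse be absorbed;
    \<open>c2\<close> is the constant of the quadratic remainder once that norm is at most
    \<open>2 * a\<close>. The summands 1 keep both positive.\<close>
  define c1 where "c1 = 2 * (a * K * K) + 1"
  define c2 where "c2 = 2 * a * a * a * K * K * K * K + 1"
  have c: "c1 > 0" "c2 > 0" using a K by (auto simp: c1_def c2_def add_nonneg_pos)
  define d where "d = min d0 (min (1 / c1) (e / c2))"
  have d: "d > 0" using d0 c e by (simp add: d_def)
  have "norm (matrix_inv Y - ?X - - (?X ** (Y - A) ** ?X)) \<le> e * norm (Y - A)" if Y: "norm (Y - A) < d" for Y
  proof -
    let ?Z = "matrix_inv Y" and ?H = "Y - A"
    have dY: "det Y \<noteq> 0" using d0 Y by (simp add: d_def)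
    have 1: "?X - ?Z = ?Z ** ?H ** ?X"
      using matrix_inv_cmat[OF A] matrix_inv_cmat[OF dY]
      by (simp add: matmul_diff_left matmul_diff_right) (metis matrix_mul_assoc matrix_mul_rid)
    have hc: "norm ?H * c1 \<le> 1" "norm ?H * c2 \<le> e"
      using Y c by (auto simp: d_def pos_le_divide_eq[symmetric] less_imp_le)
    have "norm (?Z ** ?H ** ?X) \<le> norm ?Z * norm ?H * K * a * K"
      using K(2)[of "?Z ** ?H" ?X] K(2)[of ?Z ?H] K(1) a
      by (smt (verit) a_def mult_right_mono norm_ge_zero)
    also have "\<dots> = norm ?Z * (norm ?H * (a * K * K))" by (simp add: algebra_simps)
    also have "\<dots> \<le> norm ?Z * (1 / 2)"
    proof (intro mult_left_mono norm_ge_zero)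
      have "norm ?H * c1 = 2 * (norm ?H * (a * K * K)) + norm ?H" by (simp add: c1_def algebra_simps)
      then show "norm ?H * (a * K * K) \<le> 1 / 2" using hc(1) norm_ge_zero[of ?H] by linarith
    qed
    finally have "norm ?Z \<le> 2 * a"
      using norm_triangle_ineq2[of ?Z ?X] unfolding 1[symmetric] by (simp add: a_def norm_minus_commute)
    have "?Z - ?X - - (?X ** ?H ** ?X) = (?X - ?Z) ** ?H ** ?X"
      unfolding matmul_diff_left 1[symmetric] by simp
    also have "\<dots> = ?Z ** ?H ** ?X ** ?H ** ?X" unfolding 1 ..
    also have "norm \<dots> \<le> norm ?Z * norm ?H * K * a * K * norm ?H * K * a * K"
    proof -
      have "norm (?Z ** ?H ** ?X ** ?H ** ?X) \<le> norm (?Z ** ?H ** ?X ** ?H) * a * K" using K(2) by (simp add: a_def)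
      also have "\<dots> \<le> norm (?Z ** ?H ** ?X) * norm ?H * K * a * K"
        using K a by (intro mult_right_mono K(2)) auto
      also have "\<dots> \<le> norm (?Z ** ?H) * a * K * norm ?H * K * a * K"
        using K a by (intro mult_right_mono K(2)[of "?Z ** ?H" ?X, folded a_def]) auto
      also have "\<dots> \<le> norm ?Z * norm ?H * K * a * K * norm ?H * K * a * K"
        using K a by (intro mult_right_mono K(2)) auto
      finally show ?thesis .
    qed
    also have "\<dots> \<le> (2 * a) * norm ?H * K * a * K * norm ?H * K * a * K"
      using K a \<open>norm ?Z \<le> 2 * a\<close> by (intro mult_right_mono) auto
    also have "\<dots> = (norm ?H * (c2 - 1)) * norm ?H" by (simp add: c2_def algebra_simps)
    also have "\<dots> \<le> e * norm ?H"
      using hc(2) by (intro mult_right_mono) (auto simp: algebra_simps add_increasing2 intro: order_trans[rotated])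
    finally show ?thesis .
  qed
  then show "\<exists>d>0. \<forall>Y. norm (Y - A) < d \<longrightarrow>
      norm (matrix_inv Y - ?X - - (?X ** (Y - A) ** ?X)) \<le> e * norm (Y - A)" using d by blast
qed

subsection \<open>The potential of the Bergman metric\<close>

definition Vi :: "('n::finite) cmat \<Rightarrow> 'n cmat" where "Vi z = matrix_inv (Vm z)"

definition dV :: "('n::finite) cmat \<Rightarrow> 'n cmat \<Rightarrow> 'n cmat" where
  "dV z v = - (v ** cadj z) - z ** cadj v"

lemma has_derivative_Vm: "(Vm has_derivative dV z) (at z)"
proof -
  have "((\<lambda>z. mat 1 - z ** cadj z) has_derivative (\<lambda>v. 0 - (z ** cadj v + v ** cadj z))) (at z)"
    by (intro has_derivative_diff has_derivative_const has_derivative_matmul has_derivative_cadj has_derivative_ident)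
  moreover have "0 - (z ** cadj v + v ** cadj z) = dV z v" for v by (simp add: dV_def)
  ultimately show ?thesis by (simp add: Vm_def[abs_def])
qed

text \<open>An open set of matrices, symmetric or not, that contains \<open>II\<close> and on which
  the potential is twice differentiable.\<close>

definition Ub :: "('n::finite) cmat set" where "Ub = {z. 0 < Re (det (Vm z))}"

lemma II_sub_Ub: "z \<in> II \<Longrightarrow> z \<in> Ub"
  by (simp add: Ub_def II_iff hpos_det)

lemma open_Ub: "open (Ub :: ('n::finite) cmat set)"
  unfolding Ub_def by (intro open_Collect_less continuous_intros)

lemma Ub_det: "z \<in> Ub \<Longrightarrow> det (Vm z) \<noteq> 0" "Im (det (Vm z)) = 0"
  by (auto simp: Ub_def) (metis cadj_Vm det_cadj cnj.sel(2) neg_equal_zero)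

lemma Vi_inverse: "z \<in> Ub \<Longrightarrow> Vm z ** Vi z = mat 1" "z \<in> Ub \<Longrightarrow> Vi z ** Vm z = mat 1"
  using matrix_inv_cmat Ub_det by (auto simp: Vi_def)

lemma inverse_unique: "A ** B = mat 1 \<Longrightarrow> B ** C = mat 1 \<Longrightarrow> A = (C :: ('n::finite) cmat)"
  by (metis matrix_mul_assoc matrix_mul_lid matrix_mul_rid)

lemma cadj_Vi: "z \<in> Ub \<Longrightarrow> cadj (Vi z) = Vi z"
proof (rule inverse_unique)
  assume z: "z \<in> Ub"
  show "cadj (Vi z) ** Vm z = mat 1"
    using arg_cong[OF Vi_inverse(1)[OF z], of cadj] by (simp add: cadj_mult)
  show "Vm z ** Vi z = mat 1" by (rule Vi_inverse[OF z])
qed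

lemma has_derivative_Vi:
  "z \<in> Ub \<Longrightarrow> (Vi has_derivative (\<lambda>w. - (Vi z ** dV z w ** Vi z))) (at z)"
  unfolding Vi_def[abs_def]
  by (rule has_derivative_compose[where f=Vm and g=matrix_inv, OF has_derivative_Vm has_derivative_matrix_inv[OF Ub_det(1)]])

text \<open>The first derivative of \<open>bpot\<close> by Jacobi's formula for the determinant;
  \<open>b2\<close> is the second, from the derivatives of the inverse and of
  \<open>dV\<close>.\<close>

definition b1 :: "('n::finite) cmat \<Rightarrow> 'n cmat \<Rightarrow> complex" where
  "b1 z v = - trace (Vi z ** dV z v)"

definition b2 :: "('n::finite) cmat \<Rightarrow> 'n cmat \<Rightarrow> 'n cmat \<Rightarrow> complex" where
  "b2 z w v = trace (Vi z ** dV z w ** Vi z ** dV z v) + trace (Vi z ** (v ** cadj w + w ** cadj v))"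

lemma cadj_add: "cadj (A + B) = cadj A + cadj B" and cadj_minus: "cadj (- A) = - cadj A"
  and cadj_diff: "cadj (A - B) = cadj A - cadj B"
  by (simp_all add: linear_add[OF linear_cadj] linear_neg[OF linear_cadj] linear_diff[OF linear_cadj])

lemma cadj_dV: "cadj (dV z v) = dV z v"
  by (simp add: dV_def cadj_diff cadj_minus cadj_mult)

lemma trace_cadj: "trace (cadj A) = cnj (trace A)"
  by (simp add: trace_def cnj_sum)

lemma Im_trace_Vi_dV: "z \<in> Ub \<Longrightarrow> Im (trace (Vi z ** dV z v)) = 0"
proof -
  assume z: "z \<in> Ub"
  have "cnj (trace (Vi z ** dV z v)) = trace (dV z v ** Vi z)"
    by (simp add: trace_cadj[symmetric] cadj_mult cadj_Vi[OF z] cadj_dV)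
  also have "\<dots> = trace (Vi z ** dV z v)" by (rule trace_mul_sym)
  finally show ?thesis by (metis cnj.sel(2) neg_equal_zero)
qed

lemma has_derivative_bpot: assumes z: "z \<in> Ub" shows "(bpot has_derivative b1 z) (at z)"
proof -
  let ?D = "det (Vm z)"
  have "((\<lambda>z. det (Vm z)) has_derivative (\<lambda>v. ?D * trace (Vi z ** dV z v))) (at z)"
    using has_derivative_compose[OF has_derivative_Vm has_derivative_det[OF Ub_det(1)[OF z]]] by (simp add: Vi_def)
  then have "((\<lambda>z. Re (det (Vm z))) has_derivative (\<lambda>v. Re (?D * trace (Vi z ** dV z v)))) (at z)"
    by (rule has_derivative_Re)
  then have "((\<lambda>z. ln (Re (det (Vm z)))) has_derivative (\<lambda>v. Re (?D * trace (Vi z ** dV z v)) * inverse (Re ?D))) (at z)"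
    using z by (intro has_derivative_ln) (auto simp: Ub_def)
  then have "((\<lambda>z. complex_of_real (- ln (Re (det (Vm z))))) has_derivative
      (\<lambda>v. complex_of_real (- (Re (?D * trace (Vi z ** dV z v)) * inverse (Re ?D))))) (at z)"
    by (intro has_derivative_of_real has_derivative_minus)
  moreover have "complex_of_real (- (Re (?D * trace (Vi z ** dV z v)) * inverse (Re ?D))) = b1 z v" for v
  proof -
    have "Re (?D * trace (Vi z ** dV z v)) = Re ?D * Re (trace (Vi z ** dV z v))"
      by (simp add: Ub_det(2))
    moreover have "Re ?D \<noteq> 0" using z by (simp add: Ub_def)
    ultimately show ?thesis using Im_trace_Vi_dV[OF z, of v] by (simp add: b1_def complex_eq_iff power2_eq_square)
  qed
  ultimately show ?thesis by (simp add: bpot_def[abs_def] Vm_def[symmetric])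
qed

lemma C2_on_bpot: "C2_on (Ub :: ('n::finite) cmat set) bpot b1 b2"
  unfolding C2_on_def
proof (intro conjI ballI allI open_Ub has_derivative_bpot)
  fix z v :: "'n cmat" assume z: "z \<in> Ub"
  have dv: "((\<lambda>y. dV y v) has_derivative (\<lambda>w. - (v ** cadj w + 0 ** cadj z) - (z ** 0 + w ** cadj v))) (at z)"
    unfolding dV_def
    by (intro has_derivative_minus has_derivative_diff has_derivative_matmul has_derivative_cadj has_derivative_ident)
      (use has_derivative_const[of v "at z"] has_derivative_const[of "cadj v" "at z"] in auto)
  have "((\<lambda>y. - trace (Vi y ** dV y v)) has_derivative
    (\<lambda>w. - trace (Vi z ** (- (v ** cadj w + 0 ** cadj z) - (z ** 0 + w ** cadj v))
        + (- (Vi z ** dV z w ** Vi z)) ** dV z v))) (at z)"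
    by (intro has_derivative_minus has_derivative_trace has_derivative_matmul has_derivative_Vi z dv)
  moreover have "- trace (Vi z ** (- (v ** cadj w + 0 ** cadj z) - (z ** 0 + w ** cadj v))
        + (- (Vi z ** dV z w ** Vi z)) ** dV z v) = b2 z w v" for w
  proof -
    have m: "(- A) ** B = - (A ** B)" "A ** (- B) = - (A ** B)" "0 ** A = 0" "A ** 0 = 0" for A B :: "'n cmat"
      by (simp_all add: bounded_bilinear.minus_left[OF bounded_bilinear_matmul]
          bounded_bilinear.minus_right[OF bounded_bilinear_matmul]
          bounded_bilinear.zero_left[OF bounded_bilinear_matmul] bounded_bilinear.zero_right[OF bounded_bilinear_matmul])
    have tm: "trace (- A) = - trace A" "trace (0 :: 'n cmat) = 0" for A :: "'n cmat"
      by (simp_all add: trace_def sum_negf)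
    show ?thesis unfolding m trace_add trace_sub tm b2_def matmul_diff_left matmul_diff_right matrix_add_ldistrib by simp
  qed
  ultimately show "((\<lambda>y. b1 y v) has_derivative (\<lambda>w. b2 z w v)) (at z)" by (simp add: b1_def)
next
  fix v w :: "'n cmat"
  have Vc: "continuous_on Ub (Vi :: 'n cmat \<Rightarrow> _)"
    by (intro continuous_at_imp_continuous_on ballI has_derivative_continuous[OF has_derivative_Vi])
  have tc: "continuous_on S f \<Longrightarrow> continuous_on S (\<lambda>x. trace (f x :: 'n cmat))" for S f
    unfolding trace_def by (intro continuous_intros)
  show "continuous_on Ub (\<lambda>z. b2 z w v)"
    unfolding b2_def dV_def by (intro continuous_intros tc Vc)
qed

lemma csmul_matmul: "csmul c A ** B = csmul c (A ** B)" "A ** csmul c B = csmul c (A ** B)"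
  by (rule cmat_eqI, simp add: matmul_nth sum_distrib_left algebra_simps)+

lemma trace_csmul: "trace (csmul c A) = c * trace A"
  by (simp add: trace_def sum_distrib_left)

lemma cadj_csmul: "cadj (csmul c A) = csmul (cnj c) (cadj A)"
  by (rule cmat_eqI) simp

lemma matmul_add: "(A + B) ** (C::('n::finite) cmat) = A ** C + B ** C" "C ** (A + B) = C ** A + C ** B"
  by (simp_all add: bounded_bilinear.add_left[OF bounded_bilinear_matmul]
          bounded_bilinear.add_right[OF bounded_bilinear_matmul])

lemma matmul_minus: "(- A) ** (C::('n::finite) cmat) = - (A ** C)" "C ** (- A) = - (C ** A)"
  by (simp_all add: bounded_bilinear.minus_left[OF bounded_bilinear_matmul]
          bounded_bilinear.minus_right[OF bounded_bilinear_matmul])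

lemma trace_minus: "trace (- (A::('n::finite) cmat)) = - trace A"
  by (simp add: trace_def sum_negf)

text \<open>Of the six traces that make up \<open>b2\<close>, the Levi form keeps those that are
  linear in \<open>v\<close> and antilinear in \<open>w\<close>; the other types cancel.\<close>

lemma levi_b2:
  "levi (b2 z) v w = trace (Vi z ** (v ** cadj z) ** Vi z ** (z ** cadj w)) + trace (Vi z ** (v ** cadj w))"
proof -
  define S1 where "S1 v w = trace (Vi z ** (v ** cadj z) ** Vi z ** (w ** cadj z))" for v w
  define S2 where "S2 v w = trace (Vi z ** (v ** cadj z) ** Vi z ** (z ** cadj w))" for v w
  define S3 where "S3 v w = trace (Vi z ** (z ** cadj v) ** Vi z ** (w ** cadj z))" for v w
  define S4 where "S4 v w = trace (Vi z ** (z ** cadj v) ** Vi z ** (z ** cadj w))" for v w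
  define T1 where "T1 v w = trace (Vi z ** (w ** cadj v))" for v w
  define T2 where "T2 v w = trace (Vi z ** (v ** cadj w))" for v w
  have b: "b2 z v w = S1 v w + S2 v w + S3 v w + S4 v w + T1 v w + T2 v w" for v w
    by (simp add: b2_def dV_def S1_def S2_def S3_def S4_def T1_def T2_def matmul_minus matmul_add
      matmul_diff_left matmul_diff_right trace_add trace_sub trace_minus)
  have i: "S1 (csmul c v) w = c * S1 v w" "S1 v (csmul c w) = c * S1 v w"
    "S2 (csmul c v) w = c * S2 v w" "S2 v (csmul c w) = cnj c * S2 v w"
    "S3 (csmul c v) w = cnj c * S3 v w" "S3 v (csmul c w) = c * S3 v w"
    "S4 (csmul c v) w = cnj c * S4 v w" "S4 v (csmul c w) = cnj c * S4 v w"
    "T1 (csmul c v) w = cnj c * T1 v w" "T1 v (csmul c w) = c * T1 v w"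
    "T2 (csmul c v) w = c * T2 v w" "T2 v (csmul c w) = cnj c * T2 v w" for c v w
    by (simp_all add: S1_def S2_def S3_def S4_def T1_def T2_def csmul_matmul cadj_csmul trace_csmul)
  have "levi (b2 z) v w = S2 v w + T2 v w"
    unfolding levi_def b i by (simp add: algebra_simps add_divide_distrib diff_divide_distrib)
  then show ?thesis by (simp add: S2_def T2_def)
qed

text \<open>For symmetric \<open>z\<close> the transpose of \<open>Vi z\<close> equals
  \<open>mat 1 + cadj z ** Vi z ** z\<close>, which merges the two traces into the classical form of
  the Bergman metric.\<close>

lemma levi_b2_II:
  assumes z: "z \<in> II"
  shows "levi (b2 z) v w = trace (Vi z ** v ** transpose (Vi z) ** cadj w)"
proof -
  have zU: "z \<in> Ub" by (rule II_sub_Ub[OF z])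
  have sz: "transpose z = z" using z by (simp add: II_iff)
  have ct: "transpose (cadj z) = cadj z" by (rule cmat_eqI) (metis cadj_nth sz transpose_nth)
  have tV: "transpose (Vm z) = mat 1 - cadj z ** z"
  proof -
    have "transpose (z ** cadj z) = cadj z ** z" by (simp add: matrix_transpose_mul ct sz)
    then have "(z ** cadj z) $ j $ i = (cadj z ** z) $ i $ j" for i j by (metis transpose_nth)
    then show ?thesis by (intro cmat_eqI) (auto simp: Vm_def)
  qed
  have "transpose (Vi z) = mat 1 + cadj z ** Vi z ** z"
  proof (rule inverse_unique)
    show "transpose (Vi z) ** transpose (Vm z) = mat 1"
      using arg_cong[OF Vi_inverse(1)[OF zU], of transpose] by (simp add: matrix_transpose_mul)
    have "cadj z ** z ** cadj z ** Vi z ** z = cadj z ** ((z ** cadj z) ** Vi z) ** z"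
      by (simp add: matrix_mul_assoc)
    also have "(z ** cadj z) ** Vi z = Vi z - Vm z ** Vi z"
      by (simp add: Vm_def matmul_diff_left)
    also have "\<dots> = Vi z - mat 1" by (simp add: Vi_inverse[OF zU])
    finally have "cadj z ** z ** cadj z ** Vi z ** z = cadj z ** Vi z ** z - cadj z ** z"
      by (simp add: matmul_diff_left matmul_diff_right)
    then show "transpose (Vm z) ** (mat 1 + cadj z ** Vi z ** z) = mat 1"
      unfolding tV matmul_diff_left matmul_add by (simp add: matrix_mul_assoc)
  qed
  then have "trace (Vi z ** v ** transpose (Vi z) ** cadj w)
    = trace (Vi z ** v ** cadj w) + trace (Vi z ** v ** (cadj z ** Vi z ** z) ** cadj w)"
    by (simp add: matmul_add trace_add)
  then show ?thesis unfolding levi_b2 by (simp add: matrix_mul_assoc)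
qed

subsection \<open>The Laplace--Beltrami operator through the Levi form\<close>

lemma dpart_C2:
  assumes f: "C2_on U f f1 f2" and z: "z \<in> U"
  shows "dpart f v z = f1 z v" "dpart (\<lambda>y. f1 y v) w z = f2 z w v"
  using C2_on_line[OF f, of z 0] z
  by (auto simp: dpart_def intro!: vector_derivative_at)

lemma transpose_Esym [simp]: "transpose (Esym p) = Esym p" "transpose (csmul c (Esym p)) = csmul c (Esym p)"
  by (auto intro!: cmat_eqI simp: Esym_def insert_commute)

lemma transpose_line: "transpose z = z \<Longrightarrow> transpose v = v \<Longrightarrow> transpose (z + t *\<^sub>R v) = z + t *\<^sub>R (v::('n::finite) cmat)"
  by (metis (no_types, lifting) cmat_eqI transpose_nth vector_add_component vector_scaleR_component)

lemma dpart_cong_sym: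
  assumes "\<And>y. transpose y = y \<Longrightarrow> g y = f y" "transpose z = z" "transpose v = v"
  shows "dpart g v z = dpart f v z"
  using assms by (simp add: dpart_def transpose_line)

text \<open>The coordinate operators differentiate along symmetric directions only. Agreement of
  \<open>g\<close> with the smooth extension \<open>f\<close> on symmetric matrices therefore
  suffices.\<close>

lemma dz_dzb:
  assumes f: "C2_on U f f1 f2" and z: "z \<in> U" "transpose z = z"
    and g: "\<And>y. transpose y = y \<Longrightarrow> g y = f y"
  shows "dz p (dzb q g) z = levi (f2 z) (Esym p) (Esym q)"
proof -
  have dzb: "dzb q g y = (f1 y (Esym q) + \<i> * f1 y (csmul \<i> (Esym q))) / 2" if "y \<in> U" "transpose y = y" for y
    using that dpart_cong_sym[where g=g and f=f, OF g] by (simp add: dzb_def dpart_C2(1)[OF f])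
  have "dpart (dzb q g) v z = (f2 z v (Esym q) + \<i> * f2 z v (csmul \<i> (Esym q))) / 2" if v: "transpose v = v" for v
    unfolding dpart_def
  proof (rule vector_derivative_at)
    let ?T = "{t. z + t *\<^sub>R v \<in> U}"
    have oT: "open ?T"
      using C2_onD(1)[OF f] continuous_open_vimage[of U "\<lambda>t. z + t *\<^sub>R v"]
      by (simp add: vimage_def continuous_intros)
    have "((\<lambda>t. f1 (z + t *\<^sub>R v) w) has_vector_derivative f2 z v w) (at 0)" for w
      using C2_on_line(2)[OF f, of z 0 v w] z by simp
    then have D: "((\<lambda>t. (f1 (z + t *\<^sub>R v) (Esym q) + \<i> * f1 (z + t *\<^sub>R v) (csmul \<i> (Esym q))) / 2)
      has_vector_derivative (f2 z v (Esym q) + \<i> * f2 z v (csmul \<i> (Esym q))) / 2) (at 0)"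
      by (intro has_vector_derivative_divide has_vector_derivative_add has_vector_derivative_mult_right)
    show "((\<lambda>t. dzb q g (z + t *\<^sub>R v)) has_vector_derivative
      (f2 z v (Esym q) + \<i> * f2 z v (csmul \<i> (Esym q))) / 2) (at 0)"
      by (rule has_vector_derivative_transform_within_open[OF D oT])
        (use z v in \<open>auto simp: dzb transpose_line\<close>)
  qed
  then show ?thesis unfolding dz_def levi_def by (simp add: algebra_simps add_divide_distrib diff_divide_distrib)
qed

text \<open>An off-diagonal coordinate corresponds to two matrix entries; the weight corrects the double count.\<close>

definition index_pairs :: "'n set \<Rightarrow> ('n \<times> 'n) set" where "index_pairs p = {(j, a). {j, a} = p}"

definition pair_weight :: "('n::finite) set \<Rightarrow> complex" where "pair_weight p = 1 / of_nat (card (index_pairs p))"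

text \<open>The inverse Bergman metric: \<open>Vm z\<close> takes the place of its inverse in
  \<open>levi_b2_II\<close>, and entries are averaged over the ordered pairs that name a
  coordinate.\<close>

definition Gm :: "('n::finite) cmat \<Rightarrow> 'n set \<Rightarrow> 'n set \<Rightarrow> complex" where
  "Gm z p q = pair_weight p * pair_weight q * (\<Sum>x\<in>index_pairs p. \<Sum>y\<in>index_pairs q. Vm z $ fst x $ fst y * Vm z $ snd x $ snd y)"

lemma card_index_pairs: "p \<in> idxP \<Longrightarrow> card (index_pairs (p::('n::finite) set)) \<noteq> 0"
  by (auto simp: idxP_def index_pairs_def card_eq_0_iff)

lemma sum_index_pairs: "(\<Sum>p\<in>idxP. \<Sum>x\<in>index_pairs p. h x) = (\<Sum>x\<in>(UNIV :: ('n::finite \<times> 'n) set). h x :: complex)"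
proof -
  have "(\<Sum>p\<in>idxP. sum h {x \<in> UNIV. {fst x, snd x} = p}) = sum h (UNIV :: ('n \<times> 'n) set)"
    by (rule sum.group) (auto simp: idxP_def)
  moreover have "index_pairs p = {x \<in> UNIV. {fst x, snd x} = p}" for p :: "'n set"
    by (auto simp: index_pairs_def)
  ultimately show ?thesis by simp
qed

lemma pr_sum_const: "p \<in> idxP \<Longrightarrow> pair_weight p * (\<Sum>x\<in>index_pairs p. c) = c"
  using card_index_pairs[of p] by (simp add: pair_weight_def)

lemma trace_Esym:
  assumes "transpose A = A" "x \<in> index_pairs q" "q \<in> idxP"
  shows "pair_weight q * trace (A ** Esym q) = A $ fst x $ snd x"
proof -
  have sA: "A $ j $ i = A $ i $ j" for i j using assms(1) by (metis transpose_nth)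
  have "trace (A ** Esym q) = (\<Sum>i\<in>UNIV. \<Sum>k\<in>UNIV. if {k, i} = q then A $ i $ k else 0)"
    unfolding trace_def matmul_nth Esym_def by (intro sum.cong) auto
  also have "\<dots> = (\<Sum>y\<in>UNIV. if {snd y, fst y} = q then A $ fst y $ snd y else 0)"
    by (simp add: sum.cartesian_product UNIV_Times_UNIV[symmetric] case_prod_beta del: UNIV_Times_UNIV)
  also have "\<dots> = (\<Sum>y\<in>index_pairs q. A $ fst y $ snd y)"
    by (rule sum.mono_neutral_cong_right) (auto simp: index_pairs_def insert_commute)
  also have "\<dots> = (\<Sum>y\<in>index_pairs q. A $ fst x $ snd x)"
    using assms(2) sA by (intro sum.cong refl) (auto simp: index_pairs_def doubleton_eq_iff)
  finally show ?thesis using pr_sum_const[OF assms(3)] by simp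
qed

lemma bmetric_eq:
  assumes z: "z \<in> II" shows "bmetric p q z = levi (b2 z) (Esym p) (Esym q)"
  unfolding bmetric_def
  by (rule dz_dzb[OF C2_on_bpot]) (use z II_sub_Ub in \<open>auto simp: II_iff\<close>)

lemma cadj_Esym [simp]: "cadj (Esym p) = Esym p"
  by (rule cmat_eqI) (auto simp: Esym_def insert_commute)

text \<open>Conjugating \<open>Vi z ** Esym k ** transpose (Vi z)\<close> by \<open>Vm z\<close>
  returns \<open>Esym k\<close>. Since \<open>invariant_harmonic\<close> quantifies over all
  inverses of the metric, exhibiting one is what makes its equation available.\<close>

lemma inv_metric_Gm:
  assumes z: "z \<in> II" shows "inv_metric (Gm z) z"
  unfolding inv_metric_def
proof (intro ballI)
  fix i k :: "'a set" assume ik: "i \<in> idxP" "k \<in> idxP"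
  have zU: "z \<in> Ub" by (rule II_sub_Ub[OF z])
  define A where "A = Vi z ** Esym k ** transpose (Vi z)"
  have sA: "transpose A = A" by (simp add: A_def matrix_transpose_mul matrix_mul_assoc)
  have tVi: "transpose (Vi z) ** transpose (Vm z) = mat 1"
    using arg_cong[OF Vi_inverse(1)[OF zU], of transpose] by (simp add: matrix_transpose_mul)
  have "Vm z ** A ** transpose (Vm z) = (Vm z ** Vi z) ** Esym k ** (transpose (Vi z) ** transpose (Vm z))"
    by (simp add: A_def matrix_mul_assoc)
  then have VAV: "Vm z ** A ** transpose (Vm z) = Esym k" by (simp add: tVi Vi_inverse[OF zU])
  have "(\<Sum>q\<in>idxP. Gm z i q * bmetric k q z)
    = (\<Sum>q\<in>idxP. pair_weight i * (\<Sum>x\<in>index_pairs i. \<Sum>y\<in>index_pairs q. Vm z $ fst x $ fst y * Vm z $ snd x $ snd y * (pair_weight q * trace (A ** Esym q))))"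
    unfolding bmetric_eq[OF z] levi_b2_II[OF z] Gm_def A_def[symmetric] cadj_Esym
    by (simp add: sum_distrib_left sum_distrib_right mult_ac)
  also have "\<dots> = (\<Sum>q\<in>idxP. pair_weight i * (\<Sum>x\<in>index_pairs i. \<Sum>y\<in>index_pairs q. Vm z $ fst x $ fst y * Vm z $ snd x $ snd y * A $ fst y $ snd y))"
    by (intro sum.cong refl arg_cong2[of _ _ _ _ "(*)"] trace_Esym[OF sA])
  also have "\<dots> = pair_weight i * (\<Sum>x\<in>index_pairs i. \<Sum>q\<in>idxP. \<Sum>y\<in>index_pairs q. Vm z $ fst x $ fst y * Vm z $ snd x $ snd y * A $ fst y $ snd y)"
    unfolding sum_distrib_left[symmetric] by (subst sum.swap) rule
  also have "\<dots> = pair_weight i * (\<Sum>x\<in>index_pairs i. Esym k $ fst x $ snd x)"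
  proof -
    have "(\<Sum>y\<in>UNIV. Vm z $ j $ fst y * Vm z $ a $ snd y * A $ fst y $ snd y) = Esym k $ j $ a" for j a
    proof -
      have "(\<Sum>y\<in>UNIV. Vm z $ j $ fst y * Vm z $ a $ snd y * A $ fst y $ snd y)
        = (\<Sum>l\<in>UNIV. \<Sum>m\<in>UNIV. Vm z $ j $ l * Vm z $ a $ m * A $ l $ m)"
        by (simp add: sum.cartesian_product UNIV_Times_UNIV[symmetric] case_prod_beta del: UNIV_Times_UNIV)
      also have "\<dots> = (\<Sum>m\<in>UNIV. \<Sum>l\<in>UNIV. Vm z $ j $ l * Vm z $ a $ m * A $ l $ m)" by (rule sum.swap)
      also have "\<dots> = (Vm z ** A ** transpose (Vm z)) $ j $ a"
        by (simp add: matmul_nth sum_distrib_left mult_ac)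
      finally show ?thesis unfolding VAV .
    qed
    then show ?thesis by (simp add: sum_index_pairs)
  qed
  also have "\<dots> = pair_weight i * (\<Sum>x\<in>index_pairs i. if i = k then 1 else 0)"
    by (intro arg_cong2[of _ _ _ _ "(*)"] sum.cong refl) (auto simp: Esym_def index_pairs_def)
  also have "\<dots> = (if i = k then 1 else 0)" by (rule pr_sum_const[OF ik(1)])
  finally show "(\<Sum>q\<in>idxP. Gm z i q * bmetric k q z) = (if i = k then 1 else 0)" .
qed

text \<open>The vectors \<open>p a\<close> are the columns of a factor P with \<open>Vm z\<close> =
  P \<open>cadj P\<close>. In such a frame contraction with the inverse metric becomes an unweighted
  sum.\<close>

definition Vm_frame :: "('n \<Rightarrow> complex^'n) \<Rightarrow> ('n::finite) cmat \<Rightarrow> bool" where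
  "Vm_frame p z \<longleftrightarrow> (\<forall>i j. Vm z $ i $ j = (\<Sum>a\<in>UNIV. p a $ i * cnj (p a $ j)))"

lemma Tm_expand: "Tm x y = (\<Sum>e\<in>UNIV. csmul (x $ fst e * y $ snd e * (2 * pair_weight {fst e, snd e})) (Esym {fst e, snd e}))"
proof (rule cmat_eqI)
  fix r s :: 'a
  have cpv: "pair_weight {j, a} = (if j = a then 1 else 1/2)" for j a :: 'a
  proof -
    have "index_pairs {j, a} = {(j, a), (a, j)}" by (auto simp: index_pairs_def doubleton_eq_iff)
    then show ?thesis by (simp add: pair_weight_def)
  qed
  have cp1: "pair_weight {j} = 1" for j :: 'a using cpv[of j j] by simp
  have "(\<Sum>e\<in>UNIV. csmul (x $ fst e * y $ snd e * (2 * pair_weight {fst e, snd e})) (Esym {fst e, snd e})) $ r $ s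
    = (\<Sum>e\<in>UNIV. if {r, s} = {fst e, snd e} then x $ fst e * y $ snd e * (2 * pair_weight {fst e, snd e}) else 0)"
    unfolding sum_component by (intro sum.cong refl) (auto simp: Esym_def)
  also have "\<dots> = (\<Sum>e\<in>{(r, s), (s, r)}. x $ fst e * y $ snd e * (2 * pair_weight {fst e, snd e}))"
    by (rule sum.mono_neutral_cong_right) (auto simp: doubleton_eq_iff)
  also have "\<dots> = Tm x y $ r $ s"
    by (cases "r = s") (auto simp: cpv cp1 Tm_nth insert_commute)
  finally show "Tm x y $ r $ s = (\<Sum>e\<in>UNIV. csmul (x $ fst e * y $ snd e * (2 * pair_weight {fst e, snd e})) (Esym {fst e, snd e})) $ r $ s" by simp
qed

lemma sum_swap4:
  "(\<Sum>a\<in>A. \<Sum>b\<in>B. \<Sum>c\<in>C. \<Sum>d\<in>D. h a b c d) = (\<Sum>c\<in>C. \<Sum>d\<in>D. \<Sum>a\<in>A. \<Sum>b\<in>B. (h a b c d :: complex))"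
proof -
  have "(\<Sum>a\<in>A. \<Sum>b\<in>B. \<Sum>c\<in>C. \<Sum>d\<in>D. h a b c d) = (\<Sum>a\<in>A. \<Sum>c\<in>C. \<Sum>d\<in>D. \<Sum>b\<in>B. h a b c d)"
    by (intro sum.cong refl, subst sum.swap, intro sum.cong refl sum.swap)
  also have "\<dots> = (\<Sum>c\<in>C. \<Sum>d\<in>D. \<Sum>a\<in>A. \<Sum>b\<in>B. h a b c d)"
    by (subst sum.swap, intro sum.cong refl sum.swap)
  finally show ?thesis .
qed

text \<open>Expanding both arguments in coordinates, the sums over \<open>a\<close> and
  \<open>b\<close> each reproduce an entry of \<open>Vm z\<close>, and their products are the
  entries of the inverse metric. Each \<open>Tm\<close> carries a factor 2, whence the 4.\<close>

lemma levi_sum_Gm: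
  assumes B: "bilinear B" and p: "Vm_frame p z"
  shows "(\<Sum>a\<in>UNIV. \<Sum>b\<in>UNIV. levi B (Tm (p a) (p b)) (Tm (p a) (p b)))
    = 4 * (\<Sum>i\<in>idxP. \<Sum>j\<in>idxP. Gm z i j * levi B (Esym i) (Esym j))"
proof -
  define L where "L e e' = 4 * (pair_weight {fst e, snd e} * pair_weight {fst e', snd e'} * levi B (Esym {fst e, snd e}) (Esym {fst e', snd e'}))" for e e' :: "'a \<times> 'a"
  have sym_coord: "cnj (pair_weight q) = pair_weight q" for q :: "'a set" by (simp add: pair_weight_def)
  have "levi B (Tm x y) (Tm x y) = (\<Sum>e\<in>UNIV. \<Sum>e'\<in>UNIV. (x $ fst e * cnj (x $ fst e')) * (y $ snd e * cnj (y $ snd e')) * L e e')" for x y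
    unfolding Tm_expand[of x y] unfolding levi_sum_left[OF B] unfolding levi_sum_right[OF B]
    by (intro sum.cong refl) (simp add: sym_coord levi_csmul_left[OF B] levi_csmul_right[OF B] L_def)
  then have "(\<Sum>a\<in>UNIV. \<Sum>b\<in>UNIV. levi B (Tm (p a) (p b)) (Tm (p a) (p b)))
    = (\<Sum>a\<in>UNIV. \<Sum>b\<in>UNIV. \<Sum>e\<in>UNIV. \<Sum>e'\<in>UNIV. (p a $ fst e * cnj (p a $ fst e')) * (p b $ snd e * cnj (p b $ snd e')) * L e e')"
    by simp
  also have "\<dots> = (\<Sum>e\<in>UNIV. \<Sum>e'\<in>UNIV. (\<Sum>a\<in>UNIV. p a $ fst e * cnj (p a $ fst e')) * (\<Sum>b\<in>UNIV. p b $ snd e * cnj (p b $ snd e')) * L e e')"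
    unfolding sum_product unfolding sum_distrib_right by (rule sum_swap4)
  also have "\<dots> = (\<Sum>e\<in>UNIV. \<Sum>e'\<in>UNIV. Vm z $ fst e $ fst e' * Vm z $ snd e $ snd e' * L e e')"
    using p by (simp add: Vm_frame_def)
  also have "\<dots> = (\<Sum>i\<in>idxP. \<Sum>e\<in>index_pairs i. \<Sum>j\<in>idxP. \<Sum>e'\<in>index_pairs j. Vm z $ fst e $ fst e' * Vm z $ snd e $ snd e' * L e e')"
    by (simp add: sum_index_pairs)
  also have "\<dots> = (\<Sum>i\<in>idxP. \<Sum>e\<in>index_pairs i. \<Sum>j\<in>idxP. \<Sum>e'\<in>index_pairs j. 4 * (pair_weight i * pair_weight j * (Vm z $ fst e $ fst e' * Vm z $ snd e $ snd e') * levi B (Esym i) (Esym j)))"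
    by (intro sum.cong refl) (auto simp: index_pairs_def L_def)
  also have "\<dots> = (\<Sum>i\<in>idxP. \<Sum>j\<in>idxP. \<Sum>e\<in>index_pairs i. \<Sum>e'\<in>index_pairs j. 4 * (pair_weight i * pair_weight j * (Vm z $ fst e $ fst e' * Vm z $ snd e $ snd e') * levi B (Esym i) (Esym j)))"
    by (intro sum.cong refl sum.swap)
  also have "\<dots> = 4 * (\<Sum>i\<in>idxP. \<Sum>j\<in>idxP. Gm z i j * levi B (Esym i) (Esym j))"
    unfolding Gm_def sum_distrib_left sum_distrib_right by (simp add: mult_ac)
  finally show ?thesis .
qed

lemma levi_sum_LB:
  assumes f: "C2_on U f f1 f2" and z: "z \<in> U" "z \<in> II" and p: "Vm_frame p z"
    and g: "\<And>y. transpose y = y \<Longrightarrow> g y = f y"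
  shows "(\<Sum>a\<in>UNIV. \<Sum>b\<in>UNIV. levi (f2 z) (Tm (p a) (p b)) (Tm (p a) (p b))) = 4 * LB (Gm z) g z"
proof -
  have tz: "transpose z = z" using z by (simp add: II_iff)
  have eq: "dz i (dzb j g) z = levi (f2 z) (Esym i) (Esym j)" for i j
    by (rule dz_dzb[OF f z(1) tz g])
  show ?thesis
    unfolding LB_def eq by (rule levi_sum_Gm[OF C2_on_bilinear[OF f z(1)] p])
qed

text \<open>The metric contracted with its own inverse counts the coordinates. The potential thus
  has constant Laplacian, which makes it a harmless penalty in the maximum principle.\<close>

lemma levi_sum_bpot:
  fixes z :: "('n::finite) cmat"
  assumes z: "z \<in> II" and p: "Vm_frame p z"
  shows "(\<Sum>a\<in>UNIV. \<Sum>b\<in>UNIV. levi (b2 z) (Tm (p a) (p b)) (Tm (p a) (p b)))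
    = 4 * of_nat (card (idxP :: 'n set set))"
proof -
  have "bilinear (b2 z)" using C2_on_bilinear[OF C2_on_bpot II_sub_Ub[OF z]] .
  moreover have "(\<Sum>i\<in>idxP. \<Sum>j\<in>idxP. Gm z i j * levi (b2 z) (Esym i) (Esym j)) = (\<Sum>i\<in>(idxP :: 'n set set). 1)"
    unfolding bmetric_eq[OF z, symmetric]
    by (intro sum.cong) (use inv_metric_Gm[OF z] in \<open>auto simp: inv_metric_def\<close>)
  ultimately show ?thesis using levi_sum_Gm[OF _ p] by simp
qed

lemma Vm_frame_ex: assumes "z \<in> II" obtains p where "Vm_frame p z"
proof -
  have "psd (Vm z)" using assms hpos_psd by (auto simp: II_iff)
  from psd_factor_aux[OF refl this] have "\<exists>p. Vm_frame p z" unfolding Vm_frame_def by blast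
  then show ?thesis using that by blast
qed

subsection \<open>Functions harmonic on the domain and continuous on its closure\<close>

text \<open>Up to a factor 4, this is the Laplace--Beltrami operator at \<open>z\<close> when \<open>p\<close> is a frame of \<open>Vm z\<close>.\<close>

definition lapl :: "(('n::finite) cmat \<Rightarrow> 'n cmat \<Rightarrow> complex) \<Rightarrow> ('n \<Rightarrow> complex^'n) \<Rightarrow> complex" where
  "lapl B p = (\<Sum>a\<in>UNIV. \<Sum>b\<in>UNIV. levi B (Tm (p a) (p b)) (Tm (p a) (p b)))"

text \<open>Differentiation takes place for \<open>f\<close> on the open set \<open>Om\<close>;
  \<open>h\<close> carries the boundary values. The two are required to agree on \<open>II\<close>
  only.\<close>

definition harm :: "(('n::finite) cmat \<Rightarrow> complex) \<Rightarrow> ('n cmat \<Rightarrow> 'n cmat \<Rightarrow> complex) \<Rightarrow>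
    ('n cmat \<Rightarrow> 'n cmat \<Rightarrow> 'n cmat \<Rightarrow> complex) \<Rightarrow> ('n cmat \<Rightarrow> complex) \<Rightarrow> bool" where
  "harm f f1 f2 h \<longleftrightarrow> C2_on Om f f1 f2 \<and> (\<forall>z\<in>II. \<forall>p. Vm_frame p z \<longrightarrow> lapl (f2 z) p = 0) \<and>
     continuous_on (closure II) h \<and> (\<forall>z\<in>II. h z = f z)"

lemma harmD:
  assumes "harm f f1 f2 h"
  shows "C2_on Om f f1 f2" "z \<in> II \<Longrightarrow> Vm_frame p z \<Longrightarrow> lapl (f2 z) p = 0"
    "continuous_on (closure II) h" "z \<in> II \<Longrightarrow> h z = f z"
  using assms by (auto simp: harm_def)

text \<open>Ordered pairs serve as indices, so each off-diagonal direction occurs twice; the factor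
  1/2 in \<open>sym_coord\<close> compensates.\<close>

definition sym_dir :: "('n \<times> 'n) \<times> bool \<Rightarrow> ('n::finite) cmat" where
  "sym_dir i = (if snd i then Esym {fst (fst i), snd (fst i)} else csmul \<i> (Esym {fst (fst i), snd (fst i)}))"

definition sym_coord :: "('n \<times> 'n) \<times> bool \<Rightarrow> ('n::finite) cmat \<Rightarrow> real" where
  "sym_coord i v = (if fst (fst i) = snd (fst i) then 1 else 1/2) *
     (if snd i then Re (v $ fst (fst i) $ snd (fst i)) else Im (v $ fst (fst i) $ snd (fst i)))"

lemma sym_dir_Dirs: "sym_dir i \<in> Dirs"
  by (auto simp: sym_dir_def Dirs_def idxP_def)

lemma transpose_sym_dir: "transpose (sym_dir i) = sym_dir i"
  by (simp add: sym_dir_def)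

lemma sym_dir_expand:
  assumes "transpose v = v" shows "(\<Sum>i\<in>UNIV. sym_coord i v *\<^sub>R sym_dir i) = (v :: ('n::finite) cmat)"
proof (rule cmat_eqI)
  fix r s :: 'n
  have sv: "v $ s $ r = v $ r $ s" using assms by (metis transpose_nth)
  let ?k = "\<lambda>e::'n \<times> 'n. (if fst e = snd e then 1 else 1/2) * v $ fst e $ snd e"
  have "(\<Sum>i\<in>UNIV. sym_coord i v *\<^sub>R sym_dir i) $ r $ s = (\<Sum>i\<in>UNIV. sym_coord i v *\<^sub>R (sym_dir i $ r $ s))"
    by (simp add: sum_component)
  also have "\<dots> = (\<Sum>e\<in>UNIV. \<Sum>b\<in>UNIV. sym_coord (e, b) v *\<^sub>R (sym_dir (e, b) $ r $ s))"
    by (simp add: sum.cartesian_product UNIV_Times_UNIV[symmetric] case_prod_beta del: UNIV_Times_UNIV)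
  also have "\<dots> = (\<Sum>e\<in>UNIV. if {r, s} = {fst e, snd e} then ?k e else 0)"
    by (intro sum.cong refl)
      (auto simp: UNIV_bool sym_coord_def sym_dir_def Esym_def scaleR_conv_of_real[where 'a=complex] complex_eq_iff)
  also have "\<dots> = (\<Sum>e\<in>{(r, s), (s, r)}. ?k e)"
    by (rule sum.mono_neutral_cong_right) (auto simp: doubleton_eq_iff)
  also have "\<dots> = v $ r $ s" using sv by (cases "r = s") auto
  finally show "(\<Sum>i\<in>UNIV. sym_coord i v *\<^sub>R sym_dir i) $ r $ s = v $ r $ s" .
qed

lemma norm_cmat_nth: "cmod ((v :: ('n::finite) cmat) $ i $ j) \<le> norm v"
  using Finite_Cartesian_Product.norm_nth_le[of v i] Finite_Cartesian_Product.norm_nth_le[of "v $ i" j] by simp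

lemma sym_coord_bound: "\<bar>sym_coord i v\<bar> \<le> norm v"
proof -
  have "\<bar>sym_coord i v\<bar> \<le> cmod (v $ fst (fst i) $ snd (fst i))"
    using abs_Re_le_cmod[of "v $ fst (fst i) $ snd (fst i)"] abs_Im_le_cmod[of "v $ fst (fst i) $ snd (fst i)"]
    by (auto simp: sym_coord_def abs_mult)
  then show ?thesis using norm_cmat_nth order_trans by blast
qed

lemma linear_sym_coord: "linear (sym_coord i)"
  by (rule linearI) (auto simp: sym_coord_def algebra_simps)

lemma norm_symm_le: "norm (symm v) \<le> norm (v :: ('n::finite) cmat)"
proof -
  have "(norm (transpose v))\<^sup>2 = (norm v)\<^sup>2" unfolding norm_cmat_sq by (subst sum.swap) simp
  then have "norm (transpose v) = norm v" by (simp add: power2_eq_iff_nonneg)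
  then show ?thesis using norm_triangle_ineq[of v "transpose v"] by (simp add: symm_def)
qed

text \<open>Regularity is given only as continuity of the partial derivatives along
  \<open>Dirs\<close>. The coordinates of \<open>symm v\<close> are bounded by the norm of
  \<open>v\<close>, so the increment estimate becomes Frechet differentiability of the
  extension.\<close>

lemma sym_has_derivative:
  fixes f :: "('n::finite) cmat \<Rightarrow> complex"
  assumes d: "\<And>d y. d \<in> Dirs \<Longrightarrow> y \<in> II \<Longrightarrow> has_dpart f d y"
    and c: "\<And>d. d \<in> Dirs \<Longrightarrow> continuous_on II (dpart f d)" and z: "z \<in> Om"
  shows "((\<lambda>z. f (symm z)) has_derivative (\<lambda>v. \<Sum>i\<in>UNIV. sym_coord i (symm v) *\<^sub>R dpart f (sym_dir i) (symm z))) (at z)"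
  unfolding has_derivative_at_alt
proof (intro conjI allI impI)
  let ?D = "\<lambda>v. \<Sum>i\<in>UNIV. sym_coord i (symm v) *\<^sub>R dpart f (sym_dir i) (symm z)"
  have "linear ?D"
    by (rule linearI)
      (simp_all add: linear_add[OF linear_symm] linear_add[OF linear_sym_coord] linear_scale[OF linear_symm]
        linear_scale[OF linear_sym_coord] scaleR_add_left sum.distrib scaleR_sum_right)
  then show "bounded_linear ?D" by (simp add: linear_conv_bounded_linear)
  have sz: "symm z \<in> II" using z by (simp add: Om_def)
  then have "symm z \<in> Om" by (rule II_sub_Om)
  then obtain \<rho> where \<rho>: "\<rho> > 0" "\<And>y. norm (y - symm z) < \<rho> \<Longrightarrow> y \<in> Om"
    using open_Om unfolding open_dist dist_norm by blast
  \<comment> \<open>Coordinates below \<open>\<rho> / S\<close> move the point by less than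
    \<open>\<rho>\<close>; symmetry of the directions then keeps it in \<open>II\<close>.\<close>
  define S where "S = (\<Sum>i\<in>(UNIV :: (('n \<times> 'n) \<times> bool) set). norm (sym_dir i :: 'n cmat)) + 1"
  have S: "S > 0" by (simp add: S_def add_nonneg_pos sum_nonneg)
  have inII: "symm z + (\<Sum>i\<in>UNIV. x i *\<^sub>R sym_dir i) \<in> II" if x: "\<And>i. i \<in> UNIV \<Longrightarrow> \<bar>x i\<bar> < \<rho> / S" for x
  proof -
    have "norm (\<Sum>i\<in>UNIV. x i *\<^sub>R (sym_dir i :: 'n cmat)) \<le> (\<Sum>i\<in>(UNIV :: (('n \<times> 'n) \<times> bool) set). \<rho> / S * norm (sym_dir i :: 'n cmat))"
      by (intro sum_norm_le) (simp only: norm_scaleR, intro mult_right_mono less_imp_le[OF x] norm_ge_zero UNIV_I)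
    also have "\<dots> = \<rho> / S * (S - 1)" by (simp add: S_def sum_distrib_left)
    also have "\<dots> < \<rho>" using S \<rho>(1) by (simp add: field_simps)
    finally have "symm z + (\<Sum>i\<in>UNIV. x i *\<^sub>R sym_dir i) \<in> Om" by (intro \<rho>(2)) simp
    moreover have "transpose (\<Sum>i\<in>UNIV. x i *\<^sub>R (sym_dir i :: 'n cmat)) = (\<Sum>i\<in>UNIV. x i *\<^sub>R sym_dir i)"
    proof (rule cmat_eqI)
      fix r s :: 'n
      have "sym_dir i $ s $ r = (sym_dir i :: 'n cmat) $ r $ s" for i by (metis transpose_sym_dir transpose_nth)
      then show "transpose (\<Sum>i\<in>UNIV. x i *\<^sub>R (sym_dir i :: 'n cmat)) $ r $ s = (\<Sum>i\<in>UNIV. x i *\<^sub>R sym_dir i) $ r $ s"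
        by (simp add: sum_component)
    qed
    then have "transpose (symm z + (\<Sum>i\<in>UNIV. x i *\<^sub>R sym_dir i)) = symm z + (\<Sum>i\<in>UNIV. x i *\<^sub>R sym_dir i)"
      using transpose_line[of "symm z" "\<Sum>i\<in>UNIV. x i *\<^sub>R sym_dir i" 1] by simp
    ultimately show ?thesis by (simp add: Om_def symm_id)
  qed
  have vd: "((\<lambda>t. f (y + t *\<^sub>R sym_dir i)) has_vector_derivative dpart f (sym_dir i) y) (at 0)" if "y \<in> II" for y i
    using d[OF sym_dir_Dirs that] unfolding has_dpart_def dpart_def by (simp add: vector_derivative_works)
  fix e :: real assume e: "e > 0"
  define N where "N = real (card (UNIV :: (('n \<times> 'n) \<times> bool) set))"
  have N: "N > 0" by (simp add: N_def card_gt_0_iff)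
  have e': "e / N > 0" using e N by simp
  have "\<exists>\<delta>>0. \<forall>x. (\<forall>i\<in>(UNIV :: (('n \<times> 'n) \<times> bool) set). \<bar>x i\<bar> < \<delta>) \<longrightarrow>
    cmod (f (symm z + (\<Sum>i\<in>UNIV. x i *\<^sub>R sym_dir i)) - f (symm z) - (\<Sum>i\<in>UNIV. x i *\<^sub>R dpart f (sym_dir i) (symm z)))
      \<le> e / N * (\<Sum>i\<in>UNIV. \<bar>x i\<bar>)"
    by (rule partials_increment[where r="\<rho> / S", OF finite _ inII vd c[OF sym_dir_Dirs] e']) (use \<rho>(1) S in auto)
  then obtain \<delta> where \<delta>: "\<delta> > 0" "\<And>x :: ('n \<times> 'n) \<times> bool \<Rightarrow> real. (\<And>i. \<bar>x i\<bar> < \<delta>) \<Longrightarrow>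
    cmod (f (symm z + (\<Sum>i\<in>UNIV. x i *\<^sub>R sym_dir i)) - f (symm z) - (\<Sum>i\<in>UNIV. x i *\<^sub>R dpart f (sym_dir i) (symm z)))
      \<le> e / N * (\<Sum>i\<in>UNIV. \<bar>x i\<bar>)" by auto
  have "cmod (f (symm y) - f (symm z) - ?D (y - z)) \<le> e * norm (y - z)" if y: "norm (y - z) < \<delta>" for y
  proof -
    let ?x = "\<lambda>i. sym_coord i (symm (y - z))"
    have b: "\<bar>?x i\<bar> \<le> norm (y - z)" for i using sym_coord_bound norm_symm_le order_trans by blast
    have eq: "symm z + (\<Sum>i\<in>UNIV. ?x i *\<^sub>R sym_dir i) = symm y"
    proof -
      have "(\<Sum>i\<in>UNIV. ?x i *\<^sub>R sym_dir i) = symm (y - z)" by (rule sym_dir_expand) simp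
      then show ?thesis by (simp add: linear_diff[OF linear_symm])
    qed
    have bx: "\<bar>?x i\<bar> < \<delta>" for i using b[of i] y by linarith
    have "cmod (f (symm y) - f (symm z) - ?D (y - z)) \<le> e / N * (\<Sum>i\<in>(UNIV :: (('n \<times> 'n) \<times> bool) set). \<bar>?x i\<bar>)"
      using \<delta>(2)[of ?x, OF bx] unfolding eq .
    also have "\<dots> \<le> e / N * (\<Sum>i\<in>(UNIV :: (('n \<times> 'n) \<times> bool) set). norm (y - z))"
      using e' b by (intro mult_left_mono sum_mono) auto
    also have "\<dots> = e * norm (y - z)" using N by (simp add: N_def)
    finally show ?thesis .
  qed
  then show "\<exists>d>0. \<forall>y. norm (y - z) < d \<longrightarrow> cmod (f (symm y) - f (symm z) - ?D (y - z)) \<le> e * norm (y - z)"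
    using \<delta>(1) by blast
qed

lemma C_on_2_C2:
  fixes u :: "('n::finite) cmat \<Rightarrow> complex"
  assumes "C_on 2 II u"
  shows "\<exists>f1 f2. C2_on Om (\<lambda>z. u (symm z)) f1 f2"
proof -
  have c: "continuous_on II (iderivs vs u)" if "set vs \<subseteq> Dirs" "length vs \<le> 2" for vs
    using assms that unfolding C_on_def by blast
  have d: "has_dpart (iderivs vs u) v z" if "set vs \<subseteq> Dirs" "length vs < 2" "z \<in> II" "v \<in> Dirs" for vs z v
    using assms that unfolding C_on_def by (meson less_imp_le)
  define f1 where "f1 z v = (\<Sum>i\<in>UNIV. sym_coord i (symm v) *\<^sub>R iderivs [sym_dir i] u (symm z))" for z v
  define f2 where "f2 z w v = (\<Sum>i\<in>UNIV. sym_coord i (symm v) *\<^sub>R (\<Sum>j\<in>UNIV. sym_coord j (symm w) *\<^sub>R iderivs [sym_dir j, sym_dir i] u (symm z)))" for z w v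
  have D1: "((\<lambda>z. u (symm z)) has_derivative f1 z) (at z)" if "z \<in> Om" for z
    unfolding f1_def[abs_def] iderivs.simps
    using sym_has_derivative[of "iderivs [] u" z] d[of "[]"] c[of "[d]" for d] that by simp
  have D2: "((\<lambda>y. iderivs [sym_dir i] u (symm y)) has_derivative
      (\<lambda>w. \<Sum>j\<in>UNIV. sym_coord j (symm w) *\<^sub>R iderivs [sym_dir j, sym_dir i] u (symm z))) (at z)" if "z \<in> Om" for z i
  proof -
    have "((\<lambda>y. iderivs [sym_dir i] u (symm y)) has_derivative
      (\<lambda>w. \<Sum>j\<in>UNIV. sym_coord j (symm w) *\<^sub>R dpart (iderivs [sym_dir i] u) (sym_dir j) (symm z))) (at z)"
    proof (rule sym_has_derivative[OF _ _ that])
      show "has_dpart (iderivs [sym_dir i] u) v y" if "v \<in> Dirs" "y \<in> II" for v y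
        by (rule d) (use that sym_dir_Dirs[of i] in auto)
      show "continuous_on II (dpart (iderivs [sym_dir i] u) v)" if "v \<in> Dirs" for v
        using c[of "[v, sym_dir i]"] that sym_dir_Dirs[of i] by simp
    qed
    then show ?thesis by simp
  qed
  have "C2_on Om (\<lambda>z. u (symm z)) f1 f2"
    unfolding C2_on_def
  proof (intro conjI ballI allI open_Om D1)
    fix z v :: "'n cmat" assume z: "z \<in> Om"
    show "((\<lambda>y. f1 y v) has_derivative (\<lambda>w. f2 z w v)) (at z)"
      unfolding f1_def f2_def by (intro has_derivative_sum has_derivative_scaleR_right D2[OF z])
  next
    fix v w :: "'n cmat"
    show "continuous_on Om (\<lambda>z. f2 z w v)"
      unfolding f2_def
      by (intro continuous_intros continuous_on_compose2[OF c]) (auto simp: sym_dir_Dirs[THEN subsetD[OF subset_refl]] sym_dir_Dirs Om_def)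
  qed
  then show ?thesis by blast
qed

lemma harm_of_invariant_harmonic:
  assumes u: "invariant_harmonic u" and h: "continuous_on (closure II) h" "\<And>z. z \<in> II \<Longrightarrow> h z = u z"
  obtains f1 f2 where "harm (\<lambda>z. u (symm z)) f1 f2 h"
proof -
  obtain f1 f2 where f: "C2_on Om (\<lambda>z. u (symm z)) f1 f2"
    using C_on_2_C2 u unfolding invariant_harmonic_def by blast
  have "lapl (f2 z) p = 0" if z: "z \<in> II" and p: "Vm_frame p z" for z p
  proof -
    have "lapl (f2 z) p = 4 * LB (Gm z) u z" unfolding lapl_def
      by (rule levi_sum_LB[OF f II_sub_Om[OF z] z p]) (simp add: symm_id)
    also have "LB (Gm z) u z = 0"
      using u z inv_metric_Gm[OF z] unfolding invariant_harmonic_def by blast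
    finally show ?thesis by simp
  qed
  then have "harm (\<lambda>z. u (symm z)) f1 f2 h"
    unfolding harm_def using f h by (auto simp: symm_id II_iff)
  then show ?thesis by (rule that)
qed

lemma harm_cmul:
  assumes "harm f f1 f2 h"
  shows "harm (\<lambda>z. c * f z) (\<lambda>z v. c * f1 z v) (\<lambda>z w v. c * f2 z w v) (\<lambda>z. c * h z)"
proof -
  note f = harmD(1)[OF assms]
  have "C2_on Om (\<lambda>z. c * f z) (\<lambda>z v. c * f1 z v) (\<lambda>z w v. c * f2 z w v)"
    unfolding C2_on_def using C2_onD[OF f]
    by (auto intro!: has_derivative_mult_right continuous_intros)
  moreover have lc: "levi (\<lambda>w v. c * B w v) v w = c * levi B v w" for B :: "'a cmat \<Rightarrow> 'a cmat \<Rightarrow> complex" and v w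
    by (simp add: levi_def algebra_simps)
  moreover have "lapl (\<lambda>w v. c * B w v) p = c * lapl B p" for B :: "'a cmat \<Rightarrow> 'a cmat \<Rightarrow> complex" and p
    by (simp add: lapl_def sum_distrib_left lc)
  ultimately show ?thesis
    using harmD[OF assms] unfolding harm_def by (auto intro!: continuous_intros)
qed

section \<open>Weighted averages of solutions over the unitary group\<close>

lemma levi_haar_mean:
  assumes "\<And>v w. continuous_on Ug (\<lambda>k. F k v w)"
  shows "levi (\<lambda>v w. haar_mean (\<lambda>k. F k v w)) v w = haar_mean (\<lambda>k. levi (F k) v w)"
proof -
  let ?A = "\<lambda>k. F k v w" and ?B = "\<lambda>k. F k (csmul \<i> v) (csmul \<i> w)"
  let ?C = "\<lambda>k. F k v (csmul \<i> w)" and ?D = "\<lambda>k. F k (csmul \<i> v) w"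
  let ?G = "\<lambda>k. (?A k + ?B k) + \<i> * (?C k - ?D k)"
  have "haar_mean ?G = haar_mean (\<lambda>k. ?A k + ?B k) + haar_mean (\<lambda>k. \<i> * (?C k - ?D k))"
    by (rule haar_mean_add) (intro continuous_intros assms)+
  also have "haar_mean (\<lambda>k. ?A k + ?B k) = haar_mean ?A + haar_mean ?B" by (rule haar_mean_add[OF assms assms])
  also have "haar_mean (\<lambda>k. \<i> * (?C k - ?D k)) = \<i> * haar_mean (\<lambda>k. ?C k - ?D k)"
    by (rule haar_mean_cmul) (intro continuous_intros assms)
  also have "haar_mean (\<lambda>k. ?C k - ?D k) = haar_mean ?C - haar_mean ?D" by (rule haar_mean_diff[OF assms assms])
  finally have G: "haar_mean ?G = (haar_mean ?A + haar_mean ?B) + \<i> * (haar_mean ?C - haar_mean ?D)" .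
  have "haar_mean (\<lambda>k. levi (F k) v w) = haar_mean (\<lambda>k. (1/4) * ?G k)"
    by (simp add: levi_def)
  also have "\<dots> = (1/4) * haar_mean ?G" by (rule haar_mean_cmul) (intro continuous_intros assms)
  finally show ?thesis unfolding G by (simp add: levi_def)
qed

lemma levi_act: "levi (\<lambda>v w. c * B (act k v) (act k w)) v w = c * levi B (act k v) (act k w)"
  by (simp add: levi_def act_csmul algebra_simps)

definition haar_avg :: "(('n::finite) cmat \<Rightarrow> complex) \<Rightarrow> ('n cmat \<Rightarrow> complex) \<Rightarrow> 'n cmat \<Rightarrow> complex" where
  "haar_avg c f z = haar_mean (\<lambda>k. c k * f (act k z))"

definition haar_avg1 where "haar_avg1 c f1 z v = haar_mean (\<lambda>k. c k * f1 (act k z) (act k v))"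
definition haar_avg2 where "haar_avg2 c f2 z w v = haar_mean (\<lambda>k. c k * f2 (act k z) (act k w) (act k v))"

lemma harm_avg_continuous:
  assumes f: "harm f f1 f2 h" and c: "continuous_on Ug c"
  shows "continuous_on (Om \<times> Ug) (\<lambda>(z, k). c k * f (act k z))"
    "continuous_on (Om \<times> Ug) (\<lambda>(z, k). c k * f1 (act k z) (act k v))"
    "continuous_on (Om \<times> Ug) (\<lambda>(z, k). c k * f2 (act k z) (act k w) (act k v))"
    "continuous_on (closure II \<times> Ug) (\<lambda>(z, k). c k * h (act k z))"
proof -
  note C = harmD(1)[OF f]
  have c': "continuous_on (X \<times> Ug) (\<lambda>x. c (snd x))" for X :: "'a cmat set"
    by (rule continuous_on_compose2[OF c]) (auto intro!: continuous_intros)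
  have im: "(\<lambda>x. act (snd x) (fst x)) ` (Om \<times> Ug) \<subseteq> Om" by (auto intro: act_Om)
  show "continuous_on (Om \<times> Ug) (\<lambda>(z, k). c k * f (act k z))"
    unfolding case_prod_beta by (intro continuous_on_mult c' C2_on_continuous[OF C] im continuous_intros)
  show "continuous_on (Om \<times> Ug) (\<lambda>(z, k). c k * f1 (act k z) (act k v))"
    unfolding case_prod_beta by (intro continuous_on_mult c' C2_on_continuous1[OF C] im continuous_intros)
  show "continuous_on (Om \<times> Ug) (\<lambda>(z, k). c k * f2 (act k z) (act k w) (act k v))"
    unfolding case_prod_beta by (intro continuous_on_mult c' C2_on_continuous2[OF C] im continuous_intros)
  show "continuous_on (closure II \<times> Ug) (\<lambda>(z, k). c k * h (act k z))"
    unfolding case_prod_beta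
    by (intro continuous_on_mult c' continuous_on_compose2[OF harmD(3)[OF f]] continuous_intros)
      (auto intro: act_closure_II)
qed

lemma levi_haar_avg2:
  assumes f: "harm f f1 f2 h" and c: "continuous_on Ug c" and z: "z \<in> Om"
  shows "levi (haar_avg2 c f2 z) v w = haar_mean (\<lambda>k. c k * levi (f2 (act k z)) (act k v) (act k w))"
proof -
  have "levi (haar_avg2 c f2 z) v w = haar_mean (\<lambda>k. levi (\<lambda>v w. c k * f2 (act k z) (act k v) (act k w)) v w)"
    unfolding haar_avg2_def[abs_def]
    by (rule levi_haar_mean) (rule continuous_on_slice[OF harm_avg_continuous(3)[OF f c] z])
  then show ?thesis by (simp add: levi_act)
qed

lemma continuous_levi_act:
  assumes f: "harm f f1 f2 h" and c: "continuous_on Ug c" and z: "z \<in> Om"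
  shows "continuous_on Ug (\<lambda>k. c k * levi (f2 (act k z)) (act k v) (act k w))"
proof -
  have "continuous_on Ug (\<lambda>k. levi (\<lambda>v w. c k * f2 (act k z) (act k v) (act k w)) v w)"
    unfolding levi_def
    by (intro continuous_intros continuous_on_slice[OF harm_avg_continuous(3)[OF f c] z]) auto
  then show ?thesis by (simp add: levi_act)
qed

lemma Vm_frame_act:
  assumes k: "k \<in> Ug" and p: "Vm_frame p z" shows "Vm_frame (\<lambda>a. k *v p a) (act k z)"
  unfolding Vm_frame_def
proof (intro allI)
  fix i j
  have "Vm (act k z) $ i $ j = (\<Sum>m\<in>UNIV. (\<Sum>l\<in>UNIV. k $ i $ l * (\<Sum>a\<in>UNIV. p a $ l * cnj (p a $ m))) * cnj (k $ j $ m))"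
    using p unfolding Vm_act[OF k] by (simp add: matmul_nth Vm_frame_def)
  also have "\<dots> = (\<Sum>m\<in>UNIV. \<Sum>l\<in>UNIV. \<Sum>a\<in>UNIV. k $ i $ l * p a $ l * cnj (k $ j $ m * p a $ m))"
    by (simp add: sum_distrib_left sum_distrib_right mult_ac)
  also have "\<dots> = (\<Sum>m\<in>UNIV. \<Sum>a\<in>UNIV. \<Sum>l\<in>UNIV. k $ i $ l * p a $ l * cnj (k $ j $ m * p a $ m))"
    by (intro sum.cong refl sum.swap)
  also have "\<dots> = (\<Sum>a\<in>UNIV. \<Sum>m\<in>UNIV. \<Sum>l\<in>UNIV. k $ i $ l * p a $ l * cnj (k $ j $ m * p a $ m))"
    by (rule sum.swap)
  also have "\<dots> = (\<Sum>a\<in>UNIV. (k *v p a) $ i * cnj ((k *v p a) $ j))"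
    by (simp only: matvec_nth cnj_sum sum_distrib_left sum_distrib_right)
  finally show "Vm (act k z) $ i $ j = (\<Sum>a\<in>UNIV. (k *v p a) $ i * cnj ((k *v p a) $ j))" .
qed

text \<open>Unitary matrices act linearly and map frames to frames, so each translate of a solution
  is a solution. The mean commutes with the two derivatives, hence with the Laplacian, for every
  continuous weight.\<close>

lemma harm_haar_avg:
  assumes f: "harm f f1 f2 h" and c: "continuous_on Ug c"
  shows "harm (haar_avg c f) (haar_avg1 c f1) (haar_avg2 c f2) (haar_avg c h)"
proof -
  note C = harmD(1)[OF f]
  note cont = harm_avg_continuous[OF f c]
  have act_der: "(act k has_derivative act k) (at z)" for k z :: "'a cmat"
    by (rule bounded_linear_imp_has_derivative) (simp add: linear_act flip: linear_conv_bounded_linear)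
  have "C2_on Om (haar_avg c f) (haar_avg1 c f1) (haar_avg2 c f2)"
    unfolding C2_on_def
  proof (intro conjI ballI allI open_Om)
    fix z v :: "'a cmat" assume z: "z \<in> Om"
    show "(haar_avg c f has_derivative haar_avg1 c f1 z) (at z)"
      unfolding haar_avg_def[abs_def] haar_avg1_def[abs_def]
    proof (rule haar_mean_has_derivative[OF open_Om z _ _ cont(2)])
      show "continuous_on Ug (\<lambda>k. c k * f (act k y))" if "y \<in> Om" for y
        by (rule continuous_on_slice[OF cont(1) that])
      show "((\<lambda>y. c k * f (act k y)) has_derivative (\<lambda>v. c k * f1 (act k y) (act k v))) (at y)"
        if "y \<in> Om" "k \<in> Ug" for y k
        by (intro has_derivative_mult_right has_derivative_compose[OF act_der C2_onD(2)[OF C]] act_Om that)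
    qed
    show "((\<lambda>y. haar_avg1 c f1 y v) has_derivative (\<lambda>w. haar_avg2 c f2 z w v)) (at z)"
      unfolding haar_avg1_def[abs_def] haar_avg2_def[abs_def]
    proof (rule haar_mean_has_derivative[OF open_Om z _ _ cont(3)])
      show "continuous_on Ug (\<lambda>k. c k * f1 (act k y) (act k v))" if "y \<in> Om" for y
        by (rule continuous_on_slice[OF cont(2) that])
      show "((\<lambda>y. c k * f1 (act k y) (act k v)) has_derivative (\<lambda>w. c k * f2 (act k y) (act k w) (act k v))) (at y)"
        if "y \<in> Om" "k \<in> Ug" for y k
        by (intro has_derivative_mult_right has_derivative_compose[OF act_der C2_onD(3)[OF C]] act_Om that)
    qed
  next
    fix v w
    show "continuous_on Om (\<lambda>z. haar_avg2 c f2 z w v)"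
      unfolding haar_avg2_def[abs_def] by (rule haar_mean_continuous[OF cont(3)])
  qed
  moreover have "lapl (haar_avg2 c f2 z) p = 0" if z: "z \<in> II" and p: "Vm_frame p z" for z p
  proof -
    note lc = continuous_levi_act[OF f c II_sub_Om[OF z]]
    have "lapl (haar_avg2 c f2 z) p = haar_mean (\<lambda>k. \<Sum>a\<in>UNIV. \<Sum>b\<in>UNIV. c k * levi (f2 (act k z)) (act k (Tm (p a) (p b))) (act k (Tm (p a) (p b))))"
      unfolding lapl_def levi_haar_avg2[OF f c II_sub_Om[OF z]]
      by (subst haar_mean_sum, simp, intro continuous_intros lc, subst haar_mean_sum, simp, intro lc, rule refl)
    also have "\<dots> = 0"
    proof (rule haar_mean_eq_const)
      fix k :: "'a cmat" assume k: "k \<in> Ug"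
      have "(\<Sum>a\<in>UNIV. \<Sum>b\<in>UNIV. c k * levi (f2 (act k z)) (act k (Tm (p a) (p b))) (act k (Tm (p a) (p b))))
        = c k * lapl (f2 (act k z)) (\<lambda>a. k *v p a)"
        by (simp add: act_Tm lapl_def sum_distrib_left)
      then show "(\<Sum>a\<in>UNIV. \<Sum>b\<in>UNIV. c k * levi (f2 (act k z)) (act k (Tm (p a) (p b))) (act k (Tm (p a) (p b)))) = 0"
        using harmD(2)[OF f act_II[OF k z] Vm_frame_act[OF k p]] by simp
    qed
    finally show ?thesis .
  qed
  moreover have "continuous_on (closure II) (haar_avg c h)"
    unfolding haar_avg_def[abs_def] by (rule haar_mean_continuous[OF cont(4)])
  moreover have "haar_avg c h z = haar_avg c f z" if z: "z \<in> II" for z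
    unfolding haar_avg_def
  proof (rule haar_mean_cong)
    show "continuous_on Ug (\<lambda>k. c k * h (act k z))"
      by (rule continuous_on_slice[OF cont(4) subsetD[OF closure_subset z]])
    show "c k * h (act k z) = c k * f (act k z)" if "k \<in> Ug" for k
      using harmD(4)[OF f act_II[OF that z]] by simp
  qed
  ultimately show ?thesis unfolding harm_def by blast
qed

subsection \<open>The maximum principle\<close>

text \<open>The exponential of the penalised function divided by \<open>d\<close> extends
  continuously to the compact closure and vanishes where the determinant does. Being positive at 0,
  it attains its maximum inside \<open>II\<close>.\<close>

lemma exists_penalised_maximum:
  fixes h :: "('n::finite) cmat \<Rightarrow> complex"
  assumes h: "continuous_on (closure II) h" and d: "d > 0"
  shows "\<exists>z\<in>II. \<forall>q\<in>II. Re (h q) + e * (norm q)\<^sup>2 + d * ln (Re (det (Vm q)))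
     \<le> Re (h z) + e * (norm z)\<^sup>2 + d * ln (Re (det (Vm z)))"
proof -
  let ?P = "\<lambda>z. Re (h z) + e * (norm z)\<^sup>2"
  let ?E = "\<lambda>z. exp (?P z / d) * Re (det (Vm z))"
  have cE: "continuous_on (closure II) ?E" using d by (intro continuous_intros h) simp
  have 0: "(0::'n cmat) \<in> closure II" by (rule subsetD[OF closure_subset zero_II])
  then have ne: "closure (II :: 'n cmat set) \<noteq> {}" unfolding ex_in_conv[symmetric] by (rule exI)
  have "\<exists>z\<in>closure II. \<forall>q\<in>closure II. ?E q \<le> ?E z"
    by (rule continuous_attains_sup[OF compact_closure_II ne cE])
  then obtain z where z0: "z \<in> closure II" "\<forall>q\<in>closure II. ?E q \<le> ?E z" by (rule bexE)
  note z = z0(1) bspec[OF z0(2)]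
  have pos: "0 < ?E q" if "q \<in> II" for q using that II_sub_Ub by (intro mult_pos_pos) (auto simp: Ub_def)
  have "0 < ?E z" using pos[OF zero_II] z(2)[OF 0] by linarith
  then have "0 < Re (det (Vm z))" by (simp add: zero_less_mult_iff)
  then have zI: "z \<in> II" using closure_II_det[OF z(1)] by blast
  have "?P q + d * ln (Re (det (Vm q))) \<le> ?P z + d * ln (Re (det (Vm z)))" if q: "q \<in> II" for q
  proof -
    have ln: "ln (?E q) = ?P q / d + ln (Re (det (Vm q)))" if "q \<in> II" for q
      using pos[OF that] by (subst ln_mult) (auto simp: zero_less_mult_iff)
    have "ln (?E q) \<le> ln (?E z)"
      using z(2)[of q] q closure_subset pos[OF q] pos[OF zI] by (subst ln_le_cancel_iff) auto
    then have "d * (?P q / d + ln (Re (det (Vm q)))) \<le> d * (?P z / d + ln (Re (det (Vm z))))"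
      unfolding ln[OF q] ln[OF zI] using d by (intro mult_left_mono) auto
    moreover have "d * (x / d + y) = x + d * y" for x y using d by (simp add: field_simps)
    ultimately show ?thesis by simp
  qed
  then show ?thesis using zI by blast
qed

lemma norm_csmul_ii [simp]: "norm (csmul \<i> v) = norm (v :: ('n::finite) cmat)"
proof -
  have "(norm (csmul \<i> v))\<^sup>2 = (norm v)\<^sup>2" unfolding norm_cmat_sq by (simp add: norm_mult)
  then show ?thesis by (simp add: power2_eq_iff_nonneg)
qed

lemma sym_line_II:
  assumes z: "z \<in> II" and v: "transpose v = (v :: ('n::finite) cmat)"
  obtains r where "r > 0" "\<And>t. \<bar>t\<bar> < r \<Longrightarrow> z + t *\<^sub>R v \<in> II"
proof -
  obtain \<rho> where \<rho>: "\<rho> > 0" "\<And>y. norm (y - z) < \<rho> \<Longrightarrow> y \<in> Om"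
    using open_Om II_sub_Om[OF z] unfolding open_dist dist_norm by blast
  show ?thesis
  proof (rule that[of "\<rho> / (norm v + 1)"])
    show "\<rho> / (norm v + 1) > 0" using \<rho>(1) by (simp add: add_nonneg_pos)
    fix t :: real assume "\<bar>t\<bar> < \<rho> / (norm v + 1)"
    then have t: "\<bar>t\<bar> * (norm v + 1) < \<rho>" by (simp add: pos_less_divide_eq add_nonneg_pos)
    have "norm (z + t *\<^sub>R v - z) < \<rho>" using t by (simp add: algebra_simps)
    then have "z + t *\<^sub>R v \<in> Om" by (rule \<rho>(2))
    moreover have "transpose (z + t *\<^sub>R v) = z + t *\<^sub>R v"
      using z v by (intro transpose_line) (simp_all add: II_iff)
    ultimately show "z + t *\<^sub>R v \<in> II" by (simp add: Om_def symm_id)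
  qed
qed

lemma penalised_second_order:
  assumes f: "harm f f1 f2 h" and z: "z \<in> II" and v: "transpose v = v"
    and mx: "\<And>q. q \<in> II \<Longrightarrow> Re (h q) + e * (norm q)\<^sup>2 + d * ln (Re (det (Vm q)))
     \<le> Re (h z) + e * (norm z)\<^sup>2 + d * ln (Re (det (Vm z)))"
  shows "Re (f2 z v v) + 2 * e * (norm v)\<^sup>2 - d * Re (b2 z v v) \<le> 0"
proof -
  obtain r where r: "r > 0" "\<And>t. \<bar>t\<bar> < r \<Longrightarrow> z + t *\<^sub>R v \<in> II" using sym_line_II[OF z v] by blast
  let ?g = "\<lambda>t. Re (f (z + t *\<^sub>R v)) + e * ((z + t *\<^sub>R v) \<bullet> (z + t *\<^sub>R v)) - d * Re (bpot (z + t *\<^sub>R v))"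
  let ?g' = "\<lambda>t. Re (f1 (z + t *\<^sub>R v) v) + e * (2 * ((z + t *\<^sub>R v) \<bullet> v)) - d * Re (b1 (z + t *\<^sub>R v) v)"
  have inn: "((\<lambda>t. (z + t *\<^sub>R v) \<bullet> v) has_real_derivative v \<bullet> v) (at t)" for t
    by (auto intro!: derivative_eq_intros simp: inner_add_left)
  have inn2: "((\<lambda>t. (z + t *\<^sub>R v) \<bullet> (z + t *\<^sub>R v)) has_real_derivative 2 * ((z + t *\<^sub>R v) \<bullet> v)) (at t)" for t
  proof -
    have eq: "(\<lambda>t. (z + t *\<^sub>R v) \<bullet> (z + t *\<^sub>R v)) = (\<lambda>t. z \<bullet> z + 2 * t * (z \<bullet> v) + t * t * (v \<bullet> v))"
      by (auto simp: inner_add_left inner_add_right inner_commute algebra_simps)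
    show ?thesis unfolding eq
      by (auto intro!: derivative_eq_intros simp: inner_add_left algebra_simps)
  qed
  have "Re (f2 z v v) + e * (2 * (v \<bullet> v)) - d * Re (b2 z v v) \<le> 0"
  proof (rule second_derivative_local_max[of r ?g ?g'])
    fix t :: real assume t: "\<bar>t\<bar> < r"
    have "((\<lambda>t. Re (f (z + t *\<^sub>R v))) has_real_derivative Re (f1 (z + t *\<^sub>R v) v)) (at t)"
      by (rule has_vector_derivative_cis_line[OF C2_on_line(1)[OF harmD(1)[OF f] II_sub_Om[OF r(2)[OF t]]]])
    moreover have "((\<lambda>t. Re (bpot (z + t *\<^sub>R v))) has_real_derivative Re (b1 (z + t *\<^sub>R v) v)) (at t)"
      by (rule has_vector_derivative_cis_line[OF C2_on_line(1)[OF C2_on_bpot II_sub_Ub[OF r(2)[OF t]]]])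
    ultimately show "(?g has_real_derivative ?g' t) (at t)"
      by (intro DERIV_diff DERIV_add DERIV_cmult inn2)
    show "?g t \<le> ?g 0"
      using mx[OF r(2)[OF t]] harmD(4)[OF f] r(2)[OF t] z
      by (simp add: bpot_def Vm_def[symmetric] power2_norm_eq_inner)
  next
    have z0: "z + 0 *\<^sub>R v \<in> Om" "z + 0 *\<^sub>R v \<in> Ub" using z II_sub_Om II_sub_Ub by auto
    have "((\<lambda>t. Re (f1 (z + t *\<^sub>R v) v)) has_real_derivative Re (f2 z v v)) (at 0)"
      using has_vector_derivative_cis_line[OF C2_on_line(2)[OF harmD(1)[OF f] z0(1)]] by simp
    moreover have "((\<lambda>t. Re (b1 (z + t *\<^sub>R v) v)) has_real_derivative Re (b2 z v v)) (at 0)"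
      using has_vector_derivative_cis_line[OF C2_on_line(2)[OF C2_on_bpot z0(2)]] by simp
    ultimately show "(?g' has_real_derivative Re (f2 z v v) + e * (2 * (v \<bullet> v)) - d * Re (b2 z v v)) (at 0)"
      by (intro DERIV_diff DERIV_add DERIV_cmult inn)
  qed (use r in auto)
  then show ?thesis by (simp add: power2_norm_eq_inner algebra_simps)
qed

text \<open>Summed over a frame, the harmonic part contributes 0 and the potential 4dK, with K the
  number of coordinates. What is left is e times the sum of all squared norms of
  \<open>Tm (p a) (p b)\<close>; so each frame vector, and with it the diagonal of
  \<open>Vm z\<close>, is small when d/e is.\<close>

lemma penalised_diag_bound:
  fixes z :: "('n::finite) cmat"
  assumes f: "harm f f1 f2 h" and z: "z \<in> II" and e: "e > 0" and d: "d > 0"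
    and mx: "\<And>q. q \<in> II \<Longrightarrow> Re (h q) + e * (norm q)\<^sup>2 + d * ln (Re (det (Vm q)))
     \<le> Re (h z) + e * (norm z)\<^sup>2 + d * ln (Re (det (Vm z)))"
  shows "Re (Vm z $ i $ i) \<le> real CARD('n) * sqrt (d * real (card (idxP :: 'n set set)) / e)"
proof -
  obtain p where p: "Vm_frame p z" using Vm_frame_ex[OF z] by blast
  \<comment> \<open>Adding the real second order conditions along \<open>v\<close> and
    \<open>csmul \<i> v\<close> turns the Hessians into Levi forms.\<close>
  have lv: "Re (levi (f2 z) v v) + e * (norm v)\<^sup>2 \<le> d * Re (levi (b2 z) v v)" if v: "transpose v = v" for v
  proof -
    have iv: "transpose (csmul \<i> v) = csmul \<i> v" using v by (metis cmat_eqI csmul_nth transpose_nth)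
    have s: "f2 z v w = f2 z w v" "b2 z v w = b2 z w v" for v w
      using C2_on_symmetric[OF harmD(1)[OF f] II_sub_Om[OF z]] C2_on_symmetric[OF C2_on_bpot II_sub_Ub[OF z]] by auto
    have l: "Re (levi (f2 z) v v) = (Re (f2 z v v) + Re (f2 z (csmul \<i> v) (csmul \<i> v))) / 4"
      "d * Re (levi (b2 z) v v) = (d * Re (b2 z v v) + d * Re (b2 z (csmul \<i> v) (csmul \<i> v))) / 4"
      by (simp_all add: levi_diag s algebra_simps)
    have "Re (f2 z v v) + 2 * e * (norm v)\<^sup>2 - d * Re (b2 z v v) \<le> 0"
      by (rule penalised_second_order[OF f z v mx])
    moreover have "Re (f2 z (csmul \<i> v) (csmul \<i> v)) + 2 * e * (norm (csmul \<i> v))\<^sup>2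
        - d * Re (b2 z (csmul \<i> v) (csmul \<i> v)) \<le> 0"
      by (rule penalised_second_order[OF f z iv mx])
    moreover have "2 * e * (norm v)\<^sup>2 = 2 * (e * (norm v)\<^sup>2)" by simp
    ultimately show ?thesis unfolding l norm_csmul_ii by argo
  qed
  define K where "K = real (card (idxP :: 'n set set))"
  have "(\<Sum>a\<in>UNIV. \<Sum>b\<in>UNIV. Re (levi (f2 z) (Tm (p a) (p b)) (Tm (p a) (p b))) + e * (norm (Tm (p a) (p b)))\<^sup>2)
    \<le> (\<Sum>a\<in>UNIV. \<Sum>b\<in>UNIV. d * Re (levi (b2 z) (Tm (p a) (p b)) (Tm (p a) (p b))))"
    by (intro sum_mono lv transpose_Tm)
  moreover have "(\<Sum>a\<in>UNIV. \<Sum>b\<in>UNIV. Re (levi (f2 z) (Tm (p a) (p b)) (Tm (p a) (p b)))) = 0"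
    using arg_cong[OF harmD(2)[OF f z p], of Re] by (simp add: lapl_def)
  moreover have "(\<Sum>a\<in>UNIV. \<Sum>b\<in>UNIV. d * Re (levi (b2 z) (Tm (p a) (p b)) (Tm (p a) (p b)))) = d * (4 * K)"
    using arg_cong[OF levi_sum_bpot[OF z p], of Re] by (simp add: K_def sum_distrib_left[symmetric])
  ultimately have main: "e * (\<Sum>a\<in>UNIV. \<Sum>b\<in>UNIV. (norm (Tm (p a) (p b)))\<^sup>2) \<le> d * (4 * K)"
    by (simp add: sum.distrib sum_distrib_left)
  have pb: "(cmod (p a $ i))\<^sup>2 \<le> sqrt (d * K / e)" for a
  proof -
    have "(2 * (cmod (p a $ i))\<^sup>2)\<^sup>2 = (cmod (Tm (p a) (p a) $ i $ i))\<^sup>2"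
      by (simp add: Tm_nth norm_mult power2_eq_square flip: mult_2)
    also have "\<dots> \<le> (norm (Tm (p a) (p a)))\<^sup>2" by (intro power_mono norm_cmat_nth) auto
    also have "\<dots> \<le> (\<Sum>b\<in>UNIV. (norm (Tm (p a) (p b)))\<^sup>2)" by (rule member_le_sum) auto
    also have "\<dots> \<le> (\<Sum>a\<in>UNIV. \<Sum>b\<in>UNIV. (norm (Tm (p a) (p b)))\<^sup>2)"
      by (rule member_le_sum[where f="\<lambda>a. \<Sum>b\<in>UNIV. (norm (Tm (p a) (p b)))\<^sup>2"]) (auto intro: sum_nonneg)
    also have "\<dots> \<le> d * (4 * K) / e" using main e by (simp add: pos_le_divide_eq mult.commute)
    also have "d * (4 * K) / e = 4 * (d * K / e)" by simp
    finally have "4 * ((cmod (p a $ i))\<^sup>2)\<^sup>2 \<le> 4 * (d * K / e)" unfolding power_mult_distrib by simp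
    then have "((cmod (p a $ i))\<^sup>2)\<^sup>2 \<le> d * K / e" by linarith
    then show ?thesis by (rule real_le_rsqrt)
  qed
  have "Vm z $ i $ i = complex_of_real (\<Sum>a\<in>UNIV. (cmod (p a $ i))\<^sup>2)"
    using p by (simp add: Vm_frame_def complex_norm_square del: of_real_power)
  then have "Re (Vm z $ i $ i) = (\<Sum>a\<in>UNIV. (cmod (p a $ i))\<^sup>2)" by simp
  also have "\<dots> \<le> (\<Sum>a\<in>(UNIV :: 'n set). sqrt (d * K / e))" by (intro sum_mono pb)
  finally show ?thesis by (simp add: K_def)
qed

text \<open>With \<open>e\<close> fixed and the logarithmic penalty tending to 0, the penalised
  maxima accumulate at a point where the diagonal of \<open>Vm\<close> vanishes. By semidefiniteness
  \<open>Vm\<close> itself vanishes there, and the assumption on the Shilov boundary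
  applies.\<close>

lemma max_principle_Re:
  fixes h :: "('n::finite) cmat \<Rightarrow> complex"
  assumes f: "harm f f1 f2 h"
    and S: "\<And>x. x \<in> closure II \<Longrightarrow> Vm x = 0 \<Longrightarrow> Re (h x) \<le> 0" and q: "q \<in> II"
  shows "Re (h q) \<le> 0"
proof (rule ccontr)
  assume "\<not> Re (h q) \<le> 0"
  then have hq: "Re (h q) > 0" by simp
  define N where "N = real CARD('n)"
  have N: "N > 0" by (simp add: N_def)
  \<comment> \<open>The squared norm is at most N on the closure, so the second penalty can account
    for no more than half of the supposed positive value.\<close>
  define e where "e = Re (h q) / (2 * N)"
  have e: "e > 0" using hq N by (simp add: e_def)
  define d where "d m = 1 / real (Suc m)" for m
  have d: "d m > 0" for m by (simp add: d_def)
  let ?P = "\<lambda>z. Re (h z) + e * (norm z)\<^sup>2"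
  have "\<forall>m. \<exists>z. z \<in> II \<and> (\<forall>q\<in>II. ?P q + d m * ln (Re (det (Vm q))) \<le> ?P z + d m * ln (Re (det (Vm z))))"
    using exists_penalised_maximum[OF harmD(3)[OF f] d] by (metis (no_types, lifting))
  then obtain z where z: "\<And>m. z m \<in> II"
    "\<And>m q. q \<in> II \<Longrightarrow> ?P q + d m * ln (Re (det (Vm q))) \<le> ?P (z m) + d m * ln (Re (det (Vm (z m))))"
    by metis
  have zc: "z m \<in> closure II" for m using z(1) closure_subset by blast
  obtain l r where l: "l \<in> closure II" "strict_mono r" "(z \<circ> r) \<longlonglongrightarrow> l"
    using compact_closure_II zc unfolding compact_def by metis
  have lim: "(\<lambda>m. g (z (r m))) \<longlonglongrightarrow> g l" if "continuous_on (closure II) g" for g :: "'n cmat \<Rightarrow> real"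
    using continuous_on_tendsto_compose[OF that l(3) l(1)] zc by (simp add: o_def)
  have dlim: "(\<lambda>m. d (r m) * c) \<longlonglongrightarrow> 0" for c
  proof -
    have "d \<longlonglongrightarrow> 0" unfolding d_def[abs_def] using LIMSEQ_inverse_real_of_nat by (simp add: inverse_eq_divide)
    then have "(\<lambda>m. d (r m) * c) \<longlonglongrightarrow> 0 * c"
      using LIMSEQ_subseq_LIMSEQ[OF _ l(2), of d 0] by (intro tendsto_intros) (simp add: o_def)
    then show ?thesis by simp
  qed
  have "continuous_on (closure II) (\<lambda>z :: 'n cmat. Re (det (Vm z)))" by (intro continuous_intros)
  then have "bounded ((\<lambda>z :: 'n cmat. Re (det (Vm z))) ` closure II)"
    by (rule compact_imp_bounded[OF compact_continuous_image[OF _ compact_closure_II]])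
  then obtain B where B: "\<And>z :: 'n cmat. z \<in> closure II \<Longrightarrow> \<bar>Re (det (Vm z))\<bar> \<le> B"
    unfolding bounded_iff by auto
  \<comment> \<open>The logarithm at the maximum may be very negative but never exceeds
    \<open>ln B\<close>, so it is replaced by a term that tends to 0 with
    \<open>d m\<close>.\<close>
  have "?P q + d m * (ln (Re (det (Vm q))) - ln B) \<le> ?P (z m)" for m
  proof -
    have "0 < Re (det (Vm (z m)))" using II_sub_Ub[OF z(1)] by (simp add: Ub_def)
    moreover have "Re (det (Vm (z m))) \<le> B" using B[OF zc] abs_le_D1 by blast
    ultimately have "ln (Re (det (Vm (z m)))) \<le> ln B" by simp
    then have "d m * ln (Re (det (Vm (z m)))) \<le> d m * ln B" using d[of m] by (intro mult_left_mono) auto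
    then show ?thesis using z(2)[OF q, of m] by (simp add: right_diff_distrib)
  qed
  then have "?P q + d (r m) * (ln (Re (det (Vm q))) - ln B) \<le> ?P (z (r m))" for m by blast
  moreover have "(\<lambda>m. ?P q + d (r m) * (ln (Re (det (Vm q))) - ln B)) \<longlonglongrightarrow> ?P q + 0"
    by (intro tendsto_intros dlim)
  moreover have "(\<lambda>m. ?P (z (r m))) \<longlonglongrightarrow> ?P l"
    by (rule lim) (intro continuous_intros harmD(3)[OF f])
  ultimately have Pql: "?P q \<le> ?P l"
    using LIMSEQ_le by (metis (no_types, lifting) add.right_neutral)
  have "Vm l $ i $ i = 0" for i
  proof -
    define K where "K = real (card (idxP :: 'n set set))"
    have b: "Re (Vm (z m) $ i $ i) \<le> N * sqrt (d m * (K / e))" for m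
      using penalised_diag_bound[OF f z(1) e d z(2), of m i] by (simp add: N_def K_def)
    have "(\<lambda>m. Re (Vm (z (r m)) $ i $ i)) \<longlonglongrightarrow> Re (Vm l $ i $ i)"
      by (rule lim) (intro continuous_intros)
    moreover have "(\<lambda>m. N * sqrt (d (r m) * (K / e))) \<longlonglongrightarrow> N * sqrt 0"
      by (intro tendsto_intros dlim)
    ultimately have "Re (Vm l $ i $ i) \<le> N * sqrt 0"
      using b by (intro LIMSEQ_le) auto
    then show ?thesis using psd_diag[OF closure_II(2)[OF l(1)], of i] by simp
  qed
  then have "Vm l $ i $ j = 0" for i j using psd_zero_diag(1)[OF closure_II(2)[OF l(1)]] by blast
  then have "Vm l = 0" by (intro cmat_eqI) simp
  then have "Re (h l) \<le> 0" by (rule S[OF l(1)])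
  moreover have "e * (norm l)\<^sup>2 \<le> e * N"
    using norm_closure_II[OF l(1)] e by (intro mult_left_mono) (auto simp: N_def)
  ultimately have "?P l \<le> e * N" by linarith
  also have "e * N = Re (h q) / 2" using N by (simp add: e_def)
  finally have "?P l \<le> Re (h q) / 2" .
  moreover have "Re (h q) \<le> ?P q" using e by simp
  ultimately show False using Pql hq by linarith
qed

text \<open>The symmetric matrices with \<open>Vm x = 0\<close> form the Shilov boundary.\<close>

lemma max_principle:
  assumes f: "harm f f1 f2 h"
    and S: "\<And>x. x \<in> closure II \<Longrightarrow> Vm x = 0 \<Longrightarrow> h x = 0" and q: "q \<in> II"
  shows "h q = 0"
proof -
  have le: "Re (c * h q) \<le> 0" for c
    by (rule max_principle_Re[OF harm_cmul[OF f]]) (use S q in auto)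
  have "Re (h q) = 0" using le[of 1] le[of "-1"] by simp
  moreover have "Im (h q) = 0" using le[of \<i>] le[of "-\<i>"] by simp
  ultimately show ?thesis by (simp add: complex_eq_iff)
qed

subsection \<open>Moebius transformations moving the origin along a rank one disc\<close>

lemma bounded_bilinear_csmul: "bounded_bilinear (csmul :: complex \<Rightarrow> ('n::finite) cmat \<Rightarrow> 'n cmat)"
proof -
  have "bilinear (csmul :: complex \<Rightarrow> 'n cmat \<Rightarrow> 'n cmat)"
    unfolding bilinear_def
    by (intro conjI allI linearI; rule cmat_eqI)
      (simp_all add: algebra_simps scaleR_conv_of_real[where 'a=complex])
  then show ?thesis by (simp add: bilinear_conv_bounded_bilinear)
qed

lemmas has_derivative_csmul = bounded_bilinear.FDERIV[OF bounded_bilinear_csmul]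

lemma continuous_on_csmul [continuous_intros]:
  "continuous_on S f \<Longrightarrow> continuous_on S g \<Longrightarrow> continuous_on S (\<lambda>x. csmul (f x) (g x :: ('n::finite) cmat))"
  by (intro continuous_on_cmatI) (auto intro!: continuous_intros)

lemma has_derivative_symm: "(symm has_derivative symm) (at (z :: ('n::finite) cmat))"
  by (rule bounded_linear_imp_has_derivative) (simp add: linear_symm flip: linear_conv_bounded_linear)

lemma has_derivative_cmat_nth:
  "(f has_derivative f') F \<Longrightarrow> ((\<lambda>x. (f x :: ('n::finite) cmat) $ i $ j) has_derivative (\<lambda>h. f' h $ i $ j)) F"
  by (intro bounded_linear.has_derivative[OF bounded_linear_vec_nth])

text \<open>For 0 \<le> t < 1, the positive square root of the identity minus t^2
  \<open>E1 o1\<close>, the defect operator of the point t \<open>E1 o1\<close>.\<close>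

definition Rm :: "'n \<Rightarrow> real \<Rightarrow> ('n::finite) cmat" where
  "Rm o1 t = (\<chi> i j. if i = j then (if i = o1 then complex_of_real (sqrt (1 - t\<^sup>2)) else 1) else 0)"

text \<open>The scalar for which \<open>mat 1 - csmul (tau o1 t y) (y ** E1 o1)\<close> inverts the
  identity plus t y \<open>E1 o1\<close>, possible because \<open>E1 o1\<close> has rank
  one.\<close>

definition tau :: "'n \<Rightarrow> real \<Rightarrow> ('n::finite) cmat \<Rightarrow> complex" where
  "tau o1 t y = complex_of_real t * inverse (1 + complex_of_real t * y $ o1 $ o1)"

definition mobM :: "'n \<Rightarrow> real \<Rightarrow> ('n::finite) cmat \<Rightarrow> 'n cmat" where
  "mobM o1 t y = mat 1 - csmul (tau o1 t y) (y ** E1 o1)"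

text \<open>The transvection tE + R (I + t y E)^(-1) y R with E = \<open>E1 o1\<close> and R =
  \<open>Rm o1 t\<close>, written without an inverse matrix. It sends 0 to tE.\<close>

definition mob0 :: "'n \<Rightarrow> real \<Rightarrow> ('n::finite) cmat \<Rightarrow> 'n cmat" where
  "mob0 o1 t y = t *\<^sub>R E1 o1 + Rm o1 t ** (y - csmul (tau o1 t y) (y ** E1 o1 ** y)) ** Rm o1 t"

definition mob :: "'n \<Rightarrow> real \<Rightarrow> ('n::finite) cmat \<Rightarrow> 'n cmat" where
  "mob o1 t z = mob0 o1 t (symm z)"

lemma Rm_nth: "Rm o1 t $ i $ j = (if i = j then (if i = o1 then complex_of_real (sqrt (1 - t\<^sup>2)) else 1) else 0)"
  by (simp add: Rm_def)

lemma cadj_Rm [simp]: "cadj (Rm o1 t) = Rm o1 t" and transpose_Rm [simp]: "transpose (Rm o1 t) = Rm o1 t"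
  by (rule cmat_eqI, auto simp: Rm_nth)+

lemma cadj_E1 [simp]: "cadj (E1 o1) = E1 o1" and transpose_E1 [simp]: "transpose (E1 o1) = E1 o1"
  by (rule cmat_eqI, auto simp: E1_nth)+

lemma E1_sandwich: "E1 o1 ** A ** E1 o1 = csmul (A $ o1 $ o1) (E1 o1)"
proof (rule cmat_eqI)
  fix i j
  have "(E1 o1 ** A) $ i $ k = (if i = o1 then A $ o1 $ k else 0)" for k
  proof -
    have "(E1 o1 ** A) $ i $ k = (\<Sum>l\<in>UNIV. if l = o1 then (if i = o1 then A $ o1 $ k else 0) else 0)"
      unfolding matmul_nth by (intro sum.cong) (auto simp: E1_nth)
    then show ?thesis by simp
  qed
  then have "(E1 o1 ** A ** E1 o1) $ i $ j = (\<Sum>k\<in>UNIV. if k = o1 then (if i = o1 \<and> j = o1 then A $ o1 $ o1 else 0) else 0)"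
    unfolding matmul_nth[of "E1 o1 ** A"] by (intro sum.cong) (auto simp: E1_nth)
  then show "(E1 o1 ** A ** E1 o1) $ i $ j = csmul (A $ o1 $ o1) (E1 o1) $ i $ j" by (simp add: E1_nth)
qed

lemma Rm_mult: "Rm o1 t ** A = (\<chi> i j. (if i = o1 then complex_of_real (sqrt (1 - t\<^sup>2)) else 1) * A $ i $ j)"
proof (rule cmat_eqI)
  fix i j
  have "(Rm o1 t ** A) $ i $ j = (\<Sum>k\<in>UNIV. if k = i then (if i = o1 then complex_of_real (sqrt (1 - t\<^sup>2)) else 1) * A $ i $ j else 0)"
    unfolding matmul_nth by (intro sum.cong) (auto simp: Rm_nth)
  then show "(Rm o1 t ** A) $ i $ j = (\<chi> i j. (if i = o1 then complex_of_real (sqrt (1 - t\<^sup>2)) else 1) * A $ i $ j) $ i $ j" by simp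
qed

lemma Rm_sq: assumes "0 \<le> t" "t < 1" shows "Rm o1 t ** Rm o1 t = mat 1 - csmul (complex_of_real (t\<^sup>2)) (E1 o1)"
proof -
  have "t\<^sup>2 \<le> 1" using assms by (simp add: power_le_one)
  then have "complex_of_real (sqrt (1 - t\<^sup>2)) * complex_of_real (sqrt (1 - t\<^sup>2)) = 1 - (complex_of_real t)\<^sup>2"
    by (simp flip: of_real_mult)
  then show ?thesis by (intro cmat_eqI) (auto simp: Rm_mult Rm_nth E1_nth)
qed

lemma E1_Rm: "E1 o1 ** Rm o1 t = csmul (complex_of_real (sqrt (1 - t\<^sup>2))) (E1 o1)"
  "Rm o1 t ** E1 o1 = csmul (complex_of_real (sqrt (1 - t\<^sup>2))) (E1 o1)"
proof -
  show 2: "Rm o1 t ** E1 o1 = csmul (complex_of_real (sqrt (1 - t\<^sup>2))) (E1 o1)"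
    by (intro cmat_eqI) (auto simp: Rm_mult E1_nth)
  have "E1 o1 ** Rm o1 t = transpose (Rm o1 t ** E1 o1)" by (simp add: matrix_transpose_mul)
  also have "\<dots> = csmul (complex_of_real (sqrt (1 - t\<^sup>2))) (E1 o1)"
    unfolding 2 by (intro cmat_eqI) (auto simp: E1_nth)
  finally show "E1 o1 ** Rm o1 t = csmul (complex_of_real (sqrt (1 - t\<^sup>2))) (E1 o1)" .
qed

lemma mob_denominator:
  assumes "0 \<le> t" "t < 1" "psd (Vm y)" shows "1 + complex_of_real t * y $ o1 $ o1 \<noteq> 0"
proof
  assume "1 + complex_of_real t * y $ o1 $ o1 = 0"
  then have "complex_of_real t * y $ o1 $ o1 = -1" by (simp add: add_eq_0_iff)
  then have "t * cmod (y $ o1 $ o1) = 1" using assms(1) by (metis abs_of_nonneg norm_minus_cancel norm_mult norm_of_real norm_one)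
  moreover have "t * cmod (y $ o1 $ o1) \<le> t * 1"
    using psd_Vm_row(2)[OF assms(3)] assms(1) by (intro mult_left_mono) auto
  ultimately show False using assms by simp
qed

lemma csmul_one [simp]: "csmul 1 A = A" by (rule cmat_eqI) simp

lemma csmul_diff: "csmul c (A - B) = csmul c A - csmul c B"
  by (rule cmat_eqI) (simp add: right_diff_distrib)

lemma matmul_zero: "(0 :: ('n::finite) cmat) ** A = 0" "A ** (0 :: 'n cmat) = 0"
  by (simp_all add: bounded_bilinear.zero_left[OF bounded_bilinear_matmul] bounded_bilinear.zero_right[OF bounded_bilinear_matmul])

lemma linear_transpose: "linear (transpose :: ('n::finite) cmat \<Rightarrow> 'n cmat)"
  by (rule linearI; rule cmat_eqI) simp_all

lemma has_derivative_transpose: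
  "(f has_derivative f') F \<Longrightarrow> ((\<lambda>x. transpose (f x :: ('n::finite) cmat)) has_derivative (\<lambda>h. transpose (f' h))) F"
  using bounded_linear.has_derivative linear_transpose linear_conv_bounded_linear by blast

lemma transpose_csmul: "transpose (csmul c A) = csmul c (transpose A)"
  by (rule cmat_eqI) simp

lemma Vm_frame_conj:
  assumes p: "Vm_frame p z" and V: "Vm z' = N ** Vm z ** cadj N" shows "Vm_frame (\<lambda>a. N *v p a) z'"
  unfolding Vm_frame_def
proof (intro allI)
  fix i j
  have "Vm z' $ i $ j = (\<Sum>m\<in>UNIV. (\<Sum>l\<in>UNIV. N $ i $ l * (\<Sum>a\<in>UNIV. p a $ l * cnj (p a $ m))) * cnj (N $ j $ m))"
    using p unfolding V by (simp add: matmul_nth Vm_frame_def)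
  also have "\<dots> = (\<Sum>m\<in>UNIV. \<Sum>l\<in>UNIV. \<Sum>a\<in>UNIV. N $ i $ l * p a $ l * cnj (N $ j $ m * p a $ m))"
    by (simp add: sum_distrib_left sum_distrib_right mult_ac)
  also have "\<dots> = (\<Sum>m\<in>UNIV. \<Sum>a\<in>UNIV. \<Sum>l\<in>UNIV. N $ i $ l * p a $ l * cnj (N $ j $ m * p a $ m))"
    by (intro sum.cong refl sum.swap)
  also have "\<dots> = (\<Sum>a\<in>UNIV. \<Sum>m\<in>UNIV. \<Sum>l\<in>UNIV. N $ i $ l * p a $ l * cnj (N $ j $ m * p a $ m))"
    by (rule sum.swap)
  also have "\<dots> = (\<Sum>a\<in>UNIV. (N *v p a) $ i * cnj ((N *v p a) $ j))"
    by (simp only: matvec_nth cnj_sum sum_distrib_left sum_distrib_right)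
  finally show "Vm z' $ i $ j = (\<Sum>a\<in>UNIV. (N *v p a) $ i * cnj ((N *v p a) $ j))" .
qed

context
  fixes o1 :: "'n::finite" and t :: real
  assumes t: "0 \<le> t" "t < 1"
begin

lemma mobM_mult: "transpose y = y \<Longrightarrow> mobM o1 t y ** y = y - csmul (tau o1 t y) (y ** E1 o1 ** y)"
  by (simp add: mobM_def matmul_diff_left csmul_matmul)

lemma transpose_mobM: "transpose y = y \<Longrightarrow> transpose (mobM o1 t y) = mat 1 - csmul (tau o1 t y) (E1 o1 ** y)"
proof -
  assume y: "transpose y = y"
  have "transpose (y ** E1 o1) = E1 o1 ** y" using y by (simp add: matrix_transpose_mul)
  then have "(y ** E1 o1) $ i $ j = (E1 o1 ** y) $ j $ i" for i j by (metis transpose_nth)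
  then show ?thesis by (intro cmat_eqI) (auto simp: mobM_def)
qed

text \<open>Sherman-Morrison: E y E is y_11 times E, so products of y E with itself stay
  proportional to y E.\<close>

lemma mobM_inverse:
  assumes "1 + complex_of_real t * y $ o1 $ o1 \<noteq> 0"
  shows "mobM o1 t y ** (mat 1 + csmul (complex_of_real t) (y ** E1 o1)) = mat 1"
proof -
  let ?a = "y $ o1 $ o1" and ?T = "tau o1 t y" and ?t = "complex_of_real t"
  have 1: "(y ** E1 o1) ** (y ** E1 o1) = csmul ?a (y ** E1 o1)"
  proof -
    have "(y ** E1 o1) ** (y ** E1 o1) = y ** (E1 o1 ** y ** E1 o1)" by (simp add: matrix_mul_assoc)
    then show ?thesis unfolding E1_sandwich by (simp add: csmul_matmul)
  qed
  have k: "?t - ?T - ?T * (?t * ?a) = 0" using assms by (simp add: tau_def field_simps)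
  have "csmul ?t (y ** E1 o1) - (csmul ?T (y ** E1 o1) + csmul (?T * (?t * ?a)) (y ** E1 o1))
    = csmul (?t - ?T - ?T * (?t * ?a)) (y ** E1 o1)"
    by (intro cmat_eqI) (simp add: algebra_simps)
  then have "csmul ?t (y ** E1 o1) - (csmul ?T (y ** E1 o1) + csmul (?T * (?t * ?a)) (y ** E1 o1)) = 0"
    unfolding k by simp
  moreover have "mobM o1 t y ** (mat 1 + csmul ?t (y ** E1 o1))
    = mat 1 + (csmul ?t (y ** E1 o1) - (csmul ?T (y ** E1 o1) + csmul (?T * (?t * ?a)) (y ** E1 o1)))"
    by (simp add: mobM_def matmul_diff_left matmul_add csmul_matmul csmul_csmul 1 csmul_add csmul_diff mult_ac)
  ultimately show ?thesis by simp
qed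

text \<open>The cocycle identity behind the invariance: \<open>Vm\<close> is conjugated by the
  matrix \<open>Rm o1 t ** mobM o1 t y\<close>, which is also the one by which the differential of
  the map acts.\<close>

lemma Vm_mob0:
  assumes y: "transpose y = y" and nz: "1 + complex_of_real t * y $ o1 $ o1 \<noteq> 0"
  shows "Vm (mob0 o1 t y) = (Rm o1 t ** mobM o1 t y) ** Vm y ** cadj (Rm o1 t ** mobM o1 t y)"
proof -
  define R where "R = Rm o1 t"
  define E where "E = (E1 o1 :: 'n cmat)"
  define M where "M = mobM o1 t y"
  define T where "T = tau o1 t y"
  define s where "s = complex_of_real t"
  define q where "q = complex_of_real (sqrt (1 - t\<^sup>2))"
  define w where "w = M ** y"
  have Rr: "cadj R = R" "R ** R = mat 1 - csmul (s * s) E" "E ** R = csmul q E" "R ** E = csmul q E"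
    using Rm_sq[OF t, of o1] E1_Rm by (auto simp: R_def E_def s_def q_def power2_eq_square)
  have cE: "cadj E = E" and EE: "E ** E = E" and cs: "cnj s = s" "cnj q = q"
    using E1_sandwich[of o1 "mat 1"] by (auto simp: E_def s_def q_def)
  have XE: "X ** E ** E = X ** E" "X ** E ** R = csmul q (X ** E)" "X ** R ** E = csmul q (X ** E)"
    "X ** R ** R = X - csmul (s * s) (X ** E)" for X
  proof -
    have a: "X ** E ** E = X ** (E ** E)" "X ** E ** R = X ** (E ** R)" "X ** R ** E = X ** (R ** E)"
      "X ** R ** R = X ** (R ** R)"
      by (rule matrix_mul_assoc[symmetric])+
    show "X ** E ** E = X ** E" "X ** E ** R = csmul q (X ** E)" "X ** R ** E = csmul q (X ** E)"
      "X ** R ** R = X - csmul (s * s) (X ** E)"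
      unfolding a EE Rr by (simp_all add: csmul_matmul matmul_diff_right)
  qed
  have yEyE: "y ** E ** y ** E = csmul (y $ o1 $ o1) (y ** E)"
  proof -
    have "y ** E ** y ** E = y ** (E ** y ** E)" by (simp add: matrix_mul_assoc)
    also have "E ** y ** E = csmul (y $ o1 $ o1) E" using E1_sandwich[of o1 y] by (simp add: E_def)
    finally show ?thesis by (simp add: csmul_matmul)
  qed
  have g: "mob0 o1 t y = csmul s E + R ** w ** R"
    by (simp add: mob0_def w_def M_def mobM_mult[OF y] R_def E_def s_def csmul_of_real)
  have cg: "cadj (mob0 o1 t y) = csmul s E + R ** cadj w ** R"
    unfolding g by (simp add: cadj_add cadj_csmul cE cs cadj_mult Rr matrix_mul_assoc)
  have M: "M = mat 1 - csmul T (y ** E)" by (simp add: M_def mobM_def T_def E_def)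
  \<comment> \<open>By the choice of \<open>tau\<close>, T = s (1 - T y_11). This rewrites every
    term with the constant s into one with T, so that both sides are expressed in the same
    monomials.\<close>
  have wE: "csmul s (w ** E) = csmul T (y ** E)"
  proof -
    have k: "s * (1 - T * y $ o1 $ o1) = T"
      using nz by (simp add: T_def tau_def s_def field_simps)
    have "csmul s (y ** E - csmul (T * y $ o1 $ o1) (y ** E)) = csmul (s * (1 - T * y $ o1 $ o1)) (y ** E)"
      by (intro cmat_eqI) (simp add: algebra_simps)
    then have "csmul s (y ** E - csmul (T * y $ o1 $ o1) (y ** E)) = csmul T (y ** E)" unfolding k .
    then show ?thesis unfolding w_def M
      by (simp add: matmul_diff_left csmul_matmul yEyE csmul_csmul)
  qed
  have Ew: "csmul s (E ** cadj w) = csmul (cnj T) (E ** cadj y)"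
    using arg_cong[OF wE, of cadj] by (simp add: cadj_csmul cadj_mult cE cs)
  have "mob0 o1 t y ** cadj (mob0 o1 t y)
    = csmul (s * s) E + csmul s (E ** R ** cadj w ** R) + csmul s (R ** w ** R ** E) + R ** w ** (R ** R) ** cadj w ** R"
    unfolding cg unfolding g by (simp add: matmul_add csmul_matmul csmul_csmul EE matrix_mul_assoc csmul_add add_ac)
  also have "csmul s (E ** R ** cadj w ** R) = csmul q (csmul s (E ** cadj w) ** R)"
    by (simp add: Rr csmul_matmul csmul_csmul mult.commute)
  also have "csmul s (R ** w ** R ** E) = csmul q (R ** csmul s (w ** E))"
    by (simp add: XE csmul_matmul csmul_csmul mult.commute matrix_mul_assoc)
  also have "R ** w ** (R ** R) ** cadj w ** R = R ** w ** cadj w ** R - R ** csmul s (w ** E) ** csmul s (E ** cadj w) ** R"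
    by (simp add: Rr XE matmul_diff_left matmul_diff_right csmul_matmul csmul_csmul matrix_mul_assoc)
  finally have L: "mob0 o1 t y ** cadj (mob0 o1 t y) = csmul (s * s) E + csmul q (csmul (cnj T) (E ** cadj y) ** R)
      + csmul q (R ** csmul T (y ** E)) + (R ** w ** cadj w ** R - R ** csmul T (y ** E) ** csmul (cnj T) (E ** cadj y) ** R)"
    unfolding wE Ew .
  have cM: "cadj M = mat 1 - csmul (cnj T) (E ** cadj y)"
    by (simp add: M cadj_diff cadj_csmul cadj_mult cE)
  have "(R ** M) ** Vm y ** cadj (R ** M) = R ** M ** cadj M ** R - R ** (M ** y) ** cadj (M ** y) ** R"
    by (simp add: Vm_def cadj_mult Rr matmul_diff_left matmul_diff_right matrix_mul_assoc)
  also have "R ** M ** cadj M ** R = R ** R - csmul q (csmul (cnj T) (E ** cadj y) ** R) - csmul q (R ** csmul T (y ** E))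
      + R ** csmul T (y ** E) ** csmul (cnj T) (E ** cadj y) ** R"
  proof -
    have a: "R ** (E ** cadj y) = csmul q (E ** cadj y)" by (simp add: matrix_mul_assoc Rr csmul_matmul)
    have b: "y ** E ** R = csmul q (y ** E)" by (rule XE)
    have "R ** M ** cadj M ** R = R ** R - csmul (cnj T) (R ** (E ** cadj y) ** R) - csmul T (R ** (y ** E ** R))
      + R ** csmul T (y ** E) ** csmul (cnj T) (E ** cadj y) ** R"
      unfolding cM unfolding M
      by (simp add: matmul_diff_left matmul_diff_right csmul_matmul csmul_diff csmul_csmul mult_ac matrix_mul_assoc)
    then show ?thesis unfolding a b by (simp add: csmul_matmul csmul_csmul mult.commute)
  qed
  finally have Rt: "(R ** M) ** Vm y ** cadj (R ** M) = R ** R - csmul q (csmul (cnj T) (E ** cadj y) ** R) - csmul q (R ** csmul T (y ** E))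
      + R ** csmul T (y ** E) ** csmul (cnj T) (E ** cadj y) ** R - R ** w ** cadj w ** R"
    by (simp add: w_def)
  have "Vm (mob0 o1 t y) = (R ** M) ** Vm y ** cadj (R ** M)"
    unfolding Rt Vm_def[of "mob0 o1 t y"] L Rr(2) by (simp add: algebra_simps)
  then show ?thesis by (simp add: R_def M_def)
qed

lemma transpose_mob0: "transpose y = y \<Longrightarrow> transpose (mob0 o1 t y) = mob0 o1 t y"
proof -
  assume y: "transpose y = y"
  let ?w = "y - csmul (tau o1 t y) (y ** E1 o1 ** y)"
  have "transpose (y ** E1 o1 ** y) = y ** E1 o1 ** y" using y by (simp add: matrix_transpose_mul matrix_mul_assoc)
  then have "(y ** E1 o1 ** y) $ j $ i = (y ** E1 o1 ** y) $ i $ j" "y $ j $ i = y $ i $ j" for i j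
    using y by (metis transpose_nth)+
  then have w: "transpose ?w = ?w" by (intro cmat_eqI) auto
  have "transpose (Rm o1 t ** ?w ** Rm o1 t) = Rm o1 t ** ?w ** Rm o1 t"
    using w by (simp add: matrix_transpose_mul matrix_mul_assoc)
  then have "(Rm o1 t ** ?w ** Rm o1 t) $ j $ i = (Rm o1 t ** ?w ** Rm o1 t) $ i $ j" for i j
    by (metis transpose_nth)
  then show ?thesis by (intro cmat_eqI) (auto simp: mob0_def E1_nth)
qed

lemma mob0_II:
  assumes y: "y \<in> II" shows "mob0 o1 t y \<in> II"
proof -
  have ty: "transpose y = y" and V: "hpos_def (Vm y)" using y by (auto simp: II_iff)
  have nz: "1 + complex_of_real t * y $ o1 $ o1 \<noteq> 0" by (rule mob_denominator[OF t hpos_psd[OF V]])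
  have t2: "t\<^sup>2 < 1" using t by (simp add: abs_square_less_1)
  have inj: "x = 0" if x: "cadj (Rm o1 t ** mobM o1 t y) *v x = 0" for x
  proof -
    have "cadj (mobM o1 t y) *v (Rm o1 t *v x) = 0" using x by (simp add: cadj_mult matrix_vector_mul_assoc)
    moreover have "cadj (mat 1 + csmul (complex_of_real t) (y ** E1 o1)) ** cadj (mobM o1 t y) = mat 1"
      using arg_cong[OF mobM_inverse[OF nz], of cadj] by (simp add: cadj_mult)
    ultimately have R0: "Rm o1 t *v x = 0"
      by (metis matrix_vector_mul_assoc matrix_vector_mul_lid matrix_vector_mult_0_right)
    have "(Rm o1 t *v x) $ i = (if i = o1 then complex_of_real (sqrt (1 - t\<^sup>2)) else 1) * x $ i" for i
    proof -
      have "(Rm o1 t *v x) $ i = (\<Sum>k\<in>UNIV. if k = i then (if i = o1 then complex_of_real (sqrt (1 - t\<^sup>2)) else 1) * x $ i else 0)"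
        unfolding matvec_nth by (intro sum.cong) (auto simp: Rm_nth)
      then show ?thesis by simp
    qed
    then have x0: "(if i = o1 then complex_of_real (sqrt (1 - t\<^sup>2)) else 1) * x $ i = 0" for i using R0 by simp
    have "complex_of_real (sqrt (1 - t\<^sup>2)) \<noteq> 0" using t2 by simp
    then have "x $ i = 0" for i using x0[of i] by (cases "i = o1") auto
    then show "x = 0" by (simp add: vec_eq_iff)
  qed
  show ?thesis unfolding II_iff Vm_mob0[OF ty nz]
    using transpose_mob0[OF ty] hpos_conj[OF V, of "Rm o1 t ** mobM o1 t y"] inj by blast
qed

lemma continuous_on_mob0:
  "continuous_on (closure II) (mob0 o1 t)"
proof -
  have "continuous_on (closure II) (tau o1 t)"
    unfolding tau_def[abs_def] using mob_denominator[OF t closure_II(2)]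
    by (intro continuous_intros) auto
  then show ?thesis unfolding mob0_def[abs_def] by (intro continuous_intros)
qed

lemma mob0_closure: "y \<in> closure II \<Longrightarrow> mob0 o1 t y \<in> closure II"
proof -
  have "mob0 o1 t ` closure II \<subseteq> closure II"
    by (rule image_closure_subset) (auto intro!: continuous_on_mob0 subsetD[OF closure_subset] mob0_II)
  then show "y \<in> closure II \<Longrightarrow> mob0 o1 t y \<in> closure II" by blast
qed

text \<open>The differential in factored form v -> N v N^t with N = R M. The product rule delivers
  an unfactored sum, which \<open>mob1_eq\<close> brings into this shape.\<close>

definition mob1 :: "'n cmat \<Rightarrow> 'n cmat \<Rightarrow> 'n cmat" where
  "mob1 z v = Rm o1 t ** (mobM o1 t (symm z) ** symm v ** transpose (mobM o1 t (symm z))) ** Rm o1 t"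

definition dmobM :: "'n cmat \<Rightarrow> 'n cmat \<Rightarrow> 'n cmat" where
  "dmobM y s = csmul ((tau o1 t y)\<^sup>2 * s $ o1 $ o1) (y ** E1 o1) - csmul (tau o1 t y) (s ** E1 o1)"

definition mob2 :: "'n cmat \<Rightarrow> 'n cmat \<Rightarrow> 'n cmat \<Rightarrow> 'n cmat" where
  "mob2 z w v = Rm o1 t ** (dmobM (symm z) (symm w) ** symm v ** transpose (mobM o1 t (symm z))
     + mobM o1 t (symm z) ** symm v ** transpose (dmobM (symm z) (symm w))) ** Rm o1 t"

lemma has_derivative_tau:
  assumes z: "z \<in> Om"
  shows "((\<lambda>z. tau o1 t (symm z)) has_derivative (\<lambda>v. - ((tau o1 t (symm z))\<^sup>2 * symm v $ o1 $ o1))) (at z)"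
proof -
  have nz: "1 + complex_of_real t * symm z $ o1 $ o1 \<noteq> 0"
    using z by (intro mob_denominator[OF t hpos_psd]) (simp add: Om_def II_iff)
  let ?d = "\<lambda>z. 1 + complex_of_real t * symm z $ o1 $ o1"
  have "(?d has_derivative (\<lambda>v. 0 + complex_of_real t * symm v $ o1 $ o1)) (at z)"
    by (intro has_derivative_add has_derivative_const has_derivative_mult_right has_derivative_cmat_nth has_derivative_symm)
  then have D: "((\<lambda>z. complex_of_real t * inverse (?d z)) has_derivative
      (\<lambda>v. complex_of_real t * - (inverse (?d z) * (0 + complex_of_real t * symm v $ o1 $ o1) * inverse (?d z)))) (at z)"
    by (intro has_derivative_mult_right Deriv.has_derivative_inverse nz)
  have eq: "complex_of_real t * - (inverse (?d z) * (0 + complex_of_real t * symm v $ o1 $ o1) * inverse (?d z))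
    = - ((tau o1 t (symm z))\<^sup>2 * symm v $ o1 $ o1)" for v
    by (simp add: tau_def power2_eq_square)
  show ?thesis using D unfolding eq tau_def[symmetric] .
qed

lemma has_derivative_mobM:
  assumes z: "z \<in> Om"
  shows "((\<lambda>z. mobM o1 t (symm z)) has_derivative (\<lambda>v. dmobM (symm z) (symm v))) (at z)"
proof -
  have "((\<lambda>z. mat 1 - csmul (tau o1 t (symm z)) (symm z ** E1 o1)) has_derivative
    (\<lambda>v. 0 - (csmul (tau o1 t (symm z)) (symm z ** 0 + symm v ** E1 o1) +
      csmul (- ((tau o1 t (symm z))\<^sup>2 * symm v $ o1 $ o1)) (symm z ** E1 o1)))) (at z)"
    by (intro has_derivative_diff has_derivative_const has_derivative_csmul has_derivative_tau z
        has_derivative_matmul has_derivative_symm)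
  moreover have "0 - (csmul (tau o1 t (symm z)) (symm z ** 0 + symm v ** E1 o1) +
      csmul (- ((tau o1 t (symm z))\<^sup>2 * symm v $ o1 $ o1)) (symm z ** E1 o1)) = dmobM (symm z) (symm v)" for v
    by (rule cmat_eqI) (simp add: dmobM_def matmul_zero)
  ultimately show ?thesis by (simp add: mobM_def)
qed

lemma mob1_eq:
  assumes z: "symm z = y" and s: "symm v = s"
  shows "Rm o1 t ** (s - (csmul (tau o1 t y) (y ** E1 o1 ** s + s ** E1 o1 ** y)
    + csmul (- ((tau o1 t y)\<^sup>2 * s $ o1 $ o1)) (y ** E1 o1 ** y))) ** Rm o1 t = mob1 z v"
proof -
  have ty: "transpose y = y" using z transpose_symm by metis
  have "y ** (E1 o1 ** s ** E1 o1) ** y = csmul (s $ o1 $ o1) (y ** E1 o1 ** y)"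
    unfolding E1_sandwich by (simp add: csmul_matmul)
  then have 1: "y ** E1 o1 ** s ** E1 o1 ** y = csmul (s $ o1 $ o1) (y ** E1 o1 ** y)"
    by (simp add: matrix_mul_assoc)
  have "mobM o1 t y ** s ** transpose (mobM o1 t y) = s - csmul (tau o1 t y) (s ** E1 o1 ** y)
     - (csmul (tau o1 t y) (y ** E1 o1 ** s) - csmul (tau o1 t y * tau o1 t y) (y ** E1 o1 ** s ** E1 o1 ** y))"
    unfolding transpose_mobM[OF ty] unfolding mobM_def
    by (simp add: matmul_diff_left matmul_diff_right csmul_matmul csmul_csmul csmul_diff matrix_mul_assoc)
  also have "\<dots> = s - (csmul (tau o1 t y) (y ** E1 o1 ** s + s ** E1 o1 ** y)
    + csmul (- ((tau o1 t y)\<^sup>2 * s $ o1 $ o1)) (y ** E1 o1 ** y))"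
    unfolding 1 by (intro cmat_eqI) (simp add: algebra_simps power2_eq_square)
  finally show ?thesis by (simp add: mob1_def z s)
qed

lemma has_derivative_mob:
  assumes z: "z \<in> Om"
  shows "(mob o1 t has_derivative mob1 z) (at z)"
proof -
  let ?y = "symm z"
  have "((\<lambda>z. t *\<^sub>R E1 o1 + Rm o1 t ** (symm z - csmul (tau o1 t (symm z)) (symm z ** E1 o1 ** symm z)) ** Rm o1 t) has_derivative
    (\<lambda>v. 0 + (Rm o1 t ** (?y - csmul (tau o1 t ?y) (?y ** E1 o1 ** ?y)) ** 0
      + (Rm o1 t ** (symm v - (csmul (tau o1 t ?y) (?y ** E1 o1 ** symm v + (?y ** 0 + symm v ** E1 o1) ** ?y)
          + csmul (- ((tau o1 t ?y)\<^sup>2 * symm v $ o1 $ o1)) (?y ** E1 o1 ** ?y)))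
        + 0 ** (?y - csmul (tau o1 t ?y) (?y ** E1 o1 ** ?y))) ** Rm o1 t))) (at z)"
    by (intro has_derivative_add has_derivative_diff has_derivative_const has_derivative_csmul has_derivative_tau z
        has_derivative_matmul has_derivative_symm)
  moreover have "0 + (Rm o1 t ** (?y - csmul (tau o1 t ?y) (?y ** E1 o1 ** ?y)) ** 0
      + (Rm o1 t ** (symm v - (csmul (tau o1 t ?y) (?y ** E1 o1 ** symm v + (?y ** 0 + symm v ** E1 o1) ** ?y)
          + csmul (- ((tau o1 t ?y)\<^sup>2 * symm v $ o1 $ o1)) (?y ** E1 o1 ** ?y)))
        + 0 ** (?y - csmul (tau o1 t ?y) (?y ** E1 o1 ** ?y))) ** Rm o1 t) = mob1 z v" for v
    unfolding matmul_zero add_0_left add_0_right by (rule mob1_eq[OF refl refl])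
  ultimately show ?thesis by (simp add: mob_def[abs_def] mob0_def)
qed

lemma has_derivative_mob1:
  assumes z: "z \<in> Om"
  shows "((\<lambda>z. mob1 z v) has_derivative (\<lambda>w. mob2 z w v)) (at z)"
proof -
  let ?M = "\<lambda>z. mobM o1 t (symm z)" and ?D = "\<lambda>w. dmobM (symm z) (symm w)"
  have "((\<lambda>z. Rm o1 t ** (?M z ** symm v ** transpose (?M z)) ** Rm o1 t) has_derivative
    (\<lambda>w. Rm o1 t ** (?M z ** symm v ** transpose (?M z)) ** 0
      + (Rm o1 t ** (?M z ** symm v ** transpose (?D w) + (?M z ** 0 + ?D w ** symm v) ** transpose (?M z))
        + 0 ** (?M z ** symm v ** transpose (?M z))) ** Rm o1 t)) (at z)"
    by (intro has_derivative_matmul has_derivative_const has_derivative_transpose has_derivative_mobM z)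
  then show ?thesis
    unfolding matmul_zero add_0_left add_0_right by (simp add: mob1_def mob2_def add.commute)
qed

lemma continuous_on_mob2: "continuous_on Om (\<lambda>z. mob2 z w v)"
proof -
  have T: "continuous_on Om (\<lambda>z. tau o1 t (symm z))"
    by (intro continuous_at_imp_continuous_on ballI has_derivative_continuous[OF has_derivative_tau])
  have M: "continuous_on Om (\<lambda>z. mobM o1 t (symm z))"
    by (intro continuous_at_imp_continuous_on ballI has_derivative_continuous[OF has_derivative_mobM])
  show ?thesis unfolding mob2_def dmobM_def by (intro continuous_intros T M)
qed

lemma mob1_csmul: "mob1 z (csmul c v) = csmul c (mob1 z v)"
  by (simp add: mob1_def symm_csmul csmul_matmul)

lemma dmobM_csmul: "dmobM y (csmul c s) = csmul c (dmobM y s)"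
  by (rule cmat_eqI) (simp add: dmobM_def csmul_matmul algebra_simps)

lemma mob2_csmul: "mob2 z (csmul c w) v = csmul c (mob2 z w v)" "mob2 z w (csmul c v) = csmul c (mob2 z w v)"
  by (simp_all add: mob2_def symm_csmul dmobM_csmul transpose_csmul csmul_matmul csmul_add[symmetric])

lemma mob1_sym:
  assumes "transpose v = v" shows "mob1 z v = act (Rm o1 t ** mobM o1 t (symm z)) v"
  using assms by (simp add: mob1_def symm_id act_def matrix_transpose_mul matrix_mul_assoc)

text \<open>The map is holomorphic, so the Levi form simply pulls back. Its differential and the
  change of \<open>Vm\<close> are governed by one matrix N, so frames go to frames and the equation
  is preserved.\<close>

lemma harm_mob:
  assumes f: "harm f f1 f2 h"
  obtains F1 F2 where "harm (\<lambda>z. f (mob o1 t z)) F1 F2 (\<lambda>z. h (mob0 o1 t z))"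
    "\<And>z v w. z \<in> II \<Longrightarrow> transpose v = v \<Longrightarrow> transpose w = w \<Longrightarrow> levi (F2 z) v w
      = levi (f2 (mob0 o1 t z)) (act (Rm o1 t ** mobM o1 t z) v) (act (Rm o1 t ** mobM o1 t z) w)"
proof -
  let ?F1 = "\<lambda>z v. f1 (mob o1 t z) (mob1 z v)"
  let ?F2 = "\<lambda>z w v. f2 (mob o1 t z) (mob1 z w) (mob1 z v) + f1 (mob o1 t z) (mob2 z w v)"
  have mobOm: "mob o1 t z \<in> Om" if "z \<in> Om" for z
    using that mob0_II[of "symm z"] II_sub_Om by (simp add: mob_def Om_def)
  have C: "C2_on Om (\<lambda>z. f (mob o1 t z)) ?F1 ?F2"
    by (rule C2_on_compose[OF harmD(1)[OF f] open_Om mobOm has_derivative_mob has_derivative_mob1 continuous_on_mob2])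
  have L: "levi (?F2 z) v w = levi (f2 (mob0 o1 t z)) (act (Rm o1 t ** mobM o1 t z) v) (act (Rm o1 t ** mobM o1 t z) w)"
    if z: "z \<in> II" and v: "transpose v = v" and w: "transpose w = w" for z v w
  proof -
    have sz: "symm z = z" using z by (simp add: symm_id II_iff)
    have "levi (?F2 z) v w = levi (f2 (mob o1 t z)) (mob1 z v) (mob1 z w)"
      by (rule levi_pullback[OF C2_on_linear1[OF harmD(1)[OF f] mobOm[OF II_sub_Om[OF z]]]])
        (simp_all add: mob1_csmul mob2_csmul)
    then show ?thesis by (simp add: mob1_sym[OF v] mob1_sym[OF w] mob_def sz)
  qed
  have "harm (\<lambda>z. f (mob o1 t z)) ?F1 ?F2 (\<lambda>z. h (mob0 o1 t z))"
    unfolding harm_def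
  proof (intro conjI C ballI allI impI)
    fix z :: "'n cmat" assume z: "z \<in> II"
    have tz: "transpose z = z" and V: "hpos_def (Vm z)" using z by (auto simp: II_iff)
    have nz: "1 + complex_of_real t * z $ o1 $ o1 \<noteq> 0" by (rule mob_denominator[OF t hpos_psd[OF V]])
    show "h (mob0 o1 t z) = f (mob o1 t z)"
      using harmD(4)[OF f mob0_II[OF z]] by (simp add: mob_def symm_id tz)
    fix p assume p: "Vm_frame p z"
    show "lapl (?F2 z) p = 0"
      using harmD(2)[OF f mob0_II[OF z] Vm_frame_conj[OF p Vm_mob0[OF tz nz]]]
      by (simp add: lapl_def L[OF z] act_Tm)
  next
    show "continuous_on (closure II) (\<lambda>z. h (mob0 o1 t z))"
      by (rule continuous_on_compose2[OF harmD(3)[OF f] continuous_on_mob0]) (auto intro: mob0_closure)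
  qed
  then show ?thesis using L by (rule that)
qed

end

subsection \<open>Symmetric unitary matrices\<close>

definition cnjv :: "complex^'n \<Rightarrow> complex^'n" where "cnjv x = (\<chi> i. cnj (x $ i))"

lemma cnjv_nth [simp]: "cnjv x $ i = cnj (x $ i)"
  by (simp add: cnjv_def)

lemma matvec_add: "(A :: ('n::finite) cmat) *v (x + y) = A *v x + A *v y"
  by (simp add: matrix_vector_right_distrib)

lemma matvec_smult: "(A :: ('n::finite) cmat) *v (c *s x) = c *s (A *v x)"
  by (simp add: vec_eq_iff matvec_nth sum_distrib_left mult_ac)

lemma inner_cvec: "(x :: complex^'n) \<bullet> y = Re (hf (mat 1) x y)"
  by (simp add: inner_vec_def hf_matvec inner_complex_def)

lemma smult_of_real: "complex_of_real r *s x = r *\<^sub>R (x :: complex^'n)"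
  by (simp add: vec_eq_iff scaleR_conv_of_real[where 'a=complex])

text \<open>Takagi factorization. For symmetric unitary \<open>z\<close> the map \<open>c\<close> is
  an antilinear isometric involution. Inner products are real on its fixed space R, so an
  orthonormal real basis of R is a unitary basis; its vectors are the columns of \<open>l\<close>,
  and z conj(l) = l gives z = l l^t.\<close>

lemma symmetric_unitary_factor:
  fixes z :: "('n::finite) cmat"
  assumes tz: "transpose z = z" and u: "z ** cadj z = mat 1"
  obtains l where "l \<in> Ug" "z = act l (mat 1)"
proof -
  define c where "c x = z *v cnjv x" for x
  have c_add: "c (x + y) = c x + c y" for x y
  proof -
    have "cnjv (x + y) = cnjv x + cnjv y" by (simp add: vec_eq_iff)
    then show ?thesis by (simp add: c_def matvec_add)
  qed
  have c_smult: "c (a *s x) = cnj a *s c x" for a x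
  proof -
    have "cnjv (a *s x) = cnj a *s cnjv x" by (simp add: vec_eq_iff)
    then show ?thesis by (simp add: c_def matvec_smult)
  qed
  have cadj_z: "cadj z $ i $ j = cnj (z $ i $ j)" for i j using tz by (metis cadj_nth transpose_nth)
  have sym_coord: "c (c x) = x" for x
  proof -
    have "cnjv (z *v cnjv x) = cadj z *v x"
      by (simp add: vec_eq_iff matvec_nth cnj_sum cadj_z del: cadj_nth)
    then show ?thesis using u by (simp add: c_def matrix_vector_mul_assoc)
  qed
  have hc: "hf (mat 1) (c x) (c y) = cnj (hf (mat 1) x y)" for x y
  proof -
    have "hf (cadj z ** mat 1 ** cadj (cadj z)) (cnjv x) (cnjv y) = hf (mat 1) (c x) (c y)"
      by (subst hf_conj) (simp add: c_def)
    moreover have "cadj z ** mat 1 ** cadj (cadj z) = mat 1"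
      using u by (simp add: matrix_left_right_inverse)
    moreover have "hf (mat 1) (cnjv x) (cnjv y) = cnj (hf (mat 1) x y)"
      by (simp add: hf_matvec cnj_sum)
    ultimately show ?thesis by simp
  qed
  define R where "R = {x. c x = x}"
  have "subspace R"
    unfolding subspace_def R_def
    using c_add c_smult[of "complex_of_real r" for r] c_smult[of 0 0] by (auto simp: smult_of_real)
  then obtain B where B: "B \<subseteq> R" "pairwise orthogonal B" "\<And>x. x \<in> B \<Longrightarrow> norm x = 1" "independent B"
      "card B = dim R" "span B = R"
    using orthonormal_basis_subspace by blast
  have finB: "finite B" using B(4) independent_imp_finite by blast
  have H: "hf (mat 1) x y = (if x = y then 1 else 0)" if "x \<in> B" "y \<in> B" for x y
  proof -
    have "c x = x" "c y = y" using that B(1) by (auto simp: R_def)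
    then have "cnj (hf (mat 1) x y) = hf (mat 1) x y" using hc[of x y] by simp
    then have im: "Im (hf (mat 1) x y) = 0" by (metis cnj.sel(2) neg_equal_zero)
    have "Re (hf (mat 1) x y) = (if x = y then 1 else 0)"
      using that B(2,3) inner_cvec[of x y] by (auto simp: pairwise_def orthogonal_def hf_mat1)
    then show ?thesis using im by (auto simp: complex_eq_iff)
  qed
  have hs: "hf (mat 1) x (\<Sum>y\<in>B. f y *s y) = (\<Sum>y\<in>B. f y * hf (mat 1) x y)" for x f
  proof -
    have z: "hf (mat 1) x 0 = 0" by (simp add: hf_matvec)
    show ?thesis using finB by (induction B) (auto simp: hf_add_right hf_smult_right z)
  qed
  have "vec.independent B"
  proof (rule vec.independent_if_scalars_zero[OF finB])
    fix f x assume s: "(\<Sum>x\<in>B. f x *s x) = 0" and x: "x \<in> B"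
    have "hf (mat 1) x (\<Sum>y\<in>B. f y *s y) = (\<Sum>y\<in>B. if y = x then f x else 0)"
      unfolding hs by (intro sum.cong refl) (auto simp: H x)
    then show "f x = 0" unfolding s using x finB by (simp add: hf_matvec)
  qed
  moreover have "vec.span B = vec.span UNIV"
  proof -
    have RB: "R \<subseteq> vec.span B"
    proof -
      have "span B \<subseteq> vec.span B"
      proof (rule span_minimal)
        show "B \<subseteq> vec.span B" by (rule vec.span_superset)
        show "subspace (vec.span B)"
          unfolding subspace_def
          by (auto simp: vec.span_zero vec.span_add smult_of_real[symmetric] vec.span_scale)
      qed
      then show ?thesis using B(6) by simp
    qed
    have "x \<in> vec.span B" for x
    proof -
      \<comment> \<open>The real and imaginary parts of \<open>x\<close> with respect to the
        involution; both are fixed by it.\<close>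
      define y1 y2 where "y1 = (1/2) *s (x + c x)" and "y2 = (-\<i>/2) *s (x + (-1) *s c x)"
      have "y1 \<in> R" "y2 \<in> R"
        unfolding R_def mem_Collect_eq y1_def y2_def c_smult c_add sym_coord by (simp_all add: vec_eq_iff algebra_simps)
      then have "y1 + \<i> *s y2 \<in> vec.span B" using RB by (intro vec.span_add vec.span_scale) auto
      moreover have "y1 + \<i> *s y2 = x" by (simp add: y1_def y2_def vec_eq_iff algebra_simps)
      ultimately show ?thesis by simp
    qed
    then show ?thesis by auto
  qed
  ultimately have "card B = CARD('n)" using vec.dim_eq_card vec_dim_card by metis
  then obtain e where e: "bij_betw e (UNIV :: 'n set) B"
    using finB by (metis finite_class.finite_UNIV finite_same_card_bij)
  have eB: "e j \<in> B" for j using e bij_betwE by blast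
  have einj: "e j = e k \<longleftrightarrow> j = k" for j k using e by (metis UNIV_I bij_betw_imp_inj_on inj_on_eq_iff)
  define l :: "'n cmat" where "l = (\<chi> i j. e j $ i)"
  have "cadj l ** l = mat 1"
  proof (rule cmat_eqI)
    fix j k
    have "(cadj l ** l) $ j $ k = hf (mat 1) (e j) (e k)" by (simp add: l_def matmul_nth hf_matvec)
    then show "(cadj l ** l) $ j $ k = mat 1 $ j $ k" by (simp add: H eB einj)
  qed
  then have l: "l \<in> Ug" by (simp add: Ug_iff')
  have ct: "cadj (transpose l) = transpose (cadj l)" by (rule cmat_eqI) simp
  have "z ** transpose (cadj l) = l"
  proof (rule cmat_eqI)
    fix i j
    have "(z ** transpose (cadj l)) $ i $ j = c (e j) $ i"
      by (simp add: l_def matmul_nth c_def matvec_nth)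
    also have "c (e j) = e j" using eB B(1) by (auto simp: R_def)
    finally show "(z ** transpose (cadj l)) $ i $ j = l $ i $ j" by (simp add: l_def)
  qed
  then have "z ** (transpose (cadj l) ** transpose l) = l ** transpose l" by (simp add: matrix_mul_assoc)
  moreover have "transpose (cadj l) ** transpose l = mat 1"
    using l by (simp add: matrix_transpose_mul[symmetric] Ug_iff)
  ultimately have "z = act l (mat 1)" by (simp add: act_def)
  then show ?thesis using l that by blast
qed

subsection \<open>The Hua equation at the origin\<close>

abbreviation ax :: "'n \<Rightarrow> complex^'n" where "ax i \<equiv> axis i 1"

text \<open>One factor of the symmetric product is contracted over an orthonormal basis and the
  other is left free. These are Hua's second order operators at the origin; their trace over a
  further orthonormal basis is the Laplacian.\<close>

definition hua_form :: "(('n::finite) cmat \<Rightarrow> 'n cmat \<Rightarrow> complex) \<Rightarrow> complex^'n \<Rightarrow> complex^'n \<Rightarrow> complex" where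
  "hua_form B x y = (\<Sum>a\<in>UNIV. levi B (Tm x (ax a)) (Tm y (ax a)))"

lemma Tm_add: "Tm (x + y) w = Tm x w + Tm y w" "Tm w (x + y) = Tm w x + Tm w y"
  by (auto intro!: cmat_eqI simp: Tm_nth algebra_simps)

lemma Tm_smult: "Tm (c *s x) w = csmul c (Tm x w)" "Tm w (c *s x) = csmul c (Tm w x)"
  by (auto intro!: cmat_eqI simp: Tm_nth algebra_simps)

lemma Tm_zero: "Tm 0 w = 0" "Tm w 0 = 0"
  by (auto intro!: cmat_eqI simp: Tm_nth)

lemma Tm_sum: "Tm w (\<Sum>i\<in>I. c i *s x i) = (\<Sum>i\<in>I. csmul (c i) (Tm w (x i)))"
  by (induction I rule: infinite_finite_induct) (auto simp: Tm_add Tm_smult Tm_zero)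

lemma matvec_expand: "(k :: ('n::finite) cmat) *v y = (\<Sum>i\<in>UNIV. y $ i *s (k *v ax i))"
  by (simp add: vec_eq_iff sum_component matvec_axis) (simp add: matvec_nth mult.commute)

lemma vec_expand: "(y :: complex^'n) = (\<Sum>i\<in>UNIV. y $ i *s ax i)"
  using matvec_expand[of "mat 1" y] by simp

lemma levi_Tm_sesq:
  assumes B: "bilinear B"
  shows "levi B (Tm w (\<Sum>i\<in>I. c i *s x i)) (Tm w' (\<Sum>j\<in>J. d j *s y j))
    = (\<Sum>i\<in>I. \<Sum>j\<in>J. c i * cnj (d j) * levi B (Tm w (x i)) (Tm w' (y j)))"
  unfolding Tm_sum levi_sum_left[OF B] unfolding levi_sum_right[OF B]
  by (intro sum.cong refl) (simp add: levi_csmul_left[OF B] levi_csmul_right[OF B])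

text \<open>The basis enters only through the entries of \<open>k ** cadj k\<close>, so any
  orthonormal basis gives the same contraction.\<close>

lemma levi_unitary_sum:
  assumes B: "bilinear B" and k: "k \<in> Ug"
  shows "(\<Sum>a\<in>UNIV. levi B (Tm x (k *v ax a)) (Tm y (k *v ax a))) = hua_form B x y"
proof -
  have kk: "(\<Sum>a\<in>UNIV. k $ i $ a * cnj (k $ j $ a)) = (if i = j then 1 else 0)" for i j
  proof -
    have "(\<Sum>a\<in>UNIV. k $ i $ a * cnj (k $ j $ a)) = (k ** cadj k) $ i $ j" by (simp add: matmul_nth)
    then show ?thesis using k by (simp add: Ug_iff)
  qed
  have "levi B (Tm x (k *v ax a)) (Tm y (k *v ax a))
    = (\<Sum>i\<in>UNIV. \<Sum>j\<in>UNIV. k $ i $ a * cnj (k $ j $ a) * levi B (Tm x (ax i)) (Tm y (ax j)))" for a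
  proof -
    have e: "k *v ax a = (\<Sum>i\<in>UNIV. k $ i $ a *s ax i)"
      using vec_expand[of "k *v ax a"] by (simp only: matvec_axis)
    show ?thesis unfolding e by (rule levi_Tm_sesq[OF B])
  qed
  then have "(\<Sum>a\<in>UNIV. levi B (Tm x (k *v ax a)) (Tm y (k *v ax a)))
    = (\<Sum>a\<in>UNIV. \<Sum>i\<in>UNIV. \<Sum>j\<in>UNIV. k $ i $ a * cnj (k $ j $ a) * levi B (Tm x (ax i)) (Tm y (ax j)))" by simp
  also have "\<dots> = (\<Sum>i\<in>UNIV. \<Sum>a\<in>UNIV. \<Sum>j\<in>UNIV. k $ i $ a * cnj (k $ j $ a) * levi B (Tm x (ax i)) (Tm y (ax j)))"
    by (rule sum.swap)
  also have "\<dots> = (\<Sum>i\<in>UNIV. \<Sum>j\<in>UNIV. \<Sum>a\<in>UNIV. k $ i $ a * cnj (k $ j $ a) * levi B (Tm x (ax i)) (Tm y (ax j)))"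
    by (intro sum.cong refl sum.swap)
  also have "\<dots> = (\<Sum>i\<in>UNIV. \<Sum>j\<in>UNIV. if j = i then levi B (Tm x (ax i)) (Tm y (ax i)) else 0)"
    by (intro sum.cong refl) (auto simp: kk sum_distrib_right[symmetric])
  also have "\<dots> = hua_form B x y" by (simp add: hua_form_def)
  finally show ?thesis .
qed

lemma hua_form_sesq:
  fixes k :: "('n::finite) cmat"
  assumes B: "bilinear B"
  shows "hua_form B (k *v y) (k *v y) = (\<Sum>i\<in>UNIV. \<Sum>j\<in>UNIV. y $ i * cnj (y $ j) * hua_form B (k *v ax i) (k *v ax j))"
proof -
  have "levi B (Tm (k *v y) (ax a)) (Tm (k *v y) (ax a))
    = (\<Sum>i\<in>UNIV. \<Sum>j\<in>UNIV. y $ i * cnj (y $ j) * levi B (Tm (k *v ax i) (ax a)) (Tm (k *v ax j) (ax a)))" for a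
    unfolding matvec_expand[of k y] Tm_commute[of _ "ax a"] by (rule levi_Tm_sesq[OF B])
  then have "hua_form B (k *v y) (k *v y)
    = (\<Sum>a\<in>UNIV. \<Sum>i\<in>UNIV. \<Sum>j\<in>UNIV. y $ i * cnj (y $ j) * levi B (Tm (k *v ax i) (ax a)) (Tm (k *v ax j) (ax a)))"
    by (simp add: hua_form_def)
  also have "\<dots> = (\<Sum>i\<in>UNIV. \<Sum>a\<in>UNIV. \<Sum>j\<in>UNIV. y $ i * cnj (y $ j) * levi B (Tm (k *v ax i) (ax a)) (Tm (k *v ax j) (ax a)))"
    by (rule sum.swap)
  also have "\<dots> = (\<Sum>i\<in>UNIV. \<Sum>j\<in>UNIV. \<Sum>a\<in>UNIV. y $ i * cnj (y $ j) * levi B (Tm (k *v ax i) (ax a)) (Tm (k *v ax j) (ax a)))"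
    by (intro sum.cong refl sum.swap)
  finally show ?thesis by (simp add: hua_form_def sum_distrib_left)
qed

lemma act_zero [simp]: "act k 0 = 0"
  using linear_0[OF linear_act] .

lemma Vm_frame_zero: "Vm_frame ax (0 :: ('n::finite) cmat)"
  unfolding Vm_frame_def
proof (intro allI)
  fix i j :: 'n
  have "(\<Sum>a\<in>UNIV. ax a $ i * cnj (ax a $ j)) = (\<Sum>a\<in>UNIV. if a = i then (if i = j then 1 else 0) else (0::complex))"
    by (intro sum.cong) (auto simp: axis_def)
  then show "Vm 0 $ i $ j = (\<Sum>a\<in>UNIV. ax a $ i * cnj (ax a $ j))" by (simp add: Vm_def matmul_nth)
qed

lemma hua_form_trace:
  assumes f: "harm f f1 f2 h" and k: "k \<in> Ug"
  shows "(\<Sum>i\<in>UNIV. hua_form (f2 0) (k *v ax i) (k *v ax i)) = 0"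
proof -
  have B: "bilinear (f2 0)" by (rule C2_on_bilinear[OF harmD(1)[OF f] II_sub_Om[OF zero_II]])
  have "(\<Sum>i\<in>UNIV. hua_form (f2 0) (k *v ax i) (k *v ax i)) = lapl (f2 0) (\<lambda>a. k *v ax a)"
    unfolding lapl_def levi_unitary_sum[OF B k] ..
  also have "\<dots> = 0"
    using harmD(2)[OF f zero_II] Vm_frame_act[OF k Vm_frame_zero] by simp
  finally show ?thesis .
qed

lemma continuous_on_Tm_left [continuous_intros]:
  "continuous_on S f \<Longrightarrow> continuous_on S (\<lambda>x. Tm (f x) (w :: complex^('n::finite)))"
  unfolding Tm_def outer_def
  by (intro continuous_intros continuous_on_cmatI) (auto intro!: continuous_intros)

lemma continuous_on_levi:
  assumes B: "bilinear B" and "continuous_on S f" "continuous_on S g"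
  shows "continuous_on S (\<lambda>x. levi B (f x) (g x))"
proof -
  have hua_form: "bounded_bilinear B" using B by (simp add: bilinear_conv_bounded_bilinear)
  show ?thesis unfolding levi_def
    by (intro continuous_intros bounded_bilinear.continuous_on[OF hua_form] assms) auto
qed

lemma continuous_on_hua_form:
  assumes B: "bilinear B"
  shows "continuous_on S (\<lambda>k :: ('n::finite) cmat. hua_form B (k *v x) (k *v y))"
  unfolding hua_form_def by (intro continuous_on_sum continuous_on_levi[OF B] continuous_intros)

text \<open>The function is known to vanish on \<open>II\<close>, not on the open set
  \<open>Om\<close>; hence only derivatives along symmetric directions are concluded to
  vanish.\<close>

lemma harm_zero_second:
  assumes f: "harm f f1 f2 h" and 0: "\<And>y. y \<in> II \<Longrightarrow> f y = 0"
    and z: "z \<in> II" and v: "transpose v = v" and w: "transpose w = w"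
  shows "f2 z w v = 0"
proof -
  note C = harmD(1)[OF f]
  have f1: "f1 y v = 0" if y: "y \<in> II" for y
  proof -
    obtain r where r: "r > 0" "\<And>t. \<bar>t\<bar> < r \<Longrightarrow> y + t *\<^sub>R v \<in> II" using sym_line_II[OF y v] by blast
    have D: "((\<lambda>t. f (y + t *\<^sub>R v)) has_vector_derivative f1 y v) (at 0)"
      using C2_on_line(1)[OF C, of y 0 v] II_sub_Om[OF y] by simp
    have "((\<lambda>t. 0) has_vector_derivative f1 y v) (at 0)"
      by (rule has_vector_derivative_transform_within_open[OF D, of "ball 0 r"]) (use r 0 in auto)
    then show ?thesis using vector_derivative_unique_at has_vector_derivative_const by blast
  qed
  obtain r where r: "r > 0" "\<And>t. \<bar>t\<bar> < r \<Longrightarrow> z + t *\<^sub>R w \<in> II" using sym_line_II[OF z w] by blast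
  have D: "((\<lambda>t. f1 (z + t *\<^sub>R w) v) has_vector_derivative f2 z w v) (at 0)"
    using C2_on_line(2)[OF C, of z 0 w v] II_sub_Om[OF z] by simp
  have "((\<lambda>t. 0) has_vector_derivative f2 z w v) (at 0)"
    by (rule has_vector_derivative_transform_within_open[OF D, of "ball 0 r"]) (use r f1 in auto)
  then show ?thesis using vector_derivative_unique_at has_vector_derivative_const by blast
qed

text \<open>Sign changes, and the transpositions below, are real orthogonal and so fix
  \<open>mat 1\<close> under \<open>act\<close>. They supply the part of Schur's lemma that is
  needed for the moments of the Hua form.\<close>

definition flip :: "'n \<Rightarrow> ('n::finite) cmat" where
  "flip i = (\<chi> r s. if r = s then (if r = i then -1 else 1) else 0)"

definition swapm :: "'n \<Rightarrow> 'n \<Rightarrow> ('n::finite) cmat" where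
  "swapm i j = (\<chi> r s. if r = Transposition.transpose i j s then 1 else 0)"

lemma ax_nth: "ax a $ i = (if i = a then 1 else 0)"
  by (simp add: axis_def)

lemma flip_ax: "flip i *v ax j = (if j = i then -1 else 1) *s ax j"
  by (auto simp: vec_eq_iff matvec_axis flip_def ax_nth)

lemma swapm_ax: "swapm i j *v ax i = ax j"
  by (auto simp: vec_eq_iff matvec_axis swapm_def ax_nth)

lemma flip_sq: "flip i ** transpose (flip i) = mat 1" "cadj (flip i) = transpose (flip i)"
proof -
  show "flip i ** transpose (flip i) = mat 1"
  proof (rule cmat_eqI)
    fix r s
    have "(flip i ** transpose (flip i)) $ r $ s = (\<Sum>k\<in>UNIV. if k = r then (if r = s then 1 else 0) else 0)"
      unfolding matmul_nth by (intro sum.cong) (auto simp: flip_def)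
    then show "(flip i ** transpose (flip i)) $ r $ s = mat 1 $ r $ s" by simp
  qed
  show "cadj (flip i) = transpose (flip i)" by (rule cmat_eqI) (simp add: flip_def)
qed

lemma swapm_sq: "swapm i j ** transpose (swapm i j) = mat 1" "cadj (swapm i j) = transpose (swapm i j)"
proof -
  show "swapm i j ** transpose (swapm i j) = mat 1"
  proof (rule cmat_eqI)
    fix r s
    have "(swapm i j ** transpose (swapm i j)) $ r $ s
      = (\<Sum>k\<in>UNIV. if k = Transposition.transpose i j r then (if r = s then 1 else 0) else 0)"
      unfolding matmul_nth by (intro sum.cong) (auto simp: swapm_def)
    then show "(swapm i j ** transpose (swapm i j)) $ r $ s = mat 1 $ r $ s" by simp
  qed
  show "cadj (swapm i j) = transpose (swapm i j)" by (rule cmat_eqI) (simp add: swapm_def)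
qed

lemma flip_Ug: "flip i \<in> Ug" and act_flip: "act (k ** flip i) (mat 1) = act k (mat 1)"
  unfolding Ug_iff act_act[symmetric] by (simp_all add: flip_sq act_def)

lemma swapm_Ug: "swapm i j \<in> Ug" and act_swapm: "act (k ** swapm i j) (mat 1) = act k (mat 1)"
  unfolding Ug_iff act_act[symmetric] by (simp_all add: swapm_sq act_def)

text \<open>The weight is the conjugate of a Hua entry, so the same entry of the average at the
  origin is the mean of a squared modulus. On the Shilov boundary the average is a combination of
  the moments \<open>P i j\<close> of the boundary values. These vanish, so by the maximum principle
  the average is 0, and strict positivity of the mean finishes.\<close>

lemma hua_zero:
  fixes k0 :: "('n::finite) cmat"
  assumes f: "harm f f1 f2 h" and k0: "k0 \<in> Ug"
  shows "hua_form (f2 0) (k0 *v ax o1) (k0 *v ax o1) = 0"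
proof -
  have B: "bilinear (f2 0)" by (rule C2_on_bilinear[OF harmD(1)[OF f] II_sub_Om[OF zero_II]])
  define b where "b k i j = hua_form (f2 0) (k *v ax i) (k *v ax j)" for k :: "'n cmat" and i j
  have cb: "continuous_on Ug (\<lambda>k. b k i j)" for i j unfolding b_def by (rule continuous_on_hua_form[OF B])
  define c where "c k = cnj (b k o1 o1)" for k
  have sym_coord: "continuous_on Ug c" unfolding c_def[abs_def] by (intro continuous_intros cb)
  have H: "harm (haar_avg c f) (haar_avg1 c f1) (haar_avg2 c f2) (haar_avg c h)" by (rule harm_haar_avg[OF f sym_coord])
  have "haar_avg c h x = 0" if x: "x \<in> closure II" "Vm x = 0" for x
  proof -
    have "x ** cadj x = mat 1" using x(2) by (simp add: Vm_def)
    then obtain l where l: "l \<in> Ug" "x = act l (mat 1)"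
      using symmetric_unitary_factor closure_II(1)[OF x(1)] by blast
    have "act (cadj l) x = mat 1"
      unfolding l(2) act_act using l(1) by (simp add: Ug_iff' act_def)
    then have one: "(mat 1 :: 'n cmat) \<in> closure II" using act_closure_II[OF Ug_cadj[OF l(1)] x(1)] by simp
    have ch: "continuous_on Ug (\<lambda>k. h (act k (mat 1)))"
      by (rule continuous_on_compose2[OF harmD(3)[OF f]])
        (auto intro!: continuous_intros act_closure_II one)
    \<comment> \<open>Sign changes force the moments with distinct indices to be 0, transpositions
      make the diagonal ones equal, and their sum is 0 because the trace of the Hua form is the
      Laplacian.\<close>
    define P where "P i j = haar_mean (\<lambda>k. cnj (b k i j) * h (act k (mat 1)))" for i j
    have cP: "continuous_on Ug (\<lambda>k. cnj (b k i j) * h (act k (mat 1)))" for i j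
      by (intro continuous_intros cb ch)
    have P1: "P i j = 0" if ij: "i \<noteq> j" for i j
    proof -
      have "P i j = haar_mean (\<lambda>k. cnj (b (k ** flip i) i j) * h (act (k ** flip i) (mat 1)))"
        unfolding P_def by (rule haar_mean_right[OF cP flip_Ug, symmetric])
      also have "\<dots> = haar_mean (\<lambda>k. (-1) * (cnj (b k i j) * h (act k (mat 1))))"
      proof -
        have "b (k ** flip i) i j = - b k i j" for k
          unfolding b_def hua_form_def matrix_vector_mul_assoc[symmetric] flip_ax matvec_smult Tm_smult
          using ij by (simp add: levi_csmul_left[OF B] levi_csmul_right[OF B] sum_negf)
        then show ?thesis by (simp add: act_flip)
      qed
      also have "\<dots> = - P i j" unfolding P_def by (subst haar_mean_cmul[OF cP]) simp
      finally show ?thesis by simp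
    qed
    have P2: "P i i = P j j" for i j
    proof -
      have "P i i = haar_mean (\<lambda>k. cnj (b (k ** swapm i j) i i) * h (act (k ** swapm i j) (mat 1)))"
        unfolding P_def by (rule haar_mean_right[OF cP swapm_Ug, symmetric])
      also have "\<dots> = P j j" unfolding P_def act_swapm
        by (simp add: b_def matrix_vector_mul_assoc[symmetric] swapm_ax)
      finally show ?thesis .
    qed
    have "(\<Sum>i\<in>UNIV. P i i) = haar_mean (\<lambda>k. \<Sum>i\<in>UNIV. cnj (b k i i) * h (act k (mat 1)))"
      unfolding P_def by (rule haar_mean_sum[symmetric]) (auto intro: cP)
    also have "\<dots> = 0"
    proof (rule haar_mean_eq_const)
      fix k :: "'n cmat" assume k: "k \<in> Ug"
      have "(\<Sum>i\<in>UNIV. cnj (b k i i) * h (act k (mat 1))) = cnj (\<Sum>i\<in>UNIV. b k i i) * h (act k (mat 1))"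
        by (simp add: cnj_sum sum_distrib_right)
      then show "(\<Sum>i\<in>UNIV. cnj (b k i i) * h (act k (mat 1))) = 0"
        unfolding b_def hua_form_trace[OF f k] by simp
    qed
    finally have "(\<Sum>i\<in>UNIV. P i i) = 0" .
    moreover have "(\<Sum>i\<in>UNIV. P i i) = of_nat CARD('n) * P j j" for j
    proof -
      have "(\<Sum>i\<in>UNIV. P i i) = (\<Sum>i\<in>(UNIV :: 'n set). P j j)" by (intro sum.cong refl P2)
      then show ?thesis by simp
    qed
    ultimately have P0: "P i j = 0" for i j using P1 by (cases "i = j") auto
    \<comment> \<open>For x = l l^t the factor \<open>l\<close> is moved from the argument into the
      weight, where it turns the axis into \<open>y\<close>; sesquilinearity then expresses the
      average through the moments.\<close>
    define y where "y = cadj l *v ax o1"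
    define F where "F k = (\<Sum>i\<in>UNIV. \<Sum>j\<in>UNIV. (cnj (y $ i) * y $ j) * (cnj (b k i j) * h (act k (mat 1))))" for k
    have cF: "continuous_on Ug F" unfolding F_def[abs_def] by (intro continuous_intros cb ch)
    have "haar_avg c h x = haar_mean (\<lambda>k. F (k ** l))"
    proof -
      have "c k * h (act k x) = F (k ** l)" for k
      proof -
        have "(k ** l) *v y = k *v ax o1"
          unfolding y_def using l(1) by (simp add: matrix_vector_mul_assoc matrix_mul_assoc[symmetric] Ug_iff)
        then have "b k o1 o1 = (\<Sum>i\<in>UNIV. \<Sum>j\<in>UNIV. y $ i * cnj (y $ j) * b (k ** l) i j)"
          unfolding b_def using hua_form_sesq[OF B, of "k ** l" y] by simp
        then have "c k = (\<Sum>i\<in>UNIV. \<Sum>j\<in>UNIV. (cnj (y $ i) * y $ j) * cnj (b (k ** l) i j))"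
          by (simp add: c_def cnj_sum)
        then show ?thesis by (simp add: F_def l(2) act_act sum_distrib_right mult.assoc)
      qed
      then show ?thesis by (simp add: haar_avg_def)
    qed
    also have "\<dots> = haar_mean F" by (rule haar_mean_right[OF cF l(1)])
    also have "\<dots> = (\<Sum>i\<in>UNIV. \<Sum>j\<in>UNIV. (cnj (y $ i) * y $ j) * P i j)"
      unfolding F_def[abs_def]
      by (subst haar_mean_sum, simp, intro continuous_intros cb ch, intro sum.cong refl,
          subst haar_mean_sum, simp, intro continuous_intros cb ch) (simp add: P_def haar_mean_cmul[OF cP])
    also have "\<dots> = 0" by (simp add: P0)
    finally show ?thesis .
  qed
  then have "haar_avg c h z = 0" if "z \<in> II" for z using max_principle[OF H] that by blast
  then have z0: "haar_avg c f z = 0" if "z \<in> II" for z using harmD(4)[OF H] that by metis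
  have L0: "levi (haar_avg2 c f2 0) (Tm x w) (Tm y w') = 0" for x y w w'
  proof -
    have tc: "transpose (csmul \<i> (Tm x w)) = csmul \<i> (Tm x w)" for x w :: "complex^'n"
      by (rule cmat_eqI) (simp add: Tm_nth algebra_simps)
    show ?thesis unfolding levi_def
      by (simp add: harm_zero_second[OF H z0 zero_II] tc)
  qed
  have "0 = (\<Sum>a\<in>UNIV. levi (haar_avg2 c f2 0) (Tm (ax o1) (ax a)) (Tm (ax o1) (ax a)))" by (simp add: L0)
  also have "\<dots> = (\<Sum>a\<in>UNIV. haar_mean (\<lambda>k. c k * levi (f2 (act k 0)) (act k (Tm (ax o1) (ax a))) (act k (Tm (ax o1) (ax a)))))"
    by (simp only: levi_haar_avg2[OF f sym_coord II_sub_Om[OF zero_II]])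
  also have "\<dots> = haar_mean (\<lambda>k. \<Sum>a\<in>UNIV. c k * levi (f2 (act k 0)) (act k (Tm (ax o1) (ax a))) (act k (Tm (ax o1) (ax a))))"
    by (rule haar_mean_sum[symmetric, OF finite]) (rule continuous_levi_act[OF f sym_coord II_sub_Om[OF zero_II]])
  also have "\<dots> = haar_mean (\<lambda>k. complex_of_real ((cmod (b k o1 o1))\<^sup>2))"
  proof (rule haar_mean_cong)
    show "continuous_on Ug (\<lambda>k. \<Sum>a\<in>UNIV. c k * levi (f2 (act k 0)) (act k (Tm (ax o1) (ax a))) (act k (Tm (ax o1) (ax a))))"
      by (intro continuous_on_sum continuous_levi_act[OF f sym_coord II_sub_Om[OF zero_II]])
    fix k :: "'n cmat" assume k: "k \<in> Ug"
    show "(\<Sum>a\<in>UNIV. c k * levi (f2 (act k 0)) (act k (Tm (ax o1) (ax a))) (act k (Tm (ax o1) (ax a))))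
      = complex_of_real ((cmod (b k o1 o1))\<^sup>2)"
      unfolding act_Tm act_zero sum_distrib_left[symmetric] levi_unitary_sum[OF B k] complex_norm_square
      by (simp add: c_def b_def mult.commute)
  qed
  finally have "haar_mean (\<lambda>k. complex_of_real ((cmod (b k o1 o1))\<^sup>2)) = 0" by simp
  then have "(cmod (b k0 o1 o1))\<^sup>2 = 0"
    by (intro haar_mean_eq_0_imp[OF _ _ _ k0]) (auto intro!: continuous_intros cb)
  then show ?thesis by (simp add: b_def)
qed

text \<open>The Hua equation at 0 is applied to the function composed with the transvection. Its
  differential at 0 is the action of \<open>Rm o1 t\<close>, which scales the axis \<open>o1\<close>
  by the square root of 1 - t^2 and fixes the others; one common factor cancels.\<close>

lemma hua_rank_one:
  fixes o1 :: "'n::finite"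
  assumes f: "harm f f1 f2 h" and t: "0 \<le> t" "t < 1"
  shows "complex_of_real (1 - t\<^sup>2) * levi (f2 (t *\<^sub>R E1 o1)) (Tm (ax o1) (ax o1)) (Tm (ax o1) (ax o1))
    + (\<Sum>a\<in>UNIV - {o1}. levi (f2 (t *\<^sub>R E1 o1)) (Tm (ax o1) (ax a)) (Tm (ax o1) (ax a))) = 0"
proof -
  obtain F1 F2 where F: "harm (\<lambda>z. f (mob o1 t z)) F1 F2 (\<lambda>z. h (mob0 o1 t z))"
    "\<And>z v w. z \<in> II \<Longrightarrow> transpose v = v \<Longrightarrow> transpose w = w \<Longrightarrow> levi (F2 z) v w
      = levi (f2 (mob0 o1 t z)) (act (Rm o1 t ** mobM o1 t z) v) (act (Rm o1 t ** mobM o1 t z) w)"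
    using harm_mob[OF t f] by blast
  let ?z = "t *\<^sub>R E1 o1"
  have z: "?z \<in> II" using t by (intro scaleR_E1_II) auto
  have B: "bilinear (f2 ?z)" by (rule C2_on_bilinear[OF harmD(1)[OF f] II_sub_Om[OF z]])
  have c0: "csmul c 0 = (0 :: 'n cmat)" for c by simp
  have m0: "mob0 o1 t 0 = ?z" and M0: "mobM o1 t 0 = mat 1"
    by (simp_all add: mob0_def mobM_def matmul_zero)
  define q where "q = complex_of_real (sqrt (1 - t\<^sup>2))"
  have q2: "q * cnj q = complex_of_real (1 - t\<^sup>2)"
  proof -
    have "t\<^sup>2 \<le> 1" using t by (simp add: power_le_one)
    then show ?thesis by (simp add: q_def del: of_real_diff flip: of_real_mult)
  qed
  have q0: "q * cnj q \<noteq> 0"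
  proof -
    have "t\<^sup>2 < 1" using t by (simp add: abs_square_less_1)
    then have "1 - t\<^sup>2 \<noteq> 0" by simp
    then show ?thesis unfolding q2 of_real_eq_0_iff .
  qed
  have R1: "Rm o1 t *v ax a = (if a = o1 then q else 1) *s ax a" for a
    by (auto simp: vec_eq_iff matvec_axis Rm_nth ax_nth q_def)
  have "0 = (\<Sum>a\<in>UNIV. levi (F2 0) (Tm (ax o1) (ax a)) (Tm (ax o1) (ax a)))"
    using hua_zero[OF F(1) Ug_one, of o1] by (simp add: hua_form_def)
  also have "\<dots> = (\<Sum>a\<in>UNIV. levi (f2 ?z) (Tm (Rm o1 t *v ax o1) (Rm o1 t *v ax a)) (Tm (Rm o1 t *v ax o1) (Rm o1 t *v ax a)))"
    by (simp add: F(2)[OF zero_II] m0 M0 act_Tm)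
  also have "\<dots> = (\<Sum>a\<in>UNIV. (q * cnj q) * ((if a = o1 then q * cnj q else 1) * levi (f2 ?z) (Tm (ax o1) (ax a)) (Tm (ax o1) (ax a))))"
    unfolding R1 by (intro sum.cong refl) (auto simp: Tm_smult csmul_csmul levi_csmul_left[OF B] levi_csmul_right[OF B])
  also have "\<dots> = (q * cnj q) * ((q * cnj q) * levi (f2 ?z) (Tm (ax o1) (ax o1)) (Tm (ax o1) (ax o1))
    + (\<Sum>a\<in>UNIV - {o1}. levi (f2 ?z) (Tm (ax o1) (ax a)) (Tm (ax o1) (ax a))))"
    unfolding sum_distrib_left[symmetric] by (subst sum.remove[of UNIV o1]) auto
  finally show ?thesis using q0 unfolding q2 by simp
qed

subsection \<open>The radial equation\<close>

lemma has_vector_derivative_eq: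
  assumes "(g has_vector_derivative X) (at s)" "(h has_vector_derivative Y) (at s)" "\<And>t. g t = h t"
  shows "X = Y"
proof -
  have "g = h" using assms(3) by blast
  then show ?thesis using assms(1,2) vector_derivative_unique_at by metis
qed

lemma haar_mean_linear_combination:
  assumes "continuous_on Ug F" "continuous_on Ug G" "continuous_on Ug H"
  shows "haar_mean (\<lambda>k. c * (x * F k + y * G k + w * H k)) = c * (x * haar_mean F + y * haar_mean G + w * haar_mean H)"
proof -
  have c: "continuous_on Ug (\<lambda>k. x * F k)" "continuous_on Ug (\<lambda>k. y * G k)" "continuous_on Ug (\<lambda>k. w * H k)"
    using assms by (auto intro!: continuous_intros)
  have c2: "continuous_on Ug (\<lambda>k. x * F k + y * G k)" using c by (auto intro!: continuous_intros)
  have c3: "continuous_on Ug (\<lambda>k. x * F k + y * G k + w * H k)" using c by (auto intro!: continuous_intros)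
  show ?thesis
    unfolding haar_mean_cmul[OF c3] haar_mean_add[OF c2 c(3)] haar_mean_add[OF c(1,2)]
    by (simp only: haar_mean_cmul[OF assms(1)] haar_mean_cmul[OF assms(2)] haar_mean_cmul[OF assms(3)])
qed

text \<open>Right invariance moves a unitary matrix from the point to the weight. Differentiating
  this identity along one-parameter families yields the tangential second derivatives of the
  average.\<close>

lemma haar_avg_act:
  assumes f: "harm f f1 f2 h" and c: "continuous_on Ug c" and l: "l \<in> Ug" and z: "z \<in> II"
  shows "haar_avg c f (act l z) = haar_mean (\<lambda>k. c (k ** cadj l) * f (act k z))"
proof -
  have ll: "cadj l ** l = mat 1" using l by (simp add: Ug_iff')
  have c': "continuous_on Ug (\<lambda>k. c (k ** cadj l))"
    by (rule continuous_on_compose2[OF c]) (auto intro!: continuous_intros Ug_mult Ug_cadj l)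
  have fc: "continuous_on Ug (\<lambda>k. f (act k z))"
    by (rule C2_on_continuous[OF harmD(1)[OF f]]) (auto intro!: continuous_intros act_Om II_sub_Om[OF z])
  have ll': "l ** cadj l = mat 1" using l by (simp add: Ug_iff)
  have "haar_mean (\<lambda>k. c ((k ** l) ** cadj l) * f (act (k ** l) z)) = haar_mean (\<lambda>k. c (k ** cadj l) * f (act k z))"
    by (rule haar_mean_right[OF _ l]) (intro continuous_intros c' fc)
  then show ?thesis
    by (simp add: haar_avg_def act_act matrix_mul_assoc[symmetric] ll')
qed

text \<open>Rotation by the angle \<open>s\<close> in the plane of the coordinates \<open>o1\<close>
  and \<open>a\<close>, with phase \<open>e\<close>; it is unitary when \<open>e\<close> has modulus
  1.\<close>

definition rot :: "'n \<Rightarrow> 'n \<Rightarrow> complex \<Rightarrow> real \<Rightarrow> ('n::finite) cmat" where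
  "rot o1 a e s = (\<chi> i j. if i = o1 then (if j = o1 then of_real (cos s) else if j = a then - cnj e * of_real (sin s) else 0)
     else if i = a then (if j = o1 then e * of_real (sin s) else if j = a then of_real (cos s) else 0)
     else if i = j then 1 else 0)"

lemma rot_Ug:
  assumes a: "a \<noteq> o1" and e: "e * cnj e = 1" shows "rot o1 a e s \<in> Ug"
  unfolding Ug_iff
proof (rule cmat_eqI)
  fix i j
  let ?l = "rot o1 a e s"
  let ?f = "\<lambda>k. ?l $ i $ k * cnj (?l $ j $ k)"
  have cs: "complex_of_real (cos s) * complex_of_real (cos s) + complex_of_real (sin s) * complex_of_real (sin s) = 1"
    using sin_cos_squared_add3[of s] by (simp flip: of_real_mult of_real_add)
  have "(?l ** cadj ?l) $ i $ j = sum ?f UNIV" by (simp add: matmul_nth)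
  also have "\<dots> = ?f o1 + (?f a + sum ?f (UNIV - {o1} - {a}))"
    using a by (simp add: sum.remove[of UNIV o1] sum.remove[of "UNIV - {o1}" a])
  also have "sum ?f (UNIV - {o1} - {a}) = (\<Sum>k\<in>UNIV - {o1} - {a}. if k = i then (if i = j then 1 else 0) else 0)"
    by (intro sum.cong refl) (auto simp: rot_def)
  also have "\<dots> = (if i \<noteq> o1 \<and> i \<noteq> a \<and> i = j then 1 else 0)" by auto
  also have "?f o1 + (?f a + (if i \<noteq> o1 \<and> i \<noteq> a \<and> i = j then 1 else 0)) = mat 1 $ i $ j"
  proof -
    have e': "e * (cnj e * x) = x" "cnj e * (e * x) = x" for x
      using e by (metis mult.assoc mult.commute mult_1)+
    show ?thesis
      using a cs by (auto simp: rot_def algebra_simps e')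
  qed
  finally show "(?l ** cadj ?l) $ i $ j = mat 1 $ i $ j" .
qed

lemma rot_ax:
  assumes a: "a \<noteq> o1"
  shows "rot o1 a e s *v ax o1 = of_real (cos s) *s ax o1 + (e * of_real (sin s)) *s ax a"
    "cadj (rot o1 a e s) *v ax o1 = of_real (cos s) *s ax o1 + (- e * of_real (sin s)) *s ax a"
  using a by (auto simp: vec_eq_iff matvec_axis ax_nth rot_def)

text \<open>The quartic form Q of the overview, of bidegree (2,2) in \<open>x\<close>.\<close>

definition rank_one_levi :: "(('n::finite) cmat \<Rightarrow> 'n cmat \<Rightarrow> complex) \<Rightarrow> complex^'n \<Rightarrow> complex" where
  "rank_one_levi B x = levi B (outer x x) (outer x x)"

lemma outer_lin2:
  "outer (c *s x + d *s y) (c *s x + d *s y) = csmul (c * c) (outer x x) + csmul (c * d) (Tm x y) + csmul (d * d) (outer y y)"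
  by (rule cmat_eqI) (simp add: Tm_nth algebra_simps)

lemma rank_one_levi_smult:
  assumes "bilinear B" shows "rank_one_levi B (c *s x) = (c * cnj c)\<^sup>2 * rank_one_levi B x"
proof -
  have "outer (c *s x) (c *s x) = csmul (c * c) (outer x x)" by (rule cmat_eqI) simp
  then show ?thesis using assms
    by (simp add: rank_one_levi_def levi_csmul_left levi_csmul_right power2_eq_square)
qed

text \<open>Averaging over the fourth roots of unity removes all terms whose bidegrees differ.\<close>

lemma rank_one_levi_four:
  assumes B: "bilinear B"
  shows "(\<Sum>e\<in>{1, \<i>, -1, -\<i>}. rank_one_levi B (complex_of_real c *s x + (- e * complex_of_real s) *s y))
    = 4 * (of_real (c ^ 4) * rank_one_levi B x + of_real (c\<^sup>2 * s\<^sup>2) * levi B (Tm x y) (Tm x y) + of_real (s ^ 4) * rank_one_levi B y)"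
proof -
  have d: "(1::complex) \<noteq> \<i>" "(1::complex) \<noteq> -1" "(1::complex) \<noteq> -\<i>" "\<i> \<noteq> -1" "\<i> \<noteq> -\<i>" "-1 \<noteq> -\<i>"
    by (auto simp: complex_eq_iff)
  show ?thesis
    unfolding rank_one_levi_def outer_lin2
    by (simp add: d levi_add_left[OF B] levi_add_right[OF B] levi_csmul_left[OF B] levi_csmul_right[OF B])
      (simp add: algebra_simps power2_eq_square power4_eq_xxxx)
qed

context
  fixes f :: "('n::finite) cmat \<Rightarrow> complex" and f1 f2 h and o1 :: 'n
  assumes f: "harm f f1 f2 h"
begin

text \<open>With this weight the Levi form of the average at the origin along \<open>E1 o1\<close> is the mean of a square.\<close>

definition weight :: "'n cmat \<Rightarrow> complex" where "weight k = cnj (rank_one_levi (f2 0) (k *v ax o1))"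

lemma bilinear_f2_0: "bilinear (f2 0)"
  by (rule C2_on_bilinear[OF harmD(1)[OF f] II_sub_Om[OF zero_II]])

lemma continuous_outer: "continuous_on S x \<Longrightarrow> continuous_on S y \<Longrightarrow> continuous_on S (\<lambda>k. outer (x k) (y k) :: 'n cmat)"
  by (intro continuous_on_cmatI) (auto intro!: continuous_intros)

lemma continuous_rank_one_levi: "continuous_on S x \<Longrightarrow> continuous_on S (\<lambda>k. rank_one_levi (f2 0) (x k))"
  unfolding rank_one_levi_def by (intro continuous_on_levi[OF bilinear_f2_0] continuous_outer)

lemma continuous_weight: "continuous_on Ug weight"
  unfolding weight_def[abs_def] by (intro continuous_intros continuous_rank_one_levi)

abbreviation "U0 \<equiv> haar_avg weight f"
abbreviation "U1 \<equiv> haar_avg1 weight f1"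
abbreviation "U2 \<equiv> haar_avg2 weight f2"

lemma harm_U0: "harm U0 U1 U2 (haar_avg weight h)"
  by (rule harm_haar_avg[OF f continuous_weight])

definition radial :: "real \<Rightarrow> complex" where "radial r = U0 (r *\<^sub>R E1 o1)"
definition radial1 :: "real \<Rightarrow> complex" where "radial1 r = U1 (r *\<^sub>R E1 o1) (E1 o1)"
definition radial2 :: "real \<Rightarrow> complex" where "radial2 r = U2 (r *\<^sub>R E1 o1) (E1 o1) (E1 o1)"

lemma radial_deriv:
  assumes "\<bar>r\<bar> < 1"
  shows "(radial has_vector_derivative radial1 r) (at r)" "(radial1 has_vector_derivative radial2 r) (at r)"
  using C2_on_line[OF harmD(1)[OF harm_U0], of 0 r "E1 o1"] II_sub_Om[OF scaleR_E1_II[OF assms, of o1]]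
  by (simp_all add: radial_def[abs_def] radial1_def[abs_def] radial2_def[abs_def])

text \<open>A scalar \<open>v\<close> with v^2 = w acts on matrices as multiplication by w, and it
  leaves the weight unchanged because Q has bidegree (2,2). On the disc the average thus depends on
  the modulus only.\<close>

lemma radial_phase:
  assumes r: "\<bar>r\<bar> < 1" and th: "cmod w = 1"
  shows "U0 (csmul w (r *\<^sub>R E1 o1)) = radial r"
proof -
  obtain v where v: "v\<^sup>2 = w" using power2_csqrt by blast
  then have cv: "cmod v = 1" using th by (metis norm_power norm_ge_zero power2_eq_imp_eq one_power2 zero_le_one)
  then have vv: "v * cnj v = 1" by (simp add: complex_norm_square[symmetric])
  define l :: "'n cmat" where "l = csmul v (mat 1)"
  have l: "l \<in> Ug" unfolding Ug_iff l_def using vv by (simp add: cadj_csmul csmul_matmul csmul_csmul mult.commute)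
  have "act l z = csmul w z" for z
  proof -
    have "transpose l = csmul v (mat 1)" unfolding l_def by (rule cmat_eqI) auto
    then show ?thesis using v by (simp add: act_def l_def csmul_matmul csmul_csmul power2_eq_square)
  qed
  then have U: "U0 (csmul w (r *\<^sub>R E1 o1)) = haar_mean (\<lambda>k. weight (k ** cadj l) * f (act k (r *\<^sub>R E1 o1)))"
    using haar_avg_act[OF f continuous_weight l scaleR_E1_II[OF r, of o1]] by simp
  have w: "weight (k ** cadj l) = weight k" for k
  proof -
    have "(k ** cadj l) *v ax o1 = cnj v *s (k *v ax o1)"
      by (simp add: l_def cadj_csmul csmul_matmul vec_eq_iff matvec_axis)
    then show ?thesis using vv by (simp add: weight_def rank_one_levi_smult[OF bilinear_f2_0] mult.commute)
  qed
  show ?thesis unfolding U w by (simp add: radial_def haar_avg_def)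
qed

text \<open>The second derivative along the circle of radius r is 0. Its acceleration points
  inwards, which brings in the first radial derivative as in the Laplacian in polar
  coordinates.\<close>

lemma U2_phase:
  assumes r: "\<bar>r\<bar> < 1"
  shows "of_real (r * r) * U2 (r *\<^sub>R E1 o1) (csmul \<i> (E1 o1)) (csmul \<i> (E1 o1)) = of_real r * radial1 r"
proof -
  let ?c = "\<lambda>t. csmul (cis t) (r *\<^sub>R E1 o1 :: 'n cmat)"
  let ?c1 = "\<lambda>t. csmul (\<i> * cis t) (r *\<^sub>R E1 o1 :: 'n cmat)"
  have bl: "bounded_linear (\<lambda>c. csmul c A)" for A :: "'n cmat"
    by (rule bounded_bilinear.bounded_linear_left[OF bounded_bilinear_csmul])
  have cis: "(cis has_vector_derivative \<i> * cis t) (at t)" for t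
    by (auto simp: cis_conv_exp has_vector_derivative_def scaleR_conv_of_real intro!: derivative_eq_intros)
  have c: "(?c has_vector_derivative ?c1 t) (at t)" for t
    by (rule bounded_linear.has_vector_derivative[OF bl cis])
  have "((\<lambda>t. \<i> * cis t) has_vector_derivative \<i> * (\<i> * cis 0)) (at 0)"
    by (rule has_vector_derivative_mult_right[OF cis])
  then have "((\<lambda>t. \<i> * cis t) has_vector_derivative -1) (at 0)" by simp
  then have c1: "(?c1 has_vector_derivative csmul (-1) (r *\<^sub>R E1 o1)) (at 0)"
    by (rule bounded_linear.has_vector_derivative[OF bl])
  have inU: "?c t \<in> Om" for t
  proof -
    have "?c t = csmul (cis t * of_real r) (E1 o1)" by (simp add: csmul_csmul flip: csmul_of_real)
    moreover have "cmod (cis t * of_real r) < 1" using r by (simp add: norm_mult)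
    ultimately show ?thesis using II_sub_Om csmul_E1_II by metis
  qed
  note CU = harmD(1)[OF harm_U0]
  have D1: "((\<lambda>t. U0 (?c t)) has_vector_derivative U1 (?c t) (?c1 t)) (at t)" for t
    by (rule C2_on_curve1[OF CU inU c])
  have const: "U0 (?c t) = radial r" for t by (rule radial_phase[OF r]) simp
  have U1z: "U1 (?c t) (?c1 t) = 0" for t
    by (rule has_vector_derivative_eq[OF D1 has_vector_derivative_const const])
  have D2: "((\<lambda>t. U1 (?c t) (?c1 t)) has_vector_derivative
      U2 (?c 0) (?c1 0) (?c1 0) + U1 (?c 0) (csmul (-1) (r *\<^sub>R E1 o1))) (at 0)"
    by (rule C2_on_curve2[where c="?c" and s=0, OF CU inU c c1])
  have "U2 (?c 0) (?c1 0) (?c1 0) + U1 (?c 0) (csmul (-1) (r *\<^sub>R E1 o1)) = 0"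
    by (rule has_vector_derivative_eq[OF D2 has_vector_derivative_const U1z])
  moreover have "csmul (-1) (r *\<^sub>R E1 o1) = (-r) *\<^sub>R (E1 o1 :: 'n cmat)" by (rule cmat_eqI) simp
  moreover have "linear (U1 (r *\<^sub>R E1 o1))" "bilinear (U2 (r *\<^sub>R E1 o1))"
    using C2_on_linear1[OF CU] C2_on_bilinear[OF CU] inU[of 0] by simp_all
  moreover have "csmul (-1) (E1 o1) = - (E1 o1 :: 'n cmat)" by (rule cmat_eqI) simp
  ultimately show ?thesis
    by (simp add: csmul_scaleR bilinear_lmul bilinear_rmul linear_scale radial1_def scaleR_conv_of_real[where 'a=complex] algebra_simps
        linear_neg[of "U1 (r *\<^sub>R E1 o1)"])
qed

text \<open>The average along the orbit of r \<open>E1 o1\<close> under \<open>rot\<close> is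
  computed twice: by the chain rule, and by rotating the weight instead. Summing over the four
  phases isolates the Levi form on one side and leaves cos^4, cos^2 sin^2 and sin^4 on the other;
  their second derivatives at 0 are -4, 2 and 0.\<close>

lemma U2_rotation:
  assumes r: "\<bar>r\<bar> < 1" and a: "a \<noteq> o1"
  shows "of_real (r * r) * levi (U2 (r *\<^sub>R E1 o1)) (Tm (ax o1) (ax a)) (Tm (ax o1) (ax a)) - of_real r * radial1 r
    = haar_mean (\<lambda>k. cnj (levi (f2 0) (Tm (k *v ax o1) (k *v ax a)) (Tm (k *v ax o1) (k *v ax a))) * f (act k (r *\<^sub>R E1 o1)))
      - 2 * radial r"
proof -
  let ?z = "r *\<^sub>R E1 o1 :: 'n cmat"
  have z: "?z \<in> II" by (rule scaleR_E1_II[OF r])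
  note CU = harmD(1)[OF harm_U0]
  define T where "T = (Tm (ax o1) (ax a) :: 'n cmat)"
  define D where "D = (outer (ax a) (ax a) :: 'n cmat)"
  \<comment> \<open>The orbit curve in expanded form; \<open>c1\<close> and \<open>c2\<close> are
    its velocity and its acceleration at 0.\<close>
  define c where "c e t = r *\<^sub>R ((cos t * cos t) *\<^sub>R E1 o1 + (cos t * sin t) *\<^sub>R csmul e T + (sin t * sin t) *\<^sub>R csmul (e * e) D)" for e t
  define c1 where "c1 e t = r *\<^sub>R ((- 2 * (cos t * sin t)) *\<^sub>R E1 o1 + (cos t * cos t - sin t * sin t) *\<^sub>R csmul e T + (2 * (cos t * sin t)) *\<^sub>R csmul (e * e) D)" for e t
  define c2 where "c2 e = r *\<^sub>R ((- 2) *\<^sub>R E1 o1 + 2 *\<^sub>R csmul (e * e) D)" for e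
  have c: "(c e has_vector_derivative c1 e t) (at t)" for e t
    unfolding c_def[abs_def] c1_def
    by (auto intro!: derivative_eq_intros simp: algebra_simps)
  have c1: "(c1 e has_vector_derivative c2 e) (at 0)" for e
    unfolding c1_def[abs_def] c2_def
    by (auto intro!: derivative_eq_intros simp: algebra_simps)
  have c_act: "c e t = act (rot o1 a e t) ?z" for e t
  proof -
    have "act (rot o1 a e t) ?z = r *\<^sub>R outer (rot o1 a e t *v ax o1) (rot o1 a e t *v ax o1)"
      by (simp add: linear_scale[OF linear_act] E1_def act_outer)
    also have "\<dots> = c e t"
      unfolding rot_ax[OF a] outer_lin2 c_def T_def D_def E1_def
      by (rule cmat_eqI) (simp add: Tm_nth scaleR_conv_of_real[where 'a=complex] algebra_simps)
    finally show ?thesis by simp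
  qed
  let ?R = "{1, \<i>, -1, -\<i>} :: complex set"
  have eR: "e * cnj e = 1" if "e \<in> ?R" for e using that by auto
  have inII: "c e t \<in> II" if "e \<in> ?R" for e t
    unfolding c_act by (rule act_II[OF rot_Ug[OF a eR[OF that]] z])
  define P where "P F = haar_mean (\<lambda>k. cnj (F k) * f (act k ?z))" for F
  have fc: "continuous_on Ug (\<lambda>k. f (act k ?z))"
    by (rule C2_on_continuous[OF harmD(1)[OF f]]) (auto intro!: continuous_intros act_Om II_sub_Om[OF z])
  define A where "A k = rank_one_levi (f2 0) (k *v ax o1)" for k :: "'n cmat"
  define M where "M k = levi (f2 0) (Tm (k *v ax o1) (k *v ax a)) (Tm (k *v ax o1) (k *v ax a))" for k :: "'n cmat"
  define N where "N k = rank_one_levi (f2 0) (k *v ax a)" for k :: "'n cmat"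
  have cA: "continuous_on Ug A" "continuous_on Ug N" unfolding A_def N_def by (intro continuous_rank_one_levi continuous_intros)+
  have cM: "continuous_on Ug M" unfolding M_def Tm_def
    by (intro continuous_on_levi[OF bilinear_f2_0] continuous_on_add continuous_outer continuous_intros)
  have cP: "continuous_on Ug F \<Longrightarrow> continuous_on Ug (\<lambda>k. cnj (F k) * f (act k ?z))" for F
    by (intro continuous_intros fc)
  have PA: "P A = radial r" by (simp add: P_def A_def radial_def haar_avg_def weight_def)
  have sumU: "(\<Sum>e\<in>?R. U0 (c e t)) = 4 * (of_real (cos t ^ 4) * P A + of_real ((cos t)\<^sup>2 * (sin t)\<^sup>2) * P M + of_real (sin t ^ 4) * P N)" for t
  proof -
    have "(\<Sum>e\<in>?R. U0 (c e t)) = (\<Sum>e\<in>?R. haar_mean (\<lambda>k. weight (k ** cadj (rot o1 a e t)) * f (act k ?z)))"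
      unfolding c_act by (intro sum.cong refl haar_avg_act[OF f continuous_weight _ z] rot_Ug[OF a eR])
    also have "\<dots> = haar_mean (\<lambda>k. \<Sum>e\<in>?R. weight (k ** cadj (rot o1 a e t)) * f (act k ?z))"
    proof (rule haar_mean_sum[symmetric])
      fix e assume e: "e \<in> ?R"
      have "continuous_on Ug (\<lambda>k. weight (k ** cadj (rot o1 a e t)))"
        by (rule continuous_on_compose2[OF continuous_weight])
          (auto intro!: continuous_intros Ug_mult Ug_cadj rot_Ug[OF a eR[OF e]])
      then show "continuous_on Ug (\<lambda>k. weight (k ** cadj (rot o1 a e t)) * f (act k ?z))"
        by (intro continuous_intros fc)
    qed simp
    also have "\<dots> = haar_mean (\<lambda>k. 4 * (of_real (cos t ^ 4) * (cnj (A k) * f (act k ?z)) + of_real ((cos t)\<^sup>2 * (sin t)\<^sup>2) * (cnj (M k) * f (act k ?z))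
        + of_real (sin t ^ 4) * (cnj (N k) * f (act k ?z))))"
    proof -
      have "(\<Sum>e\<in>?R. weight (k ** cadj (rot o1 a e t)) * f (act k ?z))
        = 4 * (of_real (cos t ^ 4) * (cnj (A k) * f (act k ?z)) + of_real ((cos t)\<^sup>2 * (sin t)\<^sup>2) * (cnj (M k) * f (act k ?z))
        + of_real (sin t ^ 4) * (cnj (N k) * f (act k ?z)))" for k
      proof -
        have "weight (k ** cadj (rot o1 a e t)) = cnj (rank_one_levi (f2 0) (complex_of_real (cos t) *s (k *v ax o1) + (- e * complex_of_real (sin t)) *s (k *v ax a)))" for e
          by (simp only: weight_def matrix_vector_mul_assoc[symmetric] rot_ax[OF a] matvec_add matvec_smult)
        then have "(\<Sum>e\<in>?R. weight (k ** cadj (rot o1 a e t)) * f (act k ?z))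
          = cnj (\<Sum>e\<in>?R. rank_one_levi (f2 0) (complex_of_real (cos t) *s (k *v ax o1) + (- e * complex_of_real (sin t)) *s (k *v ax a))) * f (act k ?z)"
          by (simp only: cnj_sum sum_distrib_right)
        then show ?thesis unfolding rank_one_levi_four[OF bilinear_f2_0]
          by (simp add: A_def M_def N_def algebra_simps)
      qed
      then show ?thesis by simp
    qed
    also have "\<dots> = 4 * (of_real (cos t ^ 4) * P A + of_real ((cos t)\<^sup>2 * (sin t)\<^sup>2) * P M + of_real (sin t ^ 4) * P N)"
      unfolding P_def by (rule haar_mean_linear_combination[OF cP[OF cA(1)] cP[OF cM] cP[OF cA(2)]])
    finally show ?thesis .
  qed
  have D1: "((\<lambda>t. \<Sum>e\<in>?R. U0 (c e t)) has_vector_derivative (\<Sum>e\<in>?R. U1 (c e t) (c1 e t))) (at t)" for t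
    by (intro has_vector_derivative_sum C2_on_curve1[OF CU _ c] II_sub_Om inII)
  have D2: "((\<lambda>t. \<Sum>e\<in>?R. U1 (c e t) (c1 e t)) has_vector_derivative (\<Sum>e\<in>?R. U2 (c e 0) (c1 e 0) (c1 e 0) + U1 (c e 0) (c2 e))) (at 0)"
    by (intro has_vector_derivative_sum C2_on_curve2[OF CU _ c c1] II_sub_Om inII)
  let ?G = "\<lambda>t. 4 * (of_real (cos t ^ 4) * P A + of_real ((cos t)\<^sup>2 * (sin t)\<^sup>2) * P M + of_real (sin t ^ 4) * P N)"
  let ?G1 = "\<lambda>t. 4 * (of_real (- 4 * (cos t ^ 3 * sin t)) * P A + of_real (2 * (cos t ^ 3 * sin t) - 2 * (cos t * sin t ^ 3)) * P M
     + of_real (4 * (sin t ^ 3 * cos t)) * P N)"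
  have cr: "((\<lambda>t. complex_of_real (q t)) has_vector_derivative of_real q') (at t)"
    if "(q has_real_derivative q') (at t)" for q q' t
    using has_vector_derivative_of_real[OF that] by simp
  have G: "(?G has_vector_derivative ?G1 t) (at t)" for t
    by (intro has_vector_derivative_mult_right has_vector_derivative_add has_vector_derivative_mult_left cr)
      (auto intro!: derivative_eq_intros simp: algebra_simps power2_eq_square power3_eq_cube)
  have G1: "(?G1 has_vector_derivative 4 * (of_real (-4) * P A + of_real 2 * P M + of_real 0 * P N)) (at 0)"
    by (intro has_vector_derivative_mult_right has_vector_derivative_add has_vector_derivative_mult_left cr)
      (auto intro!: derivative_eq_intros simp: algebra_simps power2_eq_square power3_eq_cube)
  have S1: "(\<Sum>e\<in>?R. U1 (c e t) (c1 e t)) = ?G1 t" for t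
    by (rule has_vector_derivative_eq[OF D1 G sumU])
  have eqA: "(\<Sum>e\<in>?R. U2 (c e 0) (c1 e 0) (c1 e 0) + U1 (c e 0) (c2 e)) = 4 * (of_real (-4) * P A + of_real 2 * P M + of_real 0 * P N)"
    by (rule has_vector_derivative_eq[OF D2 G1 S1])
  \<comment> \<open>The squares of the four phases sum to 0, which removes \<open>D\<close>; each of
    the two real directions of \<open>T\<close> occurs twice, which gives 8 times the Levi
    form.\<close>
  have eqB: "(\<Sum>e\<in>?R. U2 (c e 0) (c1 e 0) (c1 e 0) + U1 (c e 0) (c2 e)) = 8 * (of_real (r * r) * levi (U2 ?z) T T - of_real r * radial1 r)"
  proof -
    have c0: "c e 0 = ?z" "c1 e 0 = r *\<^sub>R csmul e T" for e by (simp_all add: c_def c1_def)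
    have l: "linear (U1 ?z)" and b: "bilinear (U2 ?z)"
      using C2_on_linear1[OF CU] C2_on_bilinear[OF CU] II_sub_Om[OF z] by simp_all
    have d: "(1::complex) \<noteq> \<i>" "(1::complex) \<noteq> -1" "(1::complex) \<noteq> -\<i>" "\<i> \<noteq> -1" "\<i> \<noteq> -\<i>" "-1 \<noteq> -\<i>"
      by (auto simp: complex_eq_iff)
    have n: "csmul (-1) A = - A" "csmul (- \<i>) A = - csmul \<i> A" "csmul 1 A = A" for A :: "'n cmat" by (auto intro!: cmat_eqI)
    have U1c: "U1 ?z (c2 e) = of_real (- 2 * r) * radial1 r + of_real (2 * r) * U1 ?z (csmul (e * e) D)" for e
      unfolding c2_def radial1_def using l
      by (simp add: linear_scale linear_add linear_neg linear_diff scaleR_conv_of_real[where 'a=complex] algebra_simps)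
    have s1: "(\<Sum>e\<in>?R. U1 ?z (c2 e)) = of_real (- 8 * r) * radial1 r"
      unfolding U1c by (simp add: d n linear_neg[OF l] algebra_simps)
    have s2: "(\<Sum>e\<in>?R. U2 ?z (r *\<^sub>R csmul e T) (r *\<^sub>R csmul e T)) = of_real (r * r) * (8 * levi (U2 ?z) T T)"
      using C2_on_symmetric[OF CU II_sub_Om[OF z]]
      by (subst levi_diag) (simp_all add: d n bilinear_lmul[OF b] bilinear_rmul[OF b] bilinear_lneg[OF b] bilinear_rneg[OF b]
          scaleR_conv_of_real[where 'a=complex] algebra_simps)
    show ?thesis unfolding c0 sum.distrib s1 s2 by (simp add: algebra_simps)
  qed
  have "8 * (of_real (r * r) * levi (U2 ?z) T T - of_real r * radial1 r) = 8 * (P M - 2 * radial r)"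
    unfolding eqB[symmetric] eqA PA by (simp add: algebra_simps)
  then have "of_real (r * r) * levi (U2 ?z) T T - of_real r * radial1 r = P M - 2 * radial r"
    by (subst (asm) mult_cancel_left) simp
  then show ?thesis unfolding T_def P_def M_def .
qed

text \<open>The Hua equation at r \<open>E1 o1\<close>, multiplied by r^2. \<open>U2_phase\<close>
  gives the term of the axis \<open>o1\<close> and \<open>U2_rotation\<close> the others; the means
  in the latter add up by the Hua equation of \<open>f\<close> itself, with total coefficient -4 -
  2(n-1) = -2(n+1) for g.\<close>

lemma radial_ode:
  assumes r: "0 < r" "r < 1"
  shows "of_real (1 - r\<^sup>2) * (of_real (r\<^sup>2) * radial2 r + of_real r * radial1 r) + of_real ((real CARD('n) - 1) * r) * radial1 r
     - of_real (2 * (real CARD('n) + 1)) * radial r = 0"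
proof -
  have r': "\<bar>r\<bar> < 1" using r by simp
  let ?z = "r *\<^sub>R E1 o1 :: 'n cmat"
  have z: "?z \<in> II" by (rule scaleR_E1_II[OF r'])
  note CU = harmD(1)[OF harm_U0]
  have b: "bilinear (U2 ?z)" using C2_on_bilinear[OF CU] II_sub_Om[OF z] by simp
  have fc: "continuous_on Ug (\<lambda>k. f (act k ?z))"
    by (rule C2_on_continuous[OF harmD(1)[OF f]]) (auto intro!: continuous_intros act_Om II_sub_Om[OF z])
  define M where "M a k = levi (f2 0) (Tm (k *v ax o1) (k *v ax a)) (Tm (k *v ax o1) (k *v ax a))" for a and k :: "'n cmat"
  have cM: "continuous_on Ug (M a)" for a unfolding M_def Tm_def
    by (intro continuous_on_levi[OF bilinear_f2_0] continuous_on_add continuous_outer continuous_intros)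
  \<comment> \<open>The Hua equation at the origin in direction \<open>k *v ax o1\<close>, solved
    for the terms off the axis; the 4 stems from \<open>Tm x x\<close> being twice
    \<open>outer x x\<close>.\<close>
  have MM: "(\<Sum>a\<in>UNIV - {o1}. M a k) = - 4 * rank_one_levi (f2 0) (k *v ax o1)" if k: "k \<in> Ug" for k
  proof -
    have "(\<Sum>a\<in>UNIV. M a k) = 0"
      unfolding M_def levi_unitary_sum[OF bilinear_f2_0 k] by (rule hua_zero[OF f k])
    moreover have "(\<Sum>a\<in>UNIV. M a k) = M o1 k + (\<Sum>a\<in>UNIV - {o1}. M a k)" by (rule sum.remove) auto
    moreover have "M o1 k = 4 * rank_one_levi (f2 0) (k *v ax o1)"
      by (simp add: M_def rank_one_levi_def Tm_diag levi_scaleR_left[OF bilinear_f2_0] levi_scaleR_right[OF bilinear_f2_0])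
    ultimately show ?thesis by (simp add: add_eq_0_iff)
  qed
  have "(\<Sum>a\<in>UNIV - {o1}. haar_mean (\<lambda>k. cnj (M a k) * f (act k ?z))) = haar_mean (\<lambda>k. \<Sum>a\<in>UNIV - {o1}. cnj (M a k) * f (act k ?z))"
    by (rule haar_mean_sum[symmetric]) (auto intro!: continuous_intros cM fc)
  also have "\<dots> = haar_mean (\<lambda>k. (-4) * (weight k * f (act k ?z)))"
  proof (rule haar_mean_cong)
    show "continuous_on Ug (\<lambda>k. \<Sum>a\<in>UNIV - {o1}. cnj (M a k) * f (act k ?z))" by (intro continuous_intros cM fc)
    fix k :: "'n cmat" assume k: "k \<in> Ug"
    have "(\<Sum>a\<in>UNIV - {o1}. cnj (M a k) * f (act k ?z)) = cnj (\<Sum>a\<in>UNIV - {o1}. M a k) * f (act k ?z)"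
      by (simp add: cnj_sum sum_distrib_right)
    then show "(\<Sum>a\<in>UNIV - {o1}. cnj (M a k) * f (act k ?z)) = (-4) * (weight k * f (act k ?z))"
      unfolding MM[OF k] by (simp add: weight_def)
  qed
  also have "\<dots> = (-4) * radial r"
    by (subst haar_mean_cmul) (auto intro!: continuous_intros continuous_weight fc simp: radial_def haar_avg_def)
  finally have S: "(\<Sum>a\<in>UNIV - {o1}. haar_mean (\<lambda>k. cnj (M a k) * f (act k ?z))) = (-4) * radial r" .
  let ?L = "\<lambda>a. levi (U2 ?z) (Tm (ax o1) (ax a)) (Tm (ax o1) (ax a))"
  have cn: "of_nat (card (UNIV - {o1})) = complex_of_real (real CARD('n) - 1)"
  proof -
    have "card (UNIV - {o1}) = CARD('n) - 1" by simp
    moreover have "CARD('n) \<ge> 1" by (simp add: Suc_leI)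
    ultimately show ?thesis by (simp add: of_nat_diff)
  qed
  have "(\<Sum>a\<in>UNIV - {o1}. of_real (r * r) * ?L a - of_real r * radial1 r)
    = (\<Sum>a\<in>UNIV - {o1}. haar_mean (\<lambda>k. cnj (M a k) * f (act k ?z)) - 2 * radial r)"
    unfolding M_def by (intro sum.cong refl U2_rotation[OF r']) auto
  then have "of_real (r * r) * (\<Sum>a\<in>UNIV - {o1}. ?L a) - (\<Sum>a\<in>UNIV - {o1}. of_real r * radial1 r)
    = (-4) * radial r - (\<Sum>a\<in>UNIV - {o1}. 2 * radial r)"
    unfolding sum_subtractf S sum_distrib_left .
  then have E1: "of_real (r * r) * (\<Sum>a\<in>UNIV - {o1}. ?L a) - of_real (real CARD('n) - 1) * (of_real r * radial1 r)
    = (-4) * radial r - of_real (real CARD('n) - 1) * (2 * radial r)"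
    unfolding sum_constant cn .
  have E2: "of_real (1 - r\<^sup>2) * ?L o1 + (\<Sum>a\<in>UNIV - {o1}. ?L a) = 0"
    using hua_rank_one[OF harm_U0, of r o1] r by simp
  have "?L o1 = 4 * levi (U2 ?z) (E1 o1) (E1 o1)"
    by (simp add: Tm_diag E1_def[symmetric] levi_scaleR_left[OF b] levi_scaleR_right[OF b])
  also have "\<dots> = radial2 r + U2 ?z (csmul \<i> (E1 o1)) (csmul \<i> (E1 o1))"
    using C2_on_symmetric[OF CU II_sub_Om[OF z]] by (subst levi_diag) (simp_all add: radial2_def)
  finally have L: "of_real (r * r) * ?L o1 = of_real (r * r) * radial2 r + of_real r * radial1 r"
    using U2_phase[OF r'] by (simp only: distrib_left)
  have "of_real (1 - r\<^sup>2) * (of_real (r * r) * radial2 r + of_real r * radial1 r) + of_real (r * r) * (\<Sum>a\<in>UNIV - {o1}. ?L a)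
    = of_real (r * r) * (of_real (1 - r\<^sup>2) * ?L o1 + (\<Sum>a\<in>UNIV - {o1}. ?L a))"
    unfolding L[symmetric] by (simp only: distrib_left mult.left_commute)
  then have eq1: "of_real (1 - r\<^sup>2) * (of_real (r * r) * radial2 r + of_real r * radial1 r) + of_real (r * r) * (\<Sum>a\<in>UNIV - {o1}. ?L a) = 0"
    unfolding E2 by simp
  have eq2: "of_real (r * r) * (\<Sum>a\<in>UNIV - {o1}. ?L a) = of_real (real CARD('n) - 1) * (of_real r * radial1 r)
    + ((-4) * radial r - of_real (real CARD('n) - 1) * (2 * radial r))" using E1 by (simp add: algebra_simps)
  show ?thesis using eq1 unfolding eq2 by (simp add: algebra_simps power2_eq_square)
qed

text \<open>The radial and, by \<open>U2_phase\<close>, the angular second derivatives vanish for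
  small positive r, hence at 0 by continuity. The Levi form of the average along
  \<open>E1 o1\<close> at 0 is the mean of |Q|^2.\<close>

lemma radial_zero_imp:
  assumes 0: "\<And>r. 0 < r \<Longrightarrow> r < 1 \<Longrightarrow> radial r = 0" and k: "k \<in> Ug"
  shows "rank_one_levi (f2 0) (k *v ax o1) = 0"
proof -
  note CU = harmD(1)[OF harm_U0]
  have r1: "radial1 r = 0" if r: "0 < r" "r < 1" for r
  proof -
    have "(radial has_vector_derivative radial1 r) (at r)" using radial_deriv r by simp
    moreover have "(radial has_vector_derivative 0) (at r)"
      by (rule has_vector_derivative_transform_within_open[of "\<lambda>_. 0" _ _ "{0<..<1}"]) (use r 0 in auto)
    ultimately show ?thesis using vector_derivative_unique_at by blast
  qed
  have r2: "radial2 r = 0" if r: "0 < r" "r < 1" for r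
  proof -
    have "(radial1 has_vector_derivative radial2 r) (at r)" using radial_deriv r by simp
    moreover have "(radial1 has_vector_derivative 0) (at r)"
      by (rule has_vector_derivative_transform_within_open[of "\<lambda>_. 0" _ _ "{0<..<1}"]) (use r r1 in auto)
    ultimately show ?thesis using vector_derivative_unique_at by blast
  qed
  have r3: "U2 (r *\<^sub>R E1 o1) (csmul \<i> (E1 o1)) (csmul \<i> (E1 o1)) = 0" if r: "0 < r" "r < 1" for r
    using U2_phase[of r] r r1[OF r] by simp
  have lim: "U2 0 v v = 0" if "\<And>r. 0 < r \<Longrightarrow> r < 1 \<Longrightarrow> U2 (r *\<^sub>R E1 o1) v v = 0" for v
  proof -
    have "isCont (\<lambda>z. U2 z v v) 0"
      using C2_onD(1,4)[OF CU] II_sub_Om[OF zero_II] continuous_on_eq_continuous_at by blast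
    moreover have "(\<lambda>m. (1 / real (Suc (Suc m))) *\<^sub>R E1 o1 :: 'n cmat) \<longlonglongrightarrow> 0 *\<^sub>R E1 o1"
      by (intro tendsto_intros LIMSEQ_Suc[of "\<lambda>m. 1 / real (Suc m)", OF LIMSEQ_inverse_real_of_nat[unfolded inverse_eq_divide]])
    ultimately have L: "(\<lambda>m. U2 ((1 / real (Suc (Suc m))) *\<^sub>R E1 o1) v v) \<longlonglongrightarrow> U2 0 v v"
      using isCont_tendsto_compose[of 0 "\<lambda>z. U2 z v v"] by simp
    have z: "U2 ((1 / real (Suc (Suc m))) *\<^sub>R E1 o1) v v = 0" for m by (rule that) auto
    show ?thesis using L unfolding z by (simp add: LIMSEQ_const_iff)
  qed
  have "levi (U2 0) (E1 o1) (E1 o1) = 0"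
    using C2_on_symmetric[OF CU II_sub_Om[OF zero_II]] lim[of "E1 o1"] lim[of "csmul \<i> (E1 o1)"] r2 r3
    by (subst levi_diag) (simp_all add: radial2_def)
  moreover have "levi (U2 0) (E1 o1) (E1 o1) = haar_mean (\<lambda>k. weight k * levi (f2 (act k 0)) (act k (E1 o1)) (act k (E1 o1)))"
    by (rule levi_haar_avg2[OF f continuous_weight II_sub_Om[OF zero_II]])
  moreover have "weight k * levi (f2 (act k 0)) (act k (E1 o1)) (act k (E1 o1)) = complex_of_real ((cmod (rank_one_levi (f2 0) (k *v ax o1)))\<^sup>2)" for k
    unfolding complex_norm_square by (simp add: weight_def rank_one_levi_def E1_def act_outer mult.commute)
  ultimately have "haar_mean (\<lambda>k. complex_of_real ((cmod (rank_one_levi (f2 0) (k *v ax o1)))\<^sup>2)) = 0" by simp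
  then have "(cmod (rank_one_levi (f2 0) (k *v ax o1)))\<^sup>2 = 0"
    by (intro haar_mean_eq_0_imp[OF _ _ _ k]) (auto intro!: continuous_intros continuous_rank_one_levi)
  then show ?thesis by simp
qed

end

subsection \<open>The solution of the radial equation that is regular at the origin\<close>

text \<open>The indicial polynomial of the radial equation is (i - 2)(i + n + 1). At i = 2m + 2 it
  equals 2m(2m + n + 3), while the previous coefficient enters with (2m)^2; the quotient is the
  factor here.\<close>

primrec sol_aux :: "nat \<Rightarrow> nat \<Rightarrow> real" where
  "sol_aux n 0 = 1"
| "sol_aux n (Suc m) = sol_aux n m * (2 * real (Suc m) / (2 * real (Suc m) + real n + 3))"

text \<open>The Frobenius solution with exponent 2 at the origin; the other exponent is \<open>-(n + 1)\<close>.\<close>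

definition sol_coeff :: "nat \<Rightarrow> nat \<Rightarrow> real" where
  "sol_coeff n i = (if even i \<and> i \<ge> 2 then sol_aux n ((i - 2) div 2) else 0)"

definition pow_series :: "(nat \<Rightarrow> real) \<Rightarrow> real \<Rightarrow> real" where "pow_series c r = (\<Sum>i. c i * r ^ i)"

lemma sol_aux_pos: "0 < sol_aux n m"
  by (induction m) (auto intro!: mult_pos_pos divide_pos_pos add_pos_nonneg)

lemma sol_aux_le_one: "sol_aux n m \<le> 1"
proof (induction m)
  case (Suc m)
  have "2 * real (Suc m) / (2 * real (Suc m) + real n + 3) \<le> 1" by simp
  then have "sol_aux n (Suc m) \<le> sol_aux n m * 1"
    unfolding sol_aux.simps using less_imp_le[OF sol_aux_pos[of n m]] by (intro mult_left_mono)
  then show ?case using Suc by linarith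
qed simp

lemmas sol_aux_bounds = sol_aux_pos sol_aux_le_one

lemma sol_coeff_nonneg: "0 \<le> sol_coeff n i" and sol_coeff_le_one: "sol_coeff n i \<le> 1"
  using sol_aux_bounds by (auto simp: sol_coeff_def less_imp_le)

lemma sol_coeff_even: "sol_coeff n (2 * m + 2) = sol_aux n m"
  by (simp add: sol_coeff_def)

lemma sol_coeff_recurrence:
  "((real i)\<^sup>2 + (real n - 1) * real i - 2 * (real n + 1)) * sol_coeff n i = (if i \<ge> 2 then (real (i - 2))\<^sup>2 * sol_coeff n (i - 2) else 0)"
proof (cases "even i \<and> i \<ge> 2")
  case True
  then obtain m where m: "i = 2 * m + 2"
    by (metis dvd_def le_add_diff_inverse2 dvd_diff_nat dvd_refl)
  show ?thesis
  proof (cases m)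
    case 0
    then show ?thesis using m by (simp add: algebra_simps)
  next
    case (Suc l)
    have i2: "i - 2 = 2 * l + 2" using m Suc by simp
    have "((real i)\<^sup>2 + (real n - 1) * real i - 2 * (real n + 1)) = (2 * real m) * (2 * real m + real n + 3)"
      by (simp add: m algebra_simps power2_eq_square)
    moreover have "(2 * real m) * (2 * real m + real n + 3) * sol_aux n m = (2 * real m)\<^sup>2 * sol_aux n l"
    proof -
      have "2 * real m + real n + 3 \<noteq> 0" by (simp add: add_nonneg_pos less_imp_neq[THEN not_sym] add_pos_pos)
      then show ?thesis unfolding Suc sol_aux.simps by (simp add: power2_eq_square field_simps)
    qed
    ultimately show ?thesis unfolding i2 sol_coeff_even using sol_coeff_even[of n m] m Suc by simp
  qed
next
  case False
  then show ?thesis by (auto simp: sol_coeff_def)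
qed

lemma summable_sol_coeff: "\<bar>r\<bar> < 1 \<Longrightarrow> summable (\<lambda>i. sol_coeff n i * r ^ i)"
proof (rule summable_comparison_test[where g="\<lambda>i. \<bar>r\<bar> ^ i"])
  assume r: "\<bar>r\<bar> < 1"
  show "summable (\<lambda>i. \<bar>r\<bar> ^ i)" using r by (intro summable_geometric) simp
  show "\<exists>N. \<forall>i\<ge>N. norm (sol_coeff n i * r ^ i) \<le> \<bar>r\<bar> ^ i"
    using sol_coeff_nonneg sol_coeff_le_one by (auto simp: abs_mult power_abs intro!: exI[of _ 0] mult_left_le_one_le)
qed

lemma summable_funpow_diffs:
  assumes "\<And>r::real. \<bar>r\<bar> < 1 \<Longrightarrow> summable (\<lambda>i. c i * r ^ i)"
  shows "\<bar>r\<bar> < 1 \<Longrightarrow> summable (\<lambda>i. (diffs ^^ j) c i * r ^ i)"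
proof (induction j arbitrary: r)
  case 0
  then show ?case using assms by simp
next
  case (Suc j)
  then show ?case using termdiff_converges[of r 1 "(diffs ^^ j) c"] by simp
qed

lemma pow_series_deriv:
  assumes "\<And>r::real. \<bar>r\<bar> < 1 \<Longrightarrow> summable (\<lambda>i. c i * r ^ i)" "\<bar>r\<bar> < 1"
  shows "(pow_series c has_real_derivative pow_series (diffs c) r) (at r)"
  unfolding pow_series_def[abs_def] by (rule termdiffs_strong'[where K=1]) (use assms in auto)

text \<open>The combination r^2 f'' + r f' is the square of the Euler operator and multiplies r^i by
  i^2. Comparing coefficients leaves the recurrence.\<close>

lemma pow_series_sol_ode:
  fixes r :: real and n :: nat assumes r: "\<bar>r\<bar> < 1"
  shows "(1 - r\<^sup>2) * (r\<^sup>2 * pow_series (diffs (diffs (sol_coeff n))) r + r * pow_series (diffs (sol_coeff n)) r)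
    + (real n - 1) * r * pow_series (diffs (sol_coeff n)) r - 2 * (real n + 1) * pow_series (sol_coeff n) r = 0"
proof -
  define f f1 f2 where "f = pow_series (sol_coeff n) r" and "f1 = pow_series (diffs (sol_coeff n)) r" and "f2 = pow_series (diffs (diffs (sol_coeff n))) r"
  let ?b = "sol_coeff n"
  have S: "\<And>j. summable (\<lambda>i. (diffs ^^ j) ?b i * r ^ i)" using summable_funpow_diffs[OF summable_sol_coeff r] .
  have s0: "(\<lambda>i. ?b i * r ^ i) sums f" using S[of 0] unfolding f_def pow_series_def by (simp add: summable_sums)
  have "(\<lambda>i. diffs ?b i * r ^ i) sums f1" using S[of 1] unfolding f1_def pow_series_def by (simp add: summable_sums)
  then have "(\<lambda>i. r * (diffs ?b i * r ^ i)) sums (r * f1)" by (rule sums_mult)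
  then have "(\<lambda>i. real (Suc i) * ?b (Suc i) * r ^ Suc i) sums (r * f1)" by (simp add: diffs_def mult_ac)
  then have s1: "(\<lambda>i. real i * ?b i * r ^ i) sums (r * f1)"
    using sums_Suc[of "\<lambda>i. real i * ?b i * r ^ i" "r * f1"] by simp
  have "(\<lambda>i. diffs (diffs ?b) i * r ^ i) sums f2"
    using S[of 2] unfolding f2_def pow_series_def by (simp add: summable_sums numeral_2_eq_2)
  then have "(\<lambda>i. r\<^sup>2 * (diffs (diffs ?b) i * r ^ i)) sums (r\<^sup>2 * f2)" by (rule sums_mult)
  then have "(\<lambda>i. real (Suc (Suc i)) * real (Suc i) * ?b (Suc (Suc i)) * r ^ Suc (Suc i)) sums (r\<^sup>2 * f2)"
    by (simp add: diffs_def mult_ac power2_eq_square)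
  then have "(\<lambda>i. real (Suc i) * real i * ?b (Suc i) * r ^ Suc i) sums (r\<^sup>2 * f2)"
    using sums_Suc[of "\<lambda>i. real (Suc i) * real i * ?b (Suc i) * r ^ Suc i" "r\<^sup>2 * f2"] by simp
  then have s2: "(\<lambda>i. real i * (real i - 1) * ?b i * r ^ i) sums (r\<^sup>2 * f2)"
    using sums_Suc[of "\<lambda>i. real i * (real i - 1) * ?b i * r ^ i" "r\<^sup>2 * f2"] by simp
  have th: "(\<lambda>i. (real i)\<^sup>2 * ?b i * r ^ i) sums (r\<^sup>2 * f2 + r * f1)"
    using sums_add[OF s2 s1] by (simp add: algebra_simps power2_eq_square)
  let ?t = "\<lambda>i. if i \<ge> 2 then (real (i - 2))\<^sup>2 * ?b (i - 2) * r ^ i else 0"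
  have "(\<lambda>i. r\<^sup>2 * ((real i)\<^sup>2 * ?b i * r ^ i)) sums (r\<^sup>2 * (r\<^sup>2 * f2 + r * f1))" by (rule sums_mult[OF th])
  then have "(\<lambda>i. ?t (Suc (Suc i))) sums (r\<^sup>2 * (r\<^sup>2 * f2 + r * f1))" by (simp add: mult_ac power2_eq_square)
  then have "(\<lambda>i. ?t (Suc i)) sums (r\<^sup>2 * (r\<^sup>2 * f2 + r * f1))"
    using sums_Suc[of "\<lambda>i. ?t (Suc i)"] by simp
  then have st: "?t sums (r\<^sup>2 * (r\<^sup>2 * f2 + r * f1))" using sums_Suc[of ?t] by simp
  have "(\<lambda>i. (real i)\<^sup>2 * ?b i * r ^ i - ?t i + (real n - 1) * (real i * ?b i * r ^ i) - 2 * (real n + 1) * (?b i * r ^ i))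
    sums ((r\<^sup>2 * f2 + r * f1) - r\<^sup>2 * (r\<^sup>2 * f2 + r * f1) + (real n - 1) * (r * f1) - 2 * (real n + 1) * f)"
    by (intro sums_add sums_diff sums_mult th st s1 s0)
  moreover have "(real i)\<^sup>2 * ?b i * r ^ i - ?t i + (real n - 1) * (real i * ?b i * r ^ i) - 2 * (real n + 1) * (?b i * r ^ i) = 0" for i
  proof -
    have "(real i)\<^sup>2 * ?b i * r ^ i + (real n - 1) * (real i * ?b i * r ^ i) - 2 * (real n + 1) * (?b i * r ^ i)
      = (((real i)\<^sup>2 + (real n - 1) * real i - 2 * (real n + 1)) * ?b i) * r ^ i" by (simp add: algebra_simps)
    also have "\<dots> = ?t i" unfolding sol_coeff_recurrence by simp
    finally show ?thesis by simp
  qed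
  ultimately have "(\<lambda>i::nat. 0) sums ((r\<^sup>2 * f2 + r * f1) - r\<^sup>2 * (r\<^sup>2 * f2 + r * f1) + (real n - 1) * (r * f1) - 2 * (real n + 1) * f)"
    by (simp only:)
  from sums_unique2[OF this sums_zero]
  show ?thesis unfolding f_def f1_def f2_def by (simp add: algebra_simps)
qed

lemma pow_series_sol_pos: "0 < r \<Longrightarrow> r < 1 \<Longrightarrow> 0 < pow_series (sol_coeff n) r"
proof -
  assume r: "0 < r" "r < 1"
  have "(\<Sum>i\<in>{2}. sol_coeff n i * r ^ i) \<le> pow_series (sol_coeff n) r"
    unfolding pow_series_def using r by (intro sum_le_suminf summable_sol_coeff) (auto intro!: mult_nonneg_nonneg sol_coeff_nonneg)
  moreover have "sol_coeff n 2 = 1" by (simp add: sol_coeff_def)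
  ultimately show ?thesis using r by (simp add: less_le_trans[of 0 "r^2"])
qed

lemma zero_derivative_const:
  fixes g :: "real \<Rightarrow> complex"
  assumes "\<And>r. 0 < r \<Longrightarrow> r < 1 \<Longrightarrow> (g has_vector_derivative 0) (at r)"
  obtains c where "\<And>r. 0 < r \<Longrightarrow> r < 1 \<Longrightarrow> g r = c"
proof -
  have d: "(g has_vector_derivative 0) (at x within {0<..<1})" if "x \<in> {0<..<1}" for x
    using assms that by (auto intro: has_vector_derivative_at_within)
  obtain c where "\<And>x. x \<in> {0<..<1} \<Longrightarrow> g x = c"
    by (rule has_vector_derivative_zero_constant[OF _ d]) auto
  then show ?thesis using that by auto
qed

text \<open>The Wronskian \<open>W\<close> of \<open>g\<close> with the series solution satisfies W'
  = -p W, so \<open>mu\<close> times \<open>W\<close> is constant. Near 0 the Wronskian is bounded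
  and \<open>mu\<close> tends to 0, hence the constant is 0 and the quotient of the two solutions is
  constant. Boundedness at 0 is what excludes the exponent -(n+1).\<close>

lemma radial_ode_unique:
  fixes g g1 g2 :: "real \<Rightarrow> complex"
  assumes n: "n \<ge> 1"
    and g: "\<And>r. 0 < r \<Longrightarrow> r < 1 \<Longrightarrow> (g has_vector_derivative g1 r) (at r)"
    and g1: "\<And>r. 0 < r \<Longrightarrow> r < 1 \<Longrightarrow> (g1 has_vector_derivative g2 r) (at r)"
    and bd: "\<And>r. 0 < r \<Longrightarrow> r < 1/2 \<Longrightarrow> cmod (g r) \<le> M \<and> cmod (g1 r) \<le> M"
    and ode: "\<And>r. 0 < r \<Longrightarrow> r < 1 \<Longrightarrow> of_real (1 - r\<^sup>2) * (of_real (r\<^sup>2) * g2 r + of_real r * g1 r)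
       + of_real ((real n - 1) * r) * g1 r - of_real (2 * (real n + 1)) * g r = 0"
  obtains C where "\<And>r. 0 < r \<Longrightarrow> r < 1 \<Longrightarrow> g r = C * of_real (pow_series (sol_coeff n) r)"
proof -
  let ?f = "pow_series (sol_coeff n)" and ?f1 = "pow_series (diffs (sol_coeff n))" and ?f2 = "pow_series (diffs (diffs (sol_coeff n)))"
  have cr: "((\<lambda>t. complex_of_real (q t)) has_vector_derivative of_real q') (at t)"
    if "(q has_real_derivative q') (at t)" for q q' t
    using has_vector_derivative_of_real[OF that] by simp
  have f: "((\<lambda>r. complex_of_real (?f r)) has_vector_derivative of_real (?f1 r)) (at r)" if "\<bar>r\<bar> < 1" for r
    by (rule cr[OF pow_series_deriv[OF summable_sol_coeff that]])
  have f1: "((\<lambda>r. complex_of_real (?f1 r)) has_vector_derivative of_real (?f2 r)) (at r)" if "\<bar>r\<bar> < 1" for r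
    by (rule cr[OF pow_series_deriv[OF _ that]]) (use summable_funpow_diffs[OF summable_sol_coeff, where j=1] in simp)
  define W where "W r = of_real (?f r) * g1 r - of_real (?f1 r) * g r" for r
  have W: "(W has_vector_derivative of_real (?f r) * g2 r - of_real (?f2 r) * g r) (at r)" if r: "0 < r" "r < 1" for r
  proof -
    have "\<bar>r\<bar> < 1" using r by simp
    then have "((\<lambda>r. of_real (?f r) * g1 r - of_real (?f1 r) * g r) has_vector_derivative
      (of_real (?f r) * g2 r + of_real (?f1 r) * g1 r) - (of_real (?f1 r) * g1 r + of_real (?f2 r) * g r)) (at r)"
      by (intro has_vector_derivative_diff has_vector_derivative_mult f f1 g g1 r)
    then show ?thesis by (simp add: W_def[abs_def])
  qed
  \<comment> \<open>The quotient of the coefficients of first and second order in the radial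
    equation, in partial fractions; \<open>mu\<close> is its integrating factor r^n (1 -
    r^2)^(-(n-1)/2).\<close>
  define p where "p r = real n / r + (real n - 1) * r / (1 - r\<^sup>2)" for r
  define mu where "mu r = r ^ n * exp (- (real n - 1) / 2 * ln (1 - r\<^sup>2))" for r
  have sq: "r\<^sup>2 < 1" if "0 < r" "r < 1" for r :: real using that by (simp add: power_less_one_iff)
  have mu: "(mu has_real_derivative mu r * p r) (at r)" if r: "0 < r" "r < 1" for r
  proof -
    have "1 - r\<^sup>2 > 0" using sq[OF r] by simp
    then have e: "((\<lambda>r. exp (a * ln (1 - r\<^sup>2))) has_real_derivative exp (a * ln (1 - r\<^sup>2)) * (a * (- (2 * r) / (1 - r\<^sup>2)))) (at r)" for a
      by (auto intro!: derivative_eq_intros)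
    have "((\<lambda>r. r ^ n) has_real_derivative real n * r ^ (n - 1)) (at r)"
      by (auto intro!: derivative_eq_intros)
    from DERIV_mult[OF this e[of "- (real n - 1) / 2"]]
    have "(mu has_real_derivative (real n * r ^ (n - 1) * exp (- (real n - 1) / 2 * ln (1 - r\<^sup>2))
       + exp (- (real n - 1) / 2 * ln (1 - r\<^sup>2)) * (- (real n - 1) / 2 * (- (2 * r) / (1 - r\<^sup>2))) * r ^ n)) (at r)"
      unfolding mu_def[abs_def] .
    moreover have "real n * r ^ (n - 1) = r ^ n * (real n / r)"
      using r n by (cases n) auto
    moreover have "- a / 2 * (- (2 * r) / b) = a * r / b" for a b :: real
      by (cases "b = 0") (auto simp: field_simps)
    ultimately have "(mu has_real_derivative (r ^ n * (real n / r) * exp (- (real n - 1) / 2 * ln (1 - r\<^sup>2))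
       + exp (- (real n - 1) / 2 * ln (1 - r\<^sup>2)) * ((real n - 1) * r / (1 - r\<^sup>2)) * r ^ n)) (at r)"
      by (simp only:)
    then show ?thesis unfolding mu_def p_def by (simp only: distrib_left distrib_right mult_ac times_divide_eq_left times_divide_eq_right)
  qed
  have Wp: "of_real (?f r) * g2 r - of_real (?f2 r) * g r = - of_real (p r) * W r" if r: "0 < r" "r < 1" for r
  proof -
    let ?x = "complex_of_real (r\<^sup>2 * (1 - r\<^sup>2))"
    have "r\<^sup>2 * (1 - r\<^sup>2) \<noteq> 0" using r sq[OF r] by auto
    then have x0: "?x \<noteq> 0" by (simp only: of_real_eq_0_iff not_False_eq_True)
    have fo: "of_real (1 - r\<^sup>2) * (of_real (r\<^sup>2) * of_real (?f2 r) + of_real r * of_real (?f1 r))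
       + of_real ((real n - 1) * r) * of_real (?f1 r) - of_real (2 * (real n + 1)) * of_real (?f r) = (0::complex)"
      using arg_cong[OF pow_series_sol_ode[of r n], of complex_of_real] r by simp
    have "?x * (of_real (?f r) * g2 r - of_real (?f2 r) * g r) + of_real (r * (1 - r\<^sup>2) + (real n - 1) * r) * W r
      = of_real (?f r) * (of_real (1 - r\<^sup>2) * (of_real (r\<^sup>2) * g2 r + of_real r * g1 r)
       + of_real ((real n - 1) * r) * g1 r - of_real (2 * (real n + 1)) * g r)
      - g r * (of_real (1 - r\<^sup>2) * (of_real (r\<^sup>2) * of_real (?f2 r) + of_real r * of_real (?f1 r))
       + of_real ((real n - 1) * r) * of_real (?f1 r) - of_real (2 * (real n + 1)) * of_real (?f r))"
      by (simp add: W_def algebra_simps)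
    also have "\<dots> = 0" unfolding ode[OF r] fo by simp
    finally have "?x * (of_real (?f r) * g2 r - of_real (?f2 r) * g r) = - of_real (r * (1 - r\<^sup>2) + (real n - 1) * r) * W r"
      by (simp only: mult_minus_left eq_neg_iff_add_eq_0)
    also have "r * (1 - r\<^sup>2) + (real n - 1) * r = r\<^sup>2 * (1 - r\<^sup>2) * p r"
      using r sq[OF r] by (simp add: p_def field_simps power2_eq_square) 
    finally have "?x * (of_real (?f r) * g2 r - of_real (?f2 r) * g r) = ?x * (- of_real (p r) * W r)"
      by simp
    then show ?thesis using x0 by (simp only: mult_cancel_left) blast
  qed
  have "((\<lambda>r. of_real (mu r) * W r) has_vector_derivative 0) (at r)" if r: "0 < r" "r < 1" for r
  proof -
    have "((\<lambda>r. of_real (mu r) * W r) has_vector_derivative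
      of_real (mu r) * (- of_real (p r) * W r) + of_real (mu r * p r) * W r) (at r)"
      using W[OF r] unfolding Wp[OF r] by (intro has_vector_derivative_mult cr mu r)
    then show ?thesis by simp
  qed
  then obtain c where c: "\<And>r. 0 < r \<Longrightarrow> r < 1 \<Longrightarrow> of_real (mu r) * W r = c"
    using zero_derivative_const by blast
  have W0: "W r = 0" if r: "0 < r" "r < 1" for r
  proof -
    have "continuous_on {0..1/2} (\<lambda>r. \<bar>?f r\<bar> + \<bar>?f1 r\<bar>)"
    proof (intro continuous_intros continuous_at_imp_continuous_on ballI)
      fix x :: real assume x: "x \<in> {0..1/2}"
      then have x': "\<bar>x\<bar> < 1" by auto
      show "isCont ?f x" by (rule DERIV_isCont[OF pow_series_deriv[OF summable_sol_coeff x']])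
      show "isCont ?f1 x"
        by (rule DERIV_isCont[OF pow_series_deriv[OF _ x']]) (use summable_funpow_diffs[OF summable_sol_coeff, where j=1] in simp)
    qed
    then have "bounded ((\<lambda>r. \<bar>?f r\<bar> + \<bar>?f1 r\<bar>) ` {0..1/2})"
      by (rule compact_imp_bounded[OF compact_continuous_image]) simp
    then obtain K where "\<forall>r\<in>{0..1/2}. \<bar>?f r\<bar> + \<bar>?f1 r\<bar> \<le> K"
      by (auto simp: bounded_iff)
    then have K: "\<bar>?f r\<bar> + \<bar>?f1 r\<bar> \<le> K" if "0 \<le> r" "r \<le> 1/2" for r using that by simp
    \<comment> \<open>For s < 1/2 one has 1 - s^2 \<ge> 1/2, so \<open>E\<close> bounds the second
      factor of \<open>mu\<close>, and \<open>mu s\<close> is at most \<open>s * E\<close>.\<close>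
    define E where "E = exp ((real n - 1) / 2 * ln 2)"
    have bound: "cmod c \<le> s * (E * (K * \<bar>M\<bar>))" if s: "0 < s" "s < 1/2" for s
    proof -
      have "cmod (W s) \<le> \<bar>?f s\<bar> * \<bar>M\<bar> + \<bar>?f1 s\<bar> * \<bar>M\<bar>"
      proof -
        have "cmod (W s) \<le> cmod (of_real (?f s) * g1 s) + cmod (of_real (?f1 s) * g s)"
          unfolding W_def by (rule norm_triangle_ineq4)
        also have "\<dots> \<le> \<bar>?f s\<bar> * \<bar>M\<bar> + \<bar>?f1 s\<bar> * \<bar>M\<bar>"
          unfolding norm_mult using bd[OF s] by (intro add_mono mult_mono) auto
        finally show ?thesis .
      qed
      also have "\<dots> \<le> K * \<bar>M\<bar>" using K[of s] s by (simp add: distrib_right[symmetric] mult_right_mono)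
      finally have Ws: "cmod (W s) \<le> K * \<bar>M\<bar>" .
      have "s\<^sup>2 \<le> (1/2)\<^sup>2" using s by (intro power_mono) auto
      then have s2: "1/2 \<le> 1 - s\<^sup>2" by (simp add: power2_eq_square)
      then have "- ln 2 \<le> ln (1 - s\<^sup>2)" using ln_le_cancel_iff[of "1/2" "1 - s\<^sup>2"] by (simp add: ln_div)
      then have "(real n - 1) / 2 * - ln (1 - s\<^sup>2) \<le> (real n - 1) / 2 * ln 2"
        using n by (intro mult_left_mono) auto
      then have "exp (- (real n - 1) / 2 * ln (1 - s\<^sup>2)) \<le> E"
        unfolding E_def exp_le_cancel_iff minus_divide_left[symmetric] mult_minus_left mult_minus_right .
      moreover have "s ^ n \<le> s ^ 1" using s n by (intro power_decreasing) auto
      ultimately have "mu s \<le> s * E" unfolding mu_def using s by (intro mult_mono) auto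
      moreover have "0 \<le> mu s" using s by (simp add: mu_def)
      ultimately have "cmod (of_real (mu s) * W s) \<le> (s * E) * (K * \<bar>M\<bar>)"
        unfolding norm_mult using Ws s by (intro mult_mono) (auto simp: E_def)
      then show ?thesis using c[of s] s by (simp add: mult.assoc)
    qed
    have "cmod c \<le> 0"
    proof (rule ccontr)
      assume "\<not> cmod c \<le> 0"
      then have c0: "cmod c > 0" by simp
      define X where "X = E * (K * \<bar>M\<bar>)"
      have "0 \<le> K" using K[of 0] by linarith
      then have X: "0 \<le> X" by (simp add: X_def E_def)
      define s where "s = min (1/4) (cmod c / (2 * (X + 1)))"
      have s: "0 < s" "s < 1/2" using c0 X by (auto simp: s_def)
      have "s * X \<le> cmod c / (2 * (X + 1)) * X" using X by (intro mult_right_mono) (auto simp: s_def)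
      also have "\<dots> < cmod c" using c0 X by (simp add: field_simps add_nonneg_pos)
      finally show False using bound[OF s] by (simp add: X_def)
    qed
    then have "of_real (mu r) * W r = 0" using c[OF r] by simp
    moreover have "mu r \<noteq> 0" using r by (simp add: mu_def)
    ultimately show ?thesis by simp
  qed
  have "((\<lambda>r. g r * of_real (inverse (?f r))) has_vector_derivative 0) (at r)" if r: "0 < r" "r < 1" for r
  proof -
    have fp: "?f r > 0" by (rule pow_series_sol_pos[OF r])
    have r': "\<bar>r\<bar> < 1" using r by simp
    have "((\<lambda>r. inverse (?f r)) has_real_derivative - (inverse (?f r) * ?f1 r * inverse (?f r))) (at r)"
      by (rule DERIV_inverse'[OF pow_series_deriv[OF summable_sol_coeff r']]) (use fp in auto)
    then have "((\<lambda>r. g r * of_real (inverse (?f r))) has_vector_derivative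
      g r * of_real (- (inverse (?f r) * ?f1 r * inverse (?f r))) + g1 r * of_real (inverse (?f r))) (at r)"
      by (intro has_vector_derivative_mult g r cr)
    moreover have "g r * of_real (- (inverse (?f r) * ?f1 r * inverse (?f r))) + g1 r * of_real (inverse (?f r))
      = of_real (inverse (?f r) * inverse (?f r)) * W r"
      using fp by (simp add: W_def field_simps)
    ultimately show ?thesis by (simp only: W0[OF r] mult_zero_right)
  qed
  then obtain C where C: "\<And>r. 0 < r \<Longrightarrow> r < 1 \<Longrightarrow> g r * of_real (inverse (?f r)) = C"
    using zero_derivative_const by blast
  show ?thesis
  proof (rule that)
    fix r :: real assume r: "0 < r" "r < 1"
    have "of_real (?f r) \<noteq> (0::complex)" using pow_series_sol_pos[OF r, of n] by simp
    then show "g r = C * of_real (?f r)" using C[OF r] by (simp add: field_simps)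
  qed
qed

subsection \<open>Failure of regularity at the boundary\<close>

primrec iter_deriv :: "((real \<Rightarrow> complex) \<Rightarrow> bool) \<Rightarrow> nat \<Rightarrow> (real \<Rightarrow> complex) \<Rightarrow> bool" where
  "iter_deriv P 0 h = P h"
| "iter_deriv P (Suc j) h = (\<exists>h'. (\<forall>r\<in>{0<..<1}. (h has_vector_derivative h' r) (at r)) \<and> iter_deriv P j h')"

lemma iter_deriv_power_series:
  assumes "iter_deriv P j h" "\<And>r. 0 < r \<Longrightarrow> r < 1 \<Longrightarrow> h r = C * of_real (pow_series c r)"
    and "\<And>r. \<bar>r\<bar> < 1 \<Longrightarrow> summable (\<lambda>i. c i * r ^ i)"
  shows "\<exists>h0. P h0 \<and> (\<forall>r\<in>{0<..<1}. h0 r = C * of_real (pow_series ((diffs ^^ j) c) r))"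
  using assms
proof (induction j arbitrary: h c)
  case 0
  then show ?case by auto
next
  case (Suc j)
  then obtain h' where "\<forall>r\<in>{0<..<1}. (h has_vector_derivative h' r) (at r)" and h'2: "iter_deriv P j h'" by auto
  then have h'1: "(h has_vector_derivative h' r) (at r)" if "0 < r" "r < 1" for r using that by auto
  have "h' r = C * of_real (pow_series (diffs c) r)" if r: "0 < r" "r < 1" for r
  proof -
    have "((\<lambda>r. C * of_real (pow_series c r)) has_vector_derivative C * of_real (pow_series (diffs c) r)) (at r)"
      using has_vector_derivative_of_real[OF pow_series_deriv[OF Suc.prems(3)], of r] r
      by (intro has_vector_derivative_mult_right) auto
    then have "(h has_vector_derivative C * of_real (pow_series (diffs c) r)) (at r)"
      by (rule has_vector_derivative_transform_within_open[of _ _ _ "{0<..<1}"]) (use r Suc.prems(2) in auto)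
    then show ?thesis using h'1[OF r] vector_derivative_unique_at by blast
  qed
  moreover have "\<bar>r\<bar> < 1 \<Longrightarrow> summable (\<lambda>i. diffs c i * r ^ i)" for r
    using summable_funpow_diffs[OF Suc.prems(3), where j=1] by simp
  ultimately have "\<exists>h0. P h0 \<and> (\<forall>r\<in>{0<..<1}. h0 r = C * of_real (pow_series ((diffs ^^ j) (diffs c)) r))"
    using Suc.IH[OF h'2] by blast
  then show ?case by (simp add: funpow_swap1)
qed

text \<open>Differentiating j times multiplies the coefficient by (i+1)...(i+j), a product of j
  factors each at least i+1.\<close>

lemma funpow_diffs_ge:
  assumes "\<And>i. 0 \<le> c i" shows "real (i + 1) ^ j * c (i + j) \<le> (diffs ^^ j) c i"
proof (induction j arbitrary: i)
  case (Suc j)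
  have "real (i + 1) ^ Suc j * c (i + Suc j) \<le> real (i + 1) * (real (Suc i + 1) ^ j * c (Suc i + j))"
    using assms by (simp add: mult.assoc) (intro mult_left_mono mult_right_mono power_mono; simp)
  also have "\<dots> \<le> real (i + 1) * (diffs ^^ j) c (Suc i)"
    by (intro mult_left_mono Suc.IH) auto
  finally show ?case by (simp add: diffs_def[of "(diffs ^^ j) c"])
qed simp

lemma sol_coeff_diffs_nonneg: "0 \<le> (diffs ^^ j) (sol_coeff n) i"
  using funpow_diffs_ge[of "sol_coeff n" i j] sol_coeff_nonneg by (meson mult_nonneg_nonneg of_nat_0_le_iff order_trans zero_le_power)

text \<open>Bernoulli's inequality for real exponents, by monotonicity of the difference.\<close>

lemma one_plus_powr_ge:
  fixes x q :: real assumes "0 \<le> x" "1 \<le> q" shows "1 + q * x \<le> (1 + x) powr q"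
proof -
  let ?g = "\<lambda>x. (1 + x) powr q - (1 + q * x)"
  have "?g 0 \<le> ?g x"
  proof (rule DERIV_nonneg_imp_nondecreasing[OF assms(1)])
    fix t :: real assume t: "0 \<le> t" "t \<le> x"
    have "(?g has_real_derivative q * (1 + t) powr (q - 1) - q) (at t)"
      using t by (auto intro!: derivative_eq_intros simp: powr_diff field_simps)
    moreover have "1 \<le> (1 + t) powr (q - 1)" using t assms(2) by (intro ge_one_powr_ge_zero) auto
    then have "0 \<le> q * (1 + t) powr (q - 1) - q" using assms(2) by simp
    ultimately show "\<exists>y. (?g has_real_derivative y) (at t) \<and> 0 \<le> y" by blast
  qed
  then show ?thesis by simp
qed

text \<open>With q = (n+3)/2 the recurrence factor is 1/(1 + q/(m+1)). By Bernoulli it is at least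
  (1 + 1/(m+1))^(-q), and these bounds telescope.\<close>

lemma sol_aux_lower: "real (Suc m) powr (- ((real n + 3) / 2)) \<le> sol_aux n m"
proof (induction m)
  case (Suc m)
  let ?q = "(real n + 3) / 2"
  have "real (Suc (Suc m)) powr (- ?q) = real (Suc m) powr (- ?q) * (1 + 1 / real (Suc m)) powr (- ?q)"
  proof -
    have "real (Suc (Suc m)) = real (Suc m) * (1 + 1 / real (Suc m))" by (simp add: field_simps)
    then show ?thesis by (simp only: powr_mult)
  qed
  also have "\<dots> \<le> sol_aux n m * (2 * real (Suc m) / (2 * real (Suc m) + real n + 3))"
  proof (intro mult_mono Suc)
    have "1 + ?q * (1 / real (Suc m)) \<le> (1 + 1 / real (Suc m)) powr ?q" by (rule one_plus_powr_ge) auto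
    then have "inverse ((1 + 1 / real (Suc m)) powr ?q) \<le> inverse (1 + ?q * (1 / real (Suc m)))"
      by (intro le_imp_inverse_le) (auto intro!: add_pos_nonneg)
    also have "\<dots> = 2 * real (Suc m) / (2 * real (Suc m) + real n + 3)"
      by (simp add: field_simps)
    finally show "(1 + 1 / real (Suc m)) powr (- ?q) \<le> 2 * real (Suc m) / (2 * real (Suc m) + real n + 3)"
      by (simp add: powr_minus)
  qed (auto intro: less_imp_le[OF sol_aux_bounds(1)])
  finally show ?case by simp
qed simp

text \<open>The exponent 2m + 2 drops to 2m + 2 - j after j derivatives. For j \<le> m the base 2m +
  3 - j is at least m + 1, so each derivative gains a power of m + 1.\<close>

lemma sol_coeff_diffs_lower:
  assumes "j \<le> m"
  shows "real (Suc m) powr (real j - (real n + 3) / 2) \<le> (diffs ^^ j) (sol_coeff n) (2 * m + 2 - j)"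
proof -
  have "real (Suc m) powr (real j - (real n + 3) / 2) = real (Suc m) ^ j * real (Suc m) powr (- ((real n + 3) / 2))"
    unfolding diff_conv_add_uminus powr_add by (simp add: powr_realpow)
  also have "\<dots> \<le> real (2 * m + 2 - j + 1) ^ j * sol_aux n m"
    using assms by (intro mult_mono sol_aux_lower power_mono) (auto simp: of_nat_diff)
  also have "sol_aux n m = sol_coeff n (2 * m + 2 - j + j)" using assms sol_coeff_even[of n m] by simp
  also have "real (2 * m + 2 - j + 1) ^ j * sol_coeff n (2 * m + 2 - j + j) \<le> (diffs ^^ j) (sol_coeff n) (2 * m + 2 - j)"
    by (rule funpow_diffs_ge[OF sol_coeff_nonneg])
  finally show ?thesis .
qed

text \<open>A finite part of the series is continuous at 1, so a bound valid below 1 passes to the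
  coefficients themselves even where the series diverges.\<close>

lemma tendsto_at_one:
  fixes c :: "nat \<Rightarrow> real"
  assumes "finite I" "\<And>s. r0 < s \<Longrightarrow> s < 1 \<Longrightarrow> (\<Sum>i\<in>I. c i * (s ^ i - d i)) \<le> B" "r0 < 1"
  shows "(\<Sum>i\<in>I. c i * (1 - d i)) \<le> B"
proof -
  have "((\<lambda>s. \<Sum>i\<in>I. c i * (s ^ i - d i)) \<longlongrightarrow> (\<Sum>i\<in>I. c i * (1 ^ i - d i))) (at_left 1)"
    by (intro tendsto_intros)
  moreover have "\<forall>\<^sub>F s in at_left 1. (\<Sum>i\<in>I. c i * (s ^ i - d i)) \<le> B"
    using eventually_at_left_real[OF assms(3)] assms(2) by (auto elim!: eventually_mono)
  ultimately have "(\<Sum>i\<in>I. c i * (1 ^ i - d i)) \<le> B"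
    by (intro tendsto_upperbound[where F="at_left (1::real)"]) auto
  then show ?thesis by simp
qed

lemma reindexed_sum:
  fixes F :: "nat \<Rightarrow> real" assumes "j \<le> N"
  shows "(\<Sum>i\<in>(\<lambda>m. 2 * m + 2 - j) ` {N..<L}. F i) = (\<Sum>m=N..<L. F (2 * m + 2 - j))"
  by (rule sum.reindex_cong[OF _ refl refl]) (use assms in \<open>auto simp: inj_on_def\<close>)

text \<open>After (n+1)/2 derivatives the coefficients are at least 1/(m+1). All terms are
  nonnegative, so an upper bound for the function would bound the partial sums of the harmonic
  series.\<close>

lemma unbounded_derivative:
  assumes n: "2 * j = n + 1" and M: "\<And>r. 0 < r \<Longrightarrow> r < 1 \<Longrightarrow> pow_series ((diffs ^^ j) (sol_coeff n)) r \<le> M"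
  shows False
proof -
  let ?c = "(diffs ^^ j) (sol_coeff n)"
  have ex: "real j - (real n + 3) / 2 = -1" using n by (simp add: field_simps flip: of_nat_add)
  have "(\<Sum>m=j..<L. 1 / real (Suc m)) \<le> M" for L
  proof -
    let ?I = "(\<lambda>m. 2 * m + 2 - j) ` {j..<L}"
    have "(\<Sum>i\<in>?I. ?c i * (s ^ i - 0)) \<le> M" if s: "0 < s" "s < 1" for s
    proof -
      have "(\<Sum>i\<in>?I. ?c i * s ^ i) \<le> pow_series ?c s"
        unfolding pow_series_def using s
        by (intro sum_le_suminf summable_funpow_diffs summable_sol_coeff) (auto intro!: mult_nonneg_nonneg sol_coeff_diffs_nonneg)
      then show ?thesis using M[OF s] by simp
    qed
    then have "(\<Sum>i\<in>?I. ?c i * (1 - 0)) \<le> M" by (intro tendsto_at_one[of _ 0]) auto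
    then have "(\<Sum>m=j..<L. ?c (2 * m + 2 - j)) \<le> M" using reindexed_sum[of j j ?c L] by simp
    moreover have "(\<Sum>m=j..<L. 1 / real (Suc m)) \<le> (\<Sum>m=j..<L. ?c (2 * m + 2 - j))"
    proof (rule sum_mono)
      fix m assume "m \<in> {j..<L}"
      then show "1 / real (Suc m) \<le> ?c (2 * m + 2 - j)"
        using sol_coeff_diffs_lower[of j m n] unfolding ex by (simp add: powr_minus inverse_eq_divide)
    qed
    ultimately show ?thesis by simp
  qed
  note bound = this
  have "summable (\<lambda>m. 1 / real (Suc (m + j)))"
  proof (rule summableI_nonneg_bounded)
    fix L
    have "(\<Sum>m<L. 1 / real (Suc (m + j))) = (\<Sum>m=j..<L + j. 1 / real (Suc m))"
      using sum.shift_bounds_nat_ivl[of "\<lambda>m. 1 / real (Suc m)" 0 j L] by (simp add: lessThan_atLeast0)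
    then show "(\<Sum>m<L. 1 / real (Suc (m + j))) \<le> M" using bound by simp
  qed simp
  then have "summable (\<lambda>m. 1 / real (m + Suc j))" by simp
  then have "summable (\<lambda>m. 1 / real m)" using summable_iff_shift[of "\<lambda>m. 1 / real m" "Suc j"] by simp
  then show False using not_summable_harmonic[where 'a=real] by (simp add: inverse_eq_divide)
qed

text \<open>After n/2 derivatives the coefficients are at least (m+1)^(-3/2). On the block N \<le> m
  < 2N each power of r = 1 - 1/N is at most 1/2, so the increment from r to 1 is at least a constant
  times N * N^(-3/2). A Hoelder bound M N^(-\<alpha>) with \<alpha> > 1/2 fails for large N.\<close>

lemma not_hoelder_derivative:
  assumes n: "2 * j = n" and al: "\<alpha> > 1/2"
    and M: "\<And>r s. 0 < r \<Longrightarrow> r < s \<Longrightarrow> s < 1 \<Longrightarrow> pow_series ((diffs ^^ j) (sol_coeff n)) s - pow_series ((diffs ^^ j) (sol_coeff n)) r \<le> M * (s - r) powr \<alpha>"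
    and M0: "M \<ge> 0"
  shows False
proof -
  let ?c = "(diffs ^^ j) (sol_coeff n)"
  have ex: "real j - (real n + 3) / 2 = - (3/2)" using n by (simp add: field_simps flip: of_nat_add)
  have main: "real N powr (\<alpha> - 1/2) \<le> M * (2 * 2 powr (3/2))" if N: "N \<ge> max j 2" for N
  proof -
    define r where "r = 1 - 1 / real N"
    have r: "0 < r" "r < 1" using N by (auto simp: r_def)
    let ?I = "(\<lambda>m. 2 * m + 2 - j) ` {N..<2 * N}"
    have "(\<Sum>i\<in>?I. ?c i * (s ^ i - r ^ i)) \<le> M * (1 / real N) powr \<alpha>" if s: "r < s" "s < 1" for s
    proof -
      have s0: "0 < s" using r s by simp
      have S: "summable (\<lambda>i. ?c i * s ^ i)" "summable (\<lambda>i. ?c i * r ^ i)"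
        using r s s0 by (auto intro!: summable_funpow_diffs summable_sol_coeff)
      have "(\<Sum>i\<in>?I. ?c i * (s ^ i - r ^ i)) = (\<Sum>i\<in>?I. ?c i * s ^ i - ?c i * r ^ i)" by (simp add: right_diff_distrib)
      also have "\<dots> \<le> (\<Sum>i. ?c i * s ^ i - ?c i * r ^ i)"
        using r s by (intro sum_le_suminf summable_diff S)
          (auto intro!: mult_left_mono power_mono sol_coeff_diffs_nonneg)
      also have "\<dots> = pow_series ?c s - pow_series ?c r" unfolding pow_series_def by (rule suminf_diff[OF S, symmetric])
      also have "\<dots> \<le> M * (s - r) powr \<alpha>" by (rule M[OF r(1) s])
      also have "\<dots> \<le> M * (1 / real N) powr \<alpha>"
        using s al M0 by (intro mult_left_mono powr_mono2) (auto simp: r_def)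
      finally show ?thesis .
    qed
    then have "(\<Sum>i\<in>?I. ?c i * (1 - r ^ i)) \<le> M * (1 / real N) powr \<alpha>"
      using r by (intro tendsto_at_one[of _ r]) auto
    then have up: "(\<Sum>m=N..<2 * N. ?c (2 * m + 2 - j) * (1 - r ^ (2 * m + 2 - j))) \<le> M * (1 / real N) powr \<alpha>"
      using reindexed_sum[of j N "\<lambda>i. ?c i * (1 - r ^ i)" "2 * N"] N by simp
    \<comment> \<open>The exponents in the block are at least N, and (1 - 1/N)^N \<le> exp(-1) \<le>
      1/2.\<close>
    have rN: "r ^ N \<le> 1/2"
    proof -
      have "r \<le> exp (- 1 / real N)" using exp_ge_add_one_self[of "- 1 / real N"] by (simp add: r_def)
      then have "r ^ N \<le> exp (- 1 / real N) ^ N" using r by (intro power_mono) auto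
      also have "\<dots> = exp (-1)" using N by (simp flip: exp_of_nat_mult)
      also have "\<dots> \<le> 1/2" using exp_ge_add_one_self[of 1] by (simp add: exp_minus field_simps)
      finally show ?thesis .
    qed
    have "(\<Sum>m=N..<2 * N. (2 * real N) powr (- (3/2)) * (1/2)) \<le> (\<Sum>m=N..<2 * N. ?c (2 * m + 2 - j) * (1 - r ^ (2 * m + 2 - j)))"
    proof (rule sum_mono, rule mult_mono)
      fix m assume m: "m \<in> {N..<2 * N}"
      have "(2 * real N) powr (- (3/2)) \<le> real (Suc m) powr (- (3/2))"
        using m by (intro powr_mono2') auto
      also have "\<dots> \<le> ?c (2 * m + 2 - j)" using sol_coeff_diffs_lower[of j m n] m N unfolding ex by simp
      finally show "(2 * real N) powr (- (3/2)) \<le> ?c (2 * m + 2 - j)" .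
      have "r ^ (2 * m + 2 - j) \<le> r ^ N" using m N r by (intro power_decreasing) auto
      then show "1/2 \<le> 1 - r ^ (2 * m + 2 - j)" using rN by simp
    qed (auto intro: sol_coeff_diffs_nonneg)
    then have "real N * ((2 * real N) powr (- (3/2)) * (1/2)) \<le> M * (1 / real N) powr \<alpha>"
      using up by simp
    moreover have "real N * ((2 * real N) powr (- (3/2)) * (1/2)) = real N powr (- (1/2)) / (2 * 2 powr (3/2))"
    proof -
      have "real N * real N powr (- (3/2)) = real N powr (1 + - (3/2))" using N by (subst powr_add) auto
      then show ?thesis using N by (simp add: powr_mult powr_minus field_simps)
    qed
    moreover have "(1 / real N) powr \<alpha> = real N powr (- \<alpha>)" using N by (simp add: powr_minus powr_divide inverse_eq_divide)
    ultimately have "real N powr (- (1/2)) / (2 * 2 powr (3/2)) \<le> M * real N powr (- \<alpha>)" by simp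
    then have "real N powr \<alpha> * (real N powr (- (1/2)) / (2 * 2 powr (3/2))) \<le> real N powr \<alpha> * (M * real N powr (- \<alpha>))"
      by (intro mult_left_mono) auto
    moreover have "real N powr \<alpha> * real N powr (- \<alpha>) = 1" using N by (simp flip: powr_add)
    moreover have "real N powr \<alpha> * real N powr (- (1/2)) = real N powr (\<alpha> - 1/2)" by (simp flip: powr_add)
    ultimately have "real N powr (\<alpha> - 1/2) / (2 * 2 powr (3/2)) \<le> M"
      by (metis (no_types, lifting) mult.left_commute mult.right_neutral times_divide_eq_right)
    then show ?thesis by (simp add: pos_divide_le_eq)
  qed
  define \<delta> X where "\<delta> = \<alpha> - 1/2" and "X = M * (2 * 2 powr (3/2))"
  have \<delta>: "\<delta> > 0" and X: "X \<ge> 0" using al M0 by (auto simp: \<delta>_def X_def)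
  \<comment> \<open>\<open>N0\<close> is chosen so that its power with exponent \<delta> exceeds the
    constant bound \<open>X\<close> of \<open>main\<close>.\<close>
  obtain N0 where N0: "real N0 > X powr (1 / \<delta>)" using reals_Archimedean2 by blast
  define N where "N = max N0 (max j 2)"
  have "X = (X powr (1 / \<delta>)) powr \<delta>" using \<delta> X by (simp add: powr_powr)
  also have "\<dots> < real N powr \<delta>" using \<delta> N0 by (intro powr_less_mono2) (auto simp: N_def)
  finally show False using main[of N] by (simp add: N_def X_def \<delta>_def)
qed

subsection \<open>Boundary regularity of the radial average\<close>

text \<open>For \<open>\<alpha> = 0\<close> this means bounded (\<open>0 powr 0 = 0\<close> matters only for \<open>r = s\<close>), so that both regularity hypotheses are instances.\<close>

definition hoelder :: "real \<Rightarrow> (real \<Rightarrow> complex) \<Rightarrow> bool" where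
  "hoelder \<alpha> h \<longleftrightarrow> (\<exists>M. \<forall>r\<in>{0<..<1}. \<forall>s\<in>{0<..<1}. cmod (h r - h s) \<le> M * \<bar>r - s\<bar> powr \<alpha>)"

lemma hoelder_sum:
  assumes "finite I" "\<And>i. i \<in> I \<Longrightarrow> hoelder \<alpha> (h i)"
  shows "hoelder \<alpha> (\<lambda>r. \<Sum>i\<in>I. h i r)"
proof -
  have "\<forall>i\<in>I. \<exists>M. \<forall>r\<in>{0<..<1}. \<forall>s\<in>{0<..<1}. cmod (h i r - h i s) \<le> M * \<bar>r - s\<bar> powr \<alpha>"
    using assms(2) unfolding hoelder_def by blast
  then obtain M where M: "\<forall>i\<in>I. \<forall>r\<in>{0<..<1}. \<forall>s\<in>{0<..<1}. cmod (h i r - h i s) \<le> M i * \<bar>r - s\<bar> powr \<alpha>"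
    using bchoice by metis
  have "cmod ((\<Sum>i\<in>I. h i r) - (\<Sum>i\<in>I. h i s)) \<le> (\<Sum>i\<in>I. M i) * \<bar>r - s\<bar> powr \<alpha>"
    if "r \<in> {0<..<1}" "s \<in> {0<..<1}" for r s
    unfolding sum_subtractf[symmetric] sum_distrib_right using M that by (intro sum_norm_le) blast
  then show ?thesis unfolding hoelder_def by blast
qed

lemma iter_deriv_hoelder_sum:
  assumes "finite I" "\<And>i. i \<in> I \<Longrightarrow> iter_deriv (hoelder \<alpha>) j (h i)"
  shows "iter_deriv (hoelder \<alpha>) j (\<lambda>r. \<Sum>i\<in>I. h i r)"
  using assms(2)
proof (induction j arbitrary: h)
  case 0
  then show ?case using hoelder_sum[OF assms(1)] by simp
next
  case (Suc j)
  have "\<forall>i\<in>I. \<exists>h'. (\<forall>r\<in>{0<..<1}. (h i has_vector_derivative h' r) (at r)) \<and> iter_deriv (hoelder \<alpha>) j h'"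
    using Suc.prems by simp
  then obtain h' where h': "\<forall>i\<in>I. (\<forall>r\<in>{0<..<1}. (h i has_vector_derivative h' i r) (at r)) \<and> iter_deriv (hoelder \<alpha>) j (h' i)"
    using bchoice[of I "\<lambda>i h'. (\<forall>r\<in>{0<..<1}. (h i has_vector_derivative h' r) (at r)) \<and> iter_deriv (hoelder \<alpha>) j h'"] by blast
  have "((\<lambda>r. \<Sum>i\<in>I. h i r) has_vector_derivative (\<Sum>i\<in>I. h' i r)) (at r)" if "r \<in> {0<..<1}" for r
    using h' that by (intro has_vector_derivative_sum) blast
  moreover have "iter_deriv (hoelder \<alpha>) j (\<lambda>r. \<Sum>i\<in>I. h' i r)" using h' by (intro Suc.IH) blast
  ultimately show ?case unfolding iter_deriv.simps by (intro exI[of _ "\<lambda>r. \<Sum>i\<in>I. h' i r"]) blast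
qed

section \<open>Derivatives of the average along a ray and their boundary behaviour\<close>

lemma transpose_act_E1: "transpose (act k (E1 o1)) = act k (E1 o1)"
  unfolding transpose_act by (rule arg_cong[of _ _ "act k"]) (rule cmat_eqI, auto simp: E1_nth)

lemma norm_act: "k \<in> Ug \<Longrightarrow> norm (act k z) = norm z"
proof -
  assume k: "k \<in> Ug"
  have "norm (transpose A) = norm A" for A :: "'a cmat"
  proof -
    have "(norm (transpose A))\<^sup>2 = (norm A)\<^sup>2" unfolding norm_cmat_sq by (subst sum.swap) simp
    then show ?thesis by (simp add: power2_eq_iff_nonneg)
  qed
  then have "norm (act k z) = norm (transpose (k ** z ** transpose k))" by (simp add: act_def)
  also have "\<dots> = norm (k ** transpose (k ** z))" by (simp add: matrix_transpose_mul)
  also have "\<dots> = norm (transpose (k ** z))" by (rule norm_Ug_mult[OF k])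
  also have "\<dots> = norm z" using k \<open>\<And>A. norm (transpose A) = norm A\<close> by (simp add: norm_Ug_mult)
  finally show ?thesis .
qed

lemma norm_E1: "norm (E1 o1 :: ('n::finite) cmat) = 1"
proof -
  have "(norm (E1 o1 :: 'n cmat))\<^sup>2 = (\<Sum>i\<in>UNIV. if i = o1 then 1 else 0)"
    unfolding norm_cmat_sq by (intro sum.cong refl) (simp add: E1_nth if_distrib[of cmod] if_distrib[of "\<lambda>x. x\<^sup>2"] cong: if_cong)
  then show ?thesis by (simp add: power2_eq_1_iff) (metis norm_ge_zero not_one_le_zero neg_0_le_iff_le)
qed

lemma scaleR_act_E1_II: "k \<in> Ug \<Longrightarrow> \<bar>r\<bar> < 1 \<Longrightarrow> r *\<^sub>R act k (E1 o1) \<in> II"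
  using act_II[OF _ scaleR_E1_II] by (simp add: linear_scale[OF linear_act])

text \<open>This family is closed under differentiation in \<open>r\<close>: a further direction is
  prepended to \<open>w\<close>, and its coordinate along the ray is absorbed into the weight
  \<open>c\<close>. Only derivatives along \<open>Dirs\<close> occur, as in the regularity
  hypothesis.\<close>

definition ray_mean :: "(('n::finite) cmat \<Rightarrow> complex) \<Rightarrow> 'n \<Rightarrow> 'n cmat list \<Rightarrow> ('n cmat \<Rightarrow> complex) \<Rightarrow> real \<Rightarrow> complex" where
  "ray_mean u o1 w c r = haar_mean (\<lambda>k. c k * iderivs w u (r *\<^sub>R act k (E1 o1)))"

lemma continuous_on_ray:
  assumes "continuous_on II g"
  shows "continuous_on ({-1<..<1} \<times> Ug) (\<lambda>p. g (fst p *\<^sub>R act (snd p) (E1 o1)))"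
  by (rule continuous_on_compose2[OF assms]) (auto intro!: continuous_intros scaleR_act_E1_II)

lemma continuous_on_ray_Ug:
  assumes "continuous_on II g" "\<bar>r\<bar> < 1"
  shows "continuous_on Ug (\<lambda>k. g (r *\<^sub>R act k (E1 o1)))"
  by (rule continuous_on_compose2[OF assms(1)]) (use assms(2) in \<open>auto intro!: continuous_intros scaleR_act_E1_II\<close>)

lemma continuous_on_sym_coord: "continuous_on S F \<Longrightarrow> continuous_on S (\<lambda>x. sym_coord i (F x))"
  by (rule continuous_on_compose2[OF linear_continuous_on[OF linear_sym_coord[unfolded linear_conv_bounded_linear]]]) auto

lemma ray_mean_deriv:
  fixes u :: "('n::finite) cmat \<Rightarrow> complex"
  assumes C: "C_on m II u" and w: "set w \<subseteq> Dirs" "length w < m" and c: "continuous_on Ug c" and r: "\<bar>r\<bar> < 1"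
  shows "(ray_mean u o1 w c has_vector_derivative
    (\<Sum>i\<in>UNIV. ray_mean u o1 (sym_dir i # w) (\<lambda>k. c k * of_real (sym_coord i (act k (E1 o1)))) r)) (at r)"
proof -
  let ?g = "iderivs w u" and ?e = "\<lambda>k. act k (E1 o1) :: 'n cmat"
  let ?gi = "\<lambda>i. iderivs (sym_dir i # w) u"
  have cg: "continuous_on II ?g" using C w unfolding C_on_def by (meson less_imp_le)
  have cd: "continuous_on II (dpart ?g d)" if "d \<in> Dirs" for d
    using C w that unfolding C_on_def iderivs.simps(2)[symmetric]
    by (metis insert_subset length_Cons less_eq_Suc_le list.simps(15))
  have hd: "has_dpart ?g d y" if "d \<in> Dirs" "y \<in> II" for d y
    using C w that unfolding C_on_def by (meson less_imp_le)
  have cgi: "continuous_on II (?gi i)" for i using cd[OF sym_dir_Dirs] by simp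
  define X where "X s k = (\<Sum>i\<in>UNIV. c k * of_real (sym_coord i (?e k)) * ?gi i (s *\<^sub>R ?e k))" for s k
  have line: "((\<lambda>s. c k * ?g (s *\<^sub>R ?e k)) has_derivative (\<lambda>v. v *\<^sub>R X s k)) (at s)" if k: "k \<in> Ug" and s: "\<bar>s\<bar> < 1" for s k
  proof -
    have sy: "symm (s *\<^sub>R ?e k) = s *\<^sub>R ?e k" for s
      by (rule symm_id) (simp add: transpose_act_E1 linear_scale[OF linear_transpose])
    have sO: "s *\<^sub>R ?e k \<in> Om" by (rule II_sub_Om[OF scaleR_act_E1_II[OF k s]])
    have 1: "((\<lambda>z. ?g (symm z)) has_derivative (\<lambda>v. \<Sum>i\<in>UNIV. sym_coord i (symm v) *\<^sub>R dpart ?g (sym_dir i) (symm (s *\<^sub>R ?e k)))) (at (s *\<^sub>R ?e k))"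
      by (rule sym_has_derivative[OF hd cd sO])
    have 2: "((\<lambda>s. s *\<^sub>R ?e k) has_derivative (\<lambda>v. v *\<^sub>R ?e k)) (at s)"
      by (auto intro!: derivative_eq_intros)
    have "((\<lambda>s. ?g (symm (s *\<^sub>R ?e k))) has_derivative
        (\<lambda>v. \<Sum>i\<in>UNIV. sym_coord i (symm (v *\<^sub>R ?e k)) *\<^sub>R dpart ?g (sym_dir i) (symm (s *\<^sub>R ?e k)))) (at s)"
      by (rule has_derivative_compose[OF 2 1])
    then have "((\<lambda>s. c k * ?g (s *\<^sub>R ?e k)) has_derivative
        (\<lambda>v. c k * (\<Sum>i\<in>UNIV. sym_coord i (v *\<^sub>R ?e k) *\<^sub>R dpart ?g (sym_dir i) (s *\<^sub>R ?e k)))) (at s)"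
      unfolding sy by (rule has_derivative_mult_right)
    moreover have "c k * (\<Sum>i\<in>UNIV. sym_coord i (v *\<^sub>R ?e k) *\<^sub>R dpart ?g (sym_dir i) (s *\<^sub>R ?e k)) = v *\<^sub>R X s k" for v
      unfolding X_def sum_distrib_left scaleR_sum_right
      by (intro sum.cong refl) (simp add: linear_scale[OF linear_sym_coord] scaleR_conv_of_real[where 'a=complex])
    ultimately show ?thesis by simp
  qed
  have "((\<lambda>s. haar_mean (\<lambda>k. c k * ?g (s *\<^sub>R ?e k))) has_derivative (\<lambda>v. haar_mean (\<lambda>k. v *\<^sub>R X r k))) (at r)"
  proof (rule haar_mean_has_derivative[where U="{-1<..<1}"])
    show "continuous_on Ug (\<lambda>k. c k * ?g (y *\<^sub>R ?e k))" if "y \<in> {-1<..<1}" for y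
      using that by (intro continuous_intros c continuous_on_ray_Ug cg) auto
    show "((\<lambda>s. c k * ?g (s *\<^sub>R ?e k)) has_derivative (\<lambda>v. v *\<^sub>R X y k)) (at y)" if "y \<in> {-1<..<1}" "k \<in> Ug" for y k
      using that by (intro line) auto
    show "continuous_on ({-1<..<1} \<times> Ug) (\<lambda>(y, k). v *\<^sub>R X y k)" for v
      unfolding X_def case_prod_beta
      by (intro continuous_intros continuous_on_ray cgi continuous_on_sym_coord continuous_on_compose2[OF c continuous_on_snd]) auto
  qed (use r in auto)
  moreover have "haar_mean (\<lambda>k. v *\<^sub>R X r k) = v *\<^sub>R (\<Sum>i\<in>UNIV. ray_mean u o1 (sym_dir i # w) (\<lambda>k. c k * of_real (sym_coord i (act k (E1 o1)))) r)" for v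
  proof -
    have ci: "continuous_on Ug (\<lambda>k. c k * of_real (sym_coord i (?e k)) * ?gi i (r *\<^sub>R ?e k))" for i
      by (intro continuous_intros continuous_on_ray_Ug cgi continuous_on_sym_coord c r)
    have "continuous_on Ug (X r)" unfolding X_def by (intro continuous_on_sum ci)
    then have "haar_mean (\<lambda>k. of_real v * X r k) = of_real v * haar_mean (X r)" by (rule haar_mean_cmul)
    also have "haar_mean (X r) = (\<Sum>i\<in>UNIV. ray_mean u o1 (sym_dir i # w) (\<lambda>k. c k * of_real (sym_coord i (act k (E1 o1)))) r)"
      unfolding X_def[abs_def] ray_mean_def by (rule haar_mean_sum[OF finite ci])
    finally show ?thesis by (simp add: scaleR_conv_of_real[where 'a=complex])
  qed
  ultimately show ?thesis unfolding has_vector_derivative_def ray_mean_def[abs_def] by simp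
qed

text \<open>The direction of every ray has norm 1, so points with parameters \<open>r\<close> and
  \<open>s\<close> lie at distance \<open>\<bar>r - s\<bar>\<close> for all \<open>k\<close>; the
  estimate is uniform over the group and passes to the mean.\<close>

lemma ray_mean_hoelder:
  fixes u :: "('n::finite) cmat \<Rightarrow> complex"
  assumes g: "continuous_on II (iderivs w u)" and c: "continuous_on Ug c"
    and H: "\<And>x y. x \<in> II \<Longrightarrow> y \<in> II \<Longrightarrow> cmod (iderivs w u x - iderivs w u y) \<le> K * norm (x - y) powr \<alpha>"
  shows "hoelder \<alpha> (ray_mean u o1 w c)"
proof -
  let ?g = "iderivs w u" and ?e = "\<lambda>k. act k (E1 o1) :: 'n cmat"
  obtain B where B: "\<And>k. k \<in> Ug \<Longrightarrow> cmod (c k) \<le> B"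
    using compact_imp_bounded[OF compact_continuous_image[OF c compact_Ug]] by (auto simp: bounded_iff)
  have B0: "0 \<le> B" using B[of "mat 1"] norm_ge_zero[of "c (mat 1)"] by (simp del: norm_ge_zero)
  have "cmod (ray_mean u o1 w c r - ray_mean u o1 w c s) \<le> B * K * \<bar>r - s\<bar> powr \<alpha>"
    if "r \<in> {0<..<1}" "s \<in> {0<..<1}" for r s
  proof -
    have a: "\<bar>r\<bar> < 1" "\<bar>s\<bar> < 1" using that by auto
    have ct: "continuous_on Ug (\<lambda>k. c k * ?g (t *\<^sub>R ?e k))" if "\<bar>t\<bar> < 1" for t
      by (intro continuous_intros c continuous_on_ray_Ug g that)
    have "ray_mean u o1 w c r - ray_mean u o1 w c s = haar_mean (\<lambda>k. c k * ?g (r *\<^sub>R ?e k) - c k * ?g (s *\<^sub>R ?e k))"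
      unfolding ray_mean_def by (rule haar_mean_diff[OF ct[OF a(1)] ct[OF a(2)], symmetric])
    also have "cmod \<dots> \<le> B * K * \<bar>r - s\<bar> powr \<alpha>"
    proof (rule haar_mean_bound)
      show "continuous_on Ug (\<lambda>k. c k * ?g (r *\<^sub>R ?e k) - c k * ?g (s *\<^sub>R ?e k))"
        by (intro continuous_on_diff ct a)
      fix k :: "'n cmat" assume k: "k \<in> Ug"
      have "norm (r *\<^sub>R ?e k - s *\<^sub>R ?e k) = \<bar>r - s\<bar>"
        by (simp add: scaleR_left_diff_distrib[symmetric] norm_act[OF k] norm_E1)
      then have "cmod (?g (r *\<^sub>R ?e k) - ?g (s *\<^sub>R ?e k)) \<le> K * \<bar>r - s\<bar> powr \<alpha>"
        using H[OF scaleR_act_E1_II[OF k a(1)] scaleR_act_E1_II[OF k a(2)]] by metis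
      then have "cmod (c k) * cmod (?g (r *\<^sub>R ?e k) - ?g (s *\<^sub>R ?e k)) \<le> B * (K * \<bar>r - s\<bar> powr \<alpha>)"
        by (rule mult_mono[OF B[OF k] _ B0]) simp
      then show "cmod (c k * ?g (r *\<^sub>R ?e k) - c k * ?g (s *\<^sub>R ?e k)) \<le> B * K * \<bar>r - s\<bar> powr \<alpha>"
        by (simp add: right_diff_distrib[symmetric] norm_mult mult.assoc)
    qed
    finally show ?thesis .
  qed
  then show ?thesis unfolding hoelder_def by blast
qed

text \<open>Induction on the number j of derivatives still available; \<open>w\<close> records those
  already taken, and the hypothesis on \<open>u\<close> is used when none is left.\<close>

lemma ray_mean_itd:
  fixes u :: "('n::finite) cmat \<Rightarrow> complex"
  assumes C: "C_on m II u"
    and H: "\<And>vs. set vs \<subseteq> Dirs \<Longrightarrow> length vs = m \<Longrightarrow>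
      \<exists>K. \<forall>x\<in>II. \<forall>y\<in>II. cmod (iderivs vs u x - iderivs vs u y) \<le> K * norm (x - y) powr \<alpha>"
  shows "set w \<subseteq> Dirs \<Longrightarrow> length w + j = m \<Longrightarrow> continuous_on Ug c \<Longrightarrow> iter_deriv (hoelder \<alpha>) j (ray_mean u o1 w c)"
proof (induction j arbitrary: w c)
  case 0
  then have "\<exists>K. \<forall>x\<in>II. \<forall>y\<in>II. cmod (iderivs w u x - iderivs w u y) \<le> K * norm (x - y) powr \<alpha>"
    using H[of w] by simp
  then obtain K where K: "\<forall>x\<in>II. \<forall>y\<in>II. cmod (iderivs w u x - iderivs w u y) \<le> K * norm (x - y) powr \<alpha>" ..
  have "continuous_on II (iderivs w u)" using C 0 unfolding C_on_def by simp
  then have "hoelder \<alpha> (ray_mean u o1 w c)" by (rule ray_mean_hoelder[OF _ 0(3)]) (use K in blast)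
  then show ?case by simp
next
  case (Suc j)
  let ?h = "\<lambda>i. ray_mean u o1 (sym_dir i # w) (\<lambda>k. c k * of_real (sym_coord i (act k (E1 o1))))"
  have "(ray_mean u o1 w c has_vector_derivative (\<Sum>i\<in>UNIV. ?h i r)) (at r)" if "r \<in> {0<..<1}" for r
    using Suc.prems that by (intro ray_mean_deriv[OF C]) auto
  moreover have "iter_deriv (hoelder \<alpha>) j (\<lambda>r. \<Sum>i\<in>UNIV. ?h i r)"
    using Suc.prems sym_dir_Dirs
    by (intro iter_deriv_hoelder_sum finite Suc.IH continuous_intros continuous_on_sym_coord) auto
  ultimately show ?case unfolding iter_deriv.simps by (intro exI[of _ "\<lambda>r. \<Sum>i\<in>UNIV. ?h i r"]) blast
qed

lemma radial_solution_vanishes: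
  assumes n: "n \<ge> 1" and g: "iter_deriv (hoelder \<alpha>) j g" "\<And>r. 0 < r \<Longrightarrow> r < 1 \<Longrightarrow> g r = C * of_real (pow_series (sol_coeff n) r)"
    and j: "2 * j = n + 1 \<and> \<alpha> = 0 \<or> 2 * j = n \<and> \<alpha> > 1/2"
  shows "C = 0"
proof (rule ccontr)
  assume C: "C \<noteq> 0"
  let ?p = "pow_series ((diffs ^^ j) (sol_coeff n))"
  obtain h0 where h0: "hoelder \<alpha> h0" "\<forall>r\<in>{0<..<1}. h0 r = C * of_real (?p r)"
    using iter_deriv_power_series[OF g summable_sol_coeff] by blast
  obtain M where M: "\<forall>r\<in>{0<..<1}. \<forall>s\<in>{0<..<1}. cmod (h0 r - h0 s) \<le> M * \<bar>r - s\<bar> powr \<alpha>"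
    using h0(1) unfolding hoelder_def by blast
  define K where "K = \<bar>M\<bar> / cmod C"
  have K: "\<bar>?p r - ?p s\<bar> \<le> K * \<bar>r - s\<bar> powr \<alpha>" if "r \<in> {0<..<1}" "s \<in> {0<..<1}" for r s
  proof -
    have "h0 r - h0 s = C * of_real (?p r - ?p s)" using h0(2) that by (simp add: right_diff_distrib)
    then have "cmod C * \<bar>?p r - ?p s\<bar> \<le> M * \<bar>r - s\<bar> powr \<alpha>"
      using M that by (metis norm_mult norm_of_real)
    also have "\<dots> \<le> \<bar>M\<bar> * \<bar>r - s\<bar> powr \<alpha>" by (intro mult_right_mono) auto
    finally show ?thesis using C by (simp add: K_def field_simps)
  qed
  from j show False
  proof (elim disjE conjE)
    assume j: "2 * j = n + 1" and a: "\<alpha> = 0"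
    show False
    proof (rule unbounded_derivative[OF j])
      fix r :: real assume r: "0 < r" "r < 1"
      \<comment> \<open>With exponent 0 the condition bounds the oscillation; comparison with the
        value at 1/2 bounds the function from above.\<close>
      have "\<bar>?p r - ?p (1/2)\<bar> \<le> K * \<bar>r - 1/2\<bar> powr 0" using K[of r "1/2"] r a by simp
      also have "\<dots> \<le> K * 1" by (intro mult_left_mono) (auto simp: K_def)
      finally show "?p r \<le> ?p (1/2) + K" by simp
    qed
  next
    assume j: "2 * j = n" and a: "\<alpha> > 1/2"
    show False
    proof (rule not_hoelder_derivative[OF j a])
      fix r s :: real assume rs: "0 < r" "r < s" "s < 1"
      show "?p s - ?p r \<le> K * (s - r) powr \<alpha>" using K[of s r] rs by simp
    qed (simp add: K_def)
  qed
qed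

text \<open>A Householder reflection. After division by the phase \<open>w\<close> of
  \<open>x $ o1\<close>, that coordinate is real and nonnegative, so the reflection along
  \<open>v\<close> takes the axis to \<open>cnj w *s x\<close>; multiplying by \<open>w\<close>
  gives \<open>x\<close>.\<close>

lemma unit_vector_orbit:
  fixes x :: "complex^'n::finite"
  assumes x: "(\<Sum>i\<in>UNIV. x $ i * cnj (x $ i)) = 1"
  obtains k where "k \<in> Ug" "k *v ax o1 = x"
proof -
  define w where "w = (if x $ o1 = 0 then 1 else sgn (x $ o1))"
  define a where "a = cmod (x $ o1)"
  have w: "w * cnj w = 1" by (simp add: w_def complex_norm_square[symmetric] norm_sgn)
  have xw: "cnj w * x $ o1 = of_real a"
  proof (cases "x $ o1 = 0")
    case False
    have "x $ o1 = w * of_real a" using False by (simp add: w_def a_def sgn_div_norm scaleR_conv_of_real)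
    then show ?thesis using w by (metis mult.assoc mult.commute mult_1)
  qed (simp add: a_def)
  define v where "v = ax o1 - cnj w *s x"
  define N where "N = 2 - 2 * a"
  \<comment> \<open>\<open>N\<close> is the squared norm of \<open>v\<close>. For N = 0 division by
    zero gives t = 0, so the reflection becomes the identity, as it should since then v = 0.\<close>
  define t where "t = 2 / N"
  have vo: "v $ o1 = of_real (1 - a)" using xw by (simp add: v_def ax_nth)
  have N: "(\<Sum>i\<in>UNIV. v $ i * cnj (v $ i)) = of_real N"
  proof -
    have "(\<Sum>i\<in>UNIV. v $ i * cnj (v $ i)) = (\<Sum>i\<in>UNIV. (if i = o1 then 1 - 2 * complex_of_real a else 0) + (w * cnj w) * (x $ i * cnj (x $ i)))"
    proof (intro sum.cong refl)
      fix i
      have "w * cnj (x $ o1) = of_real a" using arg_cong[OF xw, of cnj] by simp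
      then show "v $ i * cnj (v $ i) = (if i = o1 then 1 - 2 * complex_of_real a else 0) + (w * cnj w) * (x $ i * cnj (x $ i))"
        using xw by (auto simp: v_def ax_nth algebra_simps)
    qed
    also have "\<dots> = of_real N" unfolding sum.distrib sum_distrib_left[symmetric] x w by (simp add: N_def)
    finally show ?thesis .
  qed
  have v0: "v $ i = 0" if "N = 0" for i
  proof -
    have "(\<Sum>i\<in>UNIV. (cmod (v $ i))\<^sup>2) = 0"
      using N that by (simp add: complex_norm_square[symmetric] flip: of_real_power of_real_sum)
    then show ?thesis by (simp add: sum_nonneg_eq_0_iff)
  qed
  define H where "H = (\<chi> i j. (if i = j then 1 else 0) - of_real t * (v $ i * cnj (v $ j)))"
  have H: "H $ i $ j = (if i = j then 1 else 0) - of_real t * (v $ i * cnj (v $ j))" for i j by (simp add: H_def)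
  have "H ** cadj H = mat 1"
  proof (rule cmat_eqI)
    fix i j :: 'n
    have "(H ** cadj H) $ i $ j = (\<Sum>k\<in>UNIV. (if k = i then (if i = j then 1 else 0) else 0)
        - (if k = i then of_real t * (v $ i * cnj (v $ j)) else 0)
        - (if k = j then of_real t * (v $ i * cnj (v $ j)) else 0)
        + (of_real t)\<^sup>2 * (v $ i * cnj (v $ j)) * (v $ k * cnj (v $ k)))"
      unfolding matmul_nth
      by (intro sum.cong refl) (auto simp: H algebra_simps power2_eq_square)
    also have "\<dots> = (if i = j then 1 else 0) - of_real t * (v $ i * cnj (v $ j)) - of_real t * (v $ i * cnj (v $ j))
        + (of_real t)\<^sup>2 * (v $ i * cnj (v $ j)) * of_real N"
      unfolding sum.distrib sum_subtractf sum_distrib_left[symmetric] N by simp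
    also have "\<dots> = (if i = j then 1 else 0) + of_real (t\<^sup>2 * N - 2 * t) * (v $ i * cnj (v $ j))"
      by (simp add: algebra_simps)
    also have "t\<^sup>2 * N - 2 * t = 0" by (simp add: t_def power2_eq_square)
    finally show "(H ** cadj H) $ i $ j = mat 1 $ i $ j" by simp
  qed
  then have "csmul w H \<in> Ug" unfolding Ug_iff using w by (simp add: cadj_csmul csmul_matmul csmul_csmul mult.commute)
  moreover have "csmul w H *v ax o1 = x"
  proof -
    have tv: "of_real t * (v $ i * of_real (1 - a)) = v $ i" for i
    proof (cases "N = 0")
      case False
      then have "t * (1 - a) = 1" by (simp add: t_def N_def field_simps)
      then have "of_real t * of_real (1 - a) = (1::complex)" by (simp only: of_real_1 flip: of_real_mult)
      then have "(of_real t * of_real (1 - a)) * v $ i = v $ i" by simp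
      then show ?thesis by (simp only: mult_ac)
    qed (simp add: v0)
    have "w * (H $ i $ o1) = x $ i" for i
    proof -
      have "H $ i $ o1 = cnj w * x $ i"
        unfolding H vo complex_cnj_complex_of_real tv by (simp add: v_def ax_nth)
      then show ?thesis using w by (simp flip: mult.assoc)
    qed
    then show ?thesis by (simp add: vec_eq_iff matvec_axis)
  qed
  ultimately show ?thesis by (rule that)
qed

subsection \<open>Polarization\<close>

lemma sesquilinear_polarization:
  fixes s :: "complex^'n \<Rightarrow> complex^'n \<Rightarrow> complex"
  assumes add: "\<And>x y z. s (x + y) z = s x z + s y z" "\<And>x y z. s z (x + y) = s z x + s z y"
    and smult: "\<And>c x y. s (c *s x) y = c * s x y" "\<And>c x y. s x (c *s y) = cnj c * s x y"
    and diag: "\<And>x. s x x = 0"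
  shows "s x y = 0"
proof -
  have "s x y + s y x = 0" using diag[of "x + y"] unfolding add unfolding diag by (simp add: add.commute)
  moreover have "- \<i> * s x y + \<i> * s y x = 0" using diag[of "x + \<i> *s y"] unfolding add unfolding smult unfolding diag by (simp add: add.commute)
  then have "\<i> * (s y x - s x y) = 0" by (simp add: algebra_simps)
  then have "s y x = s x y" by simp
  ultimately show ?thesis by simp
qed

text \<open>Averaging Q(x + e y) over the four phases isolates the Levi form on the pair
  \<open>Tm x y\<close>, \<open>Tm x y\<close>. Polarization in the first factor and then in the
  second reaches arbitrary pairs.\<close>

lemma levi_Tm_zero:
  assumes B: "bilinear B" and Q: "\<And>x. rank_one_levi B x = 0"
  shows "levi B (Tm x y) (Tm x' y') = 0"
proof -
  have diag: "levi B (Tm x y) (Tm x y) = 0" for x y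
    using rank_one_levi_four[OF B, of 1 x 1 y] Q by simp
  have same: "levi B (Tm x y) (Tm x' y) = 0" for x x' y
    by (rule sesquilinear_polarization[of "\<lambda>x x'. levi B (Tm x y) (Tm x' y)"])
      (simp_all add: diag Tm_add Tm_smult levi_add_left[OF B] levi_add_right[OF B] levi_csmul_left[OF B] levi_csmul_right[OF B])
  show ?thesis
    by (rule sesquilinear_polarization[of "\<lambda>y y'. levi B (Tm x y) (Tm x' y')"])
      (simp_all add: same Tm_add Tm_smult levi_add_left[OF B] levi_add_right[OF B] levi_csmul_left[OF B] levi_csmul_right[OF B])
qed

lemma Esym_Tm: "Esym {j, a} = csmul (if j = a then 1/2 else 1) (Tm (ax j) (ax a))"
  by (rule cmat_eqI) (auto simp: Esym_def Tm_nth ax_nth doubleton_eq_iff)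

text \<open>Regularity makes the radial average vanish, so Q is 0 on the orbit of one axis vector.
  That orbit is the unit sphere, and homogeneity extends the vanishing to all vectors.\<close>

lemma rank_one_levi_zero:
  fixes f :: "('n::finite) cmat \<Rightarrow> complex"
  assumes f: "harm f f1 f2 h" and f_u: "\<And>z. f z = u (symm z)"
    and C: "C_on m II u"
    and H: "\<And>vs. set vs \<subseteq> Dirs \<Longrightarrow> length vs = m \<Longrightarrow>
      \<exists>K. \<forall>x\<in>II. \<forall>y\<in>II. cmod (iderivs vs u x - iderivs vs u y) \<le> K * norm (x - y) powr \<alpha>"
    and m: "2 * m = CARD('n) + 1 \<and> \<alpha> = 0 \<or> 2 * m = CARD('n) \<and> \<alpha> > 1/2"
  shows "rank_one_levi (f2 0) x = 0"
proof -
  obtain o1 :: 'n where True by blast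
  let ?r = "radial f f2 o1" and ?r1 = "radial1 f1 f2 o1" and ?r2 = "radial2 f2 o1"
  have B: "bilinear (f2 0)" by (rule C2_on_bilinear[OF harmD(1)[OF f] II_sub_Om[OF zero_II]])
  have r_mean: "?r = ray_mean u o1 [] (weight f2 o1)"
  proof
    fix r
    have "symm (act k (r *\<^sub>R E1 o1)) = r *\<^sub>R act k (E1 o1 :: 'n cmat)" for k
      by (subst symm_id) (simp_all add: linear_scale[OF linear_act] transpose_act_E1 linear_scale[OF linear_transpose])
    then show "?r r = ray_mean u o1 [] (weight f2 o1) r"
      by (simp add: radial_def[OF f] haar_avg_def ray_mean_def f_u)
  qed
  have iter_deriv: "iter_deriv (hoelder \<alpha>) m ?r"
    unfolding r_mean by (rule ray_mean_itd[OF C H]) (auto intro: continuous_weight[OF f])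
  have n: "CARD('n) \<ge> 1" by (simp add: Suc_leI)
  have "continuous_on {0..1/2} (\<lambda>r. cmod (?r r) + cmod (?r1 r))"
  proof (intro continuous_intros continuous_at_imp_continuous_on ballI)
    fix x :: real assume "x \<in> {0..1/2}"
    then have "\<bar>x\<bar> < 1" by auto
    then show "isCont ?r x" "isCont ?r1 x"
      using has_vector_derivative_continuous radial_deriv[OF f] by blast+
  qed
  then have "bounded ((\<lambda>r. cmod (?r r) + cmod (?r1 r)) ` {0..1/2})"
    by (rule compact_imp_bounded[OF compact_continuous_image]) simp
  then obtain M where M: "\<forall>r\<in>{0..1/2}. \<bar>cmod (?r r) + cmod (?r1 r)\<bar> \<le> M"
    by (auto simp: bounded_iff)
  have bd: "cmod (?r r) \<le> M \<and> cmod (?r1 r) \<le> M" if "0 < r" "r < 1/2" for r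
  proof -
    have "cmod (?r r) + cmod (?r1 r) \<le> M" using bspec[OF M, of r] that by simp
    then show ?thesis using norm_ge_zero[of "?r r"] norm_ge_zero[of "?r1 r"] by linarith
  qed
  obtain D where D: "\<And>r. 0 < r \<Longrightarrow> r < 1 \<Longrightarrow> ?r r = D * of_real (pow_series (sol_coeff CARD('n)) r)"
  proof (rule radial_ode_unique[OF n _ _ bd radial_ode[OF f]])
    show "(?r has_vector_derivative ?r1 r) (at r)" "(?r1 has_vector_derivative ?r2 r) (at r)" if "0 < r" "r < 1" for r
      using radial_deriv[OF f, of r] that by auto
  qed auto
  have "D = 0" by (rule radial_solution_vanishes[OF n iter_deriv D m])
  then have r0: "?r r = 0" if "0 < r" "r < 1" for r using D that by simp
  define t where "t = norm x"
  show ?thesis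
  proof (cases "x = 0")
    case True
    then show ?thesis using rank_one_levi_smult[OF B, of 0 x] by simp
  next
    case False
    then have t: "t > 0" by (simp add: t_def)
    define y where "y = complex_of_real (1 / t) *s x"
    have "(\<Sum>i\<in>UNIV. y $ i * cnj (y $ i)) = of_real (1 / t\<^sup>2) * (\<Sum>i\<in>UNIV. x $ i * cnj (x $ i))"
      unfolding sum_distrib_left by (intro sum.cong refl) (simp add: y_def power2_eq_square)
    also have "(\<Sum>i\<in>UNIV. x $ i * cnj (x $ i)) = of_real (t\<^sup>2)"
      by (simp add: t_def norm_vec_sq flip: complex_norm_square of_real_power)
    finally have "(\<Sum>i\<in>UNIV. y $ i * cnj (y $ i)) = 1" using t by simp
    then obtain k where k: "k \<in> Ug" "k *v ax o1 = y" by (rule unit_vector_orbit)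
    have "rank_one_levi (f2 0) y = 0" using radial_zero_imp[OF f r0 k(1)] k(2) by simp
    moreover have "x = of_real t *s y" using t by (simp add: y_def)
    ultimately show ?thesis using rank_one_levi_smult[OF B] by simp
  qed
qed

lemma C_closure_extension:
  assumes "C_closure m u" "set vs \<subseteq> Dirs" "length vs \<le> m"
  shows "\<exists>g. continuous_on (closure II) g \<and> (\<forall>z\<in>II. g z = iderivs vs u z)"
  using assms by (simp add: C_closure_def)

theorem theorem4p4:
  fixes u :: "('n::finite) cmat \<Rightarrow> complex"
  assumes "CARD('n) > 1"
    and "invariant_harmonic u"
    and "(odd CARD('n) \<and> C_closure ((CARD('n) + 1) div 2) u) \<or>
         (even CARD('n) \<and> (\<exists>\<alpha>>1/2. C_holder_closure (CARD('n) div 2) \<alpha> u))"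
  shows "\<forall>j a k b. dz {j, a} (dzb {k, b} u) 0 = 0"
proof -
  \<comment> \<open>Both cases are brought to one Hoelder condition. For odd dimension the exponent
    is 0: the derivatives of top order extend continuously to the compact closure, so their
    differences are bounded.\<close>
  obtain m \<alpha> where C: "C_closure m u"
    and H: "\<And>vs. set vs \<subseteq> Dirs \<Longrightarrow> length vs = m \<Longrightarrow>
      \<exists>K. \<forall>x\<in>II. \<forall>y\<in>II. cmod (iderivs vs u x - iderivs vs u y) \<le> K * norm (x - y) powr \<alpha>"
    and m: "2 * m = CARD('n) + 1 \<and> \<alpha> = 0 \<or> 2 * m = CARD('n) \<and> \<alpha> > 1/2"
    using assms(3)
  proof (elim disjE conjE exE)
    assume odd: "odd CARD('n)" and C: "C_closure ((CARD('n) + 1) div 2) u"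
    show thesis
    proof (rule that[OF C])
      fix vs :: "'n cmat list" assume "set vs \<subseteq> Dirs" "length vs = (CARD('n) + 1) div 2"
      then obtain g where g: "continuous_on (closure II) g" "\<forall>z\<in>II. g z = iderivs vs u z"
        using C_closure_extension[OF C] by (metis order_refl)
      obtain K where K: "\<And>z. z \<in> closure II \<Longrightarrow> cmod (g z) \<le> K"
        using compact_imp_bounded[OF compact_continuous_image[OF g(1) compact_closure_II]] by (auto simp: bounded_iff)
      have "cmod (iderivs vs u x - iderivs vs u y) \<le> (2 * K) * norm (x - y) powr 0" if "x \<in> II" "y \<in> II" for x y
      proof (cases "x = y")
        case False
        have "cmod (g x) \<le> K" "cmod (g y) \<le> K" using K that closure_subset by blast+
        then have "cmod (iderivs vs u x) \<le> K" "cmod (iderivs vs u y) \<le> K" using g(2) that by simp_all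
        then show ?thesis using False norm_triangle_ineq4[of "iderivs vs u x" "iderivs vs u y"] by simp
      qed simp
      then show "\<exists>K. \<forall>x\<in>II. \<forall>y\<in>II. cmod (iderivs vs u x - iderivs vs u y) \<le> K * norm (x - y) powr 0" by blast
    qed (use odd in auto)
  next
    fix \<alpha> assume "even CARD('n)" "\<alpha> > 1/2" "C_holder_closure (CARD('n) div 2) \<alpha> u"
    then show thesis by (intro that[of "CARD('n) div 2" \<alpha>]) (auto simp: C_holder_closure_def)
  qed
  have Cm: "C_on m II u" using C unfolding C_closure_def by (rule conjunct1)
  obtain h where h: "continuous_on (closure II) h" "\<forall>z\<in>II. h z = u z"
    using C_closure_extension[OF C, of "[]"] by auto
  obtain f1 f2 where f: "harm (\<lambda>z. u (symm z)) f1 f2 h"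
    using harm_of_invariant_harmonic[OF assms(2) h(1)] h(2) by blast
  have B: "bilinear (f2 0)" by (rule C2_on_bilinear[OF harmD(1)[OF f] II_sub_Om[OF zero_II]])
  have Q: "rank_one_levi (f2 0) x = 0" for x by (rule rank_one_levi_zero[OF f refl Cm H m])
  show ?thesis
  proof (intro allI)
    fix j a k b :: 'n
    have "dz {j, a} (dzb {k, b} u) 0 = levi (f2 0) (Esym {j, a}) (Esym {k, b})"
      by (rule dz_dzb[OF harmD(1)[OF f] II_sub_Om[OF zero_II]]) (auto simp: symm_id intro!: cmat_eqI)
    also have "\<dots> = 0"
      unfolding Esym_Tm levi_csmul_left[OF B] levi_csmul_right[OF B] levi_Tm_zero[OF B Q] by simp
    finally show "dz {j, a} (dzb {k, b} u) 0 = 0" .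
  qed
qed

end
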